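(* Let $\varepsilon > 0$, $n \geq 2$ an integer, $\alpha = 1 - \frac{1}{4n+2}$, $\tilde\alpha = \frac12$, and let $p$ be given by $\frac{2}{p} + \frac{1}{4n+2} = \frac12$. There are $\varepsilon_n, \tilde\varepsilon_n \in (0,1]$ such that the following holds. If $\|f\|_{L^{4n+2}_{\alpha+\varepsilon}(\mathbb{R})} \le \varepsilon_n$ or $\|f\|_{M^{\tilde\alpha+\varepsilon}_{4n+2,2}(\mathbb{R})} \le \tilde\varepsilon_n$, then there is $u \in L_t^p([0,1], L^{4n+2}(\mathbb{R}))$ satisfying $$ u = Lf + N_3(u,u,u).$$ Furthermore, for data $f_1,f_2$ with $\|f_1\|_{L^{4n+2}_{\alpha+\varepsilon}} + \|f_2\|_{L^{4n+2}_{\alpha+\varepsilon}} \leq \varepsilon_n$, or with $\|f_1\|_{M^{\tilde\alpha+\varepsilon}_{4n+2,2}} + \|f_2\|_{M^{\tilde\alpha+\varepsilon}_{4n+2,2}} \leq \tilde\varepsilon_n$, the corresponding solutions satisfy $\|u_1 - u_2\|_{L_t^p([0,1],L^{4n+2})} \to 0$ as $\|f_1 - f_2\|_{L^{4n+2}_{\alpha+\varepsilon}} \to 0$, or as $\|f_1-f_2\|_{M^{\tilde\alpha+\varepsilon}_{4n+2,2}} \to 0$, respectively.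
   Context: With $U(t) = e^{it\partial_x^2}$ on $\mathbb{R}$, $Lf(t) = U(t)f$ and $N_3(u_1,u_2,u_3)(t) = -i\int_0^t U(t-s)(u_1\overline{u_2}u_3)(s)\,ds$, so that $u = Lf + N_3(u,u,u)$ is the Duhamel formulation of $i\partial_t u + \partial_x^2 u = |u|^2u$, $u(0)=f$. The "corresponding solution" to $f$ is $u = \sum_{j=0}^{n-1} u^j + v$, where $u^0 = Lf$, $u^1 = N_3(u^0,u^0,u^0)$, $u^j = N_3\big(\sum_{k=0}^{j-1}u^k,\sum_{k=0}^{j-1}u^k,\sum_{k=0}^{j-1}u^k\big) - \sum_{k=1}^{j-1}u^k$ for $j\ge2$, and $v$ is the unique element of $S^0 = L_t^\infty L_x^2 \cap L_t^4L_x^\infty([-1,1]\times\mathbb{R})$ solving $v = N_3\big(v+\sum_{j=0}^{n-1}u^j, v+\sum_{j=0}^{n-1}u^j,v+\sum_{j=0}^{n-1}u^j\big) - \sum_{j=1}^{n-1}u^j$. $\|f\|_{L^r_\beta(\mathbb{R})} = \|\langle\partial_x\rangle^\beta f\|_{L^r}$, with $\langle\partial_x\rangle^\beta$ the Fourier multiplier with symbol $(1+\xi^2)^{\beta/2}$. Modulation spaces: let $\sigma_0 \in C_c^\infty(\mathbb{R})$ be such that $\sigma_k(\xi) := \sigma_0(\xi - k)$, $k \in \mathbb{Z}$, is a smooth partition of unity on $\mathbb{R}$ adapted to the intervals $k + [-\frac12,\frac12)$; set $\widehat{\Box_k f} = \sigma_k \hat f$ and $\|f\|_{M^s_{r,q}(\mathbb{R})}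 = \big( \sum_{k \in \mathbb{Z}} \langle k \rangle^{qs} \|\Box_k f\|_{L^r(\mathbb{R})}^q \big)^{1/q}$, $\langle k \rangle = (1+k^2)^{1/2}$. *)

theory Defs
  imports "HOL-Probability.Essential_Supremum"
begin

section \<open>Schwartz functions and tempered distributions on the real line\<close>

definition dx :: "(real \<Rightarrow> 'a::real_normed_vector) \<Rightarrow> real \<Rightarrow> 'a" where
  "dx f = (\<lambda>x. vector_derivative f (at x))"

definition smooth :: "(real \<Rightarrow> 'a::real_normed_vector) \<Rightarrow> bool" where
  "smooth f \<longleftrightarrow> (\<forall>k x. (dx ^^ k) f differentiable (at x))"

definition schwartz :: "(real \<Rightarrow> complex) \<Rightarrow> bool" where
  "schwartz \<phi> \<longleftrightarrow> smooth \<phi> \<and> (\<forall>j k. bounded (range (\<lambda>x. x ^ j *\<^sub>R (dx ^^ k) \<phi> x)))"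

definition schwartz_seminorm :: "nat \<Rightarrow> nat \<Rightarrow> (real \<Rightarrow> complex) \<Rightarrow> real" where
  "schwartz_seminorm j k \<phi> = (SUP x. norm (x ^ j *\<^sub>R (dx ^^ k) \<phi> x))"

text \<open>A distribution is a functional on all functions, of which only the values on Schwartz
  functions matter. The pairing is bilinear (no conjugation).\<close>

type_synonym distribution = "(real \<Rightarrow> complex) \<Rightarrow> complex"

definition tempered :: "distribution \<Rightarrow> bool" where
  "tempered T \<longleftrightarrow>
     (\<forall>\<phi> \<psi>. schwartz \<phi> \<longrightarrow> schwartz \<psi> \<longrightarrow> T (\<lambda>x. \<phi> x + \<psi> x) = T \<phi> + T \<psi>) \<and>
     (\<forall>c \<phi>. schwartz \<phi> \<longrightarrow> T (\<lambda>x. c * \<phi> x) = c * T \<phi>) \<and>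
     (\<exists>C N. \<forall>\<phi>. schwartz \<phi> \<longrightarrow> norm (T \<phi>) \<le> C * (\<Sum>j\<le>N. \<Sum>k\<le>N. schwartz_seminorm j k \<phi>))"

definition dist_of :: "(real \<Rightarrow> complex) \<Rightarrow> distribution" where
  "dist_of g = (\<lambda>\<phi>. LINT x|lborel. g x * \<phi> x)"

definition represents :: "(real \<Rightarrow> complex) \<Rightarrow> distribution \<Rightarrow> bool" where
  "represents g T \<longleftrightarrow> g \<in> borel_measurable lborel \<and>
     (\<forall>\<phi>. schwartz \<phi> \<longrightarrow> integrable lborel (\<lambda>x. g x * \<phi> x) \<and> T \<phi> = dist_of g \<phi>)"


section \<open>Fourier multipliers\<close>

text \<open>The frequency variable is normalized so that \<open>\<partial>\<^sub>x\<close> corresponds to multiplication by \<open>i\<xi>\<close>.\<close>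

definition fourier :: "(real \<Rightarrow> complex) \<Rightarrow> real \<Rightarrow> complex" where
  "fourier \<phi> \<xi> = (LINT x|lborel. cis (- (x * \<xi>)) * \<phi> x)"

definition inv_fourier :: "(real \<Rightarrow> complex) \<Rightarrow> real \<Rightarrow> complex" where
  "inv_fourier \<phi> x = (LINT \<xi>|lborel. cis (x * \<xi>) * \<phi> \<xi>) / (2 * pi)"

definition dist_fourier :: "distribution \<Rightarrow> distribution" where
  "dist_fourier T = (\<lambda>\<phi>. T (fourier \<phi>))"

definition dist_inv_fourier :: "distribution \<Rightarrow> distribution" where
  "dist_inv_fourier T = (\<lambda>\<phi>. T (inv_fourier \<phi>))"

definition dist_mult :: "(real \<Rightarrow> complex) \<Rightarrow> distribution \<Rightarrow> distribution" where
  "dist_mult m T = (\<lambda>\<phi>. T (\<lambda>\<xi>. m \<xi> * \<phi> \<xi>))"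

definition multiplier :: "(real \<Rightarrow> complex) \<Rightarrow> distribution \<Rightarrow> distribution" where
  "multiplier m T = dist_inv_fourier (dist_mult m (dist_fourier T))"

definition bessel :: "real \<Rightarrow> distribution \<Rightarrow> distribution" where
  "bessel \<beta> = multiplier (\<lambda>\<xi>. of_real ((1 + \<xi>\<^sup>2) powr (\<beta> / 2)))"

text \<open>The free propagator \<open>U(t) = e\<^bsup>it\<partial>\<^sub>x\<^sup>2\<^esup>\<close>.\<close>

definition schroedinger :: "real \<Rightarrow> distribution \<Rightarrow> distribution" where
  "schroedinger t = multiplier (\<lambda>\<xi>. cis (- (t * \<xi>\<^sup>2)))"


section \<open>Lebesgue, Sobolev and modulation norms\<close>

text \<open>Used for \<open>a > 0\<close> only.\<close>

definition epowr :: "ennreal \<Rightarrow> real \<Rightarrow> ennreal" where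
  "epowr y a = (if y = \<infinity> then \<infinity> else ennreal (enn2real y powr a))"

definition Lnorm :: "ennreal \<Rightarrow> 'a measure \<Rightarrow> ('a \<Rightarrow> ennreal) \<Rightarrow> ennreal" where
  "Lnorm p M g =
     (if p = \<infinity> then esssup M g
      else epowr (\<integral>\<^sup>+ x. epowr (g x) (enn2real p) \<partial>M) (1 / enn2real p))"

text \<open>The \<open>L\<^sup>r\<close> norm of a distribution: the representing function is unique up to null sets, so
  the infimum is over at most one value, and it is \<open>\<infinity>\<close> if there is no representing function.\<close>

definition dist_Lnorm :: "real \<Rightarrow> distribution \<Rightarrow> ennreal" where
  "dist_Lnorm r T = (INF g\<in>{g. represents g T}. Lnorm (ennreal r) lborel (\<lambda>x. ennreal (norm (g x))))"

definition sobolev_norm :: "real \<Rightarrow> real \<Rightarrow> distribution \<Rightarrow> ennreal" where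
  "sobolev_norm r \<beta> f = dist_Lnorm r (bessel \<beta> f)"

text \<open>Admissible window functions \<open>\<sigma>\<^sub>0\<close>. Localization of \<open>\<sigma>\<^sub>0(\<cdot> - k)\<close> near \<open>k + [-1/2, 1/2)\<close> is
  expressed by compact support, without prescribing how far the support may extend.\<close>

definition window :: "(real \<Rightarrow> real) \<Rightarrow> bool" where
  "window \<sigma> \<longleftrightarrow> smooth \<sigma> \<and> compact (closure {\<xi>. \<sigma> \<xi> \<noteq> 0}) \<and> (\<forall>\<xi>. 0 \<le> \<sigma> \<xi>) \<and>
     (\<forall>\<xi>. ((\<lambda>k::int. \<sigma> (\<xi> - of_int k)) has_sum 1) UNIV)"

definition box :: "(real \<Rightarrow> real) \<Rightarrow> int \<Rightarrow> distribution \<Rightarrow> distribution" where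
  "box \<sigma> k = multiplier (\<lambda>\<xi>. of_real (\<sigma> (\<xi> - of_int k)))"

definition jbracket :: "real \<Rightarrow> real" where
  "jbracket x = sqrt (1 + x\<^sup>2)"

definition modulation_norm :: "(real \<Rightarrow> real) \<Rightarrow> real \<Rightarrow> real \<Rightarrow> real \<Rightarrow> distribution \<Rightarrow> ennreal" where
  "modulation_norm \<sigma> s r q f =
     epowr (\<integral>\<^sup>+ k. ennreal (jbracket (of_int k) powr (q * s)) * epowr (dist_Lnorm r (box \<sigma> k f)) q
              \<partial>count_space UNIV) (1 / q)"


section \<open>Space-time norms\<close>

text \<open>A space-time function \<open>u\<close> is written \<open>u t x\<close>; its values for \<open>t \<notin> I\<close> are irrelevant.\<close>

definition mixed_norm :: "ennreal \<Rightarrow> real set \<Rightarrow> ennreal \<Rightarrow> (real \<Rightarrow> real \<Rightarrow> complex) \<Rightarrow> ennreal" where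
  "mixed_norm p I q u =
     Lnorm p (restrict_space lborel I) (\<lambda>t. Lnorm q lborel (\<lambda>x. ennreal (norm (u t x))))"

definition spacetime_measurable :: "real set \<Rightarrow> (real \<Rightarrow> real \<Rightarrow> complex) \<Rightarrow> bool" where
  "spacetime_measurable I u \<longleftrightarrow>
     (\<lambda>(t, x). u t x) \<in> borel_measurable (restrict_space lborel I \<Otimes>\<^sub>M lborel)"

definition LtLx :: "ennreal \<Rightarrow> real set \<Rightarrow> ennreal \<Rightarrow> (real \<Rightarrow> real \<Rightarrow> complex) set" where
  "LtLx p I q = {u. spacetime_measurable I u \<and> mixed_norm p I q u < \<infinity>}"

definition S0 :: "(real \<Rightarrow> real \<Rightarrow> complex) set" where
  "S0 = LtLx \<infinity> {-1..1} 2 \<inter> LtLx 4 {-1..1} \<infinity>"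


section \<open>The cubic Schroedinger equation\<close>

text \<open>\<open>N\<^sub>3(u\<^sub>1,u\<^sub>2,u\<^sub>3)(t)\<close> as a distribution, the time integral being taken after testing against
  a Schwartz function; for negative \<open>t\<close> the interval integral carries the usual sign.\<close>

definition N3 :: "(real \<Rightarrow> real \<Rightarrow> complex) \<Rightarrow> (real \<Rightarrow> real \<Rightarrow> complex) \<Rightarrow> (real \<Rightarrow> real \<Rightarrow> complex)
    \<Rightarrow> real \<Rightarrow> distribution" where
  "N3 u1 u2 u3 t = (\<lambda>\<phi>. - \<i> * (LBINT s=ereal 0..ereal t.
     schroedinger (t - s) (dist_of (\<lambda>x. u1 s x * cnj (u2 s x) * u3 s x)) \<phi>))"

definition duhamel_solution :: "real set \<Rightarrow> distribution \<Rightarrow> (real \<Rightarrow> real \<Rightarrow> complex) \<Rightarrow> bool" where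
  "duhamel_solution I f u \<longleftrightarrow>
     (AE t in lborel. t \<in> I \<longrightarrow> represents (u t) (\<lambda>\<phi>. schroedinger t f \<phi> + N3 u u u t \<phi>))"

definition partial_sum :: "(nat \<Rightarrow> real \<Rightarrow> real \<Rightarrow> complex) \<Rightarrow> nat \<Rightarrow> real \<Rightarrow> real \<Rightarrow> complex" where
  "partial_sum w j = (\<lambda>t x. \<Sum>k<j. w k t x)"

text \<open>\<open>w 0, \<dots>, w (n - 1)\<close> are the iterates \<open>u\<^sup>0, \<dots>, u\<^bsup>n-1\<^esup>\<close>, which are determined almost
  everywhere on \<open>[-1,1] \<times> \<real>\<close>. For \<open>j = 1\<close> the subtracted sum is empty, which gives
  \<open>u\<^sup>1 = N\<^sub>3(u\<^sup>0,u\<^sup>0,u\<^sup>0)\<close>.\<close>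

definition iterates :: "nat \<Rightarrow> distribution \<Rightarrow> (nat \<Rightarrow> real \<Rightarrow> real \<Rightarrow> complex) \<Rightarrow> bool" where
  "iterates n f w \<longleftrightarrow>
     (\<forall>j<n. spacetime_measurable {-1..1} (w j)) \<and>
     (AE t in lborel. t \<in> {-1..1} \<longrightarrow> represents (w 0 t) (schroedinger t f)) \<and>
     (\<forall>j\<in>{1..<n}. AE t in lborel. t \<in> {-1..1} \<longrightarrow>
        represents (w j t) (\<lambda>\<phi>. N3 (partial_sum w j) (partial_sum w j) (partial_sum w j) t \<phi>
                                 - (\<Sum>k=1..<j. dist_of (w k t) \<phi>)))"

definition remainder :: "nat \<Rightarrow> (nat \<Rightarrow> real \<Rightarrow> real \<Rightarrow> complex) \<Rightarrow> (real \<Rightarrow> real \<Rightarrow> complex) \<Rightarrow> bool" where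
  "remainder n w v \<longleftrightarrow> v \<in> S0 \<and>
     (let z = (\<lambda>t x. v t x + partial_sum w n t x) in
      AE t in lborel. t \<in> {-1..1} \<longrightarrow>
        represents (v t) (\<lambda>\<phi>. N3 z z z t \<phi> - (\<Sum>j=1..<n. dist_of (w j t) \<phi>)))"

definition corresponding_solution :: "nat \<Rightarrow> distribution \<Rightarrow> (real \<Rightarrow> real \<Rightarrow> complex) \<Rightarrow> bool" where
  "corresponding_solution n f u \<longleftrightarrow>
     (\<exists>w v. iterates n f w \<and> remainder n w v \<and>
        (\<forall>v'. remainder n w v' \<longrightarrow>
           (AE t in lborel. t \<in> {-1..1} \<longrightarrow> (AE x in lborel. v' t x = v t x))) \<and>
        u = (\<lambda>t x. partial_sum w n t x + v t x))"

text \<open>\<open>\<parallel>u\<^sub>1 - u\<^sub>2\<parallel> \<rightarrow> 0\<close> in \<open>L\<^sup>p\<^sub>t([0,1], L\<^sup>r)\<close> as \<open>N (f\<^sub>1 - f\<^sub>2) \<rightarrow> 0\<close>, uniformly over all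
  data \<open>f\<^sub>1, f\<^sub>2\<close> with \<open>N f\<^sub>1 + N f\<^sub>2 \<le> e\<close>.\<close>

definition continuous_dependence ::
    "nat \<Rightarrow> real \<Rightarrow> real \<Rightarrow> (distribution \<Rightarrow> ennreal) \<Rightarrow> real \<Rightarrow> bool" where
  "continuous_dependence n p r N e \<longleftrightarrow>
     (\<forall>\<eta>>0. \<exists>\<delta>>0. \<forall>f1 f2 u1 u2.
        tempered f1 \<longrightarrow> tempered f2 \<longrightarrow> N f1 + N f2 \<le> ennreal e \<longrightarrow>
        corresponding_solution n f1 u1 \<longrightarrow> corresponding_solution n f2 u2 \<longrightarrow>
        N (\<lambda>\<phi>. f1 \<phi> - f2 \<phi>) < ennreal \<delta> \<longrightarrow>
        mixed_norm (ennreal p) {0..1} (ennreal r) (\<lambda>t x. u1 t x - u2 t x) < ennreal \<eta>)"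

end

theory Submission
  imports Defs "HOL-Probability.Probability"
begin

text \<open>Both norms control \<open>\<Sum>\<^sub>k \<parallel>\<box>\<^sub>k f\<parallel>\<^sub>r\<close>: the modulation norm by Cauchy-Schwarz in \<open>k\<close>, and the Sobolev
  norm because the \<open>L\<^sup>r\<close> norms of the frequency pieces of an \<open>L\<^sup>r\<close> function are \<open>\<ell>\<^sup>r\<close>-summable for
  \<open>r \<ge> 2\<close> and the weights \<open>\<langle>k\<rangle>\<close> to the power \<open>- \<alpha> - \<epsilon>\<close> lie in the dual of \<open>\<ell>\<^sup>r\<close>.
  On the pieces the propagator is bounded in every \<open>L\<^sup>q\<close>, uniformly for \<open>|t| \<le> 1\<close>, because
  a Galilean transformation moves the piece to frequency zero. For superpositions of pieces
  the Duhamel term becomes a trilinear map on \<open>\<ell>\<^sup>1\<close>-families that satisfies Hoelder's inequality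
  in the exponents, so the Picard iteration converges geometrically. The \<open>j\<close>-th increment lies
  in \<open>L\<^sup>q\<close> with \<open>q = (4 n + 2) / (2 j + 1)\<close>, hence in \<open>L\<^sup>2\<close> from \<open>j = n\<close> on, which puts the
  remainder into \<open>S\<^sup>0\<close>. Its uniqueness is a Gronwall argument in \<open>L\<^sup>2\<close>.\<close>

text \<open>The data lie in L^r with r > 2, where the free propagator is unbounded and where
  Strichartz arguments based on L^2 cannot start. A family carries no support condition: the
  enlarged window \<open>ta\<sigma>\<close> is applied when a family is synthesized or multiplied,
  and the identity \<open>\<sigma> xi * ta\<sigma> xi = \<sigma> xi\<close> makes this harmless.
  Every bound holds in L^q and in L^\<infinity> at once, so Hoelder's inequality asks only for an
  inequality between exponents. A triple k, l, j produces frequencies within 9\<rho> of k - l + j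
  and is assigned to 20\<rho> + 1 output windows, which is why the trilinear map stays bounded on
  summable families. \<open>corresponding_solution\<close> quantifies over all choices of
  representatives, hence iterates and remainder have to be identified up to null sets before
  continuous dependence can be read off. The equations hold only after testing, so the L^2 bound
  behind uniqueness is obtained by duality with Schwartz functions.\<close>

abbreviation (input) nn_lborel :: "(real => ennreal) => ennreal" (binder "NN " 10)
 where "nn_lborel f == nn_integral lborel f"
abbreviation (input) nn_count :: "('a => ennreal) => ennreal" (binder "NC " 10)
 where "nn_count f == nn_integral (count_space UNIV) f"
abbreviation (input) lint_count :: "('a => 'b::{banach,second_countable_topology}) => 'b" (binder "LC " 10)
 where "lint_count f == lebesgue_integral (count_space UNIV) f"

lemmas LBINT_cong = Bochner_Integration.integral_cong
lemmas integrable_boundI = Bochner_Integration.integrable_bound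

section \<open>Calculus of smooth functions\<close>

text \<open>Finite-order form of \<open>smooth\<close>. Closure under products and under the Fourier
  transform is proved by induction on the order, with the functions generalized.\<close>

definition ndiff :: "nat => (real => complex) => bool" where
 "ndiff b f \<longleftrightarrow> (\<forall>k<b. \<forall>x. (dx ^^ k) f differentiable (at x))"

lemma smooth_iff_ndiff: "smooth f \<longleftrightarrow> (\<forall>b. ndiff b f)"
 unfolding smooth_def ndiff_def by blast

lemma dx_eqI: "(\<And>x. (f has_vector_derivative g x) (at x)) ==> dx f = g"
 unfolding dx_def by (intro ext vector_derivative_at)

lemma ndiff_0 [simp]: "ndiff 0 f"
 by (simp add: ndiff_def)

lemma dx_funpow_Suc: "(dx ^^ Suc k) f = (dx ^^ k) (dx f)"
 by (simp add: funpow_swap1)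

text \<open>Peels off the innermost derivative, whereas \<open>funpow\<close> unfolds the outermost
  one. Once a formula for \<open>dx f\<close> is known, this form feeds it directly into the
  induction hypothesis.\<close>

lemma ndiff_Suc: "ndiff (Suc b) f \<longleftrightarrow> (\<forall>x. f differentiable (at x)) \<and> ndiff b (dx f)"
proof
 assume L: "ndiff (Suc b) f"
 have "f differentiable (at x)" for x
  using L[unfolded ndiff_def, rule_format, of 0 x] by simp
 moreover have "(dx ^^ k) (dx f) differentiable (at x)" if "k < b" for k x
  using L[unfolded ndiff_def, rule_format, of "Suc k" x] that unfolding dx_funpow_Suc by simp
 ultimately show "(\<forall>x. f differentiable (at x)) \<and> ndiff b (dx f)"
  by (auto simp: ndiff_def)
next
 assume R: "(\<forall>x. f differentiable (at x)) \<and> ndiff b (dx f)"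
 show "ndiff (Suc b) f" unfolding ndiff_def
 proof (intro allI impI)
  fix k x assume "k < Suc b"
  then show "(dx ^^ k) f differentiable at x"
   using R unfolding ndiff_def by (cases k) (auto simp: dx_funpow_Suc simp del: funpow.simps(2))
 qed
qed

lemma ndiff_mono: "ndiff b f ==> c <= b ==> ndiff c f"
 by (auto simp: ndiff_def)

lemma differentiable_has_dx:
 "f differentiable (at x) ==> (f has_vector_derivative dx f x) (at x)"
 unfolding dx_def by (simp add: vector_derivative_works)

lemma smooth_has_dx: "smooth f ==> (f has_vector_derivative dx f x) (at x)"
 by (rule differentiable_has_dx) (metis smooth_def funpow_0)

lemma smooth_dx: "smooth f ==> smooth (dx f)"
 unfolding smooth_def using dx_funpow_Suc[of _ f] by metis

lemma smooth_dx_funpow: "smooth f ==> smooth ((dx ^^ k) f)"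
 by (induction k) (auto intro: smooth_dx)

lemma smooth_continuous: "smooth f ==> continuous_on A f"
 by (meson continuous_at_imp_continuous_on has_vector_derivative_continuous smooth_has_dx)

lemma smooth_measurable: "smooth f ==> f \<in> borel_measurable borel"
 by (intro borel_measurable_continuous_onI smooth_continuous)

lemma ndiff_add:
 "ndiff b f ==> ndiff b g ==>
   ndiff b (\<lambda>x. f x + g x) \<and> (dx ^^ b) (\<lambda>x. f x + g x) = (\<lambda>x. (dx ^^ b) f x + (dx ^^ b) g x)"
proof (induction b arbitrary: f g)
 case (Suc b)
 have f: "(f has_vector_derivative dx f x) (at x)" and g: "(g has_vector_derivative dx g x) (at x)" for x
  using Suc.prems by (auto simp: ndiff_Suc intro: differentiable_has_dx)
 have h: "((\<lambda>x. f x + g x) has_vector_derivative dx f x + dx g x) (at x)" for x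
  using f g by (auto intro!: derivative_intros)
 have e: "dx (\<lambda>x. f x + g x) = (\<lambda>x. dx f x + dx g x)"
  by (rule dx_eqI) (rule h)
 have d: "(\<lambda>x. f x + g x) differentiable (at x)" for x
  using h differentiableI_vector by blast
 show ?case
  using Suc.IH[of "dx f" "dx g"] Suc.prems d
  unfolding dx_funpow_Suc e ndiff_Suc by auto
qed simp

lemma ndiff_mult:
 "ndiff b f ==> ndiff b g ==> ndiff b (\<lambda>x. f x * g x)"
proof (induction b arbitrary: f g)
 case (Suc b)
 have f: "(f has_vector_derivative dx f x) (at x)" and g: "(g has_vector_derivative dx g x) (at x)" for x
  using Suc.prems by (auto simp: ndiff_Suc intro: differentiable_has_dx)
 have h: "((\<lambda>x. f x * g x) has_vector_derivative f x * dx g x + dx f x * g x) (at x)" for x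
  using has_vector_derivative_mult[OF f g] by simp
 have e: "dx (\<lambda>x. f x * g x) = (\<lambda>x. f x * dx g x + dx f x * g x)"
  by (rule dx_eqI) (rule h)
 have d: "(\<lambda>x. f x * g x) differentiable (at x)" for x
  using h differentiableI_vector by blast
 have "ndiff b f" "ndiff b g" using Suc.prems ndiff_mono by (meson le_SucI order_refl)+
 then show ?case
  using Suc.IH[of f "dx g"] Suc.IH[of "dx f" g] Suc.prems d ndiff_add
  unfolding e ndiff_Suc by auto
qed simp

lemma smooth_add: "smooth f ==> smooth g ==> smooth (\<lambda>x. f x + g x :: complex)"
 unfolding smooth_iff_ndiff using ndiff_add by blast

lemma smooth_mult: "smooth f ==> smooth g ==> smooth (\<lambda>x. f x * g x :: complex)"
 unfolding smooth_iff_ndiff using ndiff_mult by blast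

lemma dx_funpow_add:
 "smooth f ==> smooth g ==> (dx ^^ b) (\<lambda>x. f x + g x) = (\<lambda>x. (dx ^^ b) f x + (dx ^^ b) g x :: complex)"
 unfolding smooth_iff_ndiff using ndiff_add by blast

lemma dx_mult:
 assumes "smooth f" "smooth g"
 shows "dx (\<lambda>x. f x * g x :: complex) = (\<lambda>x. f x * dx g x + dx f x * g x)"
 by (rule dx_eqI) (use has_vector_derivative_mult[OF smooth_has_dx[OF assms(1)] smooth_has_dx[OF assms(2)]] in simp)

lemma dx_funpow_const: "(dx ^^ b) (\<lambda>x. c :: 'a::real_normed_vector) = (if b = 0 then (\<lambda>x. c) else (\<lambda>x. 0))"
 by (induction b) (auto simp: dx_def)

lemma smooth_const [simp]: "smooth (\<lambda>x. c)"
 unfolding smooth_def dx_funpow_const by auto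

lemma dx_id: "dx (\<lambda>x. of_real x :: complex) = (\<lambda>x. 1)"
 by (rule dx_eqI) (auto intro!: derivative_eq_intros)

lemma smooth_of_real_id [simp]: "smooth (\<lambda>x. of_real x :: complex)"
 unfolding smooth_iff_ndiff
proof
 fix b show "ndiff b (\<lambda>x. of_real x :: complex)"
 proof (cases b)
  case (Suc c)
  have "(\<lambda>x. of_real x :: complex) differentiable (at x)" for x
   by (rule differentiableI_vector[where y=1]) (auto intro!: derivative_eq_intros)
  then show ?thesis using smooth_const[of "1::complex"] unfolding Suc ndiff_Suc dx_id smooth_iff_ndiff by auto
 qed simp
qed

lemma smooth_sum: "finite A ==> (\<And>i. i \<in> A ==> smooth (f i)) ==> smooth (\<lambda>x. \<Sum>i\<in>A. f i x :: complex)"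
 by (induction A rule: finite_induct) (auto intro: smooth_add)

lemma dx_funpow_sum:
 "finite A ==> (\<And>i. i \<in> A ==> smooth (f i)) ==>
  (dx ^^ b) (\<lambda>x. \<Sum>i\<in>A. f i x :: complex) = (\<lambda>x. \<Sum>i\<in>A. (dx ^^ b) (f i) x)"
 by (induction A rule: finite_induct) (auto simp: dx_funpow_add smooth_sum dx_funpow_const)

lemma dx_funpow_of_real:
 assumes "smooth (f :: real => real)"
 shows "(dx ^^ b) (\<lambda>x. of_real (f x) :: complex) = (\<lambda>x. of_real ((dx ^^ b) f x))"
proof (induction b)
 case (Suc b)
 have "dx (\<lambda>x. of_real ((dx ^^ b) f x) :: complex) = (\<lambda>x. of_real (dx ((dx ^^ b) f) x))"
 proof (rule dx_eqI)
  fix x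
  have "((dx ^^ b) f has_vector_derivative dx ((dx ^^ b) f) x) (at x)"
   by (rule smooth_has_dx[OF smooth_dx_funpow[OF assms]])
  then show "((\<lambda>x. of_real ((dx ^^ b) f x) :: complex) has_vector_derivative of_real (dx ((dx ^^ b) f) x)) (at x)"
   by (intro has_vector_derivative_of_real) (simp add: has_real_derivative_iff_has_vector_derivative)
 qed
 then show ?case using Suc by simp
qed simp

lemma smooth_of_real:
 assumes "smooth (f :: real => real)"
 shows "smooth (\<lambda>x. of_real (f x) :: complex)"
 unfolding smooth_def dx_funpow_of_real[OF assms]
proof (intro allI)
 fix k x
 have "((dx ^^ k) f has_vector_derivative dx ((dx ^^ k) f) x) (at x)"
  by (rule smooth_has_dx[OF smooth_dx_funpow[OF assms]])
 from has_vector_derivative_of_real[OF this[folded has_real_derivative_iff_has_vector_derivative]]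
 show "(\<lambda>x. complex_of_real ((dx ^^ k) f x)) differentiable at x"
  using differentiableI_vector by blast
qed

lemma has_vector_derivative_shift:
 assumes "(f has_vector_derivative D) (at (x - a))"
 shows "((\<lambda>x. f (x - a)) has_vector_derivative D) (at (x::real))"
proof -
 have "((f \<circ> (\<lambda>x. x - a)) has_vector_derivative (1 *\<^sub>R D)) (at x)"
  by (rule vector_diff_chain_at) (use assms in \<open>auto intro!: derivative_eq_intros\<close>)
 then show ?thesis by (simp add: o_def)
qed

lemma dx_funpow_shift:
 assumes "smooth f"
 shows "(dx ^^ b) (\<lambda>x. f (x - a)) = (\<lambda>x. (dx ^^ b) f (x - a))"
proof (induction b)
 case (Suc b)
 have "dx (\<lambda>x. (dx ^^ b) f (x - a)) = (\<lambda>x. dx ((dx ^^ b) f) (x - a))"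
  by (rule dx_eqI) (rule has_vector_derivative_shift, rule smooth_has_dx[OF smooth_dx_funpow[OF assms]])
 then show ?case using Suc by simp
qed simp

lemma smooth_shift: "smooth f ==> smooth (\<lambda>x. f (x - a))"
 unfolding smooth_def[of "\<lambda>x. f (x - a)"]
 using dx_funpow_shift[of f _ a] has_vector_derivative_shift smooth_has_dx[OF smooth_dx_funpow[of f]]
  differentiableI_vector by metis

section \<open>Uniform families of Schwartz functions and of slowly growing functions\<close>

text \<open>The index is a time or a frequency. Seminorm bounds uniform in it survive multiplication
  by symbols and the Fourier transform, and end up as kernel bounds uniform in time and
  frequency.\<close>

definition usch :: "'i set => ('i => real => complex) => bool" where
 "usch I F \<longleftrightarrow> (\<forall>i\<in>I. smooth (F i)) \<and>
   (\<forall>a b. \<exists>C. \<forall>i\<in>I. \<forall>x. \<bar>x\<bar> ^ a * norm ((dx ^^ b) (F i) x) <= C)"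

text \<open>Multipliers of the Schwartz space. The growth exponent may depend on the order of the
  derivative but not on the index.\<close>

definition umod :: "'i set => ('i => real => complex) => bool" where
 "umod I m \<longleftrightarrow> (\<forall>i\<in>I. smooth (m i)) \<and>
   (\<forall>b. \<exists>C N. \<forall>i\<in>I. \<forall>x. norm ((dx ^^ b) (m i) x) <= C * (1 + \<bar>x\<bar> ^ N))"

lemma schwartz_iff_usch: "schwartz phi \<longleftrightarrow> usch {()} (\<lambda>_. phi)"
proof -
 have "bounded (range (\<lambda>x. x ^ j *\<^sub>R (dx ^^ k) phi x)) \<longleftrightarrow> (\<exists>C. \<forall>x. \<bar>x\<bar> ^ j * norm ((dx ^^ k) phi x) <= C)" for j k
  unfolding bounded_iff by (simp add: power_abs)
 then show ?thesis unfolding schwartz_def usch_def by simp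
qed

lemma usch_imp_schwartz: "usch I F ==> i \<in> I ==> schwartz (F i)"
 unfolding schwartz_iff_usch usch_def by auto metis

lemma schwartz_imp_usch: "schwartz phi ==> usch I (\<lambda>_. phi)"
 unfolding schwartz_iff_usch usch_def by auto

lemma usch_smooth: "usch I F ==> i \<in> I ==> smooth (F i)"
 by (simp add: usch_def)

lemma schwartz_smooth: "schwartz phi ==> smooth phi"
 by (simp add: schwartz_def)

lemma umod_smooth: "umod I F ==> i \<in> I ==> smooth (F i)"
 by (simp add: umod_def)

lemma usch_dx: "usch I F ==> usch I (\<lambda>i. dx (F i))"
 unfolding usch_def
 by (auto intro: smooth_dx simp flip: dx_funpow_Suc simp del: funpow.simps(2))

lemma umod_dx: "umod I F ==> umod I (\<lambda>i. dx (F i))"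
 unfolding umod_def
 by (auto intro: smooth_dx simp flip: dx_funpow_Suc simp del: funpow.simps(2))

lemma usch_add:
 assumes "usch I F" "usch I G" shows "usch I (\<lambda>i x. F i x + G i x)"
 unfolding usch_def
proof (intro conjI ballI allI)
 fix a b
 obtain C D where C: "\<forall>i\<in>I. \<forall>x. \<bar>x\<bar> ^ a * norm ((dx ^^ b) (F i) x) <= C"
  and D: "\<forall>i\<in>I. \<forall>x. \<bar>x\<bar> ^ a * norm ((dx ^^ b) (G i) x) <= D"
  using assms unfolding usch_def by metis
 have "\<bar>x\<bar> ^ a * norm ((dx ^^ b) (\<lambda>x. F i x + G i x) x) <= C + D" if i: "i \<in> I" for i x
 proof -
  have "(dx ^^ b) (\<lambda>x. F i x + G i x) = (\<lambda>x. (dx ^^ b) (F i) x + (dx ^^ b) (G i) x)"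
   using assms i by (intro dx_funpow_add) (auto simp: usch_def)
  then have "\<bar>x\<bar> ^ a * norm ((dx ^^ b) (\<lambda>x. F i x + G i x) x)
    <= \<bar>x\<bar> ^ a * (norm ((dx ^^ b) (F i) x) + norm ((dx ^^ b) (G i) x))"
   by (auto intro!: mult_left_mono norm_triangle_ineq)
  also have "... <= C + D" using C D i by (auto simp: distrib_left intro!: add_mono)
  finally show ?thesis .
 qed
 then show "\<exists>C. \<forall>i\<in>I. \<forall>x. \<bar>x\<bar> ^ a * norm ((dx ^^ b) (\<lambda>x. F i x + G i x) x) <= C" by blast
qed (use assms in \<open>auto simp: usch_def intro: smooth_add\<close>)

text \<open>Leibniz' rule is applied one derivative at a time: the derivative of order b + 1 of the
  product is the b-th derivative of \<open>m * dx F + dx m * F\<close>, and both summands are again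
  products of the same kind. In the base case the polynomial growth of \<open>m\<close> costs the
  seminorm with N more powers of x.\<close>

lemma usch_mult:
 assumes "umod I m" "usch I F" shows "usch I (\<lambda>i x. m i x * F i x)"
proof -
 have "\<exists>C. \<forall>i\<in>I. \<forall>x. \<bar>x\<bar> ^ a * norm ((dx ^^ b) (\<lambda>x. m i x * F i x) x) <= C" for a b
  using assms
 proof (induction b arbitrary: m F)
  case 0
  obtain C N where C: "\<forall>i\<in>I. \<forall>x. norm (m i x) <= C * (1 + \<bar>x\<bar> ^ N)"
   using 0 unfolding umod_def by (metis funpow_0)
  obtain D E where D: "\<forall>i\<in>I. \<forall>x. \<bar>x\<bar> ^ a * norm (F i x) <= D"
   and E: "\<forall>i\<in>I. \<forall>x. \<bar>x\<bar> ^ (a + N) * norm (F i x) <= E"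
   using 0 unfolding usch_def by (metis funpow_0)
  have "\<bar>x\<bar> ^ a * norm (m i x * F i x) <= \<bar>C\<bar> * (D + E)" if i: "i \<in> I" for i x
  proof -
   have "norm (m i x) <= \<bar>C\<bar> * (1 + \<bar>x\<bar> ^ N)"
    using C[rule_format, OF i, of x] by (rule order_trans) (auto intro!: mult_right_mono add_nonneg_nonneg)
   then have "\<bar>x\<bar> ^ a * norm (m i x * F i x) <= \<bar>x\<bar> ^ a * (\<bar>C\<bar> * (1 + \<bar>x\<bar> ^ N) * norm (F i x))"
    unfolding norm_mult by (intro mult_left_mono mult_right_mono) auto
   also have "... = \<bar>C\<bar> * (\<bar>x\<bar> ^ a * norm (F i x) + \<bar>x\<bar> ^ (a + N) * norm (F i x))"
    by (simp add: algebra_simps power_add)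
   also have "... <= \<bar>C\<bar> * (D + E)" using D E i by (intro mult_left_mono add_mono) auto
   finally show ?thesis .
  qed
  then show ?case by (simp only: funpow_0) blast
 next
  case (Suc b)
  note u = \<open>umod I m\<close> and s = \<open>usch I F\<close>
  obtain C1 where C1: "\<forall>i\<in>I. \<forall>x. \<bar>x\<bar> ^ a * norm ((dx ^^ b) (\<lambda>x. m i x * dx (F i) x) x) <= C1"
   using Suc.IH[OF u usch_dx[OF s]] by blast
  obtain C2 where C2: "\<forall>i\<in>I. \<forall>x. \<bar>x\<bar> ^ a * norm ((dx ^^ b) (\<lambda>x. dx (m i) x * F i x) x) <= C2"
   using Suc.IH[OF umod_dx[OF u] s] by blast
  have "\<bar>x\<bar> ^ a * norm ((dx ^^ Suc b) (\<lambda>x. m i x * F i x) x) <= C1 + C2" if i: "i \<in> I" for i x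
  proof -
   have sm: "smooth (m i)" "smooth (F i)" using u s i by (auto simp: umod_def usch_def)
   have "(dx ^^ Suc b) (\<lambda>x. m i x * F i x)
    = (\<lambda>x. (dx ^^ b) (\<lambda>x. m i x * dx (F i) x) x + (dx ^^ b) (\<lambda>x. dx (m i) x * F i x) x)"
    unfolding dx_funpow_Suc dx_mult[OF sm]
    by (intro dx_funpow_add smooth_mult smooth_dx sm)
   then have "\<bar>x\<bar> ^ a * norm ((dx ^^ Suc b) (\<lambda>x. m i x * F i x) x)
    <= \<bar>x\<bar> ^ a * (norm ((dx ^^ b) (\<lambda>x. m i x * dx (F i) x) x) + norm ((dx ^^ b) (\<lambda>x. dx (m i) x * F i x) x))"
    by (auto intro!: mult_left_mono norm_triangle_ineq simp del: funpow.simps)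
   also have "... <= C1 + C2" using C1 C2 i by (auto simp: distrib_left intro!: add_mono)
   finally show ?thesis .
  qed
  then show ?case by blast
 qed
 then show ?thesis
  using assms by (auto simp: usch_def umod_def intro: smooth_mult)
qed

lemma umod_const: "(\<And>i. i \<in> I ==> norm (c i) <= B) ==> umod I (\<lambda>i x. c i)"
 unfolding umod_def dx_funpow_const
proof (intro conjI allI)
 fix b assume B: "\<And>i. i \<in> I ==> norm (c i) <= B"
 have "\<forall>i\<in>I. \<forall>x. norm ((if b = 0 then (\<lambda>x::real. c i) else (\<lambda>x. 0)) x) <= \<bar>B\<bar> * (1 + \<bar>x\<bar> ^ 0)"
 proof (intro ballI allI)
  fix i and x :: real assume "i \<in> I"
  then have "norm (c i) <= \<bar>B\<bar>" using B[of i] by linarith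
  moreover have "\<bar>B\<bar> <= \<bar>B\<bar> * 2" by simp
  ultimately show "norm ((if b = 0 then (\<lambda>x::real. c i) else (\<lambda>x. 0)) x) <= \<bar>B\<bar> * (1 + \<bar>x\<bar> ^ 0)"
   by (auto simp del: abs_ge_self)
 qed
 then show "\<exists>C N. \<forall>i\<in>I. \<forall>x. norm ((if b = 0 then (\<lambda>x::real. c i) else (\<lambda>x. 0)) x) <= C * (1 + \<bar>x\<bar> ^ N)"
  by blast
qed simp

lemma umod_id: "umod I (\<lambda>i x. of_real x)"
 unfolding umod_def
proof (intro conjI allI)
 fix b
 show "\<exists>C N. \<forall>i\<in>I. \<forall>x. norm ((dx ^^ b) (\<lambda>x. complex_of_real x) x) <= C * (1 + \<bar>x\<bar> ^ N)"
 proof (cases b)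
  case 0
  have "\<forall>i\<in>I. \<forall>x. norm ((dx ^^ b) (\<lambda>x. complex_of_real x) x) <= 1 * (1 + \<bar>x\<bar> ^ 1)"
   by (auto simp: 0)
  then show ?thesis by blast
 next
  case (Suc c)
  have "\<forall>i\<in>I. \<forall>x. norm ((dx ^^ b) (\<lambda>x. complex_of_real x) x) <= 1 * (1 + \<bar>x\<bar> ^ 0)"
   by (auto simp: Suc dx_funpow_Suc dx_id dx_funpow_const simp del: funpow.simps)
  then show ?thesis by blast
 qed
qed auto

lemma usch_cmult: "usch I F ==> usch I (\<lambda>i x. c * F i x)"
 by (rule usch_mult[OF umod_const[where B = "norm c"]]) auto

lemma usch_uminus: "usch I F ==> usch I (\<lambda>i x. - F i x)"
 using usch_cmult[of I F "-1"] by simp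

lemma usch_diff: "usch I F ==> usch I G ==> usch I (\<lambda>i x. F i x - G i x)"
 using usch_add[OF _ usch_uminus, of I F G] by simp

lemma umod_bounded_derivs:
 assumes "\<And>i. i \<in> I ==> smooth (m i)"
  and "\<And>b. \<exists>C. \<forall>i\<in>I. \<forall>x. norm ((dx ^^ b) (m i) x) <= C"
 shows "umod I m"
 unfolding umod_def
proof (intro conjI allI ballI)
 fix b
 obtain C where C: "\<forall>i\<in>I. \<forall>x. norm ((dx ^^ b) (m i) x) <= C" using assms(2) by blast
 have "\<forall>i\<in>I. \<forall>x. norm ((dx ^^ b) (m i) x) <= \<bar>C\<bar> * (1 + \<bar>x\<bar> ^ 0)"
 proof (intro ballI allI)
  fix i x assume "i \<in> I"
  then have "norm ((dx ^^ b) (m i) x) <= \<bar>C\<bar>" using C by (meson abs_ge_self order_trans)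
  then show "norm ((dx ^^ b) (m i) x) <= \<bar>C\<bar> * (1 + \<bar>x\<bar> ^ 0)" by (auto simp: algebra_simps)
 qed
 then show "\<exists>C N. \<forall>i\<in>I. \<forall>x. norm ((dx ^^ b) (m i) x) <= C * (1 + \<bar>x\<bar> ^ N)" by blast
qed (use assms in auto)

lemma one_plus_power_mono:
 fixes x :: real
 assumes "k <= K" shows "1 + \<bar>x\<bar> ^ k <= 2 * (1 + \<bar>x\<bar> ^ K)"
proof -
 have "\<bar>x\<bar> ^ k <= 1 + \<bar>x\<bar> ^ K"
 proof (cases "\<bar>x\<bar> <= 1")
  case True
  then have "\<bar>x\<bar> ^ k <= 1" by (simp add: power_le_one)
  moreover have "0 <= \<bar>x\<bar> ^ K" by simp
  ultimately show ?thesis by linarith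
 next
  case False
  then show ?thesis using assms by (intro add_increasing power_increasing) auto
 qed
 moreover have "0 <= \<bar>x\<bar> ^ K" by simp
 moreover have "1 + u <= 2 * (1 + v)" if "u <= 1 + v" "0 <= v" for u v :: real
  using that by simp
 ultimately show ?thesis by blast
qed

text \<open>The monomials below are closed under differentiation, which gives the symbols of the free
 propagator and of the Bessel potential at once.\<close>

definition mono_symbol :: "complex => nat => real => real => real => complex" where
 "mono_symbol c j \<gamma> ta x = c * of_real x ^ j * of_real ((1 + x\<^sup>2) powr \<gamma>) * cis (ta * x\<^sup>2)"

lemma one_plus_square_pos [simp]: "0 < 1 + (x::real)\<^sup>2"
 by (simp add: add_pos_nonneg)

lemma one_plus_square_neq_0 [simp]: "1 + (x::real)\<^sup>2 \<noteq> 0"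
 using one_plus_square_pos[of x] by linarith

lemma mono_symbol_deriv:
 "(mono_symbol c j \<gamma> ta has_vector_derivative
   (mono_symbol (c * of_nat j) (j - 1) \<gamma> ta x + mono_symbol (2 * of_real \<gamma> * c) (Suc j) (\<gamma> - 1) ta x
   + mono_symbol (2 * \<i> * of_real ta * c) (Suc j) \<gamma> ta x)) (at x)"
proof -
 have 1: "((\<lambda>x. complex_of_real x ^ j) has_vector_derivative (of_nat j * of_real x ^ (j - 1))) (at x)"
 proof -
  have "((\<lambda>x. x ^ j) has_real_derivative (real j * x ^ (j - 1))) (at x)"
   by (auto intro!: derivative_eq_intros)
  from has_vector_derivative_of_real[OF this, where 'a = complex] show ?thesis by simp
 qed
 have r: "((\<lambda>x. (1 + x\<^sup>2) powr \<gamma>) has_real_derivative (\<gamma> * (1 + x\<^sup>2) powr (\<gamma> - 1) * (2 * x))) (at x)"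
  by (auto intro!: derivative_eq_intros simp: powr_diff field_simps)
 have 2: "((\<lambda>x. complex_of_real ((1 + x\<^sup>2) powr \<gamma>)) has_vector_derivative
   of_real (\<gamma> * (1 + x\<^sup>2) powr (\<gamma> - 1) * (2 * x))) (at x)"
  by (rule has_vector_derivative_of_real) (rule r)
 have 3: "((\<lambda>x. cis (ta * x\<^sup>2)) has_vector_derivative (2 * \<i> * of_real ta * of_real x) * cis (ta * x\<^sup>2)) (at x)"
 proof -
  have "((\<lambda>x. cis (ta * x\<^sup>2)) has_derivative (\<lambda>y. (ta * (2 * x * y)) *\<^sub>R (\<i> * cis (ta * x\<^sup>2)))) (at x)"
   by (auto intro!: derivative_eq_intros simp: fun_eq_iff)
  then show ?thesis
   unfolding has_vector_derivative_def
   by (rule back_subst[where P = "\<lambda>f. (_ has_derivative f) _"]) (auto simp: fun_eq_iff scaleR_conv_of_real)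
 qed
 show ?thesis
  unfolding mono_symbol_def
  by (rule has_vector_derivative_eq_rhs[OF has_vector_derivative_mult[OF has_vector_derivative_mult[OF
    has_vector_derivative_mult_right[OF 1] 2] 3]])
    (simp add: algebra_simps)
qed

text \<open>Differentiating a monomial gives three monomials. The coefficient of the third one
  contains the time \<open>ta\<close>, so uniform bounds for all derivatives require times in a
  bounded set.\<close>

lemma mono_symbol_umod:
 assumes "\<And>i. i \<in> I ==> norm (c i) <= B" "\<And>i. i \<in> I ==> \<bar>ta i\<bar> <= T"
 shows "umod I (\<lambda>i. mono_symbol (c i) j \<gamma> (ta i))"
proof -
 have "(\<forall>i\<in>I. ndiff b (mono_symbol (c i) j \<gamma> (ta i))) \<and>
  (\<exists>C N. \<forall>i\<in>I. \<forall>x. norm ((dx ^^ b) (mono_symbol (c i) j \<gamma> (ta i)) x) <= C * (1 + \<bar>x\<bar> ^ N))" for b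
  using assms(1)
 proof (induction b arbitrary: c B j \<gamma>)
  case 0
  \<comment> \<open>A natural number above \<gamma> turns the real power into a polynomial bound;
    the inequality is valid for negative \<gamma> too because the base is at least 1.\<close>
  obtain M :: nat where M: "\<gamma> <= real M" using real_arch_simple by blast
  have "norm (mono_symbol (c i) j \<gamma> (ta i) x) <= \<bar>B\<bar> * 2 ^ (M + 1) * (1 + \<bar>x\<bar> ^ (j + 2 * M))" if "i \<in> I" for i x
  proof -
   have "(1 + x\<^sup>2) powr \<gamma> <= (1 + x\<^sup>2) powr real M" using M by (intro powr_mono) auto
   also have "... = (1 + x\<^sup>2) ^ M" by (rule powr_realpow) simp
   finally have p: "(1 + x\<^sup>2) powr \<gamma> <= (1 + x\<^sup>2) ^ M" .
   have q: "\<bar>x\<bar> ^ j * (1 + x\<^sup>2) ^ M <= 2 ^ (M + 1) * (1 + \<bar>x\<bar> ^ (j + 2 * M))"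
   proof (cases "\<bar>x\<bar> <= 1")
    case True
    then have "x\<^sup>2 <= 1" by (simp add: abs_square_le_1)
    then have "(1 + x\<^sup>2) ^ M <= 2 ^ M" by (intro power_mono) auto
    moreover have "\<bar>x\<bar> ^ j <= 1" using True by (simp add: power_le_one)
    ultimately have "\<bar>x\<bar> ^ j * (1 + x\<^sup>2) ^ M <= 1 * 2 ^ M" by (intro mult_mono) auto
    also have "... <= 2 ^ (M + 1) * 1" by simp
    also have "... <= 2 ^ (M + 1) * (1 + \<bar>x\<bar> ^ (j + 2 * M))"
     by (intro mult_left_mono) auto
    finally show ?thesis .
   next
    case False
    then have "1 <= \<bar>x\<bar> ^ 2" by (intro one_le_power) auto
    then have "1 <= x\<^sup>2" by simp
    then have "(1 + x\<^sup>2) ^ M <= (2 * x\<^sup>2) ^ M" by (intro power_mono) auto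
    then have "\<bar>x\<bar> ^ j * (1 + x\<^sup>2) ^ M <= \<bar>x\<bar> ^ j * (2 * x\<^sup>2) ^ M" by (intro mult_left_mono) auto
    also have "... = 2 ^ M * \<bar>x\<bar> ^ (j + 2 * M)"
     by (simp add: power_mult_distrib power_add power_mult)
    also have "... <= 2 ^ (M + 1) * (1 + \<bar>x\<bar> ^ (j + 2 * M))"
     by (intro mult_mono) (auto intro!: power_increasing)
    finally show ?thesis .
   qed
   have "norm (mono_symbol (c i) j \<gamma> (ta i) x) = norm (c i) * (\<bar>x\<bar> ^ j * (1 + x\<^sup>2) powr \<gamma>)"
    by (simp add: mono_symbol_def norm_mult norm_power)
   also have "... <= \<bar>B\<bar> * (\<bar>x\<bar> ^ j * (1 + x\<^sup>2) ^ M)"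
   proof -
    have "norm (c i) <= \<bar>B\<bar>" using 0[OF that] by linarith
    then show ?thesis using p by (intro mult_mono) auto
   qed
   also have "... <= \<bar>B\<bar> * (2 ^ (M + 1) * (1 + \<bar>x\<bar> ^ (j + 2 * M)))" using q by (intro mult_left_mono) auto
   finally show ?thesis by (simp add: mult.assoc)
  qed
  then show ?case by (simp only: funpow_0 ndiff_0) blast
 next
  case (Suc b)
  let ?f1 = "\<lambda>i. mono_symbol (c i * of_nat j) (j - 1) \<gamma> (ta i)"
  let ?f2 = "\<lambda>i. mono_symbol (2 * of_real \<gamma> * c i) (Suc j) (\<gamma> - 1) (ta i)"
  let ?f3 = "\<lambda>i. mono_symbol (2 * \<i> * of_real (ta i) * c i) (Suc j) \<gamma> (ta i)"
  have 1: "(\<forall>i\<in>I. ndiff b (?f1 i)) \<and> (\<exists>C N. \<forall>i\<in>I. \<forall>x. norm ((dx ^^ b) (?f1 i) x) <= C * (1 + \<bar>x\<bar> ^ N))"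
   by (rule Suc.IH[where B = "\<bar>B\<bar> * real j"])
     (use Suc.prems in \<open>force simp: norm_mult intro!: mult_right_mono\<close>)
  have 2: "(\<forall>i\<in>I. ndiff b (?f2 i)) \<and> (\<exists>C N. \<forall>i\<in>I. \<forall>x. norm ((dx ^^ b) (?f2 i) x) <= C * (1 + \<bar>x\<bar> ^ N))"
   by (rule Suc.IH[where B = "2 * \<bar>\<gamma>\<bar> * \<bar>B\<bar>"])
     (use Suc.prems in \<open>force simp: norm_mult intro!: mult_left_mono\<close>)
  have 3: "(\<forall>i\<in>I. ndiff b (?f3 i)) \<and> (\<exists>C N. \<forall>i\<in>I. \<forall>x. norm ((dx ^^ b) (?f3 i) x) <= C * (1 + \<bar>x\<bar> ^ N))"
  proof (rule Suc.IH[where B = "2 * \<bar>T\<bar> * \<bar>B\<bar>"])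
   fix i assume "i \<in> I"
   then have "norm (c i) <= \<bar>B\<bar>" "\<bar>ta i\<bar> <= \<bar>T\<bar>" using Suc.prems assms(2) by force+
   then show "norm (2 * \<i> * of_real (ta i) * c i) <= 2 * \<bar>T\<bar> * \<bar>B\<bar>"
    by (auto simp: norm_mult intro!: mult_mono)
  qed
  obtain C1 N1 where C1: "\<forall>i\<in>I. \<forall>x. norm ((dx ^^ b) (?f1 i) x) <= C1 * (1 + \<bar>x\<bar> ^ N1)" using 1 by blast
  obtain C2 N2 where C2: "\<forall>i\<in>I. \<forall>x. norm ((dx ^^ b) (?f2 i) x) <= C2 * (1 + \<bar>x\<bar> ^ N2)" using 2 by blast
  obtain C3 N3 where C3: "\<forall>i\<in>I. \<forall>x. norm ((dx ^^ b) (?f3 i) x) <= C3 * (1 + \<bar>x\<bar> ^ N3)" using 3 by blast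
  have e: "dx (mono_symbol (c i) j \<gamma> (ta i)) = (\<lambda>x. ?f1 i x + ?f2 i x + ?f3 i x)" for i
   by (rule dx_eqI) (rule mono_symbol_deriv)
  have d: "mono_symbol (c i) j \<gamma> (ta i) differentiable (at x)" for i x
   using mono_symbol_deriv differentiableI_vector by blast
  have n12: "ndiff b (\<lambda>x. ?f1 i x + ?f2 i x) \<and>
   (dx ^^ b) (\<lambda>x. ?f1 i x + ?f2 i x) = (\<lambda>x. (dx ^^ b) (?f1 i) x + (dx ^^ b) (?f2 i) x)" if "i \<in> I" for i
   using 1 2 that by (intro ndiff_add) auto
  have n: "ndiff b (\<lambda>x. ?f1 i x + ?f2 i x + ?f3 i x) \<and>
   (dx ^^ b) (\<lambda>x. ?f1 i x + ?f2 i x + ?f3 i x)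
    = (\<lambda>x. (dx ^^ b) (?f1 i) x + (dx ^^ b) (?f2 i) x + (dx ^^ b) (?f3 i) x)" if "i \<in> I" for i
   using ndiff_add[of b "\<lambda>x. ?f1 i x + ?f2 i x" "?f3 i"] n12[OF that] 3 that by auto
  have *: "norm ((dx ^^ Suc b) (mono_symbol (c i) j \<gamma> (ta i)) x)
    <= 2 * (\<bar>C1\<bar> + \<bar>C2\<bar> + \<bar>C3\<bar>) * (1 + \<bar>x\<bar> ^ (N1 + N2 + N3))" if "i \<in> I" for i x
  proof -
   note p = one_plus_power_mono[of _ "N1 + N2 + N3" x]
   have q: "c * (1 + \<bar>x\<bar> ^ k) <= \<bar>c\<bar> * (2 * (1 + \<bar>x\<bar> ^ (N1 + N2 + N3)))" if "k <= N1 + N2 + N3" for c k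
   proof -
    have "c * (1 + \<bar>x\<bar> ^ k) <= \<bar>c\<bar> * (1 + \<bar>x\<bar> ^ k)" by (intro mult_right_mono) (auto intro!: add_nonneg_nonneg)
    also have "... <= \<bar>c\<bar> * (2 * (1 + \<bar>x\<bar> ^ (N1 + N2 + N3)))" using p[OF that] by (intro mult_left_mono) auto
    finally show ?thesis .
   qed
   have "norm ((dx ^^ Suc b) (mono_symbol (c i) j \<gamma> (ta i)) x)
    <= norm ((dx ^^ b) (?f1 i) x) + norm ((dx ^^ b) (?f2 i) x) + norm ((dx ^^ b) (?f3 i) x)"
    unfolding dx_funpow_Suc e n[OF that, THEN conjunct2]
    by (intro order_trans[OF norm_triangle_ineq] add_mono norm_triangle_ineq order_refl)
   also have "... <= C1 * (1 + \<bar>x\<bar> ^ N1) + C2 * (1 + \<bar>x\<bar> ^ N2) + C3 * (1 + \<bar>x\<bar> ^ N3)"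
    using C1 C2 C3 that by (intro add_mono) auto
   also have "... <= 2 * (\<bar>C1\<bar> + \<bar>C2\<bar> + \<bar>C3\<bar>) * (1 + \<bar>x\<bar> ^ (N1 + N2 + N3))"
    using q[of N1 C1] q[of N2 C2] q[of N3 C3] by (simp add: algebra_simps)
   finally show ?thesis .
  qed
  show ?case
   using * n d e unfolding ndiff_Suc by metis
 qed
 then show ?thesis unfolding umod_def smooth_iff_ndiff by blast
qed

section \<open>The Fourier transform of Schwartz functions\<close>

text \<open>Most exchanges of complex-valued integrals and sums below are dominated by a product of
  a function of x and a function of y; sums enter through counting measure. The four conclusions are
  bundled because the applications need different ones.\<close>

lemma Fubini_product_bound:
 fixes g :: "'a => 'b => complex"
 assumes "sigma_finite_measure M" "sigma_finite_measure N"
  and m: "(\<lambda>(x, y). g x y) \<in> borel_measurable (M \<Otimes>\<^sub>M N)"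
  and A: "integrable M A" and B: "integrable N B"
  and le: "\<And>x y. norm (g x y) <= A x * B y"
 shows "integrable (M \<Otimes>\<^sub>M N) (\<lambda>(x, y). g x y)"
  and "(LINT x|M. LINT y|N. g x y) = (LINT y|N. LINT x|M. g x y)"
  and "integrable M (\<lambda>x. LINT y|N. g x y)" and "integrable N (\<lambda>y. LINT x|M. g x y)"
proof -
 interpret pair_sigma_finite M N
  using assms(1,2) by (simp add: pair_sigma_finite_def)
 have [measurable]: "A \<in> borel_measurable M" "B \<in> borel_measurable N" using A B by auto
 have ab: "integrable (M \<Otimes>\<^sub>M N) (\<lambda>(x, y). A x * B y)"
 proof (rule Fubini_integrable)
  have "(LINT y|N. norm (A x * B y)) = norm (A x) * (LINT y|N. norm (B y))" for x
   by (simp add: abs_mult)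
  then show "integrable M (\<lambda>x. LINT y|N. norm (case (x, y) of (x, y) => A x * B y))"
   using A by simp
  show "AE x in M. integrable N (\<lambda>y. case (x, y) of (x, y) => A x * B y)"
   using B by simp
 qed simp
 show i: "integrable (M \<Otimes>\<^sub>M N) (\<lambda>(x, y). g x y)"
  by (rule integrable_boundI[OF ab m])
    (auto intro!: AE_I2 order_trans[OF le] simp flip: abs_mult)
 show "(LINT x|M. LINT y|N. g x y) = (LINT y|N. LINT x|M. g x y)"
  using Fubini_integral[of g] i by simp
 show "integrable M (\<lambda>x. LINT y|N. g x y)" using integrable_fst[OF i] .
 show "integrable N (\<lambda>y. LINT x|M. g x y)" using integrable_snd[OF i] .
qed

text \<open>The weight that measures decay. Its integral pi is the origin of the factors pi in all
  operator bounds.\<close>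

definition cauchy :: "real => real" where
 "cauchy x = 1 / (1 + x\<^sup>2)"

lemma cauchy_pos [simp]: "0 < cauchy x" and cauchy_nonneg [simp]: "0 <= cauchy x"
 and cauchy_le_1: "cauchy x <= 1"
 by (auto simp: cauchy_def divide_le_eq intro!: divide_nonneg_pos add_pos_nonneg)

lemma cauchy_measurable [measurable]: "cauchy \<in> borel_measurable borel"
 unfolding cauchy_def by measurable

lemma integrable_cauchy [simp]: "integrable lborel cauchy"
 and integral_cauchy: "(LBINT x. cauchy x) = pi"
proof -
 have e: "einterval (-\<infinity>) \<infinity> = (UNIV :: real set)" by (auto simp: einterval_def)
 have *: "cauchy = (\<lambda>x. inverse (1 + x\<^sup>2))" by (auto simp: cauchy_def fun_eq_iff divide_inverse)
 show "integrable lborel cauchy"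
  using integrable_inverse_1_plus_square unfolding e * set_integrable_def by simp
 show "(LBINT x. cauchy x) = pi"
  using LBINT_inverse_1_plus_square
  unfolding * interval_lebesgue_integral_def e set_lebesgue_integral_def by simp
qed

text \<open>Moving the centre of the weight costs at most 2 (1 + x^2), by y^2 <= 2 x^2 + 2 (x -
  y)^2. A Schwartz function of x absorbs that factor.\<close>

lemma cauchy_shift: "cauchy (x - y) <= 2 * (1 + x\<^sup>2) * cauchy y"
proof -
 have "1 + y\<^sup>2 <= 2 * (1 + x\<^sup>2) * (1 + (x - y)\<^sup>2)"
 proof -
  have "y\<^sup>2 <= 2 * x\<^sup>2 + 2 * (x - y)\<^sup>2"
   using zero_le_power2[of "2 * x - y"] by (simp add: power2_eq_square algebra_simps)
  moreover have "0 <= x\<^sup>2 * (x - y)\<^sup>2" by simp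
  ultimately have "1 + y\<^sup>2 <= 2 + 2 * x\<^sup>2 + 2 * (x - y)\<^sup>2 + 2 * (x\<^sup>2 * (x - y)\<^sup>2)" by linarith
  also have "... = 2 * (1 + x\<^sup>2) * (1 + (x - y)\<^sup>2)" by (simp add: algebra_simps)
  finally show ?thesis .
 qed
 then show ?thesis unfolding cauchy_def
  by (simp add: divide_simps mult.commute)
qed

definition decay :: "real => (real => complex) => bool" where
 "decay C f \<longleftrightarrow> f \<in> borel_measurable borel \<and> (\<forall>x. norm (f x) <= C * cauchy x)"

lemma decay_measurable: "decay C f ==> f \<in> borel_measurable borel"
 by (simp add: decay_def)

lemma decayD: "decay C f ==> norm (f x) <= C * cauchy x"
 by (simp add: decay_def)

lemma decay_nonneg: "decay C f ==> 0 <= C"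
proof -
 assume "decay C f"
 from decayD[OF this, of 0] have "0 <= C * cauchy 0" by (meson norm_ge_zero order_trans)
 then show ?thesis by (simp add: cauchy_def)
qed

lemma decay_le: "decay C f ==> norm (f x) <= C"
 using decayD[of C f x] decay_nonneg[of C f] mult_left_mono[OF cauchy_le_1, of C x] by fastforce

lemma decay_integrable: "decay C f ==> integrable lborel f"
 by (rule integrable_boundI[of lborel "\<lambda>x. C * cauchy x"])
   (auto simp: decay_def intro!: AE_I2 order_trans[OF _ abs_ge_self])

lemma decay_integral_norm: "decay C f ==> (LBINT x. norm (f x)) <= C * pi"
proof -
 assume d: "decay C f"
 have "(LBINT x. norm (f x)) <= (LBINT x. C * cauchy x)"
  using d by (intro integral_mono integrable_norm decay_integrable[OF d]) (auto simp: decay_def)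
 then show ?thesis by (simp add: integral_cauchy)
qed

lemma decay_integral: "decay C f ==> norm (LBINT x. f x) <= C * pi"
 using decay_integral_norm integral_norm_bound order_trans by blast

text \<open>The seminorms with weights 1 and x^2 add up to the weight 1 + x^2.\<close>

lemma usch_decay:
 assumes "usch I F" shows "\<exists>C\<ge>0. \<forall>i\<in>I. decay C (F i)"
proof -
 have u: "\<exists>C. \<forall>i\<in>I. \<forall>x. \<bar>x\<bar> ^ a * norm ((dx ^^ b) (F i) x) <= C" for a b
  using assms by (simp add: usch_def)
 obtain C where C: "\<forall>i\<in>I. \<forall>x. \<bar>x\<bar> ^ 0 * norm ((dx ^^ 0) (F i) x) <= C" using u by blast
 obtain D where D: "\<forall>i\<in>I. \<forall>x. \<bar>x\<bar> ^ 2 * norm ((dx ^^ 0) (F i) x) <= D" using u by blast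
 have "decay (max 0 (C + D)) (F i)" if i: "i \<in> I" for i
  unfolding decay_def
 proof (intro conjI allI)
  show "F i \<in> borel_measurable borel" using assms i by (intro smooth_measurable) (auto simp: usch_def)
  fix x
  have "norm (F i x) * (1 + x\<^sup>2) <= C + D"
   using C[rule_format, OF i, of x] D[rule_format, OF i, of x] by (simp add: algebra_simps)
  then have "norm (F i x) * (1 + x\<^sup>2) <= max 0 (C + D)" by linarith
  then show "norm (F i x) <= max 0 (C + D) * cauchy x" by (simp add: cauchy_def pos_le_divide_eq)
 qed
 then show ?thesis by (intro exI[of _ "max 0 (C + D)"]) auto
qed

lemma schwartz_decay: "schwartz phi ==> \<exists>C\<ge>0. decay C phi"
 using usch_decay[OF iffD1[OF schwartz_iff_usch]] by blast

lemma schwartz_integrable: "schwartz phi ==> integrable lborel phi"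
 by (metis schwartz_decay decay_integrable)

lemma schwartz_measurable: "schwartz phi ==> phi \<in> borel_measurable borel"
 by (rule smooth_measurable[OF schwartz_smooth])

lemma schwartz_mult_id: "schwartz phi ==> schwartz (\<lambda>x. of_real x * phi x)"
 unfolding schwartz_iff_usch by (rule usch_mult[OF umod_id])

lemma usch_mult_id: "usch I F ==> usch I (\<lambda>i x. of_real x * F i x)"
 by (rule usch_mult[OF umod_id])

text \<open>The sign \<open>s\<close> covers the transform (s = -1) and, up to 2 pi, its inverse (s
  = 1), so that each property is proved once for both.\<close>

definition ft :: "real => (real => complex) => real => complex" where
 "ft s f xi = (LBINT x. cis (s * (x * xi)) * f x)"

lemma fourier_ft: "fourier = ft (-1)"
 by (simp add: fourier_def ft_def fun_eq_iff)

lemma inv_fourier_ft: "inv_fourier = (\<lambda>f x. ft 1 f x / (2 * pi))"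
 by (simp add: inv_fourier_def ft_def fun_eq_iff mult.commute)

section \<open>Differentiation, decay and inversion of the Fourier transform\<close>

lemma cis_measurable [measurable]: "cis \<in> borel_measurable borel"
 by (rule borel_measurable_continuous_onI) (rule continuous_on_cis[OF continuous_on_id])

lemma borel_measurable_cnj [measurable (raw)]:
 "f \<in> borel_measurable M ==> (\<lambda>x. cnj (f x)) \<in> borel_measurable M"
 by (rule borel_measurable_continuous_on[where f = cnj]) (auto intro!: linear_continuous_on bounded_linear_cnj)

lemma decay_cis_mult: "decay C f ==> decay C (\<lambda>x. cis (s * (x * xi)) * f x)"
proof -
 assume d: "decay C f"
 note [measurable] = decay_measurable[OF d]
 have "(\<lambda>x. cis (s * (x * xi)) * f x) \<in> borel_measurable borel" by measurable
 then show ?thesis using d by (simp add: decay_def norm_mult)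
qed

lemma ft_bound: "decay C f ==> norm (ft s f xi) <= C * pi"
 unfolding ft_def by (rule decay_integral) (rule decay_cis_mult)

lemma ft_integrable: "decay C f ==> integrable lborel (\<lambda>x. cis (s * (x * xi)) * f x)"
 by (rule decay_integrable) (rule decay_cis_mult)

lemma cis_conv_iexp: "cis x = iexp x"
 by (simp add: cis_conv_exp)

text \<open>The quadratic remainder lets differentiation under the integral be controlled by the
  second moment alone.\<close>

lemma cis_taylor2: "norm (cis (a + h) - cis a - \<i> * of_real h * cis a) <= h\<^sup>2"
proof -
 have "cis (a + h) - cis a - \<i> * of_real h * cis a = cis a * (cis h - 1 - \<i> * of_real h)"
  unfolding cis_mult[of a h, symmetric] by (simp add: right_diff_distrib)
 moreover have "(\<Sum>k\<le>1. (\<i> * complex_of_real h) ^ k / fact k) = 1 + \<i> * of_real h" by simp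
 ultimately have "norm (cis (a + h) - cis a - \<i> * of_real h * cis a) <= \<bar>h\<bar> ^ Suc 1 / fact (Suc 1)"
  using iexp_approx1[of h 1] by (simp add: norm_mult cis_conv_iexp diff_diff_eq)
 also have "... <= h\<^sup>2" by (simp add: power2_eq_square)
 finally show ?thesis .
qed

text \<open>By the Taylor bound for the exponential, the difference quotient misses the expected
  derivative by at most |h| times s^2 times the second moment of \<open>f\<close>.\<close>

lemma ft_has_derivative:
 assumes "decay C0 f" "decay C1 (\<lambda>x. of_real x * f x)" "decay C2 (\<lambda>x. of_real x * (of_real x * f x))"
 shows "(ft s f has_vector_derivative ft s (\<lambda>x. \<i> * of_real s * (of_real x * f x)) xi) (at xi)"
proof -
 note [measurable] = decay_measurable[OF assms(1)]
 let ?D = "ft s (\<lambda>x. \<i> * of_real s * (of_real x * f x)) xi"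
 have i0: "integrable lborel (\<lambda>x. cis (s * (x * xi)) * f x)" for xi by (rule ft_integrable[OF assms(1)])
 have i1: "integrable lborel (\<lambda>x. cis (s * (x * xi)) * (of_real x * f x))" by (rule ft_integrable[OF assms(2)])
 have i1': "integrable lborel (\<lambda>x. cis (s * (x * xi)) * (\<i> * of_real s * (of_real x * f x)))"
  using integrable_mult_right[OF i1, of "\<i> * of_real s"] by (simp add: algebra_simps)
 have i2: "integrable lborel (\<lambda>x. x\<^sup>2 * norm (f x))"
  using integrable_norm[OF decay_integrable[OF assms(3)]]
  by (simp add: norm_mult power2_eq_square mult.assoc[symmetric] abs_mult_self_eq)
 have est: "norm (ft s f (xi + h) - ft s f xi - h *\<^sub>R ?D) <= h\<^sup>2 * (s\<^sup>2 * (LBINT x. x\<^sup>2 * norm (f x)))" for h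
 proof -
  have eq: "ft s f (xi + h) - ft s f xi - h *\<^sub>R ?D
   = (LBINT x. cis (s * (x * (xi + h))) * f x - cis (s * (x * xi)) * f x
     - h *\<^sub>R (cis (s * (x * xi)) * (\<i> * of_real s * (of_real x * f x))))"
   unfolding ft_def using i0 i1'
   by (simp add: Bochner_Integration.integral_diff)
  have "norm (ft s f (xi + h) - ft s f xi - h *\<^sub>R ?D) <= (LBINT x. h\<^sup>2 * s\<^sup>2 * (x\<^sup>2 * norm (f x)))"
   unfolding eq
  proof (rule Bochner_Integration.integral_norm_bound_integral)
   show "integrable lborel (\<lambda>x. cis (s * (x * (xi + h))) * f x - cis (s * (x * xi)) * f x
     - h *\<^sub>R (cis (s * (x * xi)) * (\<i> * of_real s * (of_real x * f x))))"
    by (intro Bochner_Integration.integrable_diff i0 integrable_scaleR_right i1')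
   show "integrable lborel (\<lambda>x. h\<^sup>2 * s\<^sup>2 * (x\<^sup>2 * norm (f x)))"
    by (intro integrable_mult_right i2)
   fix x
   have "cis (s * (x * (xi + h))) = cis (s * (x * xi) + s * x * h)" by (simp add: distrib_left mult.assoc)
   moreover have "A * z - E * z - h *\<^sub>R (E * (\<i> * of_real s * (of_real x * z)))
     = (A - E - \<i> * of_real (s * x * h) * E) * z" for A E z
    by (simp add: left_diff_distrib scaleR_conv_of_real mult.assoc mult.left_commute)
   ultimately have "norm (cis (s * (x * (xi + h))) * f x - cis (s * (x * xi)) * f x
     - h *\<^sub>R (cis (s * (x * xi)) * (\<i> * of_real s * (of_real x * f x))))
    = norm (cis (s * (x * xi) + s * x * h) - cis (s * (x * xi)) - \<i> * of_real (s * x * h) * cis (s * (x * xi))) * norm (f x)"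
    by (simp only: norm_mult)
   also have "... <= (s * x * h)\<^sup>2 * norm (f x)"
    by (intro mult_right_mono cis_taylor2) auto
   also have "(s * x * h)\<^sup>2 * norm (f x) = h\<^sup>2 * s\<^sup>2 * (x\<^sup>2 * norm (f x))"
    by (simp add: power_mult_distrib mult.assoc mult.left_commute)
   finally show "norm (cis (s * (x * (xi + h))) * f x - cis (s * (x * xi)) * f x
     - h *\<^sub>R (cis (s * (x * xi)) * (\<i> * of_real s * (of_real x * f x)))) <= h\<^sup>2 * s\<^sup>2 * (x\<^sup>2 * norm (f x))" .
  qed
  also have "... = (h\<^sup>2 * s\<^sup>2) * (LBINT x. x\<^sup>2 * norm (f x))"
   by (rule integral_mult_right_zero)
  also have "... = h\<^sup>2 * (s\<^sup>2 * (LBINT x. x\<^sup>2 * norm (f x)))"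
   by (rule mult.assoc)
  finally show ?thesis .
 qed
 define B where "B = s\<^sup>2 * (LBINT x. x\<^sup>2 * norm (f x))"
 have "(\<lambda>h. norm (ft s f (xi + h) - ft s f xi - h *\<^sub>R ?D) / norm h) \<midarrow>0\<rightarrow> 0"
 proof (rule tendsto_sandwich[where f = "\<lambda>_. 0" and h = "\<lambda>h. \<bar>h\<bar> * B"])
  show "\<forall>\<^sub>F h in at 0. norm (ft s f (xi + h) - ft s f xi - h *\<^sub>R ?D) / norm h <= \<bar>h\<bar> * B"
  proof (rule eventuallyI)
   fix h
   show "norm (ft s f (xi + h) - ft s f xi - h *\<^sub>R ?D) / norm h <= \<bar>h\<bar> * B"
   proof (cases "h = 0")
    case False
    then have h: "0 < \<bar>h\<bar>" by simp
    have e: "h\<^sup>2 * B = \<bar>h\<bar> * B * \<bar>h\<bar>"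
     unfolding power2_eq_square by (metis abs_mult_self_eq mult.assoc mult.commute)
    show ?thesis unfolding real_norm_def pos_divide_le_eq[OF h]
     using est[of h, folded B_def] unfolding e .
   qed simp
  qed
  have "((\<lambda>h. \<bar>h\<bar> * B) \<longlongrightarrow> \<bar>0\<bar> * B) (at 0)" by (intro tendsto_intros)
  then show "((\<lambda>h. \<bar>h\<bar> * B) \<longlongrightarrow> 0) (at 0)" by simp
 qed auto
 then show ?thesis unfolding has_vector_derivative_def has_derivative_at
  by (simp add: bounded_linear_scaleR_left)
qed

text \<open>The fundamental theorem of calculus on the whole line: the decay of \<open>g\<close>
  makes both boundary values vanish. It is the source of every integration by parts.\<close>

lemma integral_deriv_eq_0:
 fixes g :: "real => complex"
 assumes d: "\<And>x. (g has_vector_derivative g' x) (at x)" and c: "\<And>x. isCont g' x"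
  and g: "decay C g" and g': "decay D g'"
 shows "(LBINT x. g' x) = 0"
proof -
 have lim: "(g \<longlongrightarrow> 0) F" if "filterlim (\<lambda>x::real. \<bar>x\<bar>) at_top F" for F
 proof (rule Lim_null_comparison)
  show "\<forall>\<^sub>F x in F. norm (g x) <= C * cauchy x" using g by (auto simp: decay_def)
  have "filterlim (\<lambda>x. 1 + \<bar>x\<bar>\<^sup>2) at_top F"
   by (intro filterlim_tendsto_add_at_top[OF tendsto_const] filterlim_pow_at_top that) auto
  then have "((\<lambda>x. C * (1 / (1 + \<bar>x\<bar>\<^sup>2))) \<longlongrightarrow> C * 0) F"
   by (intro tendsto_mult tendsto_const tendsto_divide_0[OF tendsto_const] filterlim_at_top_imp_at_infinity)
  then show "((\<lambda>x. C * cauchy x) \<longlongrightarrow> 0) F" by (simp add: cauchy_def)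
 qed
 have "(LBINT x=-\<infinity>..\<infinity>. g' x) = 0 - 0"
 proof (rule interval_integral_FTC_integrable[where F = g])
  show "set_integrable lborel (einterval (- \<infinity>) \<infinity>) g'"
   using decay_integrable[OF g'] by (simp add: set_integrable_def einterval_def)
  show "((g \<circ> real_of_ereal) \<longlongrightarrow> 0) (at_right (- \<infinity>))"
  proof -
   have "filterlim (\<lambda>x::real. \<bar>- x\<bar>) at_top at_bot"
    by (rule filterlim_compose[OF filterlim_abs_real filterlim_uminus_at_top_at_bot])
   then have "filterlim (\<lambda>x::real. \<bar>x\<bar>) at_top at_bot" unfolding abs_minus_cancel .
   from lim[OF this] show ?thesis unfolding ereal_tendsto_simps1 .
  qed
  show "((g \<circ> real_of_ereal) \<longlongrightarrow> 0) (at_left \<infinity>)"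
   using lim[OF filterlim_abs_real] unfolding ereal_tendsto_simps1 .
 qed (use d c in auto)
 then show ?thesis
  by (simp add: interval_lebesgue_integral_def set_lebesgue_integral_def einterval_def)
qed

text \<open>The derivative of \<open>cis (s * (x * xi)) * f x\<close> has integral zero; its two
  summands give the two sides.\<close>

lemma ft_of_derivative:
 assumes d: "\<And>x. (f has_vector_derivative f' x) (at x)" and c: "\<And>x. isCont f' x"
  and f: "decay C f" and f': "decay D f'"
 shows "ft s f' xi = - (\<i> * of_real s * of_real xi * ft s f xi)"
proof -
 note [measurable] = decay_measurable[OF f] decay_measurable[OF f']
 let ?a = "\<i> * of_real s * of_real xi"
 have cis_d: "((\<lambda>x. cis (s * (x * xi))) has_vector_derivative ?a * cis (s * (x * xi))) (at x)" for x
 proof -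
  have "((\<lambda>x. cis (s * (x * xi))) has_derivative (\<lambda>y. (s * (y * xi)) *\<^sub>R (\<i> * cis (s * (x * xi))))) (at x)"
   by (auto intro!: derivative_eq_intros simp: fun_eq_iff)
  then show ?thesis
   unfolding has_vector_derivative_def
   by (rule back_subst[where P = "\<lambda>f. (_ has_derivative f) _"]) (auto simp: fun_eq_iff scaleR_conv_of_real)
 qed
 let ?g = "\<lambda>x. cis (s * (x * xi)) * f x"
 let ?g' = "\<lambda>x. cis (s * (x * xi)) * f' x + ?a * (cis (s * (x * xi)) * f x)"
 have isf: "isCont f x" for x using d has_vector_derivative_continuous by blast
 have "(LBINT x. ?g' x) = 0"
 proof (rule integral_deriv_eq_0)
  fix x show "(?g has_vector_derivative ?g' x) (at x)"
   using has_vector_derivative_mult[OF cis_d d, of x] by (simp add: algebra_simps)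
  have "isCont (\<lambda>x. cis (s * (x * xi))) x" by (rule has_vector_derivative_continuous[OF cis_d])
  then show "isCont ?g' x" using c isf by (intro continuous_intros)
 next
  show "decay C ?g" by (rule decay_cis_mult[OF f])
  show "decay (D + norm ?a * C) ?g'"
   unfolding decay_def
  proof (intro conjI allI)
   fix x
   have "norm (?g' x) <= norm (f' x) + norm ?a * norm (f x)"
    by (rule order_trans[OF norm_triangle_ineq]) (simp add: norm_mult)
   also have "... <= D * cauchy x + norm ?a * (C * cauchy x)"
    by (intro add_mono mult_left_mono decayD f f') auto
   finally show "norm (?g' x) <= (D + norm ?a * C) * cauchy x" by (simp add: algebra_simps)
  qed measurable
 qed
 then have "ft s f' xi + ?a * ft s f xi = 0"
  using Bochner_Integration.integral_add[OF ft_integrable[OF f', of s xi]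
    integrable_mult_right[OF ft_integrable[OF f, of s xi], of ?a]]
  unfolding ft_def integral_mult_right_zero by simp
 then show ?thesis by (simp add: eq_neg_iff_add_eq_0)
qed

lemma usch_ft_deriv:
 assumes "usch I F" "i \<in> I"
 shows "(ft s (F i) has_vector_derivative ft s (\<lambda>x. \<i> * of_real s * (of_real x * F i x)) xi) (at xi)"
proof -
 have "schwartz (F i)" by (rule usch_imp_schwartz[OF assms])
 note s = this schwartz_mult_id[OF this] schwartz_mult_id[OF schwartz_mult_id[OF this]]
 obtain C0 where C0: "decay C0 (F i)" using schwartz_decay[OF s(1)] by blast
 obtain C1 where C1: "decay C1 (\<lambda>x. of_real x * F i x)" using schwartz_decay[OF s(2)] by blast
 obtain C2 where C2: "decay C2 (\<lambda>x. of_real x * (of_real x * F i x))" using schwartz_decay[OF s(3)] by blast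
 show ?thesis by (rule ft_has_derivative[OF C0 C1 C2])
qed

lemma usch_mult_ix: "usch I F ==> usch I (\<lambda>i x. \<i> * of_real s * (of_real x * F i x))"
 using usch_cmult[OF usch_mult_id, of I F "\<i> * of_real s"] by simp

text \<open>Powers of the frequency are traded for derivatives of \<open>F\<close>
  (\<open>base\<close>), and derivatives of the transform for multiplication of \<open>F\<close> by
  x. Since \<open>s\<close> is 1 or -1, no power of |s| enters the bounds.\<close>

lemma usch_ft:
 assumes "usch I F" "s = 1 \<or> s = -1"
 shows "usch I (\<lambda>i. ft s (F i))"
proof -
 have base: "\<exists>C. \<forall>i\<in>I. \<forall>x. \<bar>x\<bar> ^ a * norm (ft s (F i) x) <= C" if "usch I F" for a and F :: "'a => real => complex"
  using that
 proof (induction a arbitrary: F)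
  case 0
  obtain C where "\<forall>i\<in>I. decay C (F i)" using usch_decay[OF 0] by blast
  then have "\<forall>i\<in>I. \<forall>x. \<bar>x\<bar> ^ 0 * norm (ft s (F i) x) <= C * pi" by (auto intro: ft_bound)
  then show ?case by blast
 next
  case (Suc a)
  obtain C where C: "\<forall>i\<in>I. \<forall>x. \<bar>x\<bar> ^ a * norm (ft s (dx (F i)) x) <= C"
   using Suc.IH[OF usch_dx[OF Suc.prems]] by blast
  have "\<bar>x\<bar> ^ Suc a * norm (ft s (F i) x) <= C" if i: "i \<in> I" for i x
  proof -
   obtain C0 where d0: "decay C0 (F i)" using usch_decay[OF Suc.prems] i by blast
   obtain C1 where d1: "decay C1 (dx (F i))" using usch_decay[OF usch_dx[OF Suc.prems]] i by blast
   have "ft s (dx (F i)) x = - (\<i> * of_real s * of_real x * ft s (F i) x)"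
   proof (rule ft_of_derivative[OF _ _ d0 d1])
    fix x
    show "(F i has_vector_derivative dx (F i) x) (at x)" using Suc.prems i by (auto intro: smooth_has_dx usch_smooth)
    show "isCont (dx (F i)) x"
     using smooth_has_dx[OF smooth_dx[OF usch_smooth[OF Suc.prems i]]] has_vector_derivative_continuous by blast
   qed
   then have "norm (ft s (dx (F i)) x) = \<bar>x\<bar> * norm (ft s (F i) x)"
    using assms(2) by (auto simp: norm_mult)
   then show ?thesis using C[rule_format, OF i, of x] by (simp add: algebra_simps)
  qed
  then show ?case by blast
 qed
 have 1: "(\<forall>i\<in>I. ndiff b (ft s (F i))) \<and> (\<exists>C. \<forall>i\<in>I. \<forall>x. \<bar>x\<bar> ^ a * norm ((dx ^^ b) (ft s (F i)) x) <= C)"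
  if "usch I F" for a b and F :: "'a => real => complex"
  using that
 proof (induction b arbitrary: F)
  case 0
  then show ?case using base[OF 0] by simp
 next
  case (Suc b)
  have e: "dx (ft s (F i)) = ft s (\<lambda>x. \<i> * of_real s * (of_real x * F i x))" if "i \<in> I" for i
   by (rule dx_eqI) (rule usch_ft_deriv[OF Suc.prems that])
  have d: "ft s (F i) differentiable (at x)" if "i \<in> I" for i x
   using usch_ft_deriv[OF Suc.prems that] differentiableI_vector by blast
  show ?case using Suc.IH[OF usch_mult_ix[OF Suc.prems, of s]] e d
   unfolding ndiff_Suc dx_funpow_Suc by auto
 qed
 show ?thesis unfolding usch_def smooth_iff_ndiff using 1[OF assms(1)] by blast
qed

lemma usch_fourier: "usch I F ==> usch I (\<lambda>i. fourier (F i))"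
 unfolding fourier_ft by (rule usch_ft) auto

lemma usch_inv_fourier: "usch I F ==> usch I (\<lambda>i. inv_fourier (F i))"
 using usch_cmult[OF usch_ft[of I F 1], of "1 / (2 * pi)"] unfolding inv_fourier_ft by simp

lemma schwartz_fourier: "schwartz phi ==> schwartz (fourier phi)"
 unfolding schwartz_iff_usch by (rule usch_fourier)

lemma schwartz_inv_fourier: "schwartz phi ==> schwartz (inv_fourier phi)"
 unfolding schwartz_iff_usch by (rule usch_inv_fourier)

lemma schwartz_ft: "schwartz phi ==> s = 1 \<or> s = -1 ==> schwartz (ft s phi)"
 unfolding schwartz_iff_usch by (rule usch_ft)

lemma ft_uminus: "ft (-s) f xi = ft s f (-xi)"
 by (simp add: ft_def)

lemma ft_cmult: "(LBINT xi. c * (cis (s * (xi * x)) * h xi)) = c * ft s h x"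
 unfolding ft_def by (rule integral_mult_right_zero)

lemma sigma_finite_lborel': "sigma_finite_measure (lborel :: real measure)"
 by (simp add: lborel.sigma_finite_measure_axioms)

text \<open>The characteristic function of the standard normal distribution, rescaled by
  \<epsilon>.\<close>

lemma ft_gaussian:
 assumes "0 < \<epsilon>"
 shows "(LBINT xi. cis (a * xi) * of_real (std_normal_density (\<epsilon> * xi)))
  = of_real (sqrt (2 * pi) / \<epsilon> * std_normal_density (a / \<epsilon>))"
proof -
 have "(LBINT xi. cis (a * xi) * of_real (std_normal_density (\<epsilon> * xi)) :: complex)
  = \<bar>1 / \<epsilon>\<bar> *\<^sub>R (LBINT z. cis (a * (0 + (1 / \<epsilon>) * z)) * of_real (std_normal_density (\<epsilon> * (0 + (1 / \<epsilon>) * z))))"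
  by (rule lborel_integral_real_affine) (use assms in auto)
 also have "(LBINT z. cis (a * (0 + (1 / \<epsilon>) * z)) * of_real (std_normal_density (\<epsilon> * (0 + (1 / \<epsilon>) * z))) :: complex)
   = char std_normal_distribution (a / \<epsilon>)"
  unfolding char_def
  by (subst integral_density) (use assms in \<open>auto simp: cis_conv_iexp scaleR_conv_of_real mult.commute\<close>)
 also have "... = of_real (exp (- ((a / \<epsilon>)\<^sup>2) / 2))"
  by (simp add: char_std_normal_distribution)
 also have "\<bar>1 / \<epsilon>\<bar> *\<^sub>R complex_of_real (exp (- ((a / \<epsilon>)\<^sup>2) / 2)) = of_real (sqrt (2 * pi) / \<epsilon> * std_normal_density (a / \<epsilon>))"
  using assms by (simp add: std_normal_density_def scaleR_conv_of_real)
 finally show ?thesis .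
qed

text \<open>Fourier inversion by Gaussian regularization. The inverse integral is damped by a
  Gaussian of width 1 / \<epsilon>; it tends to a multiple of the undamped one and, by Fubini, is a
  Gaussian average of \<open>phi\<close> around x at scale \<epsilon>, which tends to a multiple of
  \<open>phi x\<close>.\<close>

lemma ft_ft:
 fixes phi :: "real => complex"
 assumes phi: "schwartz phi"
 shows "ft 1 (ft (-1) phi) x = 2 * pi * phi x"
proof -
 let ?h = "ft (-1) phi"
 have sh: "schwartz ?h" by (rule schwartz_ft[OF phi]) simp
 obtain C where C: "decay C phi" using schwartz_decay[OF phi] by blast
 obtain D where D: "decay D ?h" using schwartz_decay[OF sh] by blast
 note [measurable] = decay_measurable[OF C] decay_measurable[OF D]
 have nn: "std_normal_density z <= 1" for z
 proof -
  have "std_normal_density z <= 1 / sqrt (2 * pi) * 1"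
   unfolding std_normal_density_def by (intro mult_left_mono) auto
  also have "... <= 1" using pi_gt3 by (simp add: divide_le_eq_1)
  finally show ?thesis .
 qed
 have cn: "isCont std_normal_density z" for z
  unfolding std_normal_density_def by (intro continuous_intros) auto
 define J where "J \<epsilon> = (LBINT xi. cis (x * xi) * of_real (std_normal_density (\<epsilon> * xi)) * ?h xi)" for \<epsilon>
 \<comment> \<open>The inner frequency integral is an explicit Gaussian, and y = x + \<epsilon> z
   turns it into a fixed density, so that the limit falls on \<open>phi\<close> only.\<close>
 have J_eq: "J \<epsilon> = of_real (sqrt (2 * pi)) * (LBINT z. of_real (std_normal_density z) * phi (x + \<epsilon> * z))" if \<epsilon>: "0 < \<epsilon>" for \<epsilon>
 proof -
  have "J \<epsilon> = (LBINT xi. LBINT y. cis (x * xi) * of_real (std_normal_density (\<epsilon> * xi)) * (cis (- (y * xi)) * phi y))"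
   unfolding J_def by (intro LBINT_cong refl) (simp add: ft_def)
  also have "... = (LBINT y. LBINT xi. cis (x * xi) * of_real (std_normal_density (\<epsilon> * xi)) * (cis (- (y * xi)) * phi y))"
  proof (rule Fubini_product_bound(2)[OF sigma_finite_lborel' sigma_finite_lborel'])
   show "integrable lborel (\<lambda>xi. std_normal_density (\<epsilon> * xi))"
    using lborel_integrable_real_affine[of std_normal_density \<epsilon> 0] \<epsilon> integrable_std_normal_moment[of 0] by simp
   show "integrable lborel (\<lambda>y. norm (phi y))" by (rule integrable_norm[OF decay_integrable[OF C]])
   show "norm (cis (x * xi) * of_real (std_normal_density (\<epsilon> * xi)) * (cis (- (y * xi)) * phi y))
    <= std_normal_density (\<epsilon> * xi) * norm (phi y)" for xi y
    by (simp add: norm_mult)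
  qed measurable
  also have "... = (LBINT y. of_real (sqrt (2 * pi) / \<epsilon> * std_normal_density ((x - y) / \<epsilon>)) * phi y)"
  proof (intro LBINT_cong refl)
   fix y
   have "(LBINT xi. cis (x * xi) * of_real (std_normal_density (\<epsilon> * xi)) * (cis (- (y * xi)) * phi y))
    = (LBINT xi. (cis ((x - y) * xi) * of_real (std_normal_density (\<epsilon> * xi))) * phi y)"
   proof (intro LBINT_cong refl)
    fix xi
    have "cis (x * xi) * cis (- (y * xi)) = cis ((x - y) * xi)" by (simp add: cis_mult left_diff_distrib)
    then show "cis (x * xi) * of_real (std_normal_density (\<epsilon> * xi)) * (cis (- (y * xi)) * phi y)
     = (cis ((x - y) * xi) * of_real (std_normal_density (\<epsilon> * xi))) * phi y"
     by (metis (no_types, lifting) mult.assoc mult.commute)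
   qed
   also have "... = of_real (sqrt (2 * pi) / \<epsilon> * std_normal_density ((x - y) / \<epsilon>)) * phi y"
    by (simp add: ft_gaussian[OF \<epsilon>])
   finally show "(LBINT xi. cis (x * xi) * of_real (std_normal_density (\<epsilon> * xi)) * (cis (- (y * xi)) * phi y))
    = of_real (sqrt (2 * pi) / \<epsilon> * std_normal_density ((x - y) / \<epsilon>)) * phi y" .
  qed
  also have "... = \<bar>\<epsilon>\<bar> *\<^sub>R (LBINT z. of_real (sqrt (2 * pi) / \<epsilon> * std_normal_density ((x - (x + \<epsilon> * z)) / \<epsilon>)) * phi (x + \<epsilon> * z))"
   by (rule lborel_integral_real_affine) (use \<epsilon> in auto)
  also have "(LBINT z. of_real (sqrt (2 * pi) / \<epsilon> * std_normal_density ((x - (x + \<epsilon> * z)) / \<epsilon>)) * phi (x + \<epsilon> * z))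
   = (LBINT z. of_real (sqrt (2 * pi) / \<epsilon>) * (of_real (std_normal_density z) * phi (x + \<epsilon> * z)))"
   by (intro LBINT_cong refl) (use \<epsilon> in \<open>simp add: std_normal_density_def\<close>)
  finally show ?thesis using \<epsilon> by (simp add: scaleR_conv_of_real)
 qed
 let ?e = "\<lambda>n. inverse (real (Suc n))"
 have e0: "?e \<longlonglongrightarrow> 0" by (rule LIMSEQ_inverse_real_of_nat)
 have "(\<lambda>n. J (?e n)) \<longlonglongrightarrow> (LBINT xi. cis (x * xi) * of_real (std_normal_density 0) * ?h xi)"
  unfolding J_def
 proof (rule integral_dominated_convergence[where w = "\<lambda>xi. norm (?h xi)"])
  show "integrable lborel (\<lambda>xi. norm (?h xi))" by (intro integrable_norm decay_integrable[OF D])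
  show "AE xi in lborel. (\<lambda>n. cis (x * xi) * of_real (std_normal_density (?e n * xi)) * ?h xi)
    \<longlonglongrightarrow> cis (x * xi) * of_real (std_normal_density 0) * ?h xi"
  proof (intro AE_I2 tendsto_intros)
   fix xi
   have "(\<lambda>n. ?e n * xi) \<longlonglongrightarrow> 0" using tendsto_mult_right[OF e0, of xi] by simp
   then show "(\<lambda>n. std_normal_density (?e n * xi)) \<longlonglongrightarrow> std_normal_density 0"
    by (rule isCont_tendsto_compose[OF cn])
  qed
  show "AE xi in lborel. norm (cis (x * xi) * of_real (std_normal_density (?e n * xi)) * ?h xi) <= norm (?h xi)" for n
  proof (rule AE_I2)
   fix xi
   have "norm (cis (x * xi) * of_real (std_normal_density (?e n * xi)) * ?h xi)
    = std_normal_density (?e n * xi) * norm (?h xi)"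
    by (simp only: norm_mult norm_cis mult_1 norm_of_real abs_of_nonneg[OF normal_density_nonneg])
   also have "... <= 1 * norm (?h xi)" by (intro mult_right_mono nn) auto
   finally show "norm (cis (x * xi) * of_real (std_normal_density (?e n * xi)) * ?h xi) <= norm (?h xi)" by simp
  qed
 qed measurable
 moreover have "(LBINT xi. cis (x * xi) * of_real (std_normal_density 0) * ?h xi) = of_real (std_normal_density 0) * ft 1 ?h x"
 proof -
  have "cis (x * xi) * of_real (std_normal_density 0) * ?h xi = of_real (std_normal_density 0) * (cis (1 * (xi * x)) * ?h xi)" for xi
   by (simp only: mult_1 mult.commute[of x xi] mult.assoc mult.left_commute)
  then show ?thesis unfolding ft_cmult[of _ 1 x ?h, symmetric] by presburger
 qed
 moreover have "(\<lambda>n. J (?e n)) \<longlonglongrightarrow> of_real (sqrt (2 * pi)) * (LBINT z. of_real (std_normal_density z) * phi x)"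
 proof -
  have "(\<lambda>n. LBINT z. of_real (std_normal_density z) * phi (x + ?e n * z)) \<longlonglongrightarrow> (LBINT z. of_real (std_normal_density z) * phi x)"
  proof (rule integral_dominated_convergence[where w = "\<lambda>z. std_normal_density z * C"])
   show "integrable lborel (\<lambda>z. std_normal_density z * C)" using integrable_std_normal_moment[of 0] by simp
   show "AE z in lborel. (\<lambda>n. of_real (std_normal_density z) * phi (x + ?e n * z)) \<longlonglongrightarrow> of_real (std_normal_density z) * phi x"
   proof (intro AE_I2 tendsto_intros)
    fix z
    have "(\<lambda>n. x + ?e n * z) \<longlonglongrightarrow> x" using tendsto_add[OF tendsto_const tendsto_mult_right[OF e0, of z], of x] by simp
    moreover have "isCont phi x"
     using smooth_has_dx[OF schwartz_smooth[OF phi]] has_vector_derivative_continuous by blast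
    ultimately show "(\<lambda>n. phi (x + ?e n * z)) \<longlonglongrightarrow> phi x" by (rule isCont_tendsto_compose[rotated])
   qed
   show "AE z in lborel. norm (of_real (std_normal_density z) * phi (x + ?e n * z)) <= std_normal_density z * C" for n
   proof (rule AE_I2)
    fix z
    have "norm (of_real (std_normal_density z) * phi (x + ?e n * z)) = std_normal_density z * norm (phi (x + ?e n * z))"
     by (simp only: norm_mult norm_of_real abs_of_nonneg[OF normal_density_nonneg])
    also have "... <= std_normal_density z * C" by (intro mult_left_mono decay_le[OF C]) auto
    finally show "norm (of_real (std_normal_density z) * phi (x + ?e n * z)) <= std_normal_density z * C" .
   qed
  qed measurable
  then show ?thesis by (subst J_eq) (auto intro!: tendsto_intros)
 qed
 moreover have "(LBINT z. of_real (std_normal_density z) * phi x) = phi x"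
  using integral_std_normal_moment_even[of 0]
   integral_mult_left_zero[of lborel "\<lambda>z. complex_of_real (std_normal_density z)" "phi x"]
  by (simp add: integral_complex_of_real)
 ultimately have "of_real (std_normal_density 0) * ft 1 ?h x = of_real (sqrt (2 * pi)) * phi x"
  using LIMSEQ_unique by metis
 then have "of_real (sqrt (2 * pi)) * (of_real (std_normal_density 0) * ft 1 ?h x) = of_real (sqrt (2 * pi)) * (of_real (sqrt (2 * pi)) * phi x)"
  by simp
 moreover have "sqrt (2 * pi) * std_normal_density 0 = 1" by (simp add: std_normal_density_def)
 moreover have "sqrt (2 * pi) * sqrt (2 * pi) = 2 * pi" by simp
 ultimately show ?thesis
  by (metis (no_types, lifting) mult.assoc mult_1 of_real_1 of_real_mult of_real_numeral)
qed

lemma inv_fourier_fourier: "schwartz phi ==> inv_fourier (fourier phi) = phi"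
 by (simp add: inv_fourier_ft fourier_ft ft_ft fun_eq_iff)

lemma fourier_inv_fourier:
 fixes phi :: "real => complex"
 assumes phi: "schwartz phi" shows "fourier (inv_fourier phi) = phi"
proof
 fix x
 have "fourier (inv_fourier phi) x = (LBINT y. cis (- (y * x)) * (ft 1 phi y / (2 * pi)))"
  by (simp add: fourier_def inv_fourier_ft)
 also have "... = (LBINT y. cis (- (y * x)) * ft (-1) phi (- y)) / (2 * pi)"
  by (simp add: ft_uminus[of 1])
 also have "(LBINT y. cis (- (y * x)) * ft (-1) phi (- y)) = ft 1 (ft (-1) phi) x"
  using lborel_integral_real_affine[of "-1" "\<lambda>y. cis (y * x) * ft (-1) phi y" 0]
  by (simp add: ft_def[of 1])
 finally show "fourier (inv_fourier phi) x = phi x" by (simp add: ft_ft[OF phi])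
qed

section \<open>Plancherel's identity\<close>

lemma schwartz_norm2_integrable:
 fixes phi :: "real => complex"
 assumes "schwartz phi" shows "integrable lborel (\<lambda>x. (norm (phi x))\<^sup>2)"
proof -
 obtain C where C: "decay C phi" using schwartz_decay[OF assms] by blast
 note [measurable] = decay_measurable[OF C]
 show ?thesis
 proof (rule integrable_boundI)
  show "integrable lborel (\<lambda>x. C * norm (phi x))" by (intro integrable_mult_right integrable_norm decay_integrable[OF C])
  show "AE x in lborel. norm ((norm (phi x))\<^sup>2) <= norm (C * norm (phi x))"
   using decay_le[OF C] decay_nonneg[OF C] by (auto simp: power2_eq_square abs_mult intro!: AE_I2 mult_right_mono)
 qed measurable
qed

text \<open>One factor of the squared modulus is expanded as an integral; after Fubini the other one
  is transformed back by the inversion formula.\<close>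

lemma Plancherel_fourier:
 fixes phi :: "real => complex"
 assumes phi: "schwartz phi"
 shows "(LBINT x. (norm (fourier phi x))\<^sup>2) = 2 * pi * (LBINT x. (norm (phi x))\<^sup>2)"
proof -
 let ?h = "ft (-1) phi"
 have sh: "schwartz ?h" by (rule schwartz_ft[OF phi]) simp
 obtain C where C: "decay C phi" using schwartz_decay[OF phi] by blast
 obtain D where D: "decay D ?h" using schwartz_decay[OF sh] by blast
 note [measurable] = decay_measurable[OF C] decay_measurable[OF D]
 have "complex_of_real (LBINT x. (norm (?h x))\<^sup>2) = (LBINT xi. ?h xi * cnj (?h xi))"
  by (subst integral_complex_of_real[symmetric]) (simp add: complex_norm_square del: of_real_power)
 also have "... = (LBINT xi. LBINT x. ?h xi * (cis (x * xi) * cnj (phi x)))"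
 proof (intro LBINT_cong refl)
  fix xi
  have "cnj (?h xi) = (LBINT x. cnj (cis (-1 * (x * xi)) * phi x))"
   unfolding ft_def by (rule Bochner_Integration.integral_cnj[symmetric])
  also have "... = (LBINT x. cis (x * xi) * cnj (phi x))" by (simp add: cis_cnj)
  finally show "?h xi * cnj (?h xi) = (LBINT x. ?h xi * (cis (x * xi) * cnj (phi x)))" by simp
 qed
 also have "... = (LBINT x. LBINT xi. ?h xi * (cis (x * xi) * cnj (phi x)))"
 proof (rule Fubini_product_bound(2)[OF sigma_finite_lborel' sigma_finite_lborel'])
  show "integrable lborel (\<lambda>y. norm (?h y))" by (rule integrable_norm[OF decay_integrable[OF D]])
  show "integrable lborel (\<lambda>y. norm (phi y))" by (rule integrable_norm[OF decay_integrable[OF C]])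
  show "norm (?h xi * (cis (x * xi) * cnj (phi x))) <= norm (?h xi) * norm (phi x)" for xi x
   by (simp add: norm_mult)
 qed measurable
 also have "... = (LBINT x. cnj (phi x) * ft 1 ?h x)"
  by (intro LBINT_cong refl, rule trans[OF _ ft_cmult],
    intro LBINT_cong refl) (simp add: mult_ac)
 also have "... = (LBINT x. complex_of_real (2 * pi * (norm (phi x))\<^sup>2))"
  by (intro LBINT_cong refl)
    (simp add: ft_ft[OF phi] complex_norm_square mult_ac del: of_real_power)
 also have "... = complex_of_real (LBINT x. 2 * pi * (norm (phi x))\<^sup>2)"
  by (rule integral_complex_of_real)
 also have "(LBINT x. 2 * pi * (norm (phi x))\<^sup>2) = 2 * pi * (LBINT x. (norm (phi x))\<^sup>2)"
  by (rule integral_mult_right_zero)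
 finally show ?thesis unfolding fourier_ft of_real_eq_iff .
qed

lemma Plancherel_inv_fourier:
 fixes phi :: "real => complex"
 assumes phi: "schwartz phi"
 shows "2 * pi * (LBINT x. (norm (inv_fourier phi x))\<^sup>2) = (LBINT x. (norm (phi x))\<^sup>2)"
 using Plancherel_fourier[OF schwartz_inv_fourier[OF phi]] by (simp add: fourier_inv_fourier[OF phi])

section \<open>Uniqueness of the representing function\<close>

text \<open>Frequency zero shows that positive and negative part have the same mass. Divided by this
  mass they become probability densities with equal characteristic functions, and Levy's uniqueness
  theorem applies.\<close>

lemma real_fourier_zero_imp_zero:
 fixes u :: "real => real"
 assumes u: "integrable lborel u"
  and z: "\<And>xi. (LBINT x. cis (xi * x) * complex_of_real (u x)) = 0"
 shows "AE x in lborel. u x = 0"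
proof -
 have [measurable]: "u \<in> borel_measurable borel" using borel_measurable_integrable[OF u] by simp
 let ?p = "\<lambda>x. max 0 (u x)" and ?n = "\<lambda>x. max 0 (- u x)"
 have p: "integrable lborel ?p" and n: "integrable lborel ?n"
  using u by (auto intro!: Bochner_Integration.integrable_max)
 have ci: "integrable lborel (\<lambda>x. cis (xi * x) * complex_of_real (f x))"
  if f: "integrable lborel f" and [measurable]: "f \<in> borel_measurable borel" for f :: "real => real" and xi
  by (rule integrable_boundI[OF f]) (auto simp: norm_mult)
 have ci_p: "integrable lborel (\<lambda>x. cis (xi * x) * complex_of_real (?p x))"
  and ci_n: "integrable lborel (\<lambda>x. cis (xi * x) * complex_of_real (?n x))" for xi
  by (rule ci[OF p], measurable) (rule ci[OF n], measurable)
 have eq: "(LBINT x. cis (xi * x) * complex_of_real (?p x)) = (LBINT x. cis (xi * x) * complex_of_real (?n x))" for xi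
 proof -
  have "(LBINT x. cis (xi * x) * complex_of_real (?p x)) - (LBINT x. cis (xi * x) * complex_of_real (?n x))
   = (LBINT x. cis (xi * x) * complex_of_real (?p x) - cis (xi * x) * complex_of_real (?n x))"
   by (rule Bochner_Integration.integral_diff[OF ci_p ci_n, symmetric])
  also have "... = (LBINT x. cis (xi * x) * complex_of_real (u x))"
   by (intro LBINT_cong refl) (auto simp: max_def)
  finally show ?thesis by (simp add: z)
 qed
 define m where "m = (LBINT x. ?p x)"
 have "complex_of_real (LBINT x. ?p x) = complex_of_real (LBINT x. ?n x)"
  using eq[of 0] by simp
 then have mn: "m = (LBINT x. ?n x)" by (simp add: m_def)
 have m0: "0 <= m" unfolding m_def by (rule Bochner_Integration.integral_nonneg) auto
 show ?thesis
 proof (cases "m = 0")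
  case True
  then have "AE x in lborel. ?p x = 0" "AE x in lborel. ?n x = 0"
   using integral_nonneg_eq_0_iff_AE[OF p] integral_nonneg_eq_0_iff_AE[OF n] mn by (auto simp: m_def)
  then show ?thesis by eventually_elim (auto simp: max_def split: if_splits)
 next
  case False
  then have m: "0 < m" using m0 by simp
  define D where "D f = density lborel (\<lambda>x. ennreal (f x / m))" for f :: "real => real"
  have rd: "real_distribution (D f)"
   if f: "integrable lborel f" "f \<in> borel_measurable borel" "\<And>x. 0 <= f x" "(LBINT x. f x) = m" for f
  proof -
   note [measurable] = f(2)
   have "emeasure (D f) (space (D f)) = (NN x. ennreal (f x / m))"
    unfolding D_def by (subst emeasure_density) auto
   also have "... = ennreal (LBINT x. f x / m)"
    by (rule nn_integral_eq_integral) (use f m in auto)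
   also have "... = 1" using f m by simp
   finally have "prob_space (D f)" by (rule prob_spaceI)
   then show ?thesis
    unfolding real_distribution_def real_distribution_axioms_def by (simp add: D_def)
  qed
  have ch: "char (D f) xi = (LBINT x. cis (xi * x) * complex_of_real (f x)) / m"
   if [measurable]: "f \<in> borel_measurable borel" and f: "\<And>x. 0 <= f x" for f xi
  proof -
   have "char (D f) xi = (LBINT x. (f x / m) *\<^sub>R iexp (xi * x))"
    unfolding char_def D_def by (subst integral_density) (use f m in auto)
   also have "... = (LBINT x. (cis (xi * x) * complex_of_real (f x)) / m)"
    by (intro LBINT_cong refl) (simp add: scaleR_conv_of_real cis_conv_exp mult_ac)
   finally show ?thesis by simp
  qed
  have "D ?p = D ?n"
  proof (rule Levy_uniqueness)
   show "real_distribution (D ?p)" by (rule rd[OF p]) (auto simp: m_def)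
   show "real_distribution (D ?n)" by (rule rd[OF n]) (auto simp: mn)
   show "char (D ?p) = char (D ?n)"
    using ch[of ?p] ch[of ?n] eq by (auto simp: fun_eq_iff)
  qed
  then have "AE x in lborel. ennreal (?p x / m) = ennreal (?n x / m)"
   unfolding D_def by (subst (asm) sigma_finite_measure.density_unique_iff[OF sigma_finite_lborel']) auto
  then show ?thesis
   by eventually_elim (use m in \<open>auto simp: max_def ennreal_eq_0_iff divide_simps split: if_splits\<close>)
 qed
qed

text \<open>Real and imaginary part are combinations of \<open>h\<close> and its conjugate, and the
  transform of the conjugate at \<open>xi\<close> is the conjugate of the transform at
  \<open>- xi\<close>.\<close>

lemma fourier_zero_imp_zero:
 assumes h: "integrable lborel h" and z: "\<And>xi. (LBINT x. cis (xi * x) * h x) = 0"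
 shows "AE x in lborel. h x = (0::complex)"
proof -
 have [measurable]: "h \<in> borel_measurable borel" using borel_measurable_integrable[OF h] by simp
 have i: "integrable lborel (\<lambda>x. cis (xi * x) * h x)" for xi
  by (rule integrable_boundI[OF h]) (auto simp: norm_mult)
 have ic: "integrable lborel (\<lambda>x. cis (xi * x) * cnj (h x))" for xi
  by (rule integrable_boundI[OF h]) (auto simp: norm_mult)
 have zc: "(LBINT x. cis (xi * x) * cnj (h x)) = 0" for xi
 proof -
  have "cnj (LBINT x. cis ((- xi) * x) * h x) = (LBINT x. cnj (cis ((- xi) * x) * h x))"
   by (rule Bochner_Integration.integral_cnj[symmetric])
  also have "... = (LBINT x. cis (xi * x) * cnj (h x))" by (simp add: cis_cnj)
  finally show ?thesis using z[of "- xi"] by simp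
 qed
 have zz: "(LBINT x. cis (xi * x) * (c * h x + d * cnj (h x))) = 0" for xi c d
 proof -
  have "(LBINT x. cis (xi * x) * (c * h x + d * cnj (h x)))
   = (LBINT x. c * (cis (xi * x) * h x) + d * (cis (xi * x) * cnj (h x)))"
   by (intro LBINT_cong refl) (simp add: algebra_simps)
  also have "... = c * (LBINT x. cis (xi * x) * h x) + d * (LBINT x. cis (xi * x) * cnj (h x))"
   by (simp add: Bochner_Integration.integral_add i ic)
  finally show ?thesis by (simp add: z zc)
 qed
 have "AE x in lborel. Re (h x) = 0"
 proof (rule real_fourier_zero_imp_zero)
  show "integrable lborel (\<lambda>x. Re (h x))" using h by simp
  fix xi
  have e: "complex_of_real (Re w) = (1/2) * w + (1/2) * cnj w" for w by (simp add: complex_eq_iff)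
  show "(LBINT x. cis (xi * x) * complex_of_real (Re (h x))) = 0" unfolding e by (rule zz)
 qed
 moreover have "AE x in lborel. Im (h x) = 0"
 proof (rule real_fourier_zero_imp_zero)
  show "integrable lborel (\<lambda>x. Im (h x))" using h by simp
  fix xi
  have e: "complex_of_real (Im w) = (-\<i>/2) * w + (\<i>/2) * cnj w" for w by (simp add: complex_eq_iff)
  show "(LBINT x. cis (xi * x) * complex_of_real (Im (h x))) = 0" unfolding e by (rule zz)
 qed
 ultimately show ?thesis by eventually_elim (simp add: complex_eq_iff)
qed

section \<open>Gaussian test functions and modulations\<close>

definition gauss :: "real => real" where
 "gauss x = exp (- x\<^sup>2 / 2)"

lemma power_div_fact_le_exp:
 fixes y :: real
 assumes "0 <= y" shows "y ^ j / fact j <= exp y"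
proof -
 have s: "(\<lambda>n. y ^ n /\<^sub>R fact n) sums exp y" by (rule exp_converges)
 have "(\<Sum>n\<in>{j}. y ^ n /\<^sub>R fact n) <= (\<Sum>n. y ^ n /\<^sub>R fact n)"
  by (rule sum_le_suminf) (use s assms in \<open>auto simp: sums_iff\<close>)
 then show ?thesis unfolding sums_unique[OF s, symmetric] by (simp add: divide_inverse mult.commute)
qed

text \<open>A single term of the exponential series at x^2 / 2 bounds the even moments; odd powers
  are dominated by 1 plus an even power.\<close>

lemma gauss_moment: "\<bar>x\<bar> ^ j * gauss x <= 1 + 2 ^ j * fact j"
proof -
 have "\<bar>x\<bar> ^ j <= 1 + x ^ (2 * j)"
 proof (cases "\<bar>x\<bar> <= 1")
  case True
  then have "\<bar>x\<bar> ^ j <= 1" by (simp add: power_le_one)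
  then show ?thesis by (intro add_increasing2) auto
 next
  case False
  then have "\<bar>x\<bar> ^ j <= \<bar>x\<bar> ^ (2 * j)" by (intro power_increasing) auto
  then show ?thesis by (simp add: power_even_abs)
 qed
 then have "\<bar>x\<bar> ^ j * gauss x <= (1 + x ^ (2 * j)) * gauss x"
  by (intro mult_right_mono) (auto simp: gauss_def)
 also have "... = gauss x + x ^ (2 * j) * gauss x" by (simp add: algebra_simps)
 also have "... <= 1 + 2 ^ j * fact j"
 proof (intro add_mono)
  show "gauss x <= 1" by (simp add: gauss_def)
  have "(x\<^sup>2 / 2) ^ j / fact j <= exp (x\<^sup>2 / 2)"
   by (rule power_div_fact_le_exp) simp
  then show "x ^ (2 * j) * gauss x <= 2 ^ j * fact j"
  proof -
   define E where "E = exp (x\<^sup>2 / 2)"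
   have E: "0 < E" "gauss x = 1 / E"
    unfolding gauss_def E_def by (simp, metis exp_minus inverse_eq_divide minus_divide_left)
   have "x ^ (2 * j) = 2 ^ j * (x\<^sup>2 / 2) ^ j"
    by (simp add: power_mult power_divide)
   then have "x ^ (2 * j) * gauss x = 2 ^ j * fact j * ((x\<^sup>2 / 2) ^ j / fact j / E)"
    unfolding E(2) by simp
   also have "... <= 2 ^ j * fact j * 1"
   proof (rule mult_left_mono)
    show "(x\<^sup>2 / 2) ^ j / fact j / E <= 1"
     unfolding pos_divide_le_eq[OF E(1)] mult_1 unfolding E_def by fact
   qed simp
   finally show ?thesis by simp
  qed
 qed
 finally show ?thesis .
qed

text \<open>Monomials times the Gaussian are closed under differentiation up to sums of two, so all
  orders follow by one induction with generalized \<open>c\<close> and \<open>j\<close>.\<close>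

lemma gauss_monomial: "ndiff b (\<lambda>x. c * of_real (x ^ j * gauss x)) \<and>
  (\<exists>C. \<forall>x. \<bar>x\<bar> ^ a * norm ((dx ^^ b) (\<lambda>x. c * of_real (x ^ j * gauss x)) x) <= C)"
proof (induction b arbitrary: c j)
 case 0
 have "\<bar>x\<bar> ^ a * norm (c * of_real (x ^ j * gauss x)) <= norm c * (1 + 2 ^ (a + j) * fact (a + j))" for x
 proof -
  have "\<bar>x\<bar> ^ a * norm (c * of_real (x ^ j * gauss x)) = norm c * (\<bar>x\<bar> ^ (a + j) * gauss x)"
   by (simp add: norm_mult norm_power gauss_def power_add)
  also have "... <= norm c * (1 + 2 ^ (a + j) * fact (a + j))"
   by (intro mult_left_mono gauss_moment) auto
  finally show ?thesis .
 qed
 then show ?case by auto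
next
 case (Suc b)
 let ?f = "\<lambda>x. c * of_real (x ^ j * gauss x)"
 let ?f1 = "\<lambda>x. (c * of_nat j) * of_real (x ^ (j - 1) * gauss x)"
 let ?f2 = "\<lambda>x. (- c) * of_real (x ^ (Suc j) * gauss x)"
 have d: "(?f has_vector_derivative (?f1 x + ?f2 x)) (at x)" for x
 proof -
  have "((\<lambda>x. x ^ j * gauss x) has_real_derivative (real j * x ^ (j - 1) * gauss x - x ^ Suc j * gauss x)) (at x)"
   unfolding gauss_def by (auto intro!: derivative_eq_intros simp: algebra_simps)
  from has_vector_derivative_mult_right[OF has_vector_derivative_of_real[OF this], of c]
  show ?thesis by (simp add: algebra_simps)
 qed
 have e: "dx ?f = (\<lambda>x. ?f1 x + ?f2 x)" by (rule dx_eqI) (rule d)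
 have df: "?f differentiable (at x)" for x using d differentiableI_vector by blast
 obtain C1 where C1: "\<forall>x. \<bar>x\<bar> ^ a * norm ((dx ^^ b) ?f1 x) <= C1" using Suc.IH by blast
 obtain C2 where C2: "\<forall>x. \<bar>x\<bar> ^ a * norm ((dx ^^ b) ?f2 x) <= C2" using Suc.IH by blast
 have n: "ndiff b (\<lambda>x. ?f1 x + ?f2 x) \<and> (dx ^^ b) (\<lambda>x. ?f1 x + ?f2 x) = (\<lambda>x. (dx ^^ b) ?f1 x + (dx ^^ b) ?f2 x)"
  by (rule ndiff_add) (use Suc.IH in blast)+
 have "\<bar>x\<bar> ^ a * norm ((dx ^^ Suc b) ?f x) <= C1 + C2" for x
 proof -
  have "\<bar>x\<bar> ^ a * norm ((dx ^^ Suc b) ?f x) <= \<bar>x\<bar> ^ a * (norm ((dx ^^ b) ?f1 x) + norm ((dx ^^ b) ?f2 x))"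
   unfolding dx_funpow_Suc e n[THEN conjunct2] by (intro mult_left_mono norm_triangle_ineq) auto
  also have "... <= C1 + C2"
   unfolding distrib_left by (intro add_mono C1[rule_format] C2[rule_format])
  finally show ?thesis .
 qed
 then show ?case using n df unfolding ndiff_Suc e by blast
qed

lemma schwartz_gauss: "schwartz (\<lambda>x. of_real (gauss x))"
 using gauss_monomial[of _ 1 0] unfolding schwartz_iff_usch usch_def smooth_iff_ndiff by simp

lemma dx_cis: "dx (\<lambda>x. c * cis (xi * x)) = (\<lambda>x. (\<i> * of_real xi * c) * cis (xi * x))"
 and cis_linear_differentiable: "(\<lambda>x. c * cis (xi * x)) differentiable (at x)"
proof -
 have d: "((\<lambda>x. c * cis (xi * x)) has_vector_derivative (\<i> * of_real xi * c) * cis (xi * x)) (at x)" for x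
 proof -
  have "((\<lambda>x. c * cis (xi * x)) has_derivative (\<lambda>y. c * ((xi * y) *\<^sub>R (\<i> * cis (xi * x))))) (at x)"
   by (auto intro!: derivative_eq_intros simp: fun_eq_iff)
  then show ?thesis
   unfolding has_vector_derivative_def
   by (rule back_subst[where P = "\<lambda>f. (_ has_derivative f) _"]) (auto simp: fun_eq_iff scaleR_conv_of_real)
 qed
 show "dx (\<lambda>x. c * cis (xi * x)) = (\<lambda>x. (\<i> * of_real xi * c) * cis (xi * x))"
  by (rule dx_eqI) (rule d)
 show "(\<lambda>x. c * cis (xi * x)) differentiable (at x)" using d differentiableI_vector by blast
qed

lemma umod_cis_linear: "umod I (\<lambda>_ x. cis (xi * x))"
proof -
 have "ndiff b (\<lambda>x. c * cis (xi * x)) \<and> (\<exists>C. \<forall>x. norm ((dx ^^ b) (\<lambda>x. c * cis (xi * x)) x) <= C)" for b c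
 proof (induction b arbitrary: c)
  case 0 show ?case by (auto simp: norm_mult)
 next
  case (Suc b)
  then show ?case unfolding ndiff_Suc dx_funpow_Suc dx_cis using cis_linear_differentiable by blast
 qed
 from this[of _ 1] show ?thesis
  by (intro umod_bounded_derivs) (auto simp: smooth_iff_ndiff)
qed

text \<open>Modulated Gaussians are Schwartz functions. Testing with all of them says that the
  difference times \<open>gauss\<close>, which is integrable, has vanishing Fourier transform; and
  \<open>gauss\<close> has no zeros.\<close>

lemma represents_unique:
 assumes "represents g T" "represents g' T"
 shows "AE x in lborel. g x = g' x"
proof -
 let ?h = "\<lambda>x. (g x - g' x) * of_real (gauss x)"
 have s: "schwartz (\<lambda>x. cis (xi * x) * of_real (gauss x))" for xi
  using usch_mult[OF umod_cis_linear, of "{()}" "\<lambda>_ x. of_real (gauss x)" xi] schwartz_gauss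
  by (simp add: schwartz_iff_usch)
 have i: "integrable lborel (\<lambda>x. g x * (cis (xi * x) * of_real (gauss x)))"
   "integrable lborel (\<lambda>x. g' x * (cis (xi * x) * of_real (gauss x)))" for xi
  using assms s unfolding represents_def by blast+
 have "AE x in lborel. ?h x = 0"
 proof (rule fourier_zero_imp_zero)
  show "integrable lborel ?h" using Bochner_Integration.integrable_diff[OF i(1)[of 0] i(2)[of 0]] by (simp add: left_diff_distrib)
  fix xi
  have "(LBINT x. cis (xi * x) * ?h x)
   = (LBINT x. g x * (cis (xi * x) * of_real (gauss x)) - g' x * (cis (xi * x) * of_real (gauss x)))"
   by (intro LBINT_cong refl) (simp add: algebra_simps)
  also have "... = dist_of g (\<lambda>x. cis (xi * x) * of_real (gauss x)) - dist_of g' (\<lambda>x. cis (xi * x) * of_real (gauss x))"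
   unfolding dist_of_def by (rule Bochner_Integration.integral_diff[OF i])
  also have "... = 0" using assms s unfolding represents_def by (metis diff_self)
  finally show "(LBINT x. cis (xi * x) * ?h x) = 0" .
 qed
 then show ?thesis by eventually_elim (simp add: gauss_def)
qed

section \<open>Convolution with band-limited kernels\<close>

text \<open>Bounded plus integrable majorant. The class contains bounded measurable functions and
  every L^q with q >= 1, and its members can be integrated against any function with
  \<open>decay\<close>.\<close>

definition tame :: "(real => complex) => bool" where
 "tame c \<longleftrightarrow> c \<in> borel_measurable borel \<and> (\<exists>B h. integrable lborel h \<and> (\<forall>y. norm (c y) <= B + h y))"

definition conv :: "(real => complex) => (real => complex) => real => complex" where
 "conv K c x = (LBINT y. K (x - y) * c y)"

lemma tame_measurable: "tame c ==> c \<in> borel_measurable borel"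
 by (simp add: tame_def)

lemma tameE:
 assumes "tame c"
 obtains B h where "0 <= B" "integrable lborel h" "\<And>y. 0 <= h y" "\<And>y. norm (c y) <= B + h y"
proof -
 obtain B h where h: "integrable lborel h" "\<And>y. norm (c y) <= B + h y"
  using assms unfolding tame_def by blast
 have "norm (c y) <= \<bar>B\<bar> + \<bar>h y\<bar>" for y using h(2)[of y] by linarith
 then show thesis using that[of "\<bar>B\<bar>" "\<lambda>y. \<bar>h y\<bar>"] h(1) by auto
qed

lemma bounded_tame: "c \<in> borel_measurable borel ==> (\<And>y. norm (c y) <= B) ==> tame c"
 unfolding tame_def by (intro conjI exI[of _ B] exI[of _ "\<lambda>_. 0"]) auto

lemma tame_mult_integrable:
 assumes c: "tame c" and \<psi>: "decay C \<psi>" shows "integrable lborel (\<lambda>y. c y * \<psi> y)"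
proof -
 obtain B h where h: "0 <= B" "integrable lborel h" "\<And>y. 0 <= h y" "\<And>y. norm (c y) <= B + h y"
  using tameE[OF c] by blast
 note [measurable] = tame_measurable[OF c] decay_measurable[OF \<psi>]
 show ?thesis
 proof (rule integrable_boundI)
  show "integrable lborel (\<lambda>y. B * (C * cauchy y) + C * h y)" using h(2) by simp
  show "AE y in lborel. norm (c y * \<psi> y) <= norm (B * (C * cauchy y) + C * h y)"
  proof (rule AE_I2)
   fix y
   have "norm (c y * \<psi> y) <= (B + h y) * norm (\<psi> y)"
    unfolding norm_mult by (intro mult_right_mono h) auto
   also have "... <= B * (C * cauchy y) + C * h y"
    unfolding distrib_right
    using mult_left_mono[OF decayD[OF \<psi>, of y] h(1)] mult_left_mono[OF decay_le[OF \<psi>, of y] h(3)[of y]]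
    by (simp add: mult.commute)
   finally show "norm (c y * \<psi> y) <= norm (B * (C * cauchy y) + C * h y)" by simp
  qed
 qed measurable
qed

lemma decay_reflect_shift:
 assumes "decay C K" shows "decay (2 * (1 + x\<^sup>2) * C) (\<lambda>y. K (x - y))"
proof -
 note [measurable] = decay_measurable[OF assms]
 have "norm (K (x - y)) <= 2 * (1 + x\<^sup>2) * C * cauchy y" for y
 proof -
  have "norm (K (x - y)) <= C * cauchy (x - y)" by (rule decayD[OF assms])
  also have "... <= C * (2 * (1 + x\<^sup>2) * cauchy y)"
   by (intro mult_left_mono cauchy_shift decay_nonneg[OF assms])
  finally show ?thesis by (simp add: mult_ac)
 qed
 then show ?thesis by (simp add: decay_def)
qed

lemma conv_measurable:
 assumes [measurable]: "K \<in> borel_measurable borel" "c \<in> borel_measurable borel"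
 shows "conv K c \<in> borel_measurable borel"
proof -
 have "(\<lambda>x. LBINT y. K (x - y) * c y) \<in> borel_measurable borel" by measurable
 then show ?thesis by (simp add: conv_def[abs_def])
qed

text \<open>Convolution with the kernel of \<open>s\<close> is the Fourier multiplier
  \<open>s\<close> in the sense of \<open>multiplier\<close>: tested against \<open>phi\<close> it
  acts on the test function instead. This is the bridge between pointwise convolutions and the
  distributional definitions.\<close>

lemma conv_pairing:
 fixes s phi :: "real => complex"
 assumes s: "schwartz s" and c: "tame c" and phi: "schwartz phi"
 shows "(LBINT x. conv (inv_fourier s) c x * phi x) = (LBINT y. c y * fourier (\<lambda>xi. s xi * inv_fourier phi xi) y)"
  and "integrable lborel (\<lambda>x. conv (inv_fourier s) c x * phi x)"
proof -
 let ?K = "inv_fourier s"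
 obtain C where C: "decay C ?K" using schwartz_decay[OF schwartz_inv_fourier[OF s]] by blast
 obtain S where S: "decay S s" using schwartz_decay[OF s] by blast
 obtain P where P: "decay P phi" using schwartz_decay[OF phi] by blast
 obtain Q where Q: "decay Q (\<lambda>x. of_real x * (of_real x * phi x))"
  using schwartz_decay[OF schwartz_mult_id[OF schwartz_mult_id[OF phi]]] by blast
 obtain B h where h: "0 <= B" "integrable lborel h" "\<And>y. 0 <= h y" "\<And>y. norm (c y) <= B + h y"
  using tameE[OF c] by blast
 note [measurable] = tame_measurable[OF c] decay_measurable[OF C] decay_measurable[OF P] decay_measurable[OF S]
 \<comment> \<open>The weight 1 + x^2 is the price of recentring the kernel at y; the Schwartz decay
   of \<open>phi\<close> pays for it.\<close>
 define A where "A x = (1 + x\<^sup>2) * norm (phi x)" for x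
 define B' where "B' y = 2 * C * B * cauchy y + C * h y" for y
 have A: "integrable lborel A"
 proof -
  have "integrable lborel (\<lambda>x. norm (phi x) + norm (of_real x * (of_real x * phi x)))"
   by (intro Bochner_Integration.integrable_add integrable_norm decay_integrable[OF P] decay_integrable[OF Q])
  moreover have "norm (phi x) + norm (of_real x * (of_real x * phi x)) = A x" for x
  proof -
   have "norm (of_real x * (of_real x * phi x)) = (\<bar>x\<bar> * \<bar>x\<bar>) * norm (phi x)" by (simp add: norm_mult)
   also have "\<bar>x\<bar> * \<bar>x\<bar> = x\<^sup>2" by (simp add: power2_eq_square)
   finally show ?thesis by (simp add: A_def distrib_right)
  qed
  ultimately show ?thesis by (simp add: A_def[abs_def])
 qed
 have B': "integrable lborel B'" unfolding B'_def using h(2) by simp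
 have C0: "0 <= C" by (rule decay_nonneg[OF C])
 have bd: "norm (?K (x - y) * c y * phi x) <= A x * B' y" for x y
 proof -
  have "norm (?K (x - y)) * norm (c y) <= norm (?K (x - y)) * (B + h y)" by (intro mult_left_mono h) auto
  also have "... = B * norm (?K (x - y)) + norm (?K (x - y)) * h y" by (simp add: algebra_simps)
  also have "... <= B * (2 * (1 + x\<^sup>2) * C * cauchy y) + C * h y"
   by (intro add_mono mult_left_mono mult_right_mono h decay_le[OF C] decayD[OF decay_reflect_shift[OF C]])
  also have "... <= B * (2 * (1 + x\<^sup>2) * C * cauchy y) + (1 + x\<^sup>2) * (C * h y)"
   using h C0 by (intro add_left_mono) (simp add: mult_le_cancel_right1 algebra_simps)
  also have "... = (1 + x\<^sup>2) * B' y" by (simp add: B'_def algebra_simps)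
  finally have "norm (?K (x - y)) * norm (c y) * norm (phi x) <= (1 + x\<^sup>2) * B' y * norm (phi x)"
   by (intro mult_right_mono) auto
  then show ?thesis by (simp add: norm_mult A_def mult_ac)
 qed
 note F = Fubini_product_bound[OF sigma_finite_lborel' sigma_finite_lborel' _ A B' bd]
 have m: "(\<lambda>(x, y). ?K (x - y) * c y * phi x) \<in> borel_measurable (lborel \<Otimes>\<^sub>M lborel)" by measurable
 have e: "conv ?K c x * phi x = (LBINT y. ?K (x - y) * c y * phi x)" for x
  by (simp add: conv_def)
 show "integrable lborel (\<lambda>x. conv ?K c x * phi x)" unfolding e by (rule F(3)[OF m])
 \<comment> \<open>Correlating the kernel with \<open>phi\<close> reproduces exactly the transposed
   multiplier that occurs in the definitions.\<close>
 have k: "(LBINT x. ?K (x - y) * phi x) = fourier (\<lambda>xi. s xi * inv_fourier phi xi) y" for y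
 proof -
  have "(LBINT x. ?K (x - y) * phi x)
    = (LBINT x. LBINT xi. cis ((x - y) * xi) * s xi * phi x / (2 * pi))"
   by (intro LBINT_cong refl) (simp add: inv_fourier_def)
  also have "... = (LBINT xi. LBINT x. cis ((x - y) * xi) * s xi * phi x / (2 * pi))"
  proof (rule Fubini_product_bound(2)[OF sigma_finite_lborel' sigma_finite_lborel'])
   show "integrable lborel (\<lambda>x. norm (phi x))" by (rule integrable_norm[OF decay_integrable[OF P]])
   show "integrable lborel (\<lambda>xi. norm (s xi) / (2 * pi))"
    using integrable_norm[OF decay_integrable[OF S]] by simp
   show "norm (cis ((x - y) * xi) * s xi * phi x / (2 * pi)) <= norm (phi x) * (norm (s xi) / (2 * pi))" for x xi
    by (simp add: norm_mult norm_divide mult.commute)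
  qed measurable
  also have "... = (LBINT xi. cis (- (xi * y)) * (s xi * inv_fourier phi xi))"
  proof (intro LBINT_cong refl)
   fix xi
   have c: "cis ((x - y) * xi) = cis (- (xi * y)) * cis (x * xi)" for x
    unfolding cis_mult by (rule arg_cong[where f = cis]) (simp add: algebra_simps)
   have "(LBINT x. cis ((x - y) * xi) * s xi * phi x / (2 * pi))
    = (LBINT x. (cis (- (xi * y)) * s xi / (2 * pi)) * (cis (x * xi) * phi x))"
    unfolding c by (intro LBINT_cong refl) simp
   also have "... = (cis (- (xi * y)) * s xi / (2 * pi)) * (LBINT x. cis (x * xi) * phi x)"
    by (rule integral_mult_right_zero)
   also have "... = cis (- (xi * y)) * (s xi * inv_fourier phi xi)"
    by (simp add: inv_fourier_def mult.commute)
   finally show "(LBINT x. cis ((x - y) * xi) * s xi * phi x / (2 * pi)) = cis (- (xi * y)) * (s xi * inv_fourier phi xi)" .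
  qed
  finally show ?thesis by (simp add: fourier_def)
 qed
 have "(LBINT x. conv ?K c x * phi x) = (LBINT y. LBINT x. ?K (x - y) * c y * phi x)"
  unfolding e by (rule F(2)[OF m])
 also have "... = (LBINT y. c y * fourier (\<lambda>xi. s xi * inv_fourier phi xi) y)"
 proof (intro LBINT_cong refl)
  fix y
  have "(LBINT x. ?K (x - y) * c y * phi x) = (LBINT x. c y * (?K (x - y) * phi x))"
   by (intro LBINT_cong refl) simp
  also have "... = c y * (LBINT x. ?K (x - y) * phi x)" by (rule integral_mult_right_zero)
  finally show "(LBINT x. ?K (x - y) * c y * phi x) = c y * fourier (\<lambda>xi. s xi * inv_fourier phi xi) y"
   unfolding k .
 qed
 finally show "(LBINT x. conv ?K c x * phi x) = (LBINT y. c y * fourier (\<lambda>xi. s xi * inv_fourier phi xi) y)" .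
qed

section \<open>Frequency localization\<close>

lemma dx_funpow_zero_on_open:
 assumes "smooth f" "open U" "\<And>y. y \<in> U ==> f y = 0" "x \<in> U"
 shows "(dx ^^ b) f x = 0"
 using assms(4)
proof (induction b arbitrary: x)
 case (Suc b)
 have "((\<lambda>_. 0) has_vector_derivative dx ((dx ^^ b) f) x) (at x)"
  by (rule has_vector_derivative_transform_within_open[OF smooth_has_dx[OF smooth_dx_funpow[OF assms(1)]]
    assms(2) Suc.prems]) (rule Suc.IH)
 then show ?case using has_vector_derivative_const vector_derivative_unique_at by (metis funpow.simps(2) o_apply)
qed (use assms in simp)

definition bump :: "(real => real) => bool" where
 "bump b \<longleftrightarrow> smooth b \<and> (\<exists>R. \<forall>x. R < \<bar>x\<bar> --> b x = 0)"

lemma bump_derivs_bounded: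
 assumes "bump b" shows "\<exists>C. \<forall>x. \<bar>x\<bar> ^ a * \<bar>(dx ^^ k) b x\<bar> <= C"
proof -
 obtain R where R: "\<And>x. R < \<bar>x\<bar> ==> b x = 0" and sm: "smooth b" using assms unfolding bump_def by blast
 have z: "(dx ^^ k) b x = 0" if "R < \<bar>x\<bar>" for x
  by (rule dx_funpow_zero_on_open[OF sm, of "{x. R < \<bar>x\<bar>}"])
    (use R that in \<open>auto intro!: open_Collect_less continuous_intros\<close>)
 have "continuous_on {- \<bar>R\<bar>..\<bar>R\<bar>} (\<lambda>x. \<bar>x\<bar> ^ a * \<bar>(dx ^^ k) b x\<bar>)"
  by (intro continuous_intros smooth_continuous smooth_dx_funpow sm)
 then have "bounded ((\<lambda>x. \<bar>x\<bar> ^ a * \<bar>(dx ^^ k) b x\<bar>) ` {- \<bar>R\<bar>..\<bar>R\<bar>})"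
  by (intro compact_imp_bounded compact_continuous_image) auto
 then obtain C where C: "\<And>x. x \<in> {- \<bar>R\<bar>..\<bar>R\<bar>} ==> norm (\<bar>x\<bar> ^ a * \<bar>(dx ^^ k) b x\<bar>) <= C"
  unfolding bounded_iff by blast
 have "\<bar>x\<bar> ^ a * \<bar>(dx ^^ k) b x\<bar> <= max 0 C" for x
 proof (cases "R < \<bar>x\<bar>")
  case False
  then have "x \<in> {- \<bar>R\<bar>..\<bar>R\<bar>}" by auto
  from C[OF this] show ?thesis by (simp add: abs_mult)
 qed (simp add: z)
 then show ?thesis by blast
qed

lemma bump_schwartz: assumes "bump b" shows "schwartz (\<lambda>x. of_real (b x))"
proof -
 have sm: "smooth b" using assms by (simp add: bump_def)
 have "\<exists>C. \<forall>x. \<bar>x\<bar> ^ a * norm ((dx ^^ k) (\<lambda>x. complex_of_real (b x)) x) <= C" for a k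
  using bump_derivs_bounded[OF assms, of a k] unfolding dx_funpow_of_real[OF sm] by simp
 then show ?thesis unfolding schwartz_iff_usch usch_def using smooth_of_real[OF sm] by simp
qed

lemma smooth_real_sum:
 "finite A ==> (\<And>i. i \<in> A ==> smooth (f i)) ==> smooth (\<lambda>x. \<Sum>i\<in>A. f i x :: real)"
proof -
 assume A: "finite A" "\<And>i. i \<in> A ==> smooth (f i)"
 have "(dx ^^ k) (\<lambda>x. \<Sum>i\<in>A. f i x) = (\<lambda>x. \<Sum>i\<in>A. (dx ^^ k) (f i) x)" for k
 proof (induction k)
  case (Suc k)
  have "dx (\<lambda>x. \<Sum>i\<in>A. (dx ^^ k) (f i) x) = (\<lambda>x. \<Sum>i\<in>A. dx ((dx ^^ k) (f i)) x)"
   by (rule dx_eqI) (rule has_vector_derivative_sum, rule smooth_has_dx[OF smooth_dx_funpow[OF A(2)]])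
  then show ?case using Suc by simp
 qed simp
 moreover have "(\<lambda>x. \<Sum>i\<in>A. (dx ^^ k) (f i) x) differentiable (at x)" for k x
  by (rule differentiable_sum[OF A(1)]) (use A(2) in \<open>auto simp: smooth_def\<close>)
 ultimately show ?thesis by (simp add: smooth_def)
qed

lemma bump_shift: "bump b ==> bump (\<lambda>x. b (x - a))"
proof -
 assume b: "bump b"
 then obtain R where R: "\<And>x. R < \<bar>x\<bar> ==> b x = 0" unfolding bump_def by blast
 have "\<forall>x. R + \<bar>a\<bar> < \<bar>x\<bar> --> b (x - a) = 0" using R by auto
 then show ?thesis using b smooth_shift[of b a] unfolding bump_def by blast
qed

section \<open>Kernels of the frequency-localized propagator\<close>

definition sym :: "(real => real) => real => real => real => complex" where
 "sym b k ta xi = of_real (b (xi - k)) * cis (- (ta * xi\<^sup>2))"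

definition ker :: "(real => real) => real => real => real => complex" where
 "ker b k ta = inv_fourier (sym b k ta)"

lemma umod_propagator: "umod {-T..T} (\<lambda>ta xi. cis (- (ta * xi\<^sup>2)))"
proof -
 have "umod {-T..T} (\<lambda>ta. mono_symbol 1 0 0 (- ta))"
  by (rule mono_symbol_umod[where B = 1 and T = "\<bar>T\<bar>"]) auto
 then show ?thesis by (simp add: mono_symbol_def[abs_def])
qed

lemma usch_propagator: "schwartz phi ==> usch {-T..T} (\<lambda>ta xi. cis (- (ta * xi\<^sup>2)) * phi xi)"
 by (rule usch_mult[OF umod_propagator schwartz_imp_usch])

lemma schwartz_propagator: "schwartz phi ==> schwartz (\<lambda>xi. cis (- (ta * xi\<^sup>2)) * phi xi)"
 by (rule usch_imp_schwartz[OF usch_propagator[of phi "\<bar>ta\<bar>"], of ta]) auto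

lemma sym_schwartz: "bump b ==> schwartz (sym b k ta)"
 using schwartz_propagator[OF bump_schwartz[OF bump_shift[of b k]], of ta]
 by (simp add: sym_def[abs_def] mult.commute)

text \<open>Galilean invariance. With frequency k + \<eta> the phase x \<xi> - ta \<xi>^2 becomes a
  phase free of \<eta> plus (x - 2 ta k) \<eta> - ta \<eta>^2, so up to a unimodular factor the
  packet at frequency k is a translate of the one at frequency zero.\<close>

lemma ker_galilei: "ker b k ta x = cis (k * x) * cis (- (ta * k\<^sup>2)) * ker b 0 ta (x - 2 * ta * k)"
proof -
 have c: "cis (x * (k + eta)) * cis (- (ta * (k + eta)\<^sup>2))
   = cis (k * x) * cis (- (ta * k\<^sup>2)) * (cis ((x - 2 * ta * k) * eta) * cis (- (ta * eta\<^sup>2)))" for eta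
  unfolding cis_mult by (rule arg_cong[where f = cis]) (simp add: power2_eq_square algebra_simps)
 have "(LBINT xi. cis (x * xi) * sym b k ta xi) = \<bar>1\<bar> *\<^sub>R (LBINT eta. cis (x * (k + 1 * eta)) * sym b k ta (k + 1 * eta))"
  by (rule lborel_integral_real_affine) simp
 also have "... = (LBINT eta. (cis (k * x) * cis (- (ta * k\<^sup>2))) * (cis ((x - 2 * ta * k) * eta) * sym b 0 ta eta))"
 proof -
  have "cis (x * (k + eta)) * sym b k ta (k + eta) = (cis (k * x) * cis (- (ta * k\<^sup>2))) * (cis ((x - 2 * ta * k) * eta) * sym b 0 ta eta)" for eta
  proof -
   have "cis (x * (k + eta)) * sym b k ta (k + eta) = of_real (b eta) * (cis (x * (k + eta)) * cis (- (ta * (k + eta)\<^sup>2)))"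
    by (simp add: sym_def)
   then show ?thesis unfolding c by (simp add: sym_def)
  qed
  then show ?thesis by simp
 qed
 also have "... = (cis (k * x) * cis (- (ta * k\<^sup>2))) * (LBINT eta. cis ((x - 2 * ta * k) * eta) * sym b 0 ta eta)"
  by (rule integral_mult_right_zero)
 finally show ?thesis by (simp add: ker_def inv_fourier_def)
qed

text \<open>Decay up to a translation; the translation is the group velocity of a wave packet.\<close>

definition sdecay :: "real => (real => complex) => bool" where
 "sdecay C K \<longleftrightarrow> (\<exists>a. decay C (\<lambda>x. K (x + a)))"

lemma sdecay_measurable: assumes "sdecay C K" shows "K \<in> borel_measurable borel"
proof -
 obtain a where a: "decay C (\<lambda>x. K (x + a))" using assms unfolding sdecay_def by blast
 note [measurable] = decay_measurable[OF a]
 have "(\<lambda>y. (\<lambda>x. K (x + a)) (y - a)) \<in> borel_measurable borel" by measurable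
 then show ?thesis by simp
qed

lemma sdecay_nonneg: "sdecay C K ==> 0 <= C"
 unfolding sdecay_def by (auto dest: decay_nonneg)

lemma sdecay_le: "sdecay C K ==> norm (K x) <= C"
 unfolding sdecay_def using decay_le[of C "\<lambda>x. K (x + a)" "x - a" for a] by auto

lemma sdecay_integrable_norm:
 assumes "sdecay C K"
 shows "integrable lborel (\<lambda>x. norm (K x))" and "(LBINT x. norm (K x)) <= C * pi"
proof -
 obtain a where a: "decay C (\<lambda>x. K (x + a))" using assms unfolding sdecay_def by blast
 have i: "integrable lborel (\<lambda>x. norm (K (a + 1 * x)))"
  using integrable_norm[OF decay_integrable[OF a]] by (simp add: add.commute)
 then show "integrable lborel (\<lambda>x. norm (K x))"
  by (subst (asm) lborel_integrable_real_affine_iff[of 1 "\<lambda>x. norm (K x)" a]) auto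
 have "(LBINT x. norm (K x)) = \<bar>1\<bar> *\<^sub>R (LBINT x. norm (K (a + 1 * x)))"
  by (rule lborel_integral_real_affine) simp
 also have "... <= C * pi" using decay_integral_norm[OF a] by (simp add: add.commute)
 finally show "(LBINT x. norm (K x)) <= C * pi" .
qed

lemma decay_sdecay: "decay C K ==> sdecay C K"
 unfolding sdecay_def by (rule exI[of _ 0]) simp

text \<open>For k = 0 the symbols with times in [-1,1] form a uniform Schwartz family. The Galilean
  identity transfers the bound to all k, with the translation 2 ta k allowed by
  \<open>sdecay\<close>.\<close>

lemma ker_bound:
 assumes "bump b" shows "\<exists>C\<ge>0. \<forall>k. \<forall>ta\<in>{-1..1}. sdecay C (ker b k ta)"
proof -
 have "usch {-1..1} (\<lambda>ta. sym b 0 ta)"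
  using usch_propagator[OF bump_schwartz[OF assms], of 1] by (simp add: sym_def[abs_def] mult.commute)
 from usch_decay[OF usch_inv_fourier[OF this]]
 obtain C where C: "0 <= C" "\<And>ta. ta \<in> {-1..1} ==> decay C (ker b 0 ta)" by (auto simp: ker_def)
 have "sdecay C (ker b k ta)" if ta: "ta \<in> {-1..1}" for k ta
 proof -
  have e: "ker b k ta (x + 2 * ta * k) = cis (k * (x + 2 * ta * k)) * cis (- (ta * k\<^sup>2)) * ker b 0 ta x" for x
   by (subst ker_galilei) simp
  note [measurable] = decay_measurable[OF C(2)[OF ta]]
  have "decay C (\<lambda>x. ker b k ta (x + 2 * ta * k))"
   unfolding e using decayD[OF C(2)[OF ta]] by (simp add: decay_def norm_mult)
  then show ?thesis unfolding sdecay_def by blast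
 qed
 then show ?thesis using C(1) by blast
qed

lemma bump_measurable: "bump b ==> b \<in> borel_measurable borel"
 unfolding bump_def by (auto intro: smooth_measurable)

lemma ker_measurable:
 assumes "bump b" and [measurable]: "f \<in> borel_measurable M" "g \<in> borel_measurable M"
 shows "(\<lambda>z. ker b k (f z) (g z)) \<in> borel_measurable M"
proof -
 note [measurable] = bump_measurable[OF assms(1)]
 have "(\<lambda>z. (LBINT xi. cis (g z * xi) * (of_real (b (xi - k)) * cis (- (f z * xi\<^sup>2)))) / (2 * pi)) \<in> borel_measurable M"
  by measurable
 then show ?thesis by (simp add: ker_def inv_fourier_def sym_def)
qed

section \<open>Tempered distributions on finite sums and vanishing sequences\<close>

lemma tempered_add: "tempered f ==> schwartz phi ==> schwartz \<psi> ==> f (\<lambda>x. phi x + \<psi> x) = f phi + f \<psi>"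
 and tempered_cmult: "tempered f ==> schwartz phi ==> f (\<lambda>x. c * phi x) = c * f phi"
 unfolding tempered_def by blast+

lemma tempered_zero: "tempered f ==> f (\<lambda>x. 0) = 0"
proof -
 assume f: "tempered f"
 have "schwartz (\<lambda>x. of_real (gauss x))" by (rule schwartz_gauss)
 from tempered_cmult[OF f this, of 0] show ?thesis by simp
qed

lemma schwartz_zero: "schwartz (\<lambda>x. 0)"
 unfolding schwartz_iff_usch usch_def by (auto simp: dx_funpow_const intro!: exI[of _ 0])

lemma schwartz_add: "schwartz phi ==> schwartz \<psi> ==> schwartz (\<lambda>x. phi x + \<psi> x)"
 unfolding schwartz_iff_usch by (rule usch_add)

lemma schwartz_cmult: "schwartz phi ==> schwartz (\<lambda>x. c * phi x)"
 unfolding schwartz_iff_usch by (rule usch_cmult)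

lemma schwartz_sum: "finite A ==> (\<And>i. i \<in> A ==> schwartz (F i)) ==> schwartz (\<lambda>x. \<Sum>i\<in>A. F i x)"
 by (induction A rule: finite_induct) (auto intro: schwartz_add schwartz_zero)

lemma tempered_sum:
 assumes f: "tempered f" and "finite A" "\<And>i. i \<in> A ==> schwartz (F i)"
 shows "f (\<lambda>x. \<Sum>i\<in>A. F i x) = (\<Sum>i\<in>A. f (F i))"
 using assms(2,3)
proof (induction A rule: finite_induct)
 case (insert i A)
 have "f (\<lambda>x. F i x + (\<Sum>i\<in>A. F i x)) = f (F i) + f (\<lambda>x. \<Sum>i\<in>A. F i x)"
  by (rule tempered_add[OF f]) (use insert in \<open>auto intro: schwartz_sum\<close>)
 then show ?case using insert by simp
qed (simp add: tempered_zero[OF f])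

lemma fourier_add: "schwartz phi ==> schwartz \<psi> ==> fourier (\<lambda>x. phi x + \<psi> x) = (\<lambda>xi. fourier phi xi + fourier \<psi> xi)"
proof
 fix xi assume s: "schwartz phi" "schwartz \<psi>"
 have i: "integrable lborel (\<lambda>x. cis (-1 * (x * xi)) * phi x)" "integrable lborel (\<lambda>x. cis (-1 * (x * xi)) * \<psi> x)"
  using s schwartz_decay ft_integrable by blast+
 then show "fourier (\<lambda>x. phi x + \<psi> x) xi = fourier phi xi + fourier \<psi> xi"
  using Bochner_Integration.integral_add[OF i] by (simp add: fourier_def distrib_left)
qed

lemma fourier_cmult: "fourier (\<lambda>x. c * phi x) = (\<lambda>xi. c * fourier phi xi)"
proof
 fix xi
 have "fourier (\<lambda>x. c * phi x) xi = (LBINT x. c * (cis (- (x * xi)) * phi x))"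
  unfolding fourier_def by (intro LBINT_cong refl) simp
 also have "... = c * (LBINT x. cis (- (x * xi)) * phi x)" by (rule integral_mult_right_zero)
 finally show "fourier (\<lambda>x. c * phi x) xi = c * fourier phi xi" by (simp add: fourier_def)
qed

lemma fourier_sum:
 assumes "finite A" "\<And>i. i \<in> A ==> schwartz (F i)"
 shows "fourier (\<lambda>x. \<Sum>i\<in>A. F i x) = (\<lambda>xi. \<Sum>i\<in>A. fourier (F i) xi)"
 using assms
proof (induction A rule: finite_induct)
 case empty
 then show ?case using fourier_cmult[of 0 "\<lambda>x. 0"] by simp
next
 case (insert i A)
 have "fourier (\<lambda>x. F i x + (\<Sum>i\<in>A. F i x)) = (\<lambda>xi. fourier (F i) xi + fourier (\<lambda>x. \<Sum>i\<in>A. F i x) xi)"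
  by (rule fourier_add) (use insert in \<open>auto intro: schwartz_sum\<close>)
 then show ?case using insert by simp
qed

text \<open>Uniform seminorm bounds for N times \<open>eta N\<close> encode a rate 1 / N in every
  seminorm. A tempered functional is controlled by finitely many of them.\<close>

lemma tempered_fourier_tendsto_0:
 fixes eta :: "nat => real => complex"
 assumes f: "tempered f" and eta: "\<And>N. schwartz (eta N)" and u: "usch UNIV (\<lambda>N x. of_nat N * eta N x)"
 shows "(\<lambda>N. f (fourier (eta N))) \<longlonglongrightarrow> 0"
proof -
 obtain C M where C: "\<And>phi. schwartz phi ==> norm (f phi) <= C * (\<Sum>j\<le>M. \<Sum>k\<le>M. schwartz_seminorm j k phi)"
  using f unfolding tempered_def by blast
 have "\<exists>D. \<forall>N x. \<bar>x\<bar> ^ j * norm ((dx ^^ k) (fourier (\<lambda>x. of_nat N * eta N x)) x) <= D" for j k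
  using usch_fourier[OF u] unfolding usch_def by simp
 then obtain D where D: "\<And>j k N x. \<bar>x\<bar> ^ j * norm ((dx ^^ k) (fourier (\<lambda>x. of_nat N * eta N x)) x) <= D j k"
  by metis
 have sn: "schwartz_seminorm j k (fourier (eta N)) <= D j k / N" if N: "0 < N" for j k N
  unfolding schwartz_seminorm_def
 proof (rule cSUP_least)
  fix x
  have sm: "smooth (fourier (eta N))" by (rule schwartz_smooth[OF schwartz_fourier[OF eta]])
  have e: "(dx ^^ k) (\<lambda>xi. of_nat N * fourier (eta N) xi) = (\<lambda>xi. of_nat N * (dx ^^ k) (fourier (eta N)) xi)"
  proof (induction k)
   case (Suc k)
   have "dx (\<lambda>xi. of_nat N * (dx ^^ k) (fourier (eta N)) xi) = (\<lambda>xi. of_nat N * dx ((dx ^^ k) (fourier (eta N))) xi)"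
    by (rule dx_eqI) (rule has_vector_derivative_mult_right[OF smooth_has_dx[OF smooth_dx_funpow[OF sm]]])
   then show ?case using Suc by simp
  qed simp
  have "real N * (\<bar>x\<bar> ^ j * norm ((dx ^^ k) (fourier (eta N)) x)) <= D j k"
   using D[where j = j and k = k and N = N and x = x] unfolding fourier_cmult e by (simp add: norm_mult mult_ac)
  then show "norm (x ^ j *\<^sub>R (dx ^^ k) (fourier (eta N)) x) <= D j k / real N"
   using N by (simp add: pos_le_divide_eq power_abs mult.commute)
 qed auto
 let ?S = "\<Sum>j\<le>M. \<Sum>k\<le>M. \<bar>D j k\<bar>"
 have "\<forall>\<^sub>F N in sequentially. norm (f (fourier (eta N))) <= \<bar>C\<bar> * ?S * (1 / real N)"
  using eventually_gt_at_top[of 0]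
 proof eventually_elim
  case (elim N)
  have "norm (f (fourier (eta N))) <= C * (\<Sum>j\<le>M. \<Sum>k\<le>M. schwartz_seminorm j k (fourier (eta N)))"
   by (rule C[OF schwartz_fourier[OF eta]])
  also have "... <= \<bar>C\<bar> * (\<Sum>j\<le>M. \<Sum>k\<le>M. schwartz_seminorm j k (fourier (eta N)))"
  proof (rule mult_right_mono)
   show "0 <= (\<Sum>j\<le>M. \<Sum>k\<le>M. schwartz_seminorm j k (fourier (eta N)))"
   proof (intro sum_nonneg)
    fix j k
    obtain E where "\<And>x. norm (x ^ j *\<^sub>R (dx ^^ k) (fourier (eta N)) x) <= E"
     using schwartz_fourier[OF eta, of N] unfolding schwartz_def bounded_iff by blast
    then have "bdd_above (range (\<lambda>x. norm (x ^ j *\<^sub>R (dx ^^ k) (fourier (eta N)) x)))"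
     by (rule bdd_aboveI2)
    from cSUP_upper[OF UNIV_I this, of 0]
    show "0 <= schwartz_seminorm j k (fourier (eta N))" unfolding schwartz_seminorm_def
     by (rule order_trans[OF norm_ge_zero])
   qed
  qed simp
  also have "... <= \<bar>C\<bar> * (\<Sum>j\<le>M. \<Sum>k\<le>M. \<bar>D j k\<bar> / N)"
  proof (intro mult_left_mono sum_mono)
   fix j k
   show "schwartz_seminorm j k (fourier (eta N)) <= \<bar>D j k\<bar> / real N"
    using sn[OF elim, of j k] elim by (smt (verit) divide_right_mono of_nat_0_le_iff)
  qed simp
  also have "... = \<bar>C\<bar> * ?S * (1 / real N)" unfolding sum_divide_distrib[symmetric] by simp
  finally show ?case .
 qed
 moreover have "(\<lambda>N. \<bar>C\<bar> * ?S * (1 / real N)) \<longlonglongrightarrow> 0"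
  by (rule tendsto_mult_right_zero[OF lim_1_over_n])
 ultimately show ?thesis by (rule Lim_null_comparison)
qed

section \<open>The partition of unity on the frequency line\<close>

locale freq_window =
 fixes \<sigma> :: "real => real" and \<rho> :: nat
 assumes window: "window \<sigma>" and \<rho>: "1 <= \<rho>" and supp: "\<And>xi. real \<rho> < \<bar>xi\<bar> ==> \<sigma> xi = 0"

lemma window_freq_window: assumes "window \<sigma>" shows "\<exists>\<rho>. freq_window \<sigma> \<rho>"
proof -
 have "bounded {xi. \<sigma> xi \<noteq> 0}"
  using assms unfolding window_def by (meson bounded_subset closure_subset compact_imp_bounded)
 then obtain B where B: "\<And>xi. \<sigma> xi \<noteq> 0 ==> \<bar>xi\<bar> <= B" unfolding bounded_iff by auto
 obtain \<rho> :: nat where \<rho>: "max 1 B <= real \<rho>" using real_arch_simple by blast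
 then have "freq_window \<sigma> \<rho>"
  unfolding freq_window_def using assms B by force
 then show ?thesis by blast
qed

context freq_window
begin

lemma bump_\<sigma>: "bump \<sigma>"
 using window supp unfolding bump_def window_def by blast

text \<open>All indices whose window can be nonzero at \<open>xi\<close> lie in \<open>F\<close>, so
  the infinite sum in \<open>window\<close> collapses to \<open>F\<close>.\<close>

lemma sum_\<sigma>:
 assumes "finite F" "\<And>k::int. \<bar>xi - of_int k\<bar> <= real \<rho> ==> k \<in> F"
 shows "(\<Sum>k\<in>F. \<sigma> (xi - of_int k)) = 1"
proof -
 have "((\<lambda>k::int. \<sigma> (xi - of_int k)) has_sum 1) UNIV" using window by (simp add: window_def)
 moreover have "((\<lambda>k::int. \<sigma> (xi - of_int k)) has_sum 1) UNIV \<longleftrightarrow> ((\<lambda>k::int. \<sigma> (xi - of_int k)) has_sum 1) F"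
 proof (rule has_sum_cong_neutral)
  fix k :: int assume "k \<in> UNIV - F"
  then show "\<sigma> (xi - of_int k) = 0" using assms(2)[of k] supp[of "xi - of_int k"] by (cases "\<bar>xi - of_int k\<bar> <= real \<rho>") auto
 qed auto
 ultimately show ?thesis
  using has_sum_finite[OF assms(1), of "\<lambda>k. \<sigma> (xi - of_int k)"] has_sum_unique by blast
qed

text \<open>Bounded overlap of the windows, uniformly in \<open>xi\<close>. It bounds the
  derivatives of partial sums of the partition of unity.\<close>

lemma card_supp: "finite {k::int. \<bar>xi - of_int k\<bar> <= real \<rho>} \<and> card {k::int. \<bar>xi - of_int k\<bar> <= real \<rho>} <= 2 * \<rho> + 2"
proof -
 let ?A = "{k::int. \<bar>xi - of_int k\<bar> <= real \<rho>}"
 have s: "?A \<subseteq> {\<lfloor>xi\<rfloor> - int \<rho>..\<lfloor>xi\<rfloor> + int \<rho> + 1}"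
 proof
  fix k assume "k \<in> ?A"
  then have 1: "real_of_int k <= xi + real \<rho>" "xi - real \<rho> <= real_of_int k" by auto
  have 2: "real_of_int \<lfloor>xi\<rfloor> <= xi" "xi < real_of_int \<lfloor>xi\<rfloor> + 1" by linarith+
  have "real_of_int k < real_of_int \<lfloor>xi\<rfloor> + real \<rho> + 1" using 1 2 by linarith
  moreover have "real_of_int \<lfloor>xi\<rfloor> - real \<rho> - 1 < real_of_int k" using 1 2 by linarith
  ultimately have "real_of_int k < real_of_int (\<lfloor>xi\<rfloor> + int \<rho> + 1)" "real_of_int (\<lfloor>xi\<rfloor> - int \<rho> - 1) < real_of_int k"
   by simp_all
  then show "k \<in> {\<lfloor>xi\<rfloor> - int \<rho>..\<lfloor>xi\<rfloor> + int \<rho> + 1}" by (simp only: of_int_less_iff) auto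
 qed
 have "card ?A <= card {\<lfloor>xi\<rfloor> - int \<rho>..\<lfloor>xi\<rfloor> + int \<rho> + 1}" by (intro card_mono s) auto
 also have "... = 2 * \<rho> + 2" by (simp add: nat_add_distrib)
 finally show ?thesis using finite_subset[OF s] by auto
qed

text \<open>An enlarged window, assembled from neighbouring windows, that equals 1 on the support of
  \<sigma>. Inserting it next to \<sigma> changes nothing, which allows localization without loss
  and yields two independent kernels.\<close>

definition ta\<sigma> :: "real => real" where
 "ta\<sigma> xi = (\<Sum>j\<in>{-2 * int \<rho>..2 * int \<rho>}. \<sigma> (xi - of_int j))"

lemma ta\<sigma>_eq_1: "\<bar>xi\<bar> <= real \<rho> ==> ta\<sigma> xi = 1"
 unfolding ta\<sigma>_def
proof (rule sum_\<sigma>)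
 fix k :: int assume "\<bar>xi\<bar> <= real \<rho>" "\<bar>xi - of_int k\<bar> <= real \<rho>"
 then have "\<bar>real_of_int k\<bar> <= 2 * real \<rho>" by linarith
 then have "real_of_int \<bar>k\<bar> <= real_of_int (2 * int \<rho>)" by simp
 then have "\<bar>k\<bar> <= 2 * int \<rho>" by (simp only: of_int_le_iff)
 then show "k \<in> {-2 * int \<rho>..2 * int \<rho>}" by auto
qed simp

lemma ta\<sigma>_supp: assumes "3 * real \<rho> < \<bar>xi\<bar>" shows "ta\<sigma> xi = 0"
 unfolding ta\<sigma>_def
proof (intro sum.neutral ballI)
 fix j assume "j \<in> {-2 * int \<rho>..2 * int \<rho>}"
 then have "real_of_int (-2 * int \<rho>) <= real_of_int j" "real_of_int j <= real_of_int (2 * int \<rho>)"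
  by (simp_all only: of_int_le_iff atLeastAtMost_iff)
 then have "\<bar>real_of_int j\<bar> <= 2 * real \<rho>" by simp
 then show "\<sigma> (xi - of_int j) = 0" using assms by (intro supp) linarith
qed

lemma \<sigma>_mult_ta\<sigma>: "\<sigma> xi * ta\<sigma> xi = \<sigma> xi"
 using ta\<sigma>_eq_1[of xi] supp[of xi] by (cases "\<bar>xi\<bar> <= real \<rho>") auto

lemma bump_ta\<sigma>: "bump ta\<sigma>"
proof -
 have "smooth (\<lambda>xi. \<Sum>j\<in>{-2 * int \<rho>..2 * int \<rho>}. \<sigma> (xi - of_int j))"
  by (intro smooth_real_sum smooth_shift) (use bump_\<sigma> in \<open>auto simp: bump_def\<close>)
 then have "smooth ta\<sigma>" by (simp add: ta\<sigma>_def[abs_def])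
 then show ?thesis using ta\<sigma>_supp unfolding bump_def by blast
qed

text \<open>The frequency pieces of a tempered distribution add up to it. The error is
  \<open>f\<close> tested with the transform of \<open>eta N\<close>, which is M times one minus a
  partial sum of the partition of unity and therefore lives at frequencies of size at least N -
  \<rho>.\<close>

lemma \<sigma>_decomposition:
 assumes f: "tempered f" and M: "schwartz M"
 shows "(\<lambda>N. \<Sum>k\<in>{-int N..int N}. f (fourier (\<lambda>xi. of_real (\<sigma> (xi - of_int k)) * M xi))) \<longlonglongrightarrow> f (fourier M)"
proof -
 let ?s = "\<lambda>k xi. complex_of_real (\<sigma> (xi - of_int k))"
 define S where "S N xi = (\<Sum>k\<in>{-int N..int N}. ?s k xi)" for N :: nat and xi
 have sm\<sigma>: "smooth (?s k)" for k
  by (rule schwartz_smooth[OF bump_schwartz[OF bump_shift[OF bump_\<sigma>]]])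
 have smS: "smooth (S N)" for N unfolding S_def by (intro smooth_sum sm\<sigma>) simp
 have d\<sigma>: "(dx ^^ b) (?s k) xi = (dx ^^ b) (\<lambda>x. complex_of_real (\<sigma> x)) (xi - of_int k)" for b k xi
  using dx_funpow_shift[OF schwartz_smooth[OF bump_schwartz[OF bump_\<sigma>]], of b "of_int k"] by metis
 have zero: "(dx ^^ b) (\<lambda>x. complex_of_real (\<sigma> x)) x = 0" if "real \<rho> < \<bar>x\<bar>" for b x
  by (rule dx_funpow_zero_on_open[OF schwartz_smooth[OF bump_schwartz[OF bump_\<sigma>]], of "{x. real \<rho> < \<bar>x\<bar>}"])
    (use supp that in \<open>auto intro!: open_Collect_less continuous_intros\<close>)
 \<comment> \<open>At each point at most 2\<rho> + 2 summands are nonzero, so the derivatives of the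
   partial sums are bounded independently of N.\<close>
 have umS: "umod UNIV S"
 proof (rule umod_bounded_derivs)
  fix b
  obtain C where C: "\<And>x. norm ((dx ^^ b) (\<lambda>x. complex_of_real (\<sigma> x)) x) <= C"
   using bump_schwartz[OF bump_\<sigma>] unfolding schwartz_iff_usch usch_def
   by (metis mult_1 power_0 singletonI)
  have "norm ((dx ^^ b) (S N) xi) <= (2 * \<rho> + 2) * C" for N xi
  proof -
   let ?A = "{k::int. \<bar>xi - of_int k\<bar> <= real \<rho>}"
   have C0: "0 <= C" using C[of 0] norm_ge_zero order_trans by blast
   have "(dx ^^ b) (S N) xi = (\<Sum>k\<in>{-int N..int N}. (dx ^^ b) (?s k) xi)"
    unfolding S_def by (subst dx_funpow_sum) (auto intro: sm\<sigma>)
   also have "... = (\<Sum>k\<in>{-int N..int N} \<inter> ?A. (dx ^^ b) (?s k) xi)"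
    by (rule sum.mono_neutral_right) (auto simp: d\<sigma> intro!: zero)
   finally have e: "(dx ^^ b) (S N) xi = (\<Sum>k\<in>{-int N..int N} \<inter> ?A. (dx ^^ b) (?s k) xi)" .
   have "norm ((dx ^^ b) (S N) xi) <= (\<Sum>k\<in>{-int N..int N} \<inter> ?A. norm ((dx ^^ b) (?s k) xi))"
    unfolding e by (rule norm_sum)
   also have "... <= (\<Sum>k\<in>{-int N..int N} \<inter> ?A. C)"
    by (intro sum_mono) (simp add: d\<sigma> C)
   also have "... = real (card ({-int N..int N} \<inter> ?A)) * C" by simp
   also have "... <= real (2 * \<rho> + 2) * C"
    by (intro mult_right_mono C0, subst of_nat_le_iff, rule order_trans[OF card_mono[of ?A]])
      (use card_supp[of xi] in auto)
   finally show ?thesis by simp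
  qed
  then show "\<exists>C. \<forall>i\<in>UNIV. \<forall>x. norm ((dx ^^ b) (S i) x) <= C" by blast
 qed (rule smS)
 define eta where "eta N xi = M xi - S N xi * M xi" for N xi
 have ueta: "usch UNIV eta" unfolding eta_def
  by (intro usch_diff schwartz_imp_usch M usch_mult[OF umS])
 have eta0: "(dx ^^ b) (eta N) x = 0" if "\<bar>x\<bar> < real N - real \<rho>" for b N x
 proof (rule dx_funpow_zero_on_open[of _ "{x. \<bar>x\<bar> < real N - real \<rho>}"])
  show "smooth (eta N)" using ueta by (simp add: usch_def)
  show "open {x::real. \<bar>x\<bar> < real N - real \<rho>}" by (intro open_Collect_less continuous_intros)
  fix y assume "y \<in> {x. \<bar>x\<bar> < real N - real \<rho>}"
  then have y: "\<bar>y\<bar> < real N - real \<rho>" by simp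
  have "(\<Sum>k\<in>{-int N..int N}. \<sigma> (y - of_int k)) = 1"
  proof (rule sum_\<sigma>)
   fix k :: int assume "\<bar>y - of_int k\<bar> <= real \<rho>"
   then have "\<bar>real_of_int k\<bar> <= real N" using y by linarith
   then have "real_of_int \<bar>k\<bar> <= real_of_int (int N)" by simp
   then have "\<bar>k\<bar> <= int N" by (simp only: of_int_le_iff)
   then show "k \<in> {-int N..int N}" by auto
  qed simp
  then have "S N y = 1" unfolding S_def by (metis of_real_1 of_real_sum)
  then show "eta N y = 0" by (simp add: eta_def)
 qed (use that in simp)
 \<comment> \<open>Where \<open>eta N\<close> does not vanish, N <= |x| + \<rho>; the factor N is
   absorbed by one additional power of x in the Schwartz seminorms of \<open>eta\<close>.\<close>
 have "usch UNIV (\<lambda>N x. of_nat N * eta N x)"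
  unfolding usch_def
 proof (intro conjI ballI allI)
  fix N show "smooth (\<lambda>x. of_nat N * eta N x)" by (rule smooth_mult) (use ueta in \<open>auto simp: usch_def\<close>)
 next
  fix a b
  have v: "\<exists>C. \<forall>i. \<forall>x. \<bar>x\<bar> ^ a * norm ((dx ^^ b) (eta i) x) <= C" for a
   using ueta by (simp add: usch_def)
  obtain C where C: "\<And>i x. \<bar>x\<bar> ^ a * norm ((dx ^^ b) (eta i) x) <= C" using v by blast
  obtain D where D: "\<And>i x. \<bar>x\<bar> ^ (Suc a) * norm ((dx ^^ b) (eta i) x) <= D" using v by blast
  have "\<bar>x\<bar> ^ a * norm ((dx ^^ b) (\<lambda>x. of_nat N * eta N x) x) <= \<bar>D + \<rho> * C\<bar>" for N x
  proof -
   have "(dx ^^ b) (\<lambda>x. of_nat N * eta N x) = (\<lambda>x. of_nat N * (dx ^^ b) (eta N) x)"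
   proof (induction b)
    case (Suc k)
    have "smooth (eta N)" using ueta by (simp add: usch_def)
    then have "dx (\<lambda>xi. of_nat N * (dx ^^ k) (eta N) xi) = (\<lambda>xi. of_nat N * dx ((dx ^^ k) (eta N)) xi)"
     by (intro dx_eqI has_vector_derivative_mult_right[OF smooth_has_dx[OF smooth_dx_funpow]])
    then show ?case using Suc by simp
   qed simp
   then have e: "\<bar>x\<bar> ^ a * norm ((dx ^^ b) (\<lambda>x. of_nat N * eta N x) x) = real N * (\<bar>x\<bar> ^ a * norm ((dx ^^ b) (eta N) x))"
    by (simp add: norm_mult)
   show ?thesis
   proof (cases "\<bar>x\<bar> < real N - real \<rho>")
    case True
    then show ?thesis unfolding e by (simp add: eta0)
   next
    case False
    then have "real N * (\<bar>x\<bar> ^ a * norm ((dx ^^ b) (eta N) x)) <= (\<bar>x\<bar> + real \<rho>) * (\<bar>x\<bar> ^ a * norm ((dx ^^ b) (eta N) x))"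
     by (intro mult_right_mono) auto
    also have "... = \<bar>x\<bar> ^ Suc a * norm ((dx ^^ b) (eta N) x) + real \<rho> * (\<bar>x\<bar> ^ a * norm ((dx ^^ b) (eta N) x))"
     by (simp add: algebra_simps)
    also have "... <= D + real \<rho> * C" by (intro add_mono mult_left_mono C D) auto
    finally show ?thesis unfolding e by linarith
   qed
  qed
  then show "\<exists>C. \<forall>i\<in>UNIV. \<forall>x. \<bar>x\<bar> ^ a * norm ((dx ^^ b) (\<lambda>x. of_nat i * eta i x) x) <= C" by blast
 qed
 then have lim: "(\<lambda>N. f (fourier (eta N))) \<longlonglongrightarrow> 0"
  by (intro tempered_fourier_tendsto_0[OF f]) (auto intro: usch_imp_schwartz[OF ueta])
 have sk: "schwartz (\<lambda>xi. ?s k xi * M xi)" for k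
 proof -
  have "umod {()} (\<lambda>_. ?s k)"
  proof (rule umod_bounded_derivs)
   show "\<exists>C. \<forall>i\<in>{()}. \<forall>x. norm ((dx ^^ b) (?s k) x) <= C" for b
    using bump_schwartz[OF bump_shift[OF bump_\<sigma>], of "of_int k"] unfolding schwartz_iff_usch usch_def
    by (metis mult_1 power_0)
  qed (rule sm\<sigma>)
  from usch_mult[OF this, of "\<lambda>_. M"] M show ?thesis by (simp add: schwartz_iff_usch)
 qed
 have eq: "(\<Sum>k\<in>{-int N..int N}. f (fourier (\<lambda>xi. ?s k xi * M xi))) = f (fourier M) - f (fourier (eta N))" for N
 proof -
  have s1: "schwartz (\<lambda>xi. \<Sum>k\<in>{-int N..int N}. ?s k xi * M xi)" by (intro schwartz_sum sk) simp
  have s2: "schwartz (eta N)" by (rule usch_imp_schwartz[OF ueta]) simp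
  have "M = (\<lambda>xi. eta N xi + (\<Sum>k\<in>{-int N..int N}. ?s k xi * M xi))"
   by (simp add: eta_def S_def sum_distrib_right fun_eq_iff)
  then have "fourier M = (\<lambda>xi. fourier (eta N) xi + fourier (\<lambda>xi. \<Sum>k\<in>{-int N..int N}. ?s k xi * M xi) xi)"
   using fourier_add[OF s2 s1] by simp
  then have "f (fourier M) = f (fourier (eta N)) + f (fourier (\<lambda>xi. \<Sum>k\<in>{-int N..int N}. ?s k xi * M xi))"
   using tempered_add[OF f schwartz_fourier[OF s2] schwartz_fourier[OF s1]] by simp
  also have "f (fourier (\<lambda>xi. \<Sum>k\<in>{-int N..int N}. ?s k xi * M xi)) = (\<Sum>k\<in>{-int N..int N}. f (fourier (\<lambda>xi. ?s k xi * M xi)))"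
   by (subst fourier_sum) (auto intro: sk intro!: tempered_sum[OF f] schwartz_fourier)
  finally show ?thesis by simp
 qed
 show ?thesis unfolding eq using tendsto_diff[OF tendsto_const lim, of "f (fourier M)"] by simp
qed

end

section \<open>Integral inequalities in Lebesgue spaces\<close>

lemma norm_integral_le:
 fixes f :: "'a => complex"
 assumes "integrable M g" "AE x in M. norm (f x) <= g x" "f \<in> borel_measurable M"
 shows "norm (LINT x|M. f x) <= (LINT x|M. g x)"
proof -
 have "integrable M f"
  by (rule integrable_boundI[OF assms(1,3)]) (use assms(2) in \<open>auto elim!: eventually_mono\<close>)
 then have "norm (LINT x|M. f x) <= (LINT x|M. norm (f x))" by simp
 also have "... <= (LINT x|M. g x)"
  by (rule integral_mono_AE) (use \<open>integrable M f\<close> assms in auto)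
 finally show ?thesis .
qed

text \<open>Convexity in the form of a supporting line at \<open>m\<close>. After scaling t = m s it
  is Young's inequality with one factor equal to 1.\<close>

lemma powr_tangent:
 fixes t m q :: real
 assumes t: "0 <= t" and m: "0 < m" and q: "1 <= q"
 shows "m powr q + q * m powr (q - 1) * (t - m) <= t powr q"
proof (cases "q = 1")
 case True
 then show ?thesis using assms by simp
next
 case False
 then have q1: "1 < q" using q by simp
 define s where "s = t / m"
 have s: "0 <= s" "t = m * s" using t m by (auto simp: s_def)
 have "s * 1 <= s powr q / q + 1 powr (q / (q - 1)) / (q / (q - 1))"
  by (rule Youngs_inequality) (use q1 s in \<open>auto simp: field_simps\<close>)
 then have "q * s <= q * (s powr q / q + (q - 1) / q)" using q1 by (intro mult_left_mono) auto
 also have "... = s powr q + (q - 1)" using q1 by (simp add: field_simps)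
 finally have "q * s <= s powr q + (q - 1)" .
 then have "m powr q * (1 + q * (s - 1)) <= m powr q * s powr q"
  by (intro mult_left_mono) (auto simp: algebra_simps)
 also have "m powr q * s powr q = t powr q" using m s by (simp add: powr_mult)
 also have "m powr q * (1 + q * (s - 1)) = m powr q + q * m powr (q - 1) * (t - m)"
 proof -
  have "m powr q = m powr (q - 1) * m" using m by (simp add: powr_diff)
  then show ?thesis unfolding s(2) by (simp add: algebra_simps)
 qed
 finally show ?thesis .
qed

text \<open>Jensen's inequality for a finite weight of mass at most \<open>W\<close>. The right-hand
  side is an extended integral, so no integrability of \<open>b powr q\<close> has to be supplied by
  the applications.\<close>

lemma jensen_norm:
 fixes F :: "'a => complex" and w b :: "'a => real"
 assumes q: "1 <= q" and w: "integrable M w" "\<And>z. 0 <= w z" "(LINT z|M. w z) <= W"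
  and b[measurable]: "b \<in> borel_measurable M" and b0: "\<And>z. 0 <= b z"
  and F[measurable]: "F \<in> borel_measurable M" and le: "\<And>z. norm (F z) <= w z * b z"
 shows "ennreal (norm (LINT z|M. F z) powr q) <= ennreal (W powr (q - 1)) * (\<integral>\<^sup>+z. ennreal (w z * b z powr q) \<partial>M)"
proof -
 have [measurable]: "w \<in> borel_measurable M" using w(1) by auto
 let ?J = "\<integral>\<^sup>+z. ennreal (w z * b z powr q) \<partial>M"
 define a where "a = (LINT z|M. w z)"
 have a0: "0 <= a" unfolding a_def by (rule Bochner_Integration.integral_nonneg) (use w in auto)
 show ?thesis
 proof (cases "a = 0")
  case True
  then have "AE z in M. w z = 0" using integral_nonneg_eq_0_iff_AE[OF w(1)] w(2) by (auto simp: a_def)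
  then have "AE z in M. F z = 0"
  proof eventually_elim
   case (elim z) then show ?case using le[of z] by simp
  qed
  then have "(LINT z|M. F z) = 0" by (rule integral_eq_zero_AE)
  then show ?thesis using q by simp
 next
  case False
  then have a: "0 < a" using a0 by simp
  have W: "0 < W" "a <= W" using a w(3) by (auto simp: a_def)
  show ?thesis
  proof (cases "?J = \<infinity>")
   case True
   then show ?thesis using W by (simp add: ennreal_mult_top)
  next
   case False
   then have i: "integrable M (\<lambda>z. w z * b z powr q)"
    by (intro integrableI_nonneg) (auto simp: w less_top)
   have J: "?J = ennreal (LINT z|M. w z * b z powr q)"
    by (rule nn_integral_eq_integral[OF i]) (auto simp: w)
   have iwb: "integrable M (\<lambda>z. w z * b z)"
   proof (rule integrable_boundI)
    show "integrable M (\<lambda>z. w z + w z * b z powr q)" using w i by simp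
    have "b z <= 1 + b z powr q" for z
    proof (cases "b z <= 1")
     case False
     then have "b z powr 1 <= b z powr q" using q by (intro powr_mono) auto
     then show ?thesis using False by simp
    qed (simp add: add_increasing2)
    then have "w z * b z <= w z * (1 + b z powr q)" for z using w(2) by (intro mult_left_mono)
    then show "AE z in M. norm (w z * b z) <= norm (w z + w z * b z powr q)"
     using w(2) b0 by (auto simp: distrib_left intro!: AE_I2)
   qed measurable
   define m where "m = (LINT z|M. w z * b z) / a"
   have m0: "0 <= m" unfolding m_def using a w b0 by (intro divide_nonneg_pos Bochner_Integration.integral_nonneg) auto
   have nF: "norm (LINT z|M. F z) <= a * m"
    using norm_integral_le[OF iwb _ F] le a by (simp add: m_def)
   \<comment> \<open>The supporting line of the power at the weighted mean \<open>m\<close> is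
     integrated against \<open>w\<close>; its linear term vanishes by the choice of
     \<open>m\<close>.\<close>
   have key: "a * m powr q <= (LINT z|M. w z * b z powr q)"
   proof (cases "m = 0")
    case True
    then show ?thesis using q w by (auto intro!: Bochner_Integration.integral_nonneg)
   next
    case False
    then have m: "0 < m" using m0 by simp
    have "a * m powr q = (LINT z|M. w z * m powr q + q * m powr (q - 1) * (w z * b z - m * w z))"
     using w(1) iwb a by (simp add: m_def a_def)
    also have "... <= (LINT z|M. w z * b z powr q)"
    proof (rule integral_mono)
     show "integrable M (\<lambda>z. w z * m powr q + q * m powr (q - 1) * (w z * b z - m * w z))"
      using w(1) iwb by simp
     fix z
     have "w z * (m powr q + q * m powr (q - 1) * (b z - m)) <= w z * b z powr q"
      by (intro mult_left_mono powr_tangent b0 m q w(2))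
     then show "w z * m powr q + q * m powr (q - 1) * (w z * b z - m * w z) <= w z * b z powr q"
      by (simp add: algebra_simps)
    qed (rule i)
    finally show ?thesis .
   qed
   have "norm (LINT z|M. F z) powr q <= (a * m) powr q"
    using nF q by (intro powr_mono2) auto
   also have "... = a powr (q - 1) * (a * m powr q)" using a m0 by (simp add: powr_mult powr_diff)
   also have "... <= W powr (q - 1) * (LINT z|M. w z * b z powr q)"
    using key a W q by (intro mult_mono powr_mono2) auto
   finally show ?thesis unfolding J
    by (subst ennreal_mult[symmetric]) (auto intro!: Bochner_Integration.integral_nonneg ennreal_leI simp: w)
  qed
 qed
qed

section \<open>Simultaneous bounds in L^q and in the supremum norm\<close>

definition Lq :: "real => real => (real => complex) => bool" where
 "Lq q A a \<longleftrightarrow> a \<in> borel_measurable borel \<and> 0 <= A \<and> (NN x. ennreal (norm (a x) powr q)) <= ennreal (A powr q)"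

text \<open>L^q intersected with L^\<infinity>, with one constant for both. Convolution with a
  bounded integrable kernel produces such functions from L^q, and the class is contained in its
  analogue for every larger exponent.\<close>

definition Bd :: "real => real => (real => complex) => bool" where
 "Bd q A a \<longleftrightarrow> Lq q A a \<and> (\<forall>x. norm (a x) <= A)"

lemma Bd_measurable: "Bd q A a ==> a \<in> borel_measurable borel"
 and Bd_nonneg: "Bd q A a ==> 0 <= A"
 and Bd_le: "Bd q A a ==> norm (a x) <= A"
 and Bd_Lq: "Bd q A a ==> Lq q A a"
 by (simp_all add: Bd_def Lq_def)

lemma Bd_nn: "Bd q A a ==> (NN x. ennreal (norm (a x) powr q)) <= ennreal (A powr q)"
 by (simp add: Bd_def Lq_def)

lemma Bd_tame: "Bd q A a ==> tame a"
 by (rule bounded_tame[OF Bd_measurable Bd_le])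

lemma Lq_tame:
 assumes "Lq q A a" "1 <= q" shows "tame a"
proof -
 have [measurable]: "a \<in> borel_measurable borel" using assms by (simp add: Lq_def)
 have "integrable lborel (\<lambda>x. norm (a x) powr q)"
  by (rule integrableI_nonneg) (use assms in \<open>auto simp: Lq_def intro: le_less_trans\<close>)
 moreover have "norm (a x) <= 1 + norm (a x) powr q" for x
 proof (cases "norm (a x) <= 1")
  case False
  then have "norm (a x) powr 1 <= norm (a x) powr q" using assms(2) by (intro powr_mono) auto
  then show ?thesis using False by simp
 qed (simp add: add_increasing2)
 ultimately show ?thesis unfolding tame_def by (auto intro!: exI[of _ 1] exI[of _ "\<lambda>x. norm (a x) powr q"])
qed

text \<open>Minkowski's integral inequality over an arbitrary \<sigma>-finite parameter space.
  Finite and infinite sums, convolutions and time integrals are all instances of it.\<close>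

lemma Bd_integral:
 fixes H :: "'z => real => complex"
 assumes M: "sigma_finite_measure M" and q: "1 <= q"
  and H[measurable]: "(\<lambda>(z, x). H z x) \<in> borel_measurable (M \<Otimes>\<^sub>M lborel)"
  and A: "integrable M A" and B: "\<And>z. Bd q (A z) (H z)"
  and I: "(LINT z|M. A z) <= I"
 shows "Bd q I (\<lambda>x. LINT z|M. H z x)"
proof -
 interpret pair_sigma_finite M "lborel :: real measure" using M sigma_finite_lborel' by (simp add: pair_sigma_finite_def)
 have [measurable]: "A \<in> borel_measurable M" using A by auto
 have A0: "0 <= A z" for z by (rule Bd_nonneg[OF B])
 have H1[measurable]: "(\<lambda>z. H z x) \<in> borel_measurable M" for x
  using measurable_compose[OF measurable_Pair[OF measurable_ident_sets[OF refl] measurable_const[of x]] H] by simp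
 have [measurable]: "(\<lambda>x. LINT z|M. H z x) \<in> borel_measurable lborel"
 proof -
  have "(\<lambda>(x, z). H z x) \<in> borel_measurable (lborel \<Otimes>\<^sub>M M)" using measurable_pair_swap[OF H] by simp
  then show ?thesis by (rule sigma_finite_measure.borel_measurable_lebesgue_integral[OF M])
 qed
 have "0 <= (LINT z|M. A z)" by (rule Bochner_Integration.integral_nonneg) (rule A0)
 then have I0: "0 <= I" using I by (rule order_trans)
 have sup: "norm (LINT z|M. H z x) <= I" for x
  using norm_integral_le[OF A AE_I2[OF Bd_le[OF B]] H1] I order_trans by blast
 \<comment> \<open>The integrand normalized by its own bound, so that \<open>A\<close> serves as the
   Jensen weight. Where \<open>A z\<close> is zero the quotient is zero by convention, and
   \<open>H z\<close> vanishes by the supremum bound.\<close>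
 let ?b = "\<lambda>z x. norm (H z x) / A z"
 have "(NN x. ennreal (norm (LINT z|M. H z x) powr q))
  <= (NN x. ennreal (I powr (q - 1)) * (\<integral>\<^sup>+z. ennreal (A z * ?b z x powr q) \<partial>M))"
 proof (rule nn_integral_mono)
  fix x
  show "ennreal (norm (LINT z|M. H z x) powr q) <= ennreal (I powr (q - 1)) * (\<integral>\<^sup>+z. ennreal (A z * ?b z x powr q) \<partial>M)"
  proof (rule jensen_norm[OF q A A0 I])
   show "norm (H z x) <= A z * (norm (H z x) / A z)" for z
    using Bd_le[OF B, of z x] A0[of z] by (cases "A z = 0") auto
  qed (use A0 in auto)
 qed
 also have "... = ennreal (I powr (q - 1)) * (NN x. (\<integral>\<^sup>+z. ennreal (A z * ?b z x powr q) \<partial>M))"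
  by (rule nn_integral_cmult) measurable
 also have "(NN x. (\<integral>\<^sup>+z. ennreal (A z * ?b z x powr q) \<partial>M)) = (\<integral>\<^sup>+z. (NN x. ennreal (A z * ?b z x powr q)) \<partial>M)"
  by (rule Fubini') measurable
 also have "... <= (\<integral>\<^sup>+z. ennreal (A z) \<partial>M)"
 proof (rule nn_integral_mono)
  fix z assume z: "z \<in> space M"
  have [measurable]: "H z \<in> borel_measurable borel" by (rule Bd_measurable[OF B])
  show "(NN x. ennreal (A z * ?b z x powr q)) <= ennreal (A z)"
  proof (cases "A z = 0")
   case False
   then have Az: "0 < A z" using A0[of z] by simp
   have "(NN x. ennreal (A z * ?b z x powr q)) = (NN x. ennreal (A z / A z powr q) * ennreal (norm (H z x) powr q))"
    using Az by (intro nn_integral_cong) (simp add: ennreal_mult[symmetric] powr_divide)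
   also have "... = ennreal (A z / A z powr q) * (NN x. ennreal (norm (H z x) powr q))"
    by (rule nn_integral_cmult) measurable
   also have "... <= ennreal (A z / A z powr q) * ennreal (A z powr q)"
    by (intro mult_left_mono Bd_nn[OF B]) auto
   also have "... = ennreal (A z)" using Az by (simp add: ennreal_mult[symmetric])
   finally show ?thesis .
  qed simp
 qed
 also have "(\<integral>\<^sup>+z. ennreal (A z) \<partial>M) = ennreal (LINT z|M. A z)"
  by (rule nn_integral_eq_integral[OF A]) (use A0 in auto)
 finally have "(NN x. ennreal (norm (LINT z|M. H z x) powr q)) <= ennreal (I powr (q - 1)) * ennreal (LINT z|M. A z)"
  by (simp add: mult_left_mono)
 also have "... <= ennreal (I powr (q - 1)) * ennreal I" by (intro mult_left_mono ennreal_leI I) auto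
 also have "... = ennreal (I powr q)" using I0 q
  by (cases "I = 0") (auto simp: ennreal_mult[symmetric] powr_diff)
 finally show ?thesis unfolding Bd_def Lq_def using sup I0 by simp
qed

text \<open>Hoelder's inequality with slack: the target exponent may exceed the Hoelder exponent
  because the factors are bounded as well.\<close>

lemma Bd_mult:
 assumes a: "Bd q1 A a" and b: "Bd q2 B b" and q: "0 < q" "0 < q1" "0 < q2" "1 / q <= 1 / q1 + 1 / q2"
 shows "Bd q (A * B) (\<lambda>x. a x * b x)"
proof -
 note [measurable] = Bd_measurable[OF a] Bd_measurable[OF b]
 have A0: "0 <= A" "0 <= B" using a b Bd_nonneg by auto
 have le: "norm (a x * b x) <= A * B" for x
  unfolding norm_mult by (intro mult_mono Bd_le[OF a] Bd_le[OF b] A0) auto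
 have "(NN x. ennreal (norm (a x * b x) powr q)) <= ennreal ((A * B) powr q)"
 proof (cases "A = 0 \<or> B = 0")
  case True
  then have "A * B = 0" by auto
  then have "a x * b x = 0" for x using le[of x] unfolding \<open>A * B = 0\<close> norm_le_zero_iff by blast
  then have z: "norm (a x * b x) powr q = 0" for x by (metis norm_zero powr_eq_0_iff)
  have e: "(NN x. ennreal (norm (a x * b x) powr q)) = (\<integral>\<^sup>+x. 0 \<partial>(lborel :: real measure))"
   by (rule nn_integral_cong) (simp only: z ennreal_0)
  show ?thesis unfolding e by simp
 next
  case False
  then have AB: "0 < A" "0 < B" using A0 by auto
  \<comment> \<open>The exact Hoelder exponent, at most q. The normalized product lies between 0 and
    1, so its power q is at most its power Q, to which Young's inequality applies pointwise.\<close>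
  define Q where "Q = 1 / (1 / q1 + 1 / q2)"
  have s: "0 < 1 / q1 + 1 / q2" using q by (simp add: add_pos_pos)
  have Q: "0 < Q" "Q <= q" "1 / Q = 1 / q1 + 1 / q2"
   using s q(1) q(4) by (auto simp: Q_def divide_simps mult.commute)
  have t: "Q / q1 + Q / q2 = 1" using Q(1,3) by (simp add: field_simps)
  have t1: "Q < q1" "Q < q2"
  proof -
   have "0 < Q / q2" "0 < Q / q1" using Q(1) q by auto
   then have "Q / q1 < 1" "Q / q2 < 1" using t by linarith+
   then show "Q < q1" "Q < q2" using q by (auto simp: divide_less_eq)
  qed
  have pw: "norm (a x * b x) powr q <= (A * B) powr q * (Q / q1 * (norm (a x) powr q1 / A powr q1) + Q / q2 * (norm (b x) powr q2 / B powr q2))" for x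
  proof -
   define u where "u = norm (a x) / A"
   define v where "v = norm (b x) / B"
   have u: "0 <= u" "u <= 1" "0 <= v" "v <= 1"
    using AB Bd_le[OF a, of x] Bd_le[OF b, of x] by (auto simp: u_def v_def divide_le_eq)
   have "(u * v) powr q <= (u * v) powr Q"
    using u Q by (cases "u * v = 0") (auto intro!: powr_mono' mult_le_one)
   also have "... = u powr Q * v powr Q" using u by (simp add: powr_mult)
   also have "... <= (u powr Q) powr (q1 / Q) / (q1 / Q) + (v powr Q) powr (q2 / Q) / (q2 / Q)"
    by (rule Youngs_inequality) (use Q t t1 in \<open>auto simp: divide_simps\<close>)
   also have "... = Q / q1 * u powr q1 + Q / q2 * v powr q2" using Q by (simp add: powr_powr mult.commute)
   finally have "(A * B) powr q * (u * v) powr q <= (A * B) powr q * (Q / q1 * u powr q1 + Q / q2 * v powr q2)"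
    by (intro mult_left_mono) auto
   moreover have "norm (a x * b x) powr q = (A * B) powr q * (u * v) powr q"
   proof -
    have "norm (a x * b x) = (A * B) * (u * v)" using AB by (simp add: u_def v_def norm_mult)
    then show ?thesis using u AB by (simp only: powr_mult)
   qed
   moreover have "u powr q1 = norm (a x) powr q1 / A powr q1" "v powr q2 = norm (b x) powr q2 / B powr q2"
    using AB by (auto simp: u_def v_def powr_divide)
   ultimately show ?thesis by simp
  qed
  define \<alpha> where "\<alpha> = (A * B) powr q * (Q / q1) / A powr q1"
  define beta where "beta = (A * B) powr q * (Q / q2) / B powr q2"
  have \<alpha>beta: "0 <= \<alpha>" "0 <= beta" using Q q by (auto simp: \<alpha>_def beta_def)
  have "(NN x. ennreal (norm (a x * b x) powr q))
   <= (NN x. ennreal \<alpha> * ennreal (norm (a x) powr q1) + ennreal beta * ennreal (norm (b x) powr q2))"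
  proof (rule nn_integral_mono)
   fix x
   have "ennreal (norm (a x * b x) powr q) <= ennreal (\<alpha> * norm (a x) powr q1 + beta * norm (b x) powr q2)"
    using pw[of x] by (intro ennreal_leI) (simp add: \<alpha>_def beta_def algebra_simps)
   also have "... = ennreal \<alpha> * ennreal (norm (a x) powr q1) + ennreal beta * ennreal (norm (b x) powr q2)"
    using \<alpha>beta by (simp add: ennreal_mult)
   finally show "ennreal (norm (a x * b x) powr q) <= ennreal \<alpha> * ennreal (norm (a x) powr q1) + ennreal beta * ennreal (norm (b x) powr q2)" .
  qed
  also have "... = ennreal \<alpha> * (NN x. ennreal (norm (a x) powr q1)) + ennreal beta * (NN x. ennreal (norm (b x) powr q2))"
   by (simp add: nn_integral_add nn_integral_cmult)
  also have "... <= ennreal \<alpha> * ennreal (A powr q1) + ennreal beta * ennreal (B powr q2)"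
   by (intro add_mono mult_left_mono Bd_nn[OF a] Bd_nn[OF b]) auto
  also have "... = ennreal (\<alpha> * A powr q1 + beta * B powr q2)"
   using \<alpha>beta by (simp add: ennreal_mult)
  also have "\<alpha> * A powr q1 + beta * B powr q2 = (A * B) powr q * (Q / q1) + (A * B) powr q * (Q / q2)"
   using AB by (simp add: \<alpha>_def beta_def)
  also have "(A * B) powr q * (Q / q1) + (A * B) powr q * (Q / q2) = (A * B) powr q" using t by (metis distrib_left mult.right_neutral)
  finally show ?thesis .
 qed
 then show ?thesis unfolding Bd_def Lq_def using le A0 by auto
qed

lemma Bd_cnj: "Bd q A a ==> Bd q A (\<lambda>x. cnj (a x))"
 unfolding Bd_def Lq_def by (auto intro: borel_measurable_cnj)

lemma Bd_unimodular_mult: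
 assumes "Bd q A a" "norm c <= 1" "0 <= q" shows "Bd q A (\<lambda>x. c * a x)"
proof -
 note [measurable] = Bd_measurable[OF assms(1)]
 have le: "norm (c * a x) <= norm (a x)" for x
  unfolding norm_mult using assms(2) by (simp add: mult_left_le_one_le)
 have "(NN x. ennreal (norm (c * a x) powr q)) <= (NN x. ennreal (norm (a x) powr q))"
  using le assms(3) by (intro nn_integral_mono ennreal_leI powr_mono2) auto
 then show ?thesis unfolding Bd_def Lq_def
  using assms(1) le order_trans[OF le Bd_le[OF assms(1)]] order_trans[OF _ Bd_nn[OF assms(1)]] Bd_nonneg[OF assms(1)] by auto
qed

lemma Bd_zero: "0 <= A ==> 0 < q ==> Bd q A (\<lambda>x. 0)"
 by (simp add: Bd_def Lq_def)

text \<open>The two-term case of Minkowski's inequality, obtained as an integral over the two truth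
  values.\<close>

lemma Bd_add:
 assumes a: "Bd q A a" and b: "Bd q B b" and q: "1 <= q" shows "Bd q (A + B) (\<lambda>x. a x + b x)"
proof -
 have [measurable]: "a \<in> borel_measurable borel" "b \<in> borel_measurable borel" using a b Bd_measurable by auto
 have e: "(LC z. f (z::bool)) = f True + f False" for f :: "bool => 'c::{banach,second_countable_topology}"
  by (subst lebesgue_integral_count_space_finite) (auto simp: UNIV_bool)
 have "Bd q (A + B) (\<lambda>x. LC z. (if z then a else b) x)"
 proof (rule Bd_integral[where A = "\<lambda>z. if z then A else B"])
  show "sigma_finite_measure (count_space (UNIV :: bool set))" by (rule sigma_finite_measure_count_space)
  show "(\<lambda>(z, x). (if z then a else b) x) \<in> borel_measurable (count_space UNIV \<Otimes>\<^sub>M lborel)"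
   by (rule measurable_pair_measure_countable1) auto
  show "integrable (count_space UNIV) (\<lambda>z. if z then A else B)" by (rule integrable_count_space) simp
 qed (use a b q in \<open>auto simp: e\<close>)
 then show ?thesis by (simp add: e)
qed

lemma conv_commute: "conv K a x = (LBINT z. K z * a (x - z))"
 unfolding conv_def
 by (subst lborel_integral_real_affine[of "-1" _ x]) simp_all

text \<open>Young's inequality: the convolution is a superposition of translates of
  \<open>a\<close>, each of the same size, with total weight at most C pi.\<close>

lemma Bd_conv:
 assumes K: "sdecay C K" and a: "Bd q A a" and q: "1 <= q"
 shows "Bd q (C * pi * A) (conv K a)"
proof -
 note [measurable] = sdecay_measurable[OF K] Bd_measurable[OF a]
 have shift: "Bd q A (\<lambda>x. a (x - z))" for z
 proof -
  have "(NN x. ennreal (norm (a (x - z)) powr q)) = ennreal \<bar>1\<bar> * (NN x. ennreal (norm (a ((z + 1 * x) - z)) powr q))"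
   by (rule nn_integral_real_affine[where f = "\<lambda>x. ennreal (norm (a (x - z)) powr q)"]) auto
  then show ?thesis using a unfolding Bd_def Lq_def by simp
 qed
 have "Bd q (C * pi * A) (\<lambda>x. LBINT z. K z * a (x - z))"
 proof (rule Bd_integral[OF sigma_finite_lborel' q, where A = "\<lambda>z. norm (K z) * A"])
  show "integrable lborel (\<lambda>z. norm (K z) * A)" using sdecay_integrable_norm(1)[OF K] by simp
  show "(LBINT z. norm (K z) * A) <= C * pi * A"
   using sdecay_integrable_norm(2)[OF K] Bd_nonneg[OF a] by (simp add: mult_right_mono)
  show "Bd q (norm (K z) * A) (\<lambda>x. K z * a (x - z))" for z
  proof (cases "K z = 0")
   case True
   then show ?thesis using q by (simp add: Bd_zero)
  next
   case False
   have "(NN x. ennreal (norm (K z * a (x - z)) powr q)) = (NN x. ennreal (norm (K z) powr q) * ennreal (norm (a (x - z)) powr q))"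
    by (simp add: norm_mult powr_mult ennreal_mult)
   also have "... = ennreal (norm (K z) powr q) * (NN x. ennreal (norm (a (x - z)) powr q))"
    by (rule nn_integral_cmult) measurable
   also have "... <= ennreal (norm (K z) powr q) * ennreal (A powr q)" by (intro mult_left_mono Bd_nn[OF shift]) auto
   also have "... = ennreal ((norm (K z) * A) powr q)" using Bd_nonneg[OF a] by (simp add: powr_mult ennreal_mult)
   finally show ?thesis unfolding Bd_def Lq_def
    using Bd_nonneg[OF a] Bd_le[OF a] by (auto simp: norm_mult intro!: mult_left_mono)
  qed
 qed measurable
 then show ?thesis by (simp add: conv_commute[abs_def])
qed

text \<open>Bernstein's inequality. Jensen's inequality with weight |K| gives the L^q bound after
  integration in x, and the supremum bound from |K| <= C. This is where L^q data enter the class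
  \<open>Bd\<close>.\<close>

lemma Bd_conv_Lq:
 assumes K: "sdecay C K" and a: "Lq q A a" and q: "1 <= q"
 shows "Bd q (C * pi * A) (conv K a)"
proof -
 have [measurable]: "a \<in> borel_measurable borel" using a by (simp add: Lq_def)
 note [measurable] = sdecay_measurable[OF K]
 note [measurable] = conv_measurable[OF sdecay_measurable[OF K], of a]
 have C0: "0 <= C" and A0: "0 <= A" using sdecay_nonneg[OF K] a by (auto simp: Lq_def)
 have wi: "integrable lborel (\<lambda>y. norm (K (x - y)))" "(LBINT y. norm (K (x - y))) <= C * pi" for x
 proof -
  have "integrable lborel (\<lambda>y. norm (K (x + (-1) * y)))"
   using sdecay_integrable_norm(1)[OF K] lborel_integrable_real_affine_iff[of "-1" "\<lambda>z. norm (K z)" x] by simp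
  then show "integrable lborel (\<lambda>y. norm (K (x - y)))" by simp
  show "(LBINT y. norm (K (x - y))) <= C * pi"
   using sdecay_integrable_norm(2)[OF K] lborel_integral_real_affine[of "-1" "\<lambda>z. norm (K z)" x] by simp
 qed
 have J: "ennreal (norm (conv K a x) powr q) <= ennreal ((C * pi) powr (q - 1)) * (NN y. ennreal (norm (K (x - y)) * norm (a y) powr q))" for x
  unfolding conv_def
  by (rule jensen_norm[OF q wi(1) _ wi(2)]) (auto simp: norm_mult)
 have e: "(C * pi * A) powr q = (C * pi) powr (q - 1) * (C * pi * A powr q)"
  using C0 A0 q by (cases "C = 0") (auto simp: powr_mult powr_diff)
 have nn: "(NN x. ennreal (norm (a x) powr q)) <= ennreal (A powr q)" using a by (simp add: Lq_def)
 have sup: "norm (conv K a x) <= C * pi * A" for x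
 proof -
  have "(NN y. ennreal (norm (K (x - y)) * norm (a y) powr q)) <= (NN y. ennreal C * ennreal (norm (a y) powr q))"
   unfolding ennreal_mult[OF C0 powr_ge_zero, symmetric]
   by (intro nn_integral_mono ennreal_leI mult_right_mono sdecay_le[OF K]) auto
  also have "... = ennreal C * (NN y. ennreal (norm (a y) powr q))" by (rule nn_integral_cmult) measurable
  also have "... <= ennreal C * ennreal (A powr q)" by (intro mult_left_mono nn) auto
  \<comment> \<open>The factor pi is inserted here so that the supremum bound has the same constant
    as the L^q bound.\<close>
  also have "... <= ennreal (C * pi * A powr q)"
   using C0 pi_gt3 by (subst ennreal_mult[symmetric]) (auto intro!: ennreal_leI mult_right_mono simp: mult_le_cancel_left1)
  finally have "ennreal (norm (conv K a x) powr q) <= ennreal ((C * pi) powr (q - 1)) * ennreal (C * pi * A powr q)"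
   using J[of x] by (meson mult_left_mono order_trans zero_le)
  also have "... = ennreal ((C * pi * A) powr q)" unfolding e using C0 by (simp add: ennreal_mult)
  finally have "norm (conv K a x) powr q <= (C * pi * A) powr q" by simp
  then show ?thesis using q C0 A0 powr_less_mono2[of q "C * pi * A" "norm (conv K a x)"] by (auto simp: not_le[symmetric])
 qed
 have "(NN x. ennreal (norm (conv K a x) powr q))
  <= (NN x. ennreal ((C * pi) powr (q - 1)) * (NN y. ennreal (norm (K (x - y)) * norm (a y) powr q)))"
  by (intro nn_integral_mono J)
 also have "... = ennreal ((C * pi) powr (q - 1)) * (NN x. (NN y. ennreal (norm (K (x - y)) * norm (a y) powr q)))"
  by (rule nn_integral_cmult) measurable
 also have "(NN x. (NN y. ennreal (norm (K (x - y)) * norm (a y) powr q)))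
   = (NN y. (NN x. ennreal (norm (K (x - y)) * norm (a y) powr q)))"
  by (rule lborel_pair.Fubini') measurable
 also have "... <= (NN y. ennreal (C * pi) * ennreal (norm (a y) powr q))"
 proof (rule nn_integral_mono)
  fix y
  have "(NN x. ennreal (norm (K (x - y)) * norm (a y) powr q)) = (NN x. ennreal (norm (K (x - y))) * ennreal (norm (a y) powr q))"
   by (simp add: ennreal_mult)
  also have "... = (NN x. ennreal (norm (K (x - y)))) * ennreal (norm (a y) powr q)"
   by (rule nn_integral_multc) measurable
  also have "(NN x. ennreal (norm (K (x - y)))) = ennreal \<bar>1\<bar> * (NN x. ennreal (norm (K ((y + 1 * x) - y))))"
   by (rule nn_integral_real_affine[where f = "\<lambda>x. ennreal (norm (K (x - y)))"]) auto
  also have "... = ennreal (LBINT x. norm (K x))"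
   using nn_integral_eq_integral[OF sdecay_integrable_norm(1)[OF K]] by simp
  also have "ennreal (LBINT x. norm (K x)) * ennreal (norm (a y) powr q) <= ennreal (C * pi) * ennreal (norm (a y) powr q)"
   by (intro mult_right_mono ennreal_leI sdecay_integrable_norm(2)[OF K]) auto
  finally show "(NN x. ennreal (norm (K (x - y)) * norm (a y) powr q)) <= ennreal (C * pi) * ennreal (norm (a y) powr q)" .
 qed
 also have "... = ennreal (C * pi) * (NN y. ennreal (norm (a y) powr q))" by (rule nn_integral_cmult) measurable
 also have "... <= ennreal (C * pi) * ennreal (A powr q)" by (intro mult_left_mono nn) auto
 finally have "(NN x. ennreal (norm (conv K a x) powr q)) <= ennreal ((C * pi) powr (q - 1)) * (ennreal (C * pi) * ennreal (A powr q))"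
  by (simp add: mult_left_mono)
 also have "... = ennreal ((C * pi * A) powr q)" unfolding e using C0 by (simp add: ennreal_mult)
 finally show ?thesis unfolding Bd_def Lq_def using sup C0 A0 conv_measurable[OF sdecay_measurable[OF K], of a] by auto
qed

section \<open>Summable families of wave packets\<close>

lemma count_integral_measurable:
 fixes f :: "'k::countable => 'a => complex"
 assumes "\<And>k. f k \<in> borel_measurable N"
 shows "(\<lambda>x. LC k. f k x) \<in> borel_measurable N"
proof -
 have "(\<lambda>(k, x). f k x) \<in> borel_measurable (count_space UNIV \<Otimes>\<^sub>M N)"
  by (rule measurable_pair_measure_countable1) (use assms in auto)
 from measurable_pair_swap[OF this]
 have "(\<lambda>(x, k). f k x) \<in> borel_measurable (N \<Otimes>\<^sub>M count_space UNIV)" by simp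
 then show ?thesis
  by (rule sigma_finite_measure.borel_measurable_lebesgue_integral[OF sigma_finite_measure_count_space])
qed

lemma count_pair_measurable:
 fixes f :: "'k::countable => 'a => complex"
 assumes "\<And>k. f k \<in> borel_measurable N"
 shows "(\<lambda>(k, x). f k x) \<in> borel_measurable (count_space UNIV \<Otimes>\<^sub>M N)"
 by (rule measurable_pair_measure_countable1) (use assms in auto)

lemma nonneg_count_integrable:
 fixes A :: "'k => real"
 assumes "\<And>k. 0 <= A k" "(NC k. ennreal (A k)) <= ennreal S" "0 <= S"
 shows "integrable (count_space UNIV) A" "(LC k. A k) <= S"
proof -
 show i: "integrable (count_space UNIV) A"
  by (rule integrableI_nonneg) (use assms in \<open>auto intro: le_less_trans\<close>)
 have "ennreal (LC k. A k) <= ennreal S"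
  using assms(2) nn_integral_eq_integral[OF i] assms(1) by simp
 then show "(LC k. A k) <= S" using assms(3) by simp
qed

definition measf :: "('k => real => real => complex) => bool" where
 "measf c \<longleftrightarrow> (\<forall>k. (\<lambda>(t, x). c k t x) \<in> borel_measurable (borel \<Otimes>\<^sub>M borel))"

lemma measfD:
 assumes "measf c" and [measurable]: "f \<in> borel_measurable M" "g \<in> borel_measurable M"
 shows "(\<lambda>z. c k (f z) (g z)) \<in> borel_measurable M"
proof -
 have [measurable]: "(\<lambda>(t, x). c k t x) \<in> borel_measurable (borel \<Otimes>\<^sub>M borel)" using assms(1) by (simp add: measf_def)
 have "(\<lambda>z. (\<lambda>(t, x). c k t x) (f z, g z)) \<in> borel_measurable M" by measurable
 then show ?thesis by simp
qed

lemma measfI: "(\<And>k. (\<lambda>p. c k (fst p) (snd p)) \<in> borel_measurable (borel \<Otimes>\<^sub>M borel)) ==> measf c"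
 by (simp add: measf_def case_prod_beta')

text \<open>The norm of families summable in frequency, uniform in time on [-1,1], with values in
  L^q and L^\<infinity> at once. The supremum over time stands inside the sum over frequencies, so
  one majorant \<open>A\<close> serves all times.\<close>

definition fam :: "real => real => ('k => real => real => complex) => bool" where
 "fam q S c \<longleftrightarrow> measf c \<and> 0 <= S \<and> (\<exists>A. (\<forall>k. \<forall>t\<in>{-1..1}. Bd q (A k) (c k t)) \<and>
   (NC k. ennreal (A k)) <= ennreal S)"

lemma fam_measf: "fam q S c ==> measf c"
 and fam_nonneg: "fam q S c ==> 0 <= S"
 by (simp_all add: fam_def)

lemma famE:
 assumes "fam q S c"
 obtains A where "\<And>k t. t \<in> {-1..1} ==> Bd q (A k) (c k t)" "\<And>k. 0 <= A k"
  "(NC k. ennreal (A k)) <= ennreal S" "integrable (count_space UNIV) A"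
  "(LC k. A k) <= S"
proof -
 obtain A where A: "\<And>k t. t \<in> {-1..1} ==> Bd q (A k) (c k t)" "(NC k. ennreal (A k)) <= ennreal S"
  using assms unfolding fam_def by blast
 have A0: "0 <= A k" for k by (rule Bd_nonneg[OF A(1)[of 0]]) simp
 show thesis by (rule that[OF A(1) A0 A(2) nonneg_count_integrable[OF A0 A(2) fam_nonneg[OF assms]]])
qed

lemma fam_mono: "fam q S c ==> S <= S' ==> fam q S' c"
 unfolding fam_def by (meson ennreal_leI order_trans)

lemma fam_zero: "0 < q ==> fam q 0 (\<lambda>k t x. 0)"
 unfolding fam_def measf_def by (auto intro!: exI[of _ "\<lambda>_. 0"] Bd_zero)

lemma fam_add:
 assumes c: "fam q S c" and d: "fam q S' d" and q: "1 <= q"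
 shows "fam q (S + S') (\<lambda>k t x. c k t x + d k t x)"
proof -
 obtain A where A: "\<And>k t. t \<in> {-1..1} ==> Bd q (A k) (c k t)" "\<And>k. 0 <= A k" "(NC k. ennreal (A k)) <= ennreal S"
  using famE[OF c] by metis
 obtain B where B: "\<And>k t. t \<in> {-1..1} ==> Bd q (B k) (d k t)" "\<And>k. 0 <= B k" "(NC k. ennreal (B k)) <= ennreal S'"
  using famE[OF d] by metis
 have "(NC k. ennreal (A k + B k)) = (NC k. ennreal (A k)) + (NC k. ennreal (B k))"
  using A(2) B(2) by (simp add: nn_integral_add)
 also have "... <= ennreal (S + S')"
  using add_mono[OF A(3) B(3)] fam_nonneg[OF c] fam_nonneg[OF d] by simp
 finally have s: "(NC k. ennreal (A k + B k)) <= ennreal (S + S')" .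
 have "measf (\<lambda>k t x. c k t x + d k t x)"
  by (rule measfI) (intro borel_measurable_add measfD[OF fam_measf[OF c]] measfD[OF fam_measf[OF d]]; measurable)
 then show ?thesis
  unfolding fam_def using s A(1) B(1) Bd_add[OF _ _ q] fam_nonneg[OF c] fam_nonneg[OF d]
  by (intro conjI exI[of _ "\<lambda>k. A k + B k"]) auto
qed

lemma fam_uminus: "fam q S c ==> 0 <= q ==> fam q S (\<lambda>k t x. - c k t x)"
proof -
 assume c: "fam q S c" and q: "0 <= q"
 obtain A where A: "\<And>k t. t \<in> {-1..1} ==> Bd q (A k) (c k t)" "(NC k. ennreal (A k)) <= ennreal S"
  using famE[OF c] by metis
 have "measf (\<lambda>k t x. - c k t x)"
  by (rule measfI) (intro borel_measurable_uminus measfD[OF fam_measf[OF c]]; measurable)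
 moreover have "Bd q (A k) (\<lambda>x. - c k t x)" if "t \<in> {-1..1}" for k t
  using Bd_unimodular_mult[OF A(1)[OF that], of "-1" k] q by simp
 ultimately show ?thesis unfolding fam_def using A(2) fam_nonneg[OF c] by blast
qed

lemma fam_diff: "fam q S c ==> fam q S' d ==> 1 <= q ==> fam q (S + S') (\<lambda>k t x. c k t x - d k t x)"
 using fam_add[OF _ fam_uminus, of q S c S' d] by simp

section \<open>The oriented time integral\<close>

definition sg :: "real => real => complex" where
 "sg t s = (if 0 < s \<and> s < t then 1 else if t < s \<and> s < 0 then -1 else 0)"

text \<open>The signed indicator \<open>sg\<close> writes the oriented integral as one over the
  whole line, so positive and negative times share all estimates and Fubini applies
  directly.\<close>

lemma interval_integral_sg: "(LBINT s=ereal 0..ereal t. g s) = (LBINT s. sg t s * (g s :: complex))"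
proof (cases "0 <= t")
 case True
 have "(LBINT s=ereal 0..ereal t. g s) = (LBINT s. indicator {0<..<t} s *\<^sub>R g s)"
  using True by (simp add: interval_lebesgue_integral_def set_lebesgue_integral_def einterval_eq)
 also have "... = (LBINT s. sg t s * g s)"
  using True by (intro LBINT_cong refl) (auto simp: sg_def indicator_def)
 finally show ?thesis .
next
 case False
 have "(LBINT s=ereal 0..ereal t. g s) = - (LBINT s. indicator {t<..<0} s *\<^sub>R g s)"
  using False by (simp add: interval_lebesgue_integral_def set_lebesgue_integral_def einterval_eq)
 also have "... = (LBINT s. - (indicator {t<..<0} s *\<^sub>R g s))" by simp
 also have "... = (LBINT s. sg t s * g s)"
  using False by (intro LBINT_cong refl) (auto simp: sg_def indicator_def)
 finally show ?thesis .
qed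

lemma sg_measurable [measurable (raw)]:
 assumes [measurable]: "f \<in> borel_measurable M" "g \<in> borel_measurable M"
 shows "(\<lambda>z. sg (f z) (g z)) \<in> borel_measurable M"
 unfolding sg_def by measurable

text \<open>On the support of \<open>sg t\<close> both the running time and the propagation time
  remain in [-1,1], the range in which the kernel bounds hold.\<close>

lemma sg_range: "sg t s \<noteq> 0 ==> t \<in> {-1..1} ==> s \<in> {-1..1} \<and> t - s \<in> {-1..1}"
 by (auto simp: sg_def split: if_splits)

lemma norm_sg_le: "norm (sg t s) <= 1"
 by (simp add: sg_def)

context freq_window
begin

text \<open>One kernel bound for both windows, fixed by choice so that it can occur in the
  definitions of later constants. It exists by \<open>ker_bound\<close>.\<close>

definition K\<^sub>0 :: real where
 "K\<^sub>0 = (SOME C. 0 <= C \<and> (\<forall>k. \<forall>ta\<in>{-1..1}. sdecay C (ker \<sigma> k ta) \<and> sdecay C (ker ta\<sigma> k ta)))"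

lemma sdecay_mono: "sdecay C K ==> C <= C' ==> sdecay C' K"
 unfolding sdecay_def decay_def by (meson cauchy_nonneg mult_right_mono order_trans)

lemma K\<^sub>0: "0 <= K\<^sub>0" "ta \<in> {-1..1} ==> sdecay K\<^sub>0 (ker \<sigma> k ta)" "ta \<in> {-1..1} ==> sdecay K\<^sub>0 (ker ta\<sigma> k ta)"
proof -
 obtain C1 where C1: "0 <= C1" "\<And>k ta. ta \<in> {-1..1} ==> sdecay C1 (ker \<sigma> k ta)" using ker_bound[OF bump_\<sigma>] by blast
 obtain C2 where C2: "0 <= C2" "\<And>k ta. ta \<in> {-1..1} ==> sdecay C2 (ker ta\<sigma> k ta)" using ker_bound[OF bump_ta\<sigma>] by blast
 have "0 <= K\<^sub>0 \<and> (\<forall>k. \<forall>ta\<in>{-1..1}. sdecay K\<^sub>0 (ker \<sigma> k ta) \<and> sdecay K\<^sub>0 (ker ta\<sigma> k ta))"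
  unfolding K\<^sub>0_def
  by (rule someI[of _ "C1 + C2"])
    (use C1 C2 in \<open>auto intro: sdecay_mono[OF C1(2)] sdecay_mono[OF C2(2)]\<close>)
 then show "0 <= K\<^sub>0" "ta \<in> {-1..1} ==> sdecay K\<^sub>0 (ker \<sigma> k ta)" "ta \<in> {-1..1} ==> sdecay K\<^sub>0 (ker ta\<sigma> k ta)"
  by blast+
qed

definition Kp :: real where "Kp = K\<^sub>0 * pi"

lemma Kp_nonneg: "0 <= Kp" using K\<^sub>0(1) by (simp add: Kp_def)

text \<open>The enlarged window is imposed here, so every piece has frequencies within 3\<rho> of k
  whatever the member of the family is. Later support statements rest on this alone.\<close>

definition piece :: "(int => real => real => complex) => int => real => real => complex" where
 "piece c k t = conv (ker ta\<sigma> (of_int k) 0) (c k t)"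

definition Syn :: "(int => real => real => complex) => real => real => complex" where
 "Syn c t x = (LC k. piece c k t x)"

lemma piece_Bd: "Bd q A (c k t) ==> 1 <= q ==> Bd q (Kp * A) (piece c k t)"
 unfolding piece_def Kp_def by (rule Bd_conv[OF K\<^sub>0(3)]) auto

lemma piece_measf: assumes c: "measf c" shows "measf (piece c)"
proof (rule measfI)
 fix k
 note [measurable (raw)] = measfD[OF c] ker_measurable[OF bump_ta\<sigma>]
 have "(\<lambda>p. LBINT y. ker ta\<sigma> (of_int k) 0 (snd p - y) * c k (fst p) y) \<in> borel_measurable (borel \<Otimes>\<^sub>M borel)"
  by measurable
 then show "(\<lambda>p. piece c k (fst p) (snd p)) \<in> borel_measurable (borel \<Otimes>\<^sub>M borel)"
  by (simp add: piece_def conv_def)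
qed

lemma Syn_measurable: assumes c: "measf c" shows "(\<lambda>(t, x). Syn c t x) \<in> borel_measurable (borel \<Otimes>\<^sub>M borel)"
proof -
 have "(\<lambda>p. LC k. piece c k (fst p) (snd p)) \<in> borel_measurable (borel \<Otimes>\<^sub>M borel)"
  by (rule count_integral_measurable) (intro measfD[OF piece_measf[OF c]]; measurable)
 then show ?thesis by (simp add: Syn_def case_prod_beta')
qed

lemma Syn_measurable_raw:
 assumes c: "measf c" and [measurable]: "f \<in> borel_measurable M" "g \<in> borel_measurable M"
 shows "(\<lambda>z. Syn c (f z) (g z)) \<in> borel_measurable M"
proof -
 note [measurable] = Syn_measurable[OF c]
 have "(\<lambda>z. (\<lambda>(t, x). Syn c t x) (f z, g z)) \<in> borel_measurable M" by measurable
 then show ?thesis by simp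
qed

lemma Syn_Bd:
 assumes c: "fam q S c" and q: "1 <= q" and t: "t \<in> {-1..1}"
 shows "Bd q (Kp * S) (Syn c t)"
proof -
 obtain A where A: "\<And>k t. t \<in> {-1..1} ==> Bd q (A k) (c k t)" "integrable (count_space UNIV) A" "(LC k. A k) <= S"
  using famE[OF c] by metis
 have "Bd q (Kp * S) (\<lambda>x. LC k. piece c k t x)"
 proof (rule Bd_integral[OF sigma_finite_measure_count_space q, where A = "\<lambda>k. Kp * A k"])
  show "(\<lambda>(k, x). piece c k t x) \<in> borel_measurable (count_space UNIV \<Otimes>\<^sub>M lborel)"
   by (rule count_pair_measurable) (intro measfD[OF piece_measf[OF fam_measf[OF c]]]; measurable)
  show "integrable (count_space UNIV) (\<lambda>k. Kp * A k)" using A(2) by simp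
  show "Bd q (Kp * A k) (piece c k t)" for k by (rule piece_Bd[of q "A k" c k t, OF A(1)[OF t] q])
  show "(LC k. Kp * A k) <= Kp * S" using A(3) Kp_nonneg by (simp add: mult_left_mono)
 qed
 then show ?thesis by (simp add: Syn_def[abs_def])
qed

text \<open>The centre of the frequencies of the triple product; the conjugated factor counts with
  the opposite sign.\<close>

definition \<kappa> :: "int \<times> int \<times> int => int" where "\<kappa> = (\<lambda>(k, l, j). k - l + j)"

text \<open>The radius 10\<rho> is the sum of 9\<rho>, the spread of a product of three pieces, and
  \<rho>, the support radius of the window around the output frequency m.\<close>

definition near :: "int => int \<times> int \<times> int => complex" where
 "near m z = of_bool (m \<in> {\<kappa> z - 10 * int \<rho>..\<kappa> z + 10 * int \<rho>})"

definition prod3 where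
 "prod3 c d e = (\<lambda>(k, l, j) s y. piece c k s y * cnj (piece d l s y) * piece e j s y)"

definition Fm where
 "Fm c d e m s y = (LC z. near m z * prod3 c d e z s y)"

text \<open>The Duhamel term rewritten as a family: the m-th member collects the triple products
  that can reach the window at m and propagates them with the kernel cut off by that window. Output
  and input are thus of the same kind, which permits iteration.\<close>

definition T where
 "T c d e m t x = (LBINT s. (- \<i> * sg t s) * conv (ker \<sigma> (of_int m) (t - s)) (Fm c d e m s) x)"

lemma prod3_measf: assumes "measf c" "measf d" "measf e" shows "measf (prod3 c d e)"
proof (rule measfI)
 fix z :: "int \<times> int \<times> int"
 obtain k l j where z: "z = (k, l, j)" by (cases z) auto
 show "(\<lambda>p. prod3 c d e z (fst p) (snd p)) \<in> borel_measurable (borel \<Otimes>\<^sub>M borel)"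
  unfolding z prod3_def prod.case
  by (intro borel_measurable_times borel_measurable_cnj measfD[OF piece_measf[OF assms(1)]]
    measfD[OF piece_measf[OF assms(2)]] measfD[OF piece_measf[OF assms(3)]]; measurable)
qed

lemma Fm_measf: assumes "measf c" "measf d" "measf e" shows "measf (Fm c d e)"
proof (rule measfI)
 fix m
 show "(\<lambda>p. Fm c d e m (fst p) (snd p)) \<in> borel_measurable (borel \<Otimes>\<^sub>M borel)"
  unfolding Fm_def
  by (rule count_integral_measurable) (intro borel_measurable_times measfD[OF prod3_measf[OF assms]]; measurable)
qed

lemma T_integrand_measurable:
 assumes "measf c" "measf d" "measf e" and [measurable]: "f \<in> borel_measurable M" "g \<in> borel_measurable M" "h \<in> borel_measurable M"
 shows "(\<lambda>p. (- \<i> * sg (f p) (h p)) * conv (ker \<sigma> (of_int m) (f p - h p)) (Fm c d e m (h p)) (g p)) \<in> borel_measurable M"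
proof -
 note [measurable (raw)] = measfD[OF Fm_measf[OF assms(1-3)]] ker_measurable[OF bump_\<sigma>]
 show ?thesis unfolding conv_def by measurable
qed

lemma T_measf: assumes "measf c" "measf d" "measf e" shows "measf (T c d e)"
proof (rule measfI)
 fix m
 note [measurable (raw)] = T_integrand_measurable[OF assms]
 show "(\<lambda>p. T c d e m (fst p) (snd p)) \<in> borel_measurable (borel \<Otimes>\<^sub>M borel)"
  unfolding T_def by measurable
qed

definition B3 where
 "B3 A B C = (\<lambda>(k, l, j). (Kp * A k) * (Kp * B l) * (Kp * C j) :: real)"

lemma prod3_Bd:
 assumes "Bd q1 (A k) (c k s)" "Bd q2 (B l) (d l s)" "Bd q3 (C j) (e j s)"
  and q: "1 <= q1" "1 <= q2" "1 <= q3" "1 <= q" "1 / q <= 1 / q1 + 1 / q2 + 1 / q3"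
 shows "Bd q (B3 A B C (k, l, j)) (prod3 c d e (k, l, j) s)"
proof -
 have p: "0 < 1 / q1 + 1 / q2" using q by (simp add: add_pos_pos)
 have "Bd (1 / (1 / q1 + 1 / q2)) ((Kp * A k) * (Kp * B l)) (\<lambda>x. piece c k s x * cnj (piece d l s x))"
  by (rule Bd_mult[OF piece_Bd[of q1 "A k" c k s, OF assms(1)] Bd_cnj[OF piece_Bd[of q2 "B l" d l s, OF assms(2)]]]) (use q p in auto)
 then have "Bd q ((Kp * A k) * (Kp * B l) * (Kp * C j)) (\<lambda>x. piece c k s x * cnj (piece d l s x) * piece e j s x)"
  by (rule Bd_mult[OF _ piece_Bd[of q3 "C j" e j s, OF assms(3)]]) (use q p in auto)
 then show ?thesis by (simp add: B3_def prod3_def)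
qed

text \<open>The sum over triples of the product of the bounds factorizes. This is why summability
  with exponent 1 in frequency is stable under the cubic term.\<close>

lemma B3_sum:
 assumes "\<And>k. 0 <= A k" "\<And>k. 0 <= B k" "\<And>k. 0 <= C k"
  and "(NC k. ennreal (A k)) <= ennreal S1" "(NC k. ennreal (B k)) <= ennreal S2"
  "(NC k. ennreal (C k)) <= ennreal S3" "0 <= S1" "0 <= S2" "0 <= S3"
 shows "(NC z. ennreal (B3 A B C z)) <= ennreal (Kp ^ 3 * (S1 * S2 * S3))"
proof -
 have e: "ennreal (B3 A B C (k, l, j)) = ennreal (Kp ^ 3) * (ennreal (A k) * (ennreal (B l) * ennreal (C j)))" for k l j
  unfolding B3_def prod.case
  by (subst ennreal_mult[symmetric] | simp add: assms Kp_nonneg)+ (simp add: power3_eq_cube mult_ac)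
 have "(NC z. ennreal (B3 A B C z))
  = (NC k. (NC l. (NC j. ennreal (B3 A B C (k, l, j)))))"
  by (subst nn_integral_fst_count_space[symmetric], subst nn_integral_fst_count_space[symmetric]) (rule refl)
 also have "... = ennreal (Kp ^ 3) * ((NC k. ennreal (A k)) * ((NC k. ennreal (B k)) * (NC k. ennreal (C k))))"
  unfolding e by (simp add: nn_integral_cmult nn_integral_multc)
 also have "... <= ennreal (Kp ^ 3) * (ennreal S1 * (ennreal S2 * ennreal S3))"
  by (intro mult_mono assms) auto
 also have "... = ennreal (Kp ^ 3 * (S1 * S2 * S3))"
  using assms Kp_nonneg by (simp add: ennreal_mult[symmetric] mult_ac)
 finally show ?thesis .
qed

text \<open>Each triple is counted for exactly 20\<rho> + 1 output frequencies.\<close>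

lemma near_sum:
 assumes "\<And>z. 0 <= B z"
 shows "(NC m. (NC z. ennreal (norm (near m z) * B z)))
  = ennreal (20 * \<rho> + 1) * (NC z. ennreal (B z))"
proof -
 have "(NC m. (NC z. ennreal (norm (near m z) * B z)))
  = (NC z. (NC m. ennreal (norm (near m z) * B z)))"
  by (subst nn_integral_fst_count_space[where f = "\<lambda>(m, z). ennreal (norm (near m z) * B z)", simplified],
    subst nn_integral_snd_count_space[where f = "\<lambda>(m, z). ennreal (norm (near m z) * B z)", simplified]) (rule refl)
 also have "... = (NC z. ennreal (20 * \<rho> + 1) * ennreal (B z))"
 proof (rule nn_integral_cong)
  fix z
  have "(NC m. ennreal (norm (near m z) * B z)) = (NC m. ennreal (B z) * indicator {\<kappa> z - 10 * int \<rho>..\<kappa> z + 10 * int \<rho>} m)"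
   by (intro nn_integral_cong) (auto simp: near_def indicator_def)
  also have "... = ennreal (B z) * emeasure (count_space UNIV) {\<kappa> z - 10 * int \<rho>..\<kappa> z + 10 * int \<rho>}"
   by (rule nn_integral_cmult_indicator) simp
  also have "emeasure (count_space UNIV) {\<kappa> z - 10 * int \<rho>..\<kappa> z + 10 * int \<rho>} = ennreal (20 * \<rho> + 1)"
   by (subst emeasure_count_space_finite) (auto simp: ennreal_of_nat_eq_real_of_nat nat_add_distrib nat_mult_distrib)
  finally show "(NC m. ennreal (norm (near m z) * B z)) = ennreal (20 * \<rho> + 1) * ennreal (B z)"
   by (simp add: mult.commute)
 qed
 also have "... = ennreal (20 * \<rho> + 1) * (NC z. ennreal (B z))"
  by (rule nn_integral_cmult) simp
 finally show ?thesis .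
qed

text \<open>The factor 2 is the length of [-1,1], the first \<open>Kp\<close> comes from the
  propagated kernel, and the rest from the triple products with their 20\<rho> + 1 outputs.\<close>

definition CT :: real where "CT = 2 * Kp * ((20 * \<rho> + 1) * Kp ^ 3)"

lemma CT_nonneg: "0 <= CT" using Kp_nonneg by (simp add: CT_def)

lemma fam3E:
 assumes c: "fam q1 S1 c" and d: "fam q2 S2 d" and e: "fam q3 S3 e"
  and q: "1 <= q1" "1 <= q2" "1 <= q3" "1 <= q" "1 / q <= 1 / q1 + 1 / q2 + 1 / q3"
 obtains B E where "\<And>z. 0 <= B z" "integrable (count_space UNIV) B" "\<And>z s. s \<in> {-1..1} ==> Bd q (B z) (prod3 c d e z s)"
  "\<And>m. 0 <= E m" "\<And>m. integrable (count_space UNIV) (\<lambda>z. norm (near m z) * B z)"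
  "\<And>m. E m = (LC z. norm (near m z) * B z)"
  "\<And>m s. s \<in> {-1..1} ==> Bd q (E m) (Fm c d e m s)"
  "(NC m. ennreal (E m)) <= ennreal ((20 * \<rho> + 1) * Kp ^ 3 * (S1 * S2 * S3))"
proof -
 obtain A where A: "\<And>k t. t \<in> {-1..1} ==> Bd q1 (A k) (c k t)" "\<And>k. 0 <= A k" "(NC k. ennreal (A k)) <= ennreal S1"
  using famE[OF c] by metis
 obtain A' where A': "\<And>k t. t \<in> {-1..1} ==> Bd q2 (A' k) (d k t)" "\<And>k. 0 <= A' k" "(NC k. ennreal (A' k)) <= ennreal S2"
  using famE[OF d] by metis
 obtain A'' where A'': "\<And>k t. t \<in> {-1..1} ==> Bd q3 (A'' k) (e k t)" "\<And>k. 0 <= A'' k" "(NC k. ennreal (A'' k)) <= ennreal S3"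
  using famE[OF e] by metis
 define B where "B = B3 A A' A''"
 define E where "E m = (LC z. norm (near m z) * B z)" for m
 have S0: "0 <= S1" "0 <= S2" "0 <= S3" using fam_nonneg c d e by auto
 have B0: "0 <= B z" for z
  using A(2) A'(2) A''(2) Kp_nonneg by (cases z) (auto simp: B_def B3_def)
 have Bs: "(NC z. ennreal (B z)) <= ennreal (Kp ^ 3 * (S1 * S2 * S3))"
  unfolding B_def by (rule B3_sum[OF A(2) A'(2) A''(2) A(3) A'(3) A''(3) S0])
 have Bi: "integrable (count_space UNIV) B"
  by (rule nonneg_count_integrable[OF B0 Bs]) (use S0 Kp_nonneg in auto)
 have PB: "Bd q (B z) (prod3 c d e z s)" if "s \<in> {-1..1}" for z s
 proof -
  obtain k l j where z: "z = (k, l, j)" by (cases z) auto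
  show ?thesis unfolding z B_def
   by (rule prod3_Bd[OF _ _ _ q]) (rule A(1)[OF that] A'(1)[OF that] A''(1)[OF that])+
 qed
 have nB: "norm (norm (near m z) * B z) <= norm (B z)" for m z
  using B0[of z] by (auto simp: near_def)
 have ni: "integrable (count_space UNIV) (\<lambda>z. norm (near m z) * B z)" for m
  by (rule integrable_boundI[OF Bi]) (use nB in auto)
 have E0: "0 <= E m" for m unfolding E_def by (rule Bochner_Integration.integral_nonneg) (use B0 in auto)
 have FB: "Bd q (E m) (Fm c d e m s)" if s: "s \<in> {-1..1}" for m s
 proof -
  have "Bd q (E m) (\<lambda>y. LC z. near m z * prod3 c d e z s y)"
  proof (rule Bd_integral[OF sigma_finite_measure_count_space q(4) _ ni])
   show "(\<lambda>(z, y). near m z * prod3 c d e z s y) \<in> borel_measurable (count_space UNIV \<Otimes>\<^sub>M lborel)"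
    by (rule count_pair_measurable)
      (intro borel_measurable_times measfD[OF prod3_measf[OF fam_measf[OF c] fam_measf[OF d] fam_measf[OF e]]]; measurable)
   show "Bd q (norm (near m z) * B z) (\<lambda>y. near m z * prod3 c d e z s y)" for z
    using PB[OF s, of z] q by (cases "near m z = 0") (auto simp: near_def Bd_zero)
   show "(LC z. norm (near m z) * B z) <= E m" by (simp add: E_def)
  qed
  then show ?thesis by (simp add: Fm_def[abs_def])
 qed
 have "(NC m. ennreal (E m)) = (NC m. (NC z. ennreal (norm (near m z) * B z)))"
  unfolding E_def by (intro nn_integral_cong nn_integral_eq_integral[symmetric] ni) (use B0 in auto)
 also have "... = ennreal (20 * \<rho> + 1) * (NC z. ennreal (B z))" by (rule near_sum[OF B0])
 also have "... <= ennreal (20 * \<rho> + 1) * ennreal (Kp ^ 3 * (S1 * S2 * S3))" by (intro mult_left_mono Bs) auto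
 also have "... = ennreal ((20 * \<rho> + 1) * Kp ^ 3 * (S1 * S2 * S3))"
  using S0 Kp_nonneg by (subst ennreal_mult[symmetric]) (auto simp: mult.assoc)
 finally have Es: "(NC m. ennreal (E m)) <= ennreal ((20 * \<rho> + 1) * Kp ^ 3 * (S1 * S2 * S3))" .
 show thesis by (rule that[OF B0 Bi PB E0 ni E_def FB Es])
qed

text \<open>At fixed time Hoelder's inequality and the counting of triples bound \<open>Fm\<close>;
  convolution with the localized propagator is bounded on \<open>Bd\<close>, and Minkowski's
  inequality carries the bound through the time integral.\<close>

lemma T_fam:
 assumes c: "fam q1 S1 c" and d: "fam q2 S2 d" and e: "fam q3 S3 e"
  and q: "1 <= q1" "1 <= q2" "1 <= q3" "1 <= q" "1 / q <= 1 / q1 + 1 / q2 + 1 / q3"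
 shows "fam q (CT * (S1 * S2 * S3)) (T c d e)"
proof -
 obtain B E where E: "\<And>m. 0 <= E m" "\<And>m s. s \<in> {-1..1} ==> Bd q (E m) (Fm c d e m s)"
  "(NC m. ennreal (E m)) <= ennreal ((20 * \<rho> + 1) * Kp ^ 3 * (S1 * S2 * S3))"
  using fam3E[OF c d e q] by metis
 have S0: "0 <= S1" "0 <= S2" "0 <= S3" using fam_nonneg c d e by auto
 have TB: "Bd q (2 * Kp * E m) (T c d e m t)" if t: "t \<in> {-1..1}" for m t
 proof -
  have "Bd q (2 * Kp * E m) (\<lambda>x. LBINT s. (- \<i> * sg t s) * conv (ker \<sigma> (of_int m) (t - s)) (Fm c d e m s) x)"
  proof (rule Bd_integral[OF sigma_finite_lborel' q(4), where A = "\<lambda>s. indicator {-1..1} s *\<^sub>R (Kp * E m)"])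
   have "(\<lambda>p. (- \<i> * sg t (fst p)) * conv (ker \<sigma> (of_int m) (t - fst p)) (Fm c d e m (fst p)) (snd p)) \<in> borel_measurable (lborel \<Otimes>\<^sub>M lborel)"
    by (rule T_integrand_measurable[OF fam_measf[OF c] fam_measf[OF d] fam_measf[OF e]]) measurable
   then show "(\<lambda>(s, x). (- \<i> * sg t s) * conv (ker \<sigma> (of_int m) (t - s)) (Fm c d e m s) x) \<in> borel_measurable (lborel \<Otimes>\<^sub>M lborel)"
    by (simp add: case_prod_beta')
   show "integrable lborel (\<lambda>s. indicator {-1..1::real} s *\<^sub>R (Kp * E m))"
    by (intro integrable_scaleR_left integrable_real_indicator) auto
   show "(LBINT s. indicator {-1..1::real} s *\<^sub>R (Kp * E m)) <= 2 * Kp * E m"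
    by simp
   fix s
   show "Bd q (indicator {-1..1} s *\<^sub>R (Kp * E m)) (\<lambda>x. (- \<i> * sg t s) * conv (ker \<sigma> (of_int m) (t - s)) (Fm c d e m s) x)"
   proof (cases "sg t s = 0")
    case True
    then show ?thesis using q E(1)[of m] Kp_nonneg by (simp add: Bd_zero)
   next
    case False
    then have r: "s \<in> {-1..1}" "t - s \<in> {-1..1}" using sg_range[OF _ t] by auto
    have "Bd q (Kp * E m) (conv (ker \<sigma> (of_int m) (t - s)) (Fm c d e m s))"
     unfolding Kp_def by (rule Bd_conv[OF K\<^sub>0(2)[OF r(2)] E(2)[OF r(1)] q(4)])
    then have "Bd q (Kp * E m) (\<lambda>x. (- \<i> * sg t s) * conv (ker \<sigma> (of_int m) (t - s)) (Fm c d e m s) x)"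
     by (rule Bd_unimodular_mult) (use q norm_sg_le in \<open>auto simp: norm_mult\<close>)
    then show ?thesis using r by simp
   qed
  qed
  then show ?thesis by (simp add: T_def[abs_def])
 qed
 have "(NC m. ennreal (2 * Kp * E m)) = ennreal (2 * Kp) * (NC m. ennreal (E m))"
  using Kp_nonneg E(1) by (subst nn_integral_cmult[symmetric]) (auto simp: ennreal_mult)
 also have "... <= ennreal (2 * Kp) * ennreal ((20 * \<rho> + 1) * Kp ^ 3 * (S1 * S2 * S3))"
  by (intro mult_left_mono E(3)) auto
 also have "... = ennreal (CT * (S1 * S2 * S3))"
  using S0 Kp_nonneg by (subst ennreal_mult[symmetric]) (auto simp: CT_def mult.assoc)
 finally show ?thesis unfolding fam_def
  using TB T_measf[OF fam_measf[OF c] fam_measf[OF d] fam_measf[OF e]] S0 CT_nonneg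
  by (intro conjI exI[of _ "\<lambda>m. 2 * Kp * E m"]) auto
qed

end

section \<open>The Duhamel term of wave packet families\<close>

text \<open>\<open>spec \<kappa> r Q\<close>: the distributional Fourier transform of the bounded function \<open>Q\<close> is
 supported in \<open>[\<kappa> - r, \<kappa> + r]\<close>.\<close>

definition spec :: "real => real => (real => complex) => bool" where
 "spec \<kappa> r Q \<longleftrightarrow> Q \<in> borel_measurable borel \<and> (\<exists>B. \<forall>x. norm (Q x) <= B) \<and>
   (\<forall>M. schwartz M --> (\<forall>eta. \<bar>eta - \<kappa>\<bar> <= r --> M eta = 0) --> (LBINT x. Q x * fourier M x) = 0)"

text \<open>The starting point of the multiplication rule for spectra: a constant has frequency zero
  only.\<close>

lemma spec_one: "spec 0 0 (\<lambda>_. 1)"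
 unfolding spec_def
proof (intro conjI allI impI)
 fix M :: "real => complex" assume M: "schwartz M" and z: "\<forall>eta. \<bar>eta - 0\<bar> <= 0 --> M eta = 0"
 have "inv_fourier (fourier M) 0 = (LBINT x. fourier M x) / (2 * pi)" by (simp add: inv_fourier_def)
 then have "(LBINT x. fourier M x) = M 0 * (2 * pi)" by (simp add: inv_fourier_fourier[OF M])
 then show "(LBINT x. 1 * fourier M x) = 0" using z by simp
qed auto

lemma fourier_modulate: "fourier (\<lambda>eta. M (eta + a)) x = cis (a * x) * fourier M x"
proof -
 have "fourier (\<lambda>eta. M (eta + a)) x = \<bar>1\<bar> *\<^sub>R (LBINT eta. cis (- ((- a + 1 * eta) * x)) * M ((- a + 1 * eta) + a))"
  unfolding fourier_def by (rule lborel_integral_real_affine) simp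
 also have "... = (LBINT eta. cis (a * x) * (cis (- (eta * x)) * M eta))"
 proof -
  have "cis (- ((- a + eta) * x)) = cis (a * x) * cis (- (eta * x))" for eta
   unfolding cis_mult by (rule arg_cong[where f = cis]) (simp add: algebra_simps)
  then show ?thesis by (simp add: mult.assoc)
 qed
 also have "... = cis (a * x) * (LBINT eta. cis (- (eta * x)) * M eta)" by (rule integral_mult_right_zero)
 finally show ?thesis by (simp add: fourier_def)
qed

text \<open>Translation is modulation on the Fourier side, and modulations preserve Schwartz
  functions.\<close>

lemma schwartz_translate: assumes "schwartz M" shows "schwartz (\<lambda>eta. M (eta + a))"
proof -
 have "schwartz (\<lambda>x. cis (a * x) * fourier M x)"
  using usch_mult[OF umod_cis_linear, of "{()}" "\<lambda>_. fourier M" a] schwartz_fourier[OF assms]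
  by (simp add: schwartz_iff_usch)
 from schwartz_inv_fourier[OF this]
 have s: "schwartz (inv_fourier (\<lambda>x. cis (a * x) * fourier M x))" .
 have h: "inv_fourier (\<lambda>x. cis (a * x) * fourier M x) eta = M (eta + a)" for eta
 proof -
  have e: "cis (eta * x) * (cis (a * x) * fourier M x) = cis ((eta + a) * x) * fourier M x" for x
  proof -
   have "cis (eta * x) * cis (a * x) = cis ((eta + a) * x)"
    unfolding cis_mult by (rule arg_cong[where f = cis]) (simp add: algebra_simps)
   then show ?thesis by (simp add: mult.assoc[symmetric])
  qed
  have "inv_fourier (\<lambda>x. cis (a * x) * fourier M x) eta = inv_fourier (fourier M) (eta + a)"
   by (simp only: inv_fourier_def e)
  then show ?thesis by (simp add: inv_fourier_fourier[OF assms])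
 qed
 have "inv_fourier (\<lambda>x. cis (a * x) * fourier M x) = (\<lambda>eta. M (eta + a))" by (rule ext) (rule h)
 with s show ?thesis by simp
qed

lemma conv_bounded:
 assumes K: "decay C K" and [measurable]: "c \<in> borel_measurable borel" and c: "\<And>y. norm (c y) <= B"
 shows "norm (conv K c x) <= C * pi * B"
proof -
 note [measurable] = decay_measurable[OF K]
 have B0: "0 <= B" using c[of 0] norm_ge_zero order_trans by blast
 have "norm (LBINT z. K z * c (x - z)) <= (LBINT z. norm (K z) * B)"
  by (rule norm_integral_le)
    (use c integrable_norm[OF decay_integrable[OF K]] in \<open>auto simp: norm_mult intro!: AE_I2 mult_left_mono\<close>)
 also have "... <= C * pi * B" using decay_integral_norm[OF K] B0 by (simp add: mult_right_mono)
 finally show ?thesis by (simp add: conv_commute)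
qed

lemma schwartz_weight_integrable:
 assumes phi: "schwartz phi" shows "integrable lborel (\<lambda>x. (1 + x\<^sup>2) * norm (phi x))"
proof -
 have "integrable lborel (\<lambda>x. norm (phi x) + norm (of_real x * (of_real x * phi x)))"
  by (intro Bochner_Integration.integrable_add integrable_norm schwartz_integrable schwartz_mult_id phi)
 moreover have "norm (phi x) + norm (of_real x * (of_real x * phi x)) = (1 + x\<^sup>2) * norm (phi x)" for x
 proof -
  have "norm (of_real x * (of_real x * phi x)) = (\<bar>x\<bar> * \<bar>x\<bar>) * norm (phi x)" by (simp add: norm_mult)
  also have "\<bar>x\<bar> * \<bar>x\<bar> = x\<^sup>2" by (simp add: power2_eq_square)
  finally show ?thesis by (simp add: distrib_right)
 qed
 ultimately show ?thesis by simp
qed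

text \<open>Multiplication adds spectra. The kernel is a superposition of exponentials with
  frequencies within w of \<kappa>', each of which translates the test symbol; the translate still
  vanishes on the spectrum of \<open>Q\<close>. The sign \<epsilon> includes conjugated
  factors.\<close>

lemma spec_conv_mult:
 fixes s :: "real => complex"
 assumes s: "decay S s" and \<epsilon>: "\<epsilon> = 1 \<or> \<epsilon> = -1" and K: "\<And>x. K x = ft \<epsilon> s x / (2 * pi)" and KC: "decay C K"
  and supp: "\<And>xi. s xi \<noteq> 0 ==> \<bar>\<epsilon> * xi - \<kappa>'\<bar> <= w"
  and c[measurable]: "c \<in> borel_measurable borel" and cB: "\<And>y. norm (c y) <= Bc"
  and Q: "spec \<kappa> r Q"
 shows "spec (\<kappa>' + \<kappa>) (w + r) (\<lambda>x. conv K c x * Q x)"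
proof -
 obtain BQ where [measurable]: "Q \<in> borel_measurable borel" and BQ: "\<And>x. norm (Q x) <= BQ"
  and Qz: "\<And>M. schwartz M ==> (\<forall>eta. \<bar>eta - \<kappa>\<bar> <= r --> M eta = 0) ==> (LBINT x. Q x * fourier M x) = 0"
  using Q unfolding spec_def by blast
 note [measurable] = decay_measurable[OF KC] decay_measurable[OF s] conv_measurable[OF decay_measurable[OF KC] c]
 have B0: "0 <= BQ" "0 <= Bc" using BQ[of 0] cB[of 0] norm_ge_zero order_trans by blast+
 have C0: "0 <= C" by (rule decay_nonneg[OF KC])
 have b: "norm (conv K c x * Q x) <= C * pi * Bc * BQ" for x
  unfolding norm_mult using C0 B0 by (intro mult_mono conv_bounded[OF KC c cB] BQ) auto
 have z: "(LBINT x. (conv K c x * Q x) * fourier M x) = 0"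
  if M: "schwartz M" and Mz: "\<forall>eta. \<bar>eta - (\<kappa>' + \<kappa>)\<bar> <= w + r --> M eta = 0" for M
 proof -
  let ?\<psi> = "fourier M"
  have s\<psi>: "schwartz ?\<psi>" by (rule schwartz_fourier[OF M])
  note [measurable] = schwartz_measurable[OF s\<psi>]
  \<comment> \<open>For fixed y the pairing of the translated kernel with \<open>Q\<close> vanishes
    already frequency by frequency, after writing the kernel as a Fourier integral.\<close>
  have inner: "(LBINT x. K (x - y) * (Q x * ?\<psi> x)) = 0" for y
  proof -
   have "(LBINT x. K (x - y) * (Q x * ?\<psi> x))
    = (LBINT x. LBINT xi. cis (\<epsilon> * (xi * (x - y))) * s xi * (Q x * ?\<psi> x) / (2 * pi))"
    by (intro LBINT_cong refl) (simp add: K ft_def)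
   also have "... = (LBINT xi. LBINT x. cis (\<epsilon> * (xi * (x - y))) * s xi * (Q x * ?\<psi> x) / (2 * pi))"
   proof (rule Fubini_product_bound(2)[OF sigma_finite_lborel' sigma_finite_lborel'])
    show "integrable lborel (\<lambda>x. BQ * norm (?\<psi> x))" using schwartz_integrable[OF s\<psi>] by simp
    show "integrable lborel (\<lambda>xi. norm (s xi) / (2 * pi))"
     using integrable_norm[OF decay_integrable[OF s]] by simp
    show "norm (cis (\<epsilon> * (xi * (x - y))) * s xi * (Q x * ?\<psi> x) / (2 * pi)) <= (BQ * norm (?\<psi> x)) * (norm (s xi) / (2 * pi))" for x xi
    proof -
     have "norm (cis (\<epsilon> * (xi * (x - y))) * s xi * (Q x * ?\<psi> x) / (2 * pi)) = norm (Q x) * (norm (?\<psi> x) * (norm (s xi) / (2 * pi)))"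
      by (simp add: norm_mult norm_divide)
     also have "... <= BQ * (norm (?\<psi> x) * (norm (s xi) / (2 * pi)))" by (intro mult_right_mono BQ) auto
     finally show ?thesis by (simp add: mult.assoc)
    qed
   qed measurable
   also have "... = (LINT xi|(lborel :: real measure). 0)"
   proof (intro LBINT_cong refl)
    fix xi
    show "(LBINT x. cis (\<epsilon> * (xi * (x - y))) * s xi * (Q x * ?\<psi> x) / (2 * pi)) = 0"
    proof (cases "s xi = 0")
     case False
     have e: "cis (\<epsilon> * (xi * (x - y))) * s xi * (Q x * ?\<psi> x) / (2 * pi)
       = (cis (- (\<epsilon> * xi * y)) * s xi / (2 * pi)) * (Q x * fourier (\<lambda>eta. M (eta + \<epsilon> * xi)) x)" for x
     proof -
      have "cis (\<epsilon> * (xi * (x - y))) = cis (- (\<epsilon> * xi * y)) * cis (\<epsilon> * xi * x)"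
       unfolding cis_mult by (rule arg_cong[where f = cis]) (simp add: algebra_simps)
      then show ?thesis by (simp add: fourier_modulate mult_ac)
     qed
     have "(LBINT x. Q x * fourier (\<lambda>eta. M (eta + \<epsilon> * xi)) x) = 0"
     proof (rule Qz[OF schwartz_translate[OF M]], intro allI impI)
      fix eta assume "\<bar>eta - \<kappa>\<bar> <= r"
      then have "\<bar>eta + \<epsilon> * xi - (\<kappa>' + \<kappa>)\<bar> <= w + r" using supp[OF False] by linarith
      then show "M (eta + \<epsilon> * xi) = 0" using Mz by blast
     qed
     then show ?thesis unfolding e integral_mult_right_zero by simp
    qed simp
   qed
   finally show ?thesis by simp
  qed
  have "(LBINT x. (conv K c x * Q x) * ?\<psi> x) = (LBINT x. LBINT y. K (x - y) * c y * (Q x * ?\<psi> x))"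
   unfolding integral_mult_left_zero
   by (intro LBINT_cong refl) (simp add: conv_def mult.assoc)
  also have "... = (LBINT y. LBINT x. K (x - y) * c y * (Q x * ?\<psi> x))"
  proof (rule Fubini_product_bound(2)[OF sigma_finite_lborel' sigma_finite_lborel'])
   show "integrable lborel (\<lambda>x. BQ * ((1 + x\<^sup>2) * norm (?\<psi> x)))" using schwartz_weight_integrable[OF s\<psi>] by simp
   show "integrable lborel (\<lambda>y. 2 * C * Bc * cauchy y)" by simp
   fix x y
   have k: "norm (K (x - y)) <= 2 * (1 + x\<^sup>2) * C * cauchy y" by (rule decayD[OF decay_reflect_shift[OF KC]])
   have "norm (K (x - y) * c y * (Q x * ?\<psi> x)) = norm (K (x - y)) * norm (c y) * (norm (Q x) * norm (?\<psi> x))"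
    by (simp add: norm_mult)
   also have "... <= (2 * (1 + x\<^sup>2) * C * cauchy y) * Bc * (BQ * norm (?\<psi> x))"
    using B0 C0 by (intro mult_mono k cB BQ mult_nonneg_nonneg) auto
   also have "... = (BQ * ((1 + x\<^sup>2) * norm (?\<psi> x))) * (2 * C * Bc * cauchy y)" by (simp add: mult_ac)
   finally show "norm (K (x - y) * c y * (Q x * ?\<psi> x)) <= (BQ * ((1 + x\<^sup>2) * norm (?\<psi> x))) * (2 * C * Bc * cauchy y)" .
  qed measurable
  also have "... = (LINT y|(lborel :: real measure). 0)"
  proof (intro LBINT_cong refl)
   fix y
   have "(LBINT x. K (x - y) * c y * (Q x * ?\<psi> x)) = (LBINT x. c y * (K (x - y) * (Q x * ?\<psi> x)))"
    by (intro LBINT_cong refl) (simp add: mult_ac)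
   also have "... = c y * (LBINT x. K (x - y) * (Q x * ?\<psi> x))" by (rule integral_mult_right_zero)
   finally show "(LBINT x. K (x - y) * c y * (Q x * ?\<psi> x)) = 0" by (simp add: inner)
  qed
  finally show ?thesis by simp
 qed
 show ?thesis unfolding spec_def
  by (intro conjI allI impI exI[of _ "C * pi * Bc * BQ"] b z) measurable
qed

lemma umod_reindex: "umod I m ==> (\<And>j. j \<in> J ==> h j \<in> I) ==> umod J (\<lambda>j. m (h j))"
 unfolding umod_def by (intro conjI allI ballI) (blast, meson)

lemma count_prod_integral:
 fixes f :: "'a::countable => complex" and g :: "'b::countable => complex"
 assumes f: "integrable (count_space UNIV) f" and g: "integrable (count_space UNIV) g"
 shows "integrable (count_space UNIV) (\<lambda>(x, y). f x * g y)"
  and "(LC p. (case p of (x, y) => f x * g y)) = (LC x. f x) * (LC y. g y)"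
proof -
 have cs: "count_space UNIV \<Otimes>\<^sub>M count_space UNIV = (count_space UNIV :: ('a \<times> 'b) measure)"
  using pair_measure_countable[of "UNIV :: 'a set" "UNIV :: 'b set"] by simp
 interpret pair_sigma_finite "count_space (UNIV :: 'a set)" "count_space (UNIV :: 'b set)"
  by (simp add: pair_sigma_finite_def sigma_finite_measure_count_space)
 have "integrable (count_space UNIV \<Otimes>\<^sub>M count_space UNIV) (\<lambda>(x, y). f x * g y)"
  by (rule Fubini_product_bound(1)[OF sigma_finite_measure_count_space sigma_finite_measure_count_space _ integrable_norm[OF f] integrable_norm[OF g]])
    (auto simp: cs norm_mult)
 then show i: "integrable (count_space UNIV) (\<lambda>(x, y). f x * g y)" unfolding cs .
 have "(LC p. (case p of (x, y) => f x * g y)) = (LC x. LC y. f x * g y)"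
  using integral_fst[of "\<lambda>x y. f x * g y"] i unfolding cs by (simp add: case_prod_beta')
 then show "(LC p. (case p of (x, y) => f x * g y)) = (LC x. f x) * (LC y. g y)"
  by simp
qed

lemma cnj_conv: "cnj (conv K c x) = conv (\<lambda>x. cnj (K x)) (\<lambda>x. cnj (c x)) x"
 unfolding conv_def by (subst Bochner_Integration.integral_cnj[symmetric]) simp

lemma cnj_ft: "cnj (ft s f x) = ft (- s) (\<lambda>x. cnj (f x)) x"
 unfolding ft_def by (subst Bochner_Integration.integral_cnj[symmetric]) (simp add: cis_cnj)

lemma decay_cnj: "decay C f ==> decay C (\<lambda>x. cnj (f x))"
 unfolding decay_def by (auto intro: borel_measurable_cnj)

context freq_window
begin

lemma sym_0: "sym b k 0 xi = of_real (b (xi - k))"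
 by (simp add: sym_def)

text \<open>Three applications of the multiplication rule, starting from the constant 1. Each
  enlarged window has radius 3\<rho>, and conjugation moves the middle centre to -l.\<close>

lemma prod3_spec:
 assumes c: "c k s \<in> borel_measurable borel" "\<And>y. norm (c k s y) <= Bc"
  and d: "d l s \<in> borel_measurable borel" "\<And>y. norm (d l s y) <= Bd'"
  and e: "e j s \<in> borel_measurable borel" "\<And>y. norm (e j s y) <= Be"
 shows "spec (of_int (\<kappa> (k, l, j))) (9 * real \<rho>) (prod3 c d e (k, l, j) s)"
proof -
 let ?s = "\<lambda>k::int. sym ta\<sigma> (of_int k) 0"
 have ss: "schwartz (?s k)" for k by (rule sym_schwartz[OF bump_ta\<sigma>])
 have s1: "\<exists>S. decay S (?s k)" for k using schwartz_decay[OF ss] by blast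
 have K1: "\<exists>C. decay C (ker ta\<sigma> (of_int k) 0)" for k :: int
  using schwartz_decay[OF schwartz_inv_fourier[OF ss]] unfolding ker_def by blast
 have Kf: "ker ta\<sigma> (of_int k) 0 x = ft 1 (?s k) x / (2 * pi)" for k x
  by (simp add: ker_def inv_fourier_ft)
 have su: "\<bar>xi - of_int k\<bar> <= 3 * real \<rho>" if "?s k xi \<noteq> 0" for k xi
  using that ta\<sigma>_supp[of "xi - of_int k"] by (force simp: sym_0)
 have e1: "spec (of_int j + 0) (3 * real \<rho> + 0) (\<lambda>x. conv (ker ta\<sigma> (of_int j) 0) (e j s) x * 1)"
 proof -
  obtain S C where "decay S (?s j)" "decay C (ker ta\<sigma> (of_int j) 0)" using s1[of j] K1[of j] by blast
  then show ?thesis by (rule spec_conv_mult[OF _ disjI1[OF refl] Kf _ _ e spec_one]) (use su in simp)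
 qed
 have e2: "spec (- of_int l + (of_int j + 0)) (3 * real \<rho> + (3 * real \<rho> + 0))
   (\<lambda>x. conv (\<lambda>x. cnj (ker ta\<sigma> (of_int l) 0 x)) (\<lambda>x. cnj (d l s x)) x * (conv (ker ta\<sigma> (of_int j) 0) (e j s) x * 1))"
 proof -
  obtain S C where S: "decay S (?s l)" and C: "decay C (ker ta\<sigma> (of_int l) 0)" using s1[of l] K1[of l] by blast
  show ?thesis
  proof (rule spec_conv_mult[OF decay_cnj[OF S] disjI2[OF refl] _ decay_cnj[OF C] _ borel_measurable_cnj[OF d(1)] _ e1])
   show "cnj (ker ta\<sigma> (of_int l) 0 x) = ft (- 1) (\<lambda>x. cnj (?s l x)) x / complex_of_real (2 * pi)" for x
    by (simp add: Kf cnj_ft)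
   show "\<bar>- 1 * xi - - of_int l\<bar> <= 3 * real \<rho>" if "cnj (?s l xi) \<noteq> 0" for xi
    using su[of l xi] that by (simp add: abs_minus_commute)
   show "norm (cnj (d l s y)) <= Bd'" for y using d(2) by simp
  qed
 qed
 have e3: "spec (of_int k + (- of_int l + (of_int j + 0))) (3 * real \<rho> + (3 * real \<rho> + (3 * real \<rho> + 0)))
   (\<lambda>x. conv (ker ta\<sigma> (of_int k) 0) (c k s) x *
    (conv (\<lambda>x. cnj (ker ta\<sigma> (of_int l) 0 x)) (\<lambda>x. cnj (d l s x)) x * (conv (ker ta\<sigma> (of_int j) 0) (e j s) x * 1)))"
 proof -
  obtain S C where "decay S (?s k)" "decay C (ker ta\<sigma> (of_int k) 0)" using s1[of k] K1[of k] by blast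
  then show ?thesis by (rule spec_conv_mult[OF _ disjI1[OF refl] Kf _ _ c e2]) (use su in simp)
 qed
 have 1: "real_of_int k + (- of_int l + (of_int j + 0)) = of_int (\<kappa> (k, l, j))" by (simp add: \<kappa>_def)
 have 2: "3 * real \<rho> + (3 * real \<rho> + (3 * real \<rho> + 0)) = 9 * real \<rho>" by simp
 have 3: "prod3 c d e (k, l, j) s = (\<lambda>x. conv (ker ta\<sigma> (of_int k) 0) (c k s) x *
    (conv (\<lambda>x. cnj (ker ta\<sigma> (of_int l) 0 x)) (\<lambda>x. cnj (d l s x)) x * (conv (ker ta\<sigma> (of_int j) 0) (e j s) x * 1)))"
  by (simp add: prod3_def piece_def cnj_conv mult.assoc)
 show ?thesis using e3 unfolding 1 2 3 .
qed

section \<open>Summation of the output windows\<close>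

lemma umod_\<sigma>: "umod UNIV (\<lambda>k xi. complex_of_real (\<sigma> (xi - k)))"
proof (rule umod_bounded_derivs)
 fix k show "smooth (\<lambda>xi. complex_of_real (\<sigma> (xi - k)))"
  by (rule schwartz_smooth[OF bump_schwartz[OF bump_shift[OF bump_\<sigma>]]])
next
 fix b
 have "smooth (\<lambda>x. complex_of_real (\<sigma> x))" by (rule schwartz_smooth[OF bump_schwartz[OF bump_\<sigma>]])
 note sh = dx_funpow_shift[OF this, of b]
 obtain C where "\<And>x. norm ((dx ^^ b) (\<lambda>x. complex_of_real (\<sigma> x)) x) <= C"
  using bump_schwartz[OF bump_\<sigma>] unfolding schwartz_iff_usch usch_def by (metis mult_1 power_0 singletonI)
 then show "\<exists>C. \<forall>i\<in>UNIV. \<forall>x. norm ((dx ^^ b) (\<lambda>xi. complex_of_real (\<sigma> (xi - i))) x) <= C"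
  unfolding sh by (intro exI[of _ C] ballI allI)
qed

lemma schwartz_\<sigma>_mult: "schwartz M ==> schwartz (\<lambda>xi. complex_of_real (\<sigma> (xi - k)) * M xi)"
 by (rule usch_imp_schwartz[OF usch_mult[OF umod_\<sigma> schwartz_imp_usch], of M k]) auto

text \<open>On the spectrum of \<open>P\<close>, of radius 9\<rho>, the windows with index within
  10\<rho> of its centre already add up to 1. Hence the difference of the two test symbols vanishes
  there and is invisible to \<open>P\<close>.\<close>

lemma window_sum_test:
 assumes P: "spec (of_int \<kappa>') (9 * real \<rho>) P" and M: "schwartz M"
 shows "(\<Sum>m\<in>{\<kappa>' - 10 * int \<rho>..\<kappa>' + 10 * int \<rho>}. LBINT y. P y * fourier (\<lambda>xi. of_real (\<sigma> (xi - of_int m)) * M xi) y)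
  = (LBINT y. P y * fourier M y)"
proof -
 let ?I = "{\<kappa>' - 10 * int \<rho>..\<kappa>' + 10 * int \<rho>}"
 let ?f = "\<lambda>m::int. (\<lambda>xi. complex_of_real (\<sigma> (xi - of_int m)) * M xi)"
 obtain B where Pm: "P \<in> borel_measurable borel" "\<And>x. norm (P x) <= B"
  and Pz: "\<And>M. schwartz M ==> (\<forall>eta. \<bar>eta - of_int \<kappa>'\<bar> <= 9 * real \<rho> --> M eta = 0) ==> (LBINT x. P x * fourier M x) = 0"
  using P unfolding spec_def by blast
 have tP: "tame P" by (rule bounded_tame[OF Pm])
 have iP: "integrable lborel (\<lambda>y. P y * \<psi> y)" if "schwartz \<psi>" for \<psi>
  using schwartz_decay[OF that] tame_mult_integrable[OF tP] by blast
 have sf: "schwartz (?f m)" for m by (rule schwartz_\<sigma>_mult[OF M])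
 have sS: "schwartz (\<lambda>xi. \<Sum>m\<in>?I. ?f m xi)" by (rule schwartz_sum) (use sf in auto)
 have sD: "schwartz (\<lambda>xi. M xi + (-1) * (\<Sum>m\<in>?I. ?f m xi))" by (intro schwartz_add schwartz_cmult M sS)
 have z: "(LBINT y. P y * fourier (\<lambda>xi. M xi + (-1) * (\<Sum>m\<in>?I. ?f m xi)) y) = 0"
 proof (rule Pz[OF sD], intro allI impI)
  fix eta :: real assume eta: "\<bar>eta - of_int \<kappa>'\<bar> <= 9 * real \<rho>"
  have "(\<Sum>m\<in>?I. \<sigma> (eta - of_int m)) = 1"
  proof (rule sum_\<sigma>)
   fix k :: int assume "\<bar>eta - of_int k\<bar> <= real \<rho>"
   then have "\<bar>real_of_int k - real_of_int \<kappa>'\<bar> <= 10 * real \<rho>" using eta by linarith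
   then have "real_of_int \<bar>k - \<kappa>'\<bar> <= real_of_int (10 * int \<rho>)" by simp
   then have "\<bar>k - \<kappa>'\<bar> <= 10 * int \<rho>" by (simp only: of_int_le_iff)
   then show "k \<in> ?I" by auto
  qed simp
  then have "complex_of_real (\<Sum>m\<in>?I. \<sigma> (eta - of_int m)) = 1" by simp
  then show "M eta + (-1) * (\<Sum>m\<in>?I. ?f m eta) = 0" by (simp add: sum_distrib_right[symmetric])
 qed
 have D: "fourier (\<lambda>xi. M xi + (-1) * (\<Sum>m\<in>?I. ?f m xi)) = (\<lambda>y. fourier M y + (-1) * (\<Sum>m\<in>?I. fourier (?f m) y))"
  unfolding fourier_add[OF M schwartz_cmult[OF sS]] fourier_cmult fourier_sum[OF finite_atLeastAtMost_int sf] ..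
 have "0 = (LBINT y. P y * (fourier M y + (-1) * (\<Sum>m\<in>?I. fourier (?f m) y)))"
  using z unfolding D by (rule HOL.sym)
 also have "... = (LBINT y. P y * fourier M y - (\<Sum>m\<in>?I. P y * fourier (?f m) y))"
  by (intro LBINT_cong refl) (simp add: sum_distrib_left right_diff_distrib distrib_left sum_negf)
 also have "... = (LBINT y. P y * fourier M y) - (\<Sum>m\<in>?I. LBINT y. P y * fourier (?f m) y)"
  using iP[OF schwartz_fourier[OF M]] iP[OF schwartz_fourier[OF sf]]
  by (subst Bochner_Integration.integral_diff) (auto intro!: Bochner_Integration.integrable_sum simp: Bochner_Integration.integral_sum)
 finally show ?thesis by simp
qed

text \<open>What remains of \<open>phi\<close> once the window at m and the propagation by
  \<open>ta\<close> have been moved onto the test function.\<close>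

definition tst where
 "tst phi ta m = fourier (\<lambda>xi. of_real (\<sigma> (xi - of_int m)) * (cis (- (ta * xi\<^sup>2)) * inv_fourier phi xi))"

lemma tst_decay:
 assumes "schwartz phi" shows "\<exists>D\<ge>0. \<forall>m. \<forall>ta\<in>{-1..1}. decay D (tst phi ta m)"
proof -
 let ?I = "UNIV \<times> {-1..1} :: (int \<times> real) set"
 have "usch ?I (\<lambda>p xi. cis (- (snd p * xi\<^sup>2)) * inv_fourier phi xi)"
  by (intro usch_mult[OF umod_reindex[OF umod_propagator]] schwartz_imp_usch schwartz_inv_fourier assms) auto
 then have "usch ?I (\<lambda>p xi. of_real (\<sigma> (xi - of_int (fst p))) * (cis (- (snd p * xi\<^sup>2)) * inv_fourier phi xi))"
  by (intro usch_mult[OF umod_reindex[OF umod_\<sigma>]]) auto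
 from usch_decay[OF usch_fourier[OF this]] show ?thesis by (auto simp: tst_def)
qed

lemma propagated_decay:
 assumes "schwartz phi" shows "\<exists>D\<ge>0. \<forall>ta\<in>{-1..1}. decay D (fourier (\<lambda>xi. cis (- (ta * xi\<^sup>2)) * inv_fourier phi xi))"
 using usch_decay[OF usch_fourier[OF usch_propagator[OF schwartz_inv_fourier[OF assms], of 1]]] by simp

lemma propagated_measurable:
 assumes phi: "schwartz phi" and [measurable]: "f \<in> borel_measurable M" "g \<in> borel_measurable M"
 shows "(\<lambda>z. fourier (\<lambda>xi. cis (- (f z * xi\<^sup>2)) * inv_fourier phi xi) (g z)) \<in> borel_measurable M"
proof -
 note [measurable] = schwartz_measurable[OF schwartz_inv_fourier[OF phi]]
 show ?thesis unfolding fourier_def by measurable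
qed

lemma tst_measurable:
 assumes phi: "schwartz phi" and [measurable]: "f \<in> borel_measurable M" "g \<in> borel_measurable M"
 shows "(\<lambda>z. tst phi (f z) m (g z)) \<in> borel_measurable M"
proof -
 note [measurable] = schwartz_measurable[OF schwartz_inv_fourier[OF phi]] bump_measurable[OF bump_\<sigma>]
 show ?thesis unfolding tst_def fourier_def by measurable
qed

lemma Syn_integrable:
 assumes c: "fam q S c" and q: "1 <= q" and t: "t \<in> {-1..1}"
 shows "integrable (count_space UNIV) (\<lambda>k. piece c k t x)"
proof -
 obtain A where A: "\<And>k t. t \<in> {-1..1} ==> Bd q (A k) (c k t)" "integrable (count_space UNIV) A"
  using famE[OF c] by metis
 show ?thesis
 proof (rule integrable_boundI)
  show "integrable (count_space UNIV) (\<lambda>k. Kp * A k)" using A(2) by simp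
  show "AE k in count_space UNIV. norm (piece c k t x) <= norm (Kp * A k)"
  proof (rule AE_I2)
   fix k
   have "norm (piece c k t x) <= Kp * A k" by (rule Bd_le[OF piece_Bd[of q "A k" c k t, OF A(1)[OF t] q]])
   then show "norm (piece c k t x) <= norm (Kp * A k)" by simp
  qed
 qed simp
qed

text \<open>The absolutely convergent sum over all triples factorizes into the three synthesized
  functions.\<close>

lemma prod3_sum:
 assumes c: "fam q1 S1 c" and d: "fam q2 S2 d" and e: "fam q3 S3 e"
  and q: "1 <= q1" "1 <= q2" "1 <= q3" and s: "s \<in> {-1..1}"
 shows "(LC z. prod3 c d e z s y) = Syn c s y * cnj (Syn d s y) * Syn e s y"
proof -
 note ic = Syn_integrable[OF c q(1) s, of y] and id = Syn_integrable[OF d q(2) s, of y] and ie = Syn_integrable[OF e q(3) s, of y]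
 have idc: "integrable (count_space UNIV) (\<lambda>l. cnj (piece d l s y))" using id by simp
 note de = count_prod_integral[OF idc ie]
 have "(LC z. prod3 c d e z s y)
   = (LC p. (case p of (k, lj) => piece c k s y * (case lj of (l, j) => cnj (piece d l s y) * piece e j s y)))"
  by (intro LBINT_cong refl) (auto simp: prod3_def)
 also have "... = Syn c s y * (cnj (Syn d s y) * Syn e s y)"
  using count_prod_integral(2)[OF ic de(1)] unfolding de(2) by (simp add: Syn_def)
 finally show ?thesis by (simp add: mult.assoc)
qed

end

lemma schwartz_umod: assumes "schwartz m" shows "umod I (\<lambda>_. m)"
proof (rule umod_bounded_derivs)
 show "smooth m" by (rule schwartz_smooth[OF assms])
 fix b
 obtain C where "\<forall>x. \<bar>x\<bar> ^ 0 * norm ((dx ^^ b) m x) <= C"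
  using assms unfolding schwartz_iff_usch usch_def by blast
 then show "\<exists>C. \<forall>i\<in>I. \<forall>x. norm ((dx ^^ b) m x) <= C" by auto
qed

lemma schwartz_mult: assumes "schwartz phi" "schwartz \<psi>" shows "schwartz (\<lambda>x. phi x * \<psi> x)"
 using usch_mult[OF schwartz_umod[OF assms(1)], of "{()}" "\<lambda>_. \<psi>"] assms(2) by (simp add: schwartz_iff_usch)

context freq_window
begin

text \<open>Absolute summability, with 20\<rho> + 1 outputs per triple, permits summing over the
  output frequency first; \<open>near\<close> then leaves a finite sum.\<close>

lemma near_swap:
 fixes g :: "int => int \<times> int \<times> int => complex"
 assumes B: "\<And>z. 0 <= B z" "integrable (count_space UNIV) B" and g: "\<And>m z. norm (g m z) <= D * B z" and D: "0 <= D"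
 shows "(LC m. LC z. near m z * g m z)
  = (LC z. (\<Sum>m\<in>{\<kappa> z - 10 * int \<rho>..\<kappa> z + 10 * int \<rho>}. g m z))"
proof -
 let ?Z = "UNIV :: (int \<times> int \<times> int) set"
 have cs: "count_space UNIV \<Otimes>\<^sub>M count_space UNIV = (count_space UNIV :: (int \<times> int \<times> int \<times> int) measure)"
  using pair_measure_countable[of "UNIV :: int set" "?Z"] by simp
 interpret pair_sigma_finite "count_space (UNIV :: int set)" "count_space ?Z"
  by (simp add: pair_sigma_finite_def sigma_finite_measure_count_space)
 let ?F = "\<lambda>m z. near m z * g m z"
 have le: "norm (?F m z) <= D * (norm (near m z) * B z)" for m z
  unfolding norm_mult using mult_left_mono[OF g[of m z], of "norm (near m z)"] by (simp add: mult_ac)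
 have "(NC p. ennreal (norm (case p of (m, z) => ?F m z)))
  = (NC m. (NC z. ennreal (norm (?F m z))))"
  by (subst nn_integral_fst_count_space[symmetric]) simp
 also have "... <= (NC m. (NC z. ennreal D * ennreal (norm (near m z) * B z)))"
  using le D B(1) by (intro nn_integral_mono) (auto simp: ennreal_mult[symmetric] intro!: ennreal_leI)
 also have "... = ennreal D * (NC m. (NC z. ennreal (norm (near m z) * B z)))"
  by (simp add: nn_integral_cmult)
 also have "... = ennreal D * (ennreal (20 * \<rho> + 1) * (NC z. ennreal (B z)))"
  by (simp only: near_sum[OF B(1)])
 also have "... < \<infinity>"
  using nn_integral_eq_integral[OF B(2)] B(1) by (simp add: ennreal_mult_less_top)
 finally have "integrable (count_space UNIV) (\<lambda>(m, z). ?F m z)"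
  by (intro integrableI_bounded) auto
 then have i: "integrable (count_space UNIV \<Otimes>\<^sub>M count_space UNIV) (\<lambda>(m, z). ?F m z)" unfolding cs .
 have "(LC m. LC z. ?F m z) = (LC z. LC m. ?F m z)"
  using Fubini_integral[OF i] by simp
 also have "... = (LC z. (\<Sum>m\<in>{\<kappa> z - 10 * int \<rho>..\<kappa> z + 10 * int \<rho>}. g m z))"
 proof (intro LBINT_cong refl)
  fix z
  let ?I = "{\<kappa> z - 10 * int \<rho>..\<kappa> z + 10 * int \<rho>}"
  have sub: "{m. ?F m z \<noteq> 0} \<subseteq> ?I" by (auto simp: near_def)
  then have fin: "finite {m. ?F m z \<noteq> 0}" by (rule finite_subset) simp
  have "(LC m. ?F m z) = (\<Sum>m | ?F m z \<noteq> 0. ?F m z)"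
   by (subst lebesgue_integral_count_space_finite_support) (use fin in auto)
  also have "... = (\<Sum>m\<in>?I. ?F m z)" by (rule sum.mono_neutral_left) (use sub in auto)
  also have "... = (\<Sum>m\<in>?I. g m z)" by (intro sum.cong refl) (auto simp: near_def)
  finally show "(LC m. ?F m z) = (\<Sum>m\<in>?I. g m z)" .
 qed
 finally show ?thesis .
qed

text \<open>Reassembly at fixed times. After exchanging sums, all output windows near a given triple
  add up to the identity on its spectrum, and summing the triples restores the cubic
  product.\<close>

lemma T_represents_at:
 assumes c: "fam q1 S1 c" and d: "fam q2 S2 d" and e: "fam q3 S3 e" and q: "1 <= q1" "1 <= q2" "1 <= q3"
  and phi: "schwartz phi" and s: "s \<in> {-1..1}" and ta: "ta \<in> {-1..1}"
 shows "(LC m. LBINT y. Fm c d e m s y * tst phi ta m y)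
  = (LBINT y. Syn c s y * cnj (Syn d s y) * Syn e s y * fourier (\<lambda>xi. cis (- (ta * xi\<^sup>2)) * inv_fourier phi xi) y)"
proof -
 \<comment> \<open>Any admissible output exponent serves here, since only summable supremum bounds
   are extracted from the estimate.\<close>
 have q': "1 / q1 <= 1 / q1 + 1 / q2 + 1 / q3" using q by simp
 obtain B E where B0: "\<And>z. 0 <= B z" and Bi: "integrable (count_space UNIV) B"
  and PB: "\<And>z s. s \<in> {-1..1} ==> Bd q1 (B z) (prod3 c d e z s)"
  using fam3E[OF c d e q q(1) q'] by metis
 obtain D where D: "0 <= D" "\<And>m ta. ta \<in> {-1..1} ==> decay D (tst phi ta m)" using tst_decay[OF phi] by blast
 let ?\<psi> = "fourier (\<lambda>xi. cis (- (ta * xi\<^sup>2)) * inv_fourier phi xi)"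
 have sM: "schwartz (\<lambda>xi. cis (- (ta * xi\<^sup>2)) * inv_fourier phi xi)" by (rule schwartz_propagator[OF schwartz_inv_fourier[OF phi]])
 obtain D' where D': "decay D' ?\<psi>" using schwartz_decay[OF schwartz_fourier[OF sM]] by blast
 have mm: "measf c" "measf d" "measf e" using c d e fam_measf by auto
 note pm[measurable (raw)] = measfD[OF prod3_measf[OF mm]]
 note [measurable] = decay_measurable[OF D(2)[OF ta]] decay_measurable[OF D']
 have pb: "norm (prod3 c d e z s y) <= B z" for z y by (rule Bd_le[OF PB[OF s]])
 define g where "g m z = (LBINT y. prod3 c d e z s y * tst phi ta m y)" for m z
 have gb: "norm (g m z) <= (D * pi) * B z" for m z
 proof -
  have "norm (g m z) <= (LBINT y. B z * (D * cauchy y))"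
   unfolding g_def
   by (rule norm_integral_le)
     (auto simp: norm_mult intro!: AE_I2 mult_mono pb decayD[OF D(2)[OF ta]] B0)
  also have "... = (D * pi) * B z" by (simp add: integral_cauchy)
  finally show ?thesis .
 qed
 have "(LBINT y. Fm c d e m s y * tst phi ta m y) = (LC z. near m z * g m z)" for m
 proof -
  have "(LBINT y. Fm c d e m s y * tst phi ta m y)
   = (LBINT y. LC z. near m z * prod3 c d e z s y * tst phi ta m y)"
   unfolding Fm_def integral_mult_left_zero ..
  also have "... = (LC z. LBINT y. near m z * prod3 c d e z s y * tst phi ta m y)"
  proof (rule Fubini_product_bound(2)[OF sigma_finite_measure_count_space sigma_finite_lborel', symmetric])
   show "(\<lambda>(z, y). near m z * prod3 c d e z s y * tst phi ta m y) \<in> borel_measurable (count_space UNIV \<Otimes>\<^sub>M lborel)"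
    by (rule count_pair_measurable) measurable
   show "integrable (count_space UNIV) B" by (rule Bi)
   show "integrable lborel (\<lambda>y. D * cauchy y)" by simp
   fix z y
   have "norm (near m z * prod3 c d e z s y * tst phi ta m y) <= 1 * B z * (D * cauchy y)"
    unfolding norm_mult
    by (intro mult_mono pb decayD[OF D(2)[OF ta]] mult_nonneg_nonneg B0) (auto simp: near_def D(1))
   then show "norm (near m z * prod3 c d e z s y * tst phi ta m y) <= B z * (D * cauchy y)" by simp
  qed
  also have "... = (LC z. near m z * g m z)"
   unfolding g_def mult.assoc integral_mult_right_zero ..
  finally show ?thesis .
 qed
 then have "(LC m. LBINT y. Fm c d e m s y * tst phi ta m y)
  = (LC m. LC z. near m z * g m z)" by simp
 also have "... = (LC z. (\<Sum>m\<in>{\<kappa> z - 10 * int \<rho>..\<kappa> z + 10 * int \<rho>}. g m z))"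
  by (rule near_swap[OF B0 Bi gb]) (use D(1) in simp)
 also have "... = (LC z. LBINT y. prod3 c d e z s y * ?\<psi> y)"
 proof (intro LBINT_cong refl)
  fix z :: "int \<times> int \<times> int"
  obtain k l j where z: "z = (k, l, j)" by (cases z) auto
  obtain A1 where A1: "\<And>k t. t \<in> {-1..1} ==> Bd q1 (A1 k) (c k t)" using famE[OF c] by metis
  obtain A2 where A2: "\<And>k t. t \<in> {-1..1} ==> Bd q2 (A2 k) (d k t)" using famE[OF d] by metis
  obtain A3 where A3: "\<And>k t. t \<in> {-1..1} ==> Bd q3 (A3 k) (e k t)" using famE[OF e] by metis
  have "spec (of_int (\<kappa> z)) (9 * real \<rho>) (prod3 c d e z s)"
   unfolding z
   by (rule prod3_spec) (rule Bd_measurable[OF A1[OF s]] Bd_le[OF A1[OF s]] Bd_measurable[OF A2[OF s]] Bd_le[OF A2[OF s]]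
     Bd_measurable[OF A3[OF s]] Bd_le[OF A3[OF s]])+
  from window_sum_test[OF this sM]
  show "(\<Sum>m\<in>{\<kappa> z - 10 * int \<rho>..\<kappa> z + 10 * int \<rho>}. g m z) = (LBINT y. prod3 c d e z s y * ?\<psi> y)"
   by (simp add: g_def tst_def)
 qed
 also have "... = (LBINT y. LC z. prod3 c d e z s y * ?\<psi> y)"
 proof (rule Fubini_product_bound(2)[OF sigma_finite_measure_count_space sigma_finite_lborel'])
  show "(\<lambda>(z, y). prod3 c d e z s y * ?\<psi> y) \<in> borel_measurable (count_space UNIV \<Otimes>\<^sub>M lborel)"
   by (rule count_pair_measurable) measurable
  show "integrable (count_space UNIV) B" by (rule Bi)
  show "integrable lborel (\<lambda>y. norm (?\<psi> y))" by (rule integrable_norm[OF decay_integrable[OF D']])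
  show "norm (prod3 c d e z s y * ?\<psi> y) <= B z * norm (?\<psi> y)" for z y
   unfolding norm_mult by (intro mult_right_mono pb) auto
 qed
 also have "... = (LBINT y. Syn c s y * cnj (Syn d s y) * Syn e s y * ?\<psi> y)"
  unfolding integral_mult_left_zero prod3_sum[OF c d e q s] ..
 finally show ?thesis .
qed

text \<open>Justifies the definition of \<open>T\<close>: its synthesis is the distributional
  Duhamel term of the synthesized functions. All operators are moved onto \<open>phi\<close>, the
  sum over output frequencies is taken under the time integral, and the identity at fixed times is
  inserted.\<close>

lemma T_represents:
 assumes c: "fam q1 S1 c" and d: "fam q2 S2 d" and e: "fam q3 S3 e" and q: "1 <= q1" "1 <= q2" "1 <= q3"
  and phi: "schwartz phi" and t: "t \<in> {-1..1}"
 shows "(LBINT x. Syn (T c d e) t x * phi x) = N3 (Syn c) (Syn d) (Syn e) t phi"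
proof -
 have q': "1 / q1 <= 1 / q1 + 1 / q2 + 1 / q3" using q by simp
 obtain B E where E0: "\<And>m. 0 <= E m" and FB: "\<And>m s. s \<in> {-1..1} ==> Bd q1 (E m) (Fm c d e m s)"
  and Es: "(NC m. ennreal (E m)) <= ennreal ((20 * \<rho> + 1) * Kp ^ 3 * (S1 * S2 * S3))"
  using fam3E[OF c d e q q(1) q'] by metis
 have S0: "0 <= S1" "0 <= S2" "0 <= S3" using fam_nonneg c d e by auto
 have Ei: "integrable (count_space UNIV) E"
  by (rule nonneg_count_integrable[OF E0 Es]) (use S0 Kp_nonneg in auto)
 have TF: "fam q1 (CT * (S1 * S2 * S3)) (T c d e)" by (rule T_fam[OF c d e q q(1) q'])
 obtain A where TA: "\<And>k t. t \<in> {-1..1} ==> Bd q1 (A k) (T c d e k t)" "\<And>k. 0 <= A k" "integrable (count_space UNIV) A"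
  using famE[OF TF] by metis
 obtain D where D: "0 <= D" "\<And>m ta. ta \<in> {-1..1} ==> decay D (tst phi ta m)" using tst_decay[OF phi] by blast
 have mm: "measf c" "measf d" "measf e" using c d e fam_measf by auto
 let ?th = "\<lambda>m::int. fourier (\<lambda>xi. sym ta\<sigma> (of_int m) 0 xi * inv_fourier phi xi)"
 let ?ind = "\<lambda>s::real. indicator {-1..1} s :: real"
 have ind_i: "integrable lborel ?ind" by (rule integrable_real_indicator) auto
 have sg_ind: "norm (sg t s) <= ?ind s" for s
  using sg_range[of t s, OF _ t] norm_sg_le[of t s] by (cases "sg t s = 0") (auto simp: indicator_def)
 have sth0: "schwartz (\<lambda>xi. sym ta\<sigma> (of_int m) 0 xi * inv_fourier phi xi)" for m
  by (rule schwartz_mult[OF sym_schwartz[OF bump_ta\<sigma>] schwartz_inv_fourier[OF phi]])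
 have sth: "schwartz (?th m)" for m by (rule schwartz_fourier[OF sth0])
 note phim[measurable] = schwartz_measurable[OF phi]
 have step1: "(LBINT x. Syn (T c d e) t x * phi x) = (LC m. LBINT x. piece (T c d e) m t x * phi x)"
 proof -
  have "(LBINT x. Syn (T c d e) t x * phi x) = (LBINT x. LC m. piece (T c d e) m t x * phi x)"
   unfolding Syn_def integral_mult_left_zero ..
  also have "... = (LC m. LBINT x. piece (T c d e) m t x * phi x)"
  proof (rule Fubini_product_bound(2)[OF sigma_finite_measure_count_space sigma_finite_lborel', symmetric])
   show "(\<lambda>(m, x). piece (T c d e) m t x * phi x) \<in> borel_measurable (count_space UNIV \<Otimes>\<^sub>M lborel)"
    by (rule count_pair_measurable) (intro borel_measurable_times measfD[OF piece_measf[OF T_measf[OF mm]]]; measurable)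
   show "integrable (count_space UNIV) (\<lambda>m. Kp * A m)" using TA(3) by simp
   show "integrable lborel (\<lambda>x. norm (phi x))" by (rule integrable_norm[OF schwartz_integrable[OF phi]])
   fix m x
   show "norm (piece (T c d e) m t x * phi x) <= (Kp * A m) * norm (phi x)"
    unfolding norm_mult
    by (intro mult_right_mono Bd_le[OF piece_Bd[of q1 "A m" "T c d e" m t, OF TA(1)[OF t] q(1)]]) auto
  qed
  finally show ?thesis .
 qed
 have step2: "(LBINT x. piece (T c d e) m t x * phi x) = (LBINT s. (- \<i> * sg t s) * (LBINT y. Fm c d e m s y * tst phi (t - s) m y))" for m
 proof -
  obtain P where P: "decay P (?th m)" using schwartz_decay[OF sth] by blast
  note [measurable] = decay_measurable[OF P]
  have "(LBINT x. piece (T c d e) m t x * phi x) = (LBINT y. T c d e m t y * ?th m y)"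
   unfolding piece_def ker_def
   by (rule conv_pairing(1)[OF sym_schwartz[OF bump_ta\<sigma>] Bd_tame[OF TA(1)[OF t]] phi])
  also have "... = (LBINT y. LBINT s. ((- \<i> * sg t s) * conv (ker \<sigma> (of_int m) (t - s)) (Fm c d e m s) y) * ?th m y)"
   unfolding T_def integral_mult_left_zero ..
  also have "... = (LBINT s. LBINT y. ((- \<i> * sg t s) * conv (ker \<sigma> (of_int m) (t - s)) (Fm c d e m s) y) * ?th m y)"
  proof (rule Fubini_product_bound(2)[OF sigma_finite_lborel' sigma_finite_lborel', symmetric])
   note [measurable (raw)] = T_integrand_measurable[OF mm]
   have "(\<lambda>p. ((- \<i> * sg t (fst p)) * conv (ker \<sigma> (of_int m) (t - fst p)) (Fm c d e m (fst p)) (snd p)) * ?th m (snd p)) \<in> borel_measurable (lborel \<Otimes>\<^sub>M lborel)"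
    by (intro borel_measurable_times[of "\<lambda>p. ((- \<i> * sg t (fst p)) * conv (ker \<sigma> (of_int m) (t - fst p)) (Fm c d e m (fst p)) (snd p))"] T_integrand_measurable[OF mm]) measurable
   then show "(\<lambda>(s, y). ((- \<i> * sg t s) * conv (ker \<sigma> (of_int m) (t - s)) (Fm c d e m s) y) * ?th m y) \<in> borel_measurable (lborel \<Otimes>\<^sub>M lborel)"
    by (simp add: case_prod_beta')
   show "integrable lborel (\<lambda>s. ?ind s * (Kp * E m))" using ind_i by simp
   show "integrable lborel (\<lambda>y. norm (?th m y))" by (rule integrable_norm[OF decay_integrable[OF P]])
   fix s y
   show "norm (((- \<i> * sg t s) * conv (ker \<sigma> (of_int m) (t - s)) (Fm c d e m s) y) * ?th m y) <= ?ind s * (Kp * E m) * norm (?th m y)"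
   proof (cases "sg t s = 0")
    case True then show ?thesis using Kp_nonneg E0[of m] by simp
   next
    case False
    then have r: "s \<in> {-1..1}" "t - s \<in> {-1..1}" using sg_range[OF _ t] by auto
    have "norm (conv (ker \<sigma> (of_int m) (t - s)) (Fm c d e m s) y) <= Kp * E m"
     unfolding Kp_def by (rule Bd_le[OF Bd_conv[OF K\<^sub>0(2)[OF r(2)] FB[OF r(1)] q(1)]])
    then have "norm (sg t s) * norm (conv (ker \<sigma> (of_int m) (t - s)) (Fm c d e m s) y) <= ?ind s * (Kp * E m)"
     by (intro mult_mono sg_ind) auto
    then show ?thesis by (auto simp: norm_mult intro!: mult_right_mono)
   qed
  qed
  also have "... = (LBINT s. (- \<i> * sg t s) * (LBINT y. Fm c d e m s y * tst phi (t - s) m y))"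
  proof (intro LBINT_cong refl)
   fix s
   show "(LBINT y. ((- \<i> * sg t s) * conv (ker \<sigma> (of_int m) (t - s)) (Fm c d e m s) y) * ?th m y)
    = (- \<i> * sg t s) * (LBINT y. Fm c d e m s y * tst phi (t - s) m y)"
   proof (cases "sg t s = 0")
    case False
    then have r: "s \<in> {-1..1}" "t - s \<in> {-1..1}" using sg_range[OF _ t] by auto
    have "(LBINT y. conv (ker \<sigma> (of_int m) (t - s)) (Fm c d e m s) y * ?th m y)
     = (LBINT y. Fm c d e m s y * fourier (\<lambda>xi. sym \<sigma> (of_int m) (t - s) xi * inv_fourier (?th m) xi) y)"
     unfolding ker_def by (rule conv_pairing(1)[OF sym_schwartz[OF bump_\<sigma>] Bd_tame[OF FB[OF r(1)]] sth])
    \<comment> \<open>The synthesis window and the window of the propagated kernel multiply to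
      \<sigma> alone, so the enlarged window leaves no trace.\<close>
    also have "(\<lambda>xi. sym \<sigma> (of_int m) (t - s) xi * inv_fourier (?th m) xi)
     = (\<lambda>xi. of_real (\<sigma> (xi - of_int m)) * (cis (- ((t - s) * xi\<^sup>2)) * inv_fourier phi xi))"
    proof
     fix xi
     have ac: "(a * b) * (c * d) = (a * c) * (b * d)" for a b c d :: complex by (simp add: mult_ac)
     have "complex_of_real (\<sigma> (xi - of_int m)) * of_real (ta\<sigma> (xi - of_int m)) = of_real (\<sigma> (xi - of_int m))"
      using \<sigma>_mult_ta\<sigma>[of "xi - of_int m"] by (metis of_real_mult)
     then show "sym \<sigma> (of_int m) (t - s) xi * inv_fourier (?th m) xi = of_real (\<sigma> (xi - of_int m)) * (cis (- ((t - s) * xi\<^sup>2)) * inv_fourier phi xi)"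
      unfolding inv_fourier_fourier[OF sth0] unfolding sym_0 unfolding sym_def
      by (simp only: ac)
    qed
    finally have e: "(LBINT y. conv (ker \<sigma> (of_int m) (t - s)) (Fm c d e m s) y * ?th m y)
     = (LBINT y. Fm c d e m s y * tst phi (t - s) m y)" by (simp add: tst_def)
    have "(LBINT y. ((- \<i> * sg t s) * conv (ker \<sigma> (of_int m) (t - s)) (Fm c d e m s) y) * ?th m y)
     = (- \<i> * sg t s) * (LBINT y. conv (ker \<sigma> (of_int m) (t - s)) (Fm c d e m s) y * ?th m y)"
     by (simp only: mult.assoc integral_mult_right_zero)
    then show ?thesis unfolding e .
   qed simp
  qed
  finally show ?thesis .
 qed
 have Gb: "norm (LBINT y. Fm c d e m s y * tst phi ta m y) <= E m * (D * pi)" if "s \<in> {-1..1}" "ta \<in> {-1..1}" for m s ta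
 proof -
  note [measurable] = Bd_measurable[OF FB[OF that(1)]] decay_measurable[OF D(2)[OF that(2)]]
  have "norm (LBINT y. Fm c d e m s y * tst phi ta m y) <= (LBINT y. E m * (D * cauchy y))"
   by (rule norm_integral_le)
     (auto simp: norm_mult intro!: AE_I2 mult_mono Bd_le[OF FB[OF that(1)]] decayD[OF D(2)[OF that(2)]] E0)
  then show ?thesis by (simp add: integral_cauchy)
 qed
 have "(LBINT x. Syn (T c d e) t x * phi x)
  = (LC m. LBINT s. (- \<i> * sg t s) * (LBINT y. Fm c d e m s y * tst phi (t - s) m y))"
  unfolding step1 step2 ..
 also have "... = (LBINT s. LC m. (- \<i> * sg t s) * (LBINT y. Fm c d e m s y * tst phi (t - s) m y))"
 proof (rule Fubini_product_bound(2)[OF sigma_finite_measure_count_space sigma_finite_lborel'])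
  show "(\<lambda>(m, s). (- \<i> * sg t s) * (LBINT y. Fm c d e m s y * tst phi (t - s) m y)) \<in> borel_measurable (count_space UNIV \<Otimes>\<^sub>M lborel)"
  proof (rule count_pair_measurable)
   fix m
   note [measurable (raw)] = measfD[OF Fm_measf[OF mm]] tst_measurable[OF phi]
   show "(\<lambda>s. (- \<i> * sg t s) * (LBINT y. Fm c d e m s y * tst phi (t - s) m y)) \<in> borel_measurable lborel"
    by measurable
  qed
  show "integrable (count_space UNIV) (\<lambda>m. E m * (D * pi))" using Ei by simp
  show "integrable lborel ?ind" by (rule ind_i)
  fix m s
  show "norm ((- \<i> * sg t s) * (LBINT y. Fm c d e m s y * tst phi (t - s) m y)) <= E m * (D * pi) * ?ind s"
  proof (cases "sg t s = 0")
   case True then show ?thesis using D(1) E0[of m] by simp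
  next
   case False
   then have r: "s \<in> {-1..1}" "t - s \<in> {-1..1}" using sg_range[OF _ t] by auto
   have "norm (sg t s) * norm (LBINT y. Fm c d e m s y * tst phi (t - s) m y) <= ?ind s * (E m * (D * pi))"
    by (intro mult_mono sg_ind Gb r) auto
   then show ?thesis by (simp add: norm_mult mult.commute)
  qed
 qed
 also have "... = (LBINT s. (- \<i> * sg t s) * (LBINT y. Syn c s y * cnj (Syn d s y) * Syn e s y * fourier (\<lambda>xi. cis (- ((t - s) * xi\<^sup>2)) * inv_fourier phi xi) y))"
 proof (intro LBINT_cong refl)
  fix s
  show "(LC m. (- \<i> * sg t s) * (LBINT y. Fm c d e m s y * tst phi (t - s) m y))
   = (- \<i> * sg t s) * (LBINT y. Syn c s y * cnj (Syn d s y) * Syn e s y * fourier (\<lambda>xi. cis (- ((t - s) * xi\<^sup>2)) * inv_fourier phi xi) y)"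
  proof (cases "sg t s = 0")
   case False
   then have r: "s \<in> {-1..1}" "t - s \<in> {-1..1}" using sg_range[OF _ t] by auto
   show ?thesis unfolding integral_mult_right_zero T_represents_at[OF c d e q phi r] ..
  qed simp
 qed
 also have "... = - \<i> * (LBINT s. sg t s * (LBINT y. Syn c s y * cnj (Syn d s y) * Syn e s y * fourier (\<lambda>xi. cis (- ((t - s) * xi\<^sup>2)) * inv_fourier phi xi) y))"
  by (simp only: mult.assoc integral_mult_right_zero)
 also have "... = N3 (Syn c) (Syn d) (Syn e) t phi"
  unfolding N3_def interval_integral_sg schroedinger_def multiplier_def dist_inv_fourier_def dist_mult_def dist_fourier_def dist_of_def ..
 finally show ?thesis .
qed

end

section \<open>Almost orthogonality of the frequency pieces\<close>

lemma int_nn_integral_le: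
 fixes f :: "int => ennreal"
 assumes "\<And>n::nat. (\<Sum>k\<in>{-int n..int n}. f k) <= X"
 shows "(NC k. f k) <= X"
proof -
 let ?g = "\<lambda>n k. f k * indicator {-int n..int n} k"
 have sup: "(SUP n. ?g n k) = f k" for k
 proof (rule antisym)
  show "(SUP n. ?g n k) <= f k" by (rule SUP_least) (auto simp: indicator_def)
  have "f k = ?g (nat \<bar>k\<bar>) k" by (auto simp: indicator_def)
  also have "... <= (SUP n. ?g n k)" by (rule SUP_upper) simp
  finally show "f k <= (SUP n. ?g n k)" .
 qed
 have "(NC k. f k) = (NC k. (SUP n. ?g n k))" by (simp only: sup)
 also have "... = (SUP n. (NC k. ?g n k))"
  by (rule nn_integral_monotone_convergence_SUP)
    (auto simp: incseq_def le_fun_def indicator_def)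
 also have "... <= X"
 proof (rule SUP_least)
  fix n
  have "(NC k. ?g n k) = (\<integral>\<^sup>+k. f k \<partial>count_space {-int n..int n})"
   by (simp add: nn_integral_count_space_indicator)
  also have "... = (\<Sum>k\<in>{-int n..int n}. f k)" by (rule nn_integral_count_space_finite) simp
  also have "... <= X" by (rule assms)
  finally show "(NC k. ?g n k) <= X" .
 qed
 finally show ?thesis .
qed

lemma jbracket_ge_1: "1 <= jbracket x"
 by (simp add: jbracket_def)

lemma jbracket_powr: "jbracket x powr a = (1 + x\<^sup>2) powr (a / 2)"
proof -
 have "jbracket x = (1 + x\<^sup>2) powr (1 / 2)" by (simp add: jbracket_def powr_half_sqrt)
 then show ?thesis by (simp add: powr_powr)
qed

text \<open>Comparison with the p-series on each half line. Both the integral form and the bound for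
  finite partial sums are recorded with the same constant.\<close>

lemma jbracket_summable:
 assumes p: "1 < p"
 shows "\<exists>W\<ge>0. (NC k. ennreal (jbracket (of_int k) powr (- p))) <= ennreal W
   \<and> (\<forall>F. finite F --> (\<Sum>k\<in>F. jbracket (of_int k) powr (- p)) <= W)"
proof -
 let ?f = "\<lambda>k::int. jbracket (of_int k) powr (- p)"
 have s: "summable (\<lambda>n::nat. real n powr (- p))" using p by (subst summable_real_powr_iff) simp
 define W where "W = 2 * (1 + (\<Sum>n. real n powr (- p)))"
 have W0: "0 <= W" unfolding W_def using suminf_nonneg[OF s] by simp
 have fn: "?f (int n) <= real n powr (- p)" if "0 < n" for n
 proof (rule powr_mono2')
  show "real n <= jbracket (of_int (int n))" unfolding jbracket_def by (rule real_le_rsqrt) simp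
 qed (use p that in auto)
 have nat_sum: "(\<Sum>n\<le>N. ?f (int n)) <= 1 + (\<Sum>n. real n powr (- p))" for N
 proof -
  have "(\<Sum>n\<le>N. ?f (int n)) = ?f (int 0) + (\<Sum>n\<in>{1..N}. ?f (int n))"
   by (simp add: sum.atMost_shift sum.atLeast1_atMost_eq atMost_atLeast0 sum.atLeast_Suc_atMost)
  also have "... <= 1 + (\<Sum>n\<in>{1..N}. real n powr (- p))"
   by (intro add_mono sum_mono fn) (auto simp: jbracket_def)
  also have "(\<Sum>n\<in>{1..N}. real n powr (- p)) <= (\<Sum>n. real n powr (- p))"
   by (rule sum_le_suminf[OF s]) auto
  finally show ?thesis by simp
 qed
 have fin: "(\<Sum>k\<in>{-int N..int N}. ?f k) <= W" for N
 proof -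
  have sub: "{-int N..int N} \<subseteq> int ` {..N} \<union> (\<lambda>n. - int n) ` {..N}"
  proof
   fix k assume "k \<in> {-int N..int N}"
   then show "k \<in> int ` {..N} \<union> (\<lambda>n. - int n) ` {..N}"
    by (cases "0 <= k") (auto intro!: image_eqI[of _ _ "nat \<bar>k\<bar>"])
  qed
  have "(\<Sum>k\<in>{-int N..int N}. ?f k) <= (\<Sum>k\<in>int ` {..N} \<union> (\<lambda>n. - int n) ` {..N}. ?f k)"
   by (rule sum_mono2[OF _ sub]) auto
  also have "... <= (\<Sum>k\<in>int ` {..N}. ?f k) + (\<Sum>k\<in>(\<lambda>n. - int n) ` {..N}. ?f k)"
   by (subst sum.union_inter[symmetric]) (auto intro!: sum_nonneg)
  also have "... = 2 * (\<Sum>n\<le>N. ?f (int n))"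
   by (simp add: sum.reindex inj_on_def jbracket_def)
  also have "... <= W" unfolding W_def using nat_sum[of N] by simp
  finally show ?thesis .
 qed
 have "(NC k. ennreal (?f k)) <= ennreal W"
 proof (rule int_nn_integral_le)
  fix n show "(\<Sum>k\<in>{-int n..int n}. ennreal (?f k)) <= ennreal W"
   using fin[of n] by (subst sum_ennreal) (auto intro: ennreal_leI)
 qed
 moreover have "(\<Sum>k\<in>F. ?f k) <= W" if F: "finite F" for F
 proof -
  obtain N where "F \<subseteq> {-int N..int N}"
  proof
   show "F \<subseteq> {- int (\<Sum>k\<in>F. nat \<bar>k\<bar>)..int (\<Sum>k\<in>F. nat \<bar>k\<bar>)}"
   proof
    fix k assume k: "k \<in> F"
    have "nat \<bar>k\<bar> <= (\<Sum>k\<in>F. nat \<bar>k\<bar>)" by (rule member_le_sum[OF k]) (use F in auto)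
    then show "k \<in> {- int (\<Sum>k\<in>F. nat \<bar>k\<bar>)..int (\<Sum>k\<in>F. nat \<bar>k\<bar>)}"
     unfolding atLeastAtMost_iff by linarith
   qed
  qed
  then have "(\<Sum>k\<in>F. ?f k) <= (\<Sum>k\<in>{-int N..int N}. ?f k)" by (intro sum_mono2) auto
  then show ?thesis using fin[of N] by simp
 qed
 ultimately show ?thesis using W0 by blast
qed

text \<open>A derivative either lowers the power of x or lowers \<gamma> by 1 while raising the
  power by 1; in both cases the total order does not increase, so one weight dominates all
  derivatives.\<close>

lemma bessel_symbol_derivs:
 "\<exists>C. \<forall>x. norm ((dx ^^ b) (mono_symbol c j \<gamma> 0) x) <= C * (1 + x\<^sup>2) powr (\<gamma> + real j / 2)"
proof (induction b arbitrary: c j \<gamma>)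
 case 0
 have "norm (mono_symbol c j \<gamma> 0 x) <= norm c * (1 + x\<^sup>2) powr (\<gamma> + real j / 2)" for x
 proof -
  have "\<bar>x\<bar> <= (1 + x\<^sup>2) powr (1 / 2)" by (simp add: powr_half_sqrt real_le_rsqrt)
  then have "\<bar>x\<bar> ^ j <= ((1 + x\<^sup>2) powr (1 / 2)) ^ j" by (intro power_mono) auto
  also have "... = (1 + x\<^sup>2) powr (real j / 2)" by (subst powr_realpow[symmetric]) (auto simp: powr_powr)
  finally have "\<bar>x\<bar> ^ j * (1 + x\<^sup>2) powr \<gamma> <= (1 + x\<^sup>2) powr (real j / 2) * (1 + x\<^sup>2) powr \<gamma>"
   by (intro mult_right_mono) auto
  then have "norm c * (\<bar>x\<bar> ^ j * (1 + x\<^sup>2) powr \<gamma>) <= norm c * (1 + x\<^sup>2) powr (\<gamma> + real j / 2)"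
   by (intro mult_left_mono) (auto simp: powr_add mult.commute)
  then show ?thesis by (simp add: mono_symbol_def norm_mult norm_power mult.assoc)
 qed
 then show ?case by auto
next
 case (Suc b)
 let ?f1 = "mono_symbol (c * of_nat j) (j - 1) \<gamma> 0"
 let ?f2 = "mono_symbol (2 * of_real \<gamma> * c) (Suc j) (\<gamma> - 1) 0"
 obtain C1 where C1: "\<And>x. norm ((dx ^^ b) ?f1 x) <= C1 * (1 + x\<^sup>2) powr (\<gamma> + real (j - 1) / 2)" using Suc by blast
 obtain C2 where C2: "\<And>x. norm ((dx ^^ b) ?f2 x) <= C2 * (1 + x\<^sup>2) powr ((\<gamma> - 1) + real (Suc j) / 2)" using Suc by blast
 have sm: "smooth (mono_symbol c j \<gamma> 0)" for c j \<gamma>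
  using mono_symbol_umod[of "{()}" "\<lambda>_. c" "norm c" "\<lambda>_. 0" 0 j \<gamma>] by (auto dest: umod_smooth)
 have e: "dx (mono_symbol c j \<gamma> 0) = (\<lambda>x. ?f1 x + ?f2 x)"
 proof (rule dx_eqI)
  fix x show "(mono_symbol c j \<gamma> 0 has_vector_derivative ?f1 x + ?f2 x) (at x)"
   using mono_symbol_deriv[of c j \<gamma> 0 x] by (simp add: mono_symbol_def[of 0])
 qed
 have "norm ((dx ^^ Suc b) (mono_symbol c j \<gamma> 0) x) <= (\<bar>C1\<bar> + \<bar>C2\<bar>) * (1 + x\<^sup>2) powr (\<gamma> + real j / 2)" for x
 proof -
  have p: "(1 + x\<^sup>2) powr a <= (1 + x\<^sup>2) powr (\<gamma> + real j / 2)" if "a <= \<gamma> + real j / 2" for a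
   using that by (intro powr_mono) auto
  have "norm ((dx ^^ Suc b) (mono_symbol c j \<gamma> 0) x) <= norm ((dx ^^ b) ?f1 x) + norm ((dx ^^ b) ?f2 x)"
   unfolding dx_funpow_Suc e dx_funpow_add[OF sm sm] by (rule norm_triangle_ineq)
  also have "... <= C1 * (1 + x\<^sup>2) powr (\<gamma> + real (j - 1) / 2) + C2 * (1 + x\<^sup>2) powr ((\<gamma> - 1) + real (Suc j) / 2)"
   by (intro add_mono C1 C2)
  also have "... <= \<bar>C1\<bar> * (1 + x\<^sup>2) powr (\<gamma> + real j / 2) + \<bar>C2\<bar> * (1 + x\<^sup>2) powr (\<gamma> + real j / 2)"
  proof (rule add_mono)
   show "C1 * (1 + x\<^sup>2) powr (\<gamma> + real (j - 1) / 2) <= \<bar>C1\<bar> * (1 + x\<^sup>2) powr (\<gamma> + real j / 2)"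
    by (rule mult_mono) (auto intro!: powr_mono)
   show "C2 * (1 + x\<^sup>2) powr ((\<gamma> - 1) + real (Suc j) / 2) <= \<bar>C2\<bar> * (1 + x\<^sup>2) powr (\<gamma> + real j / 2)"
    by (rule mult_mono) (auto intro!: powr_mono simp: field_simps)
  qed
  finally show ?thesis by (simp add: distrib_right)
 qed
 then show ?case by blast
qed

text \<open>Two integrations by parts: the weight and its second derivative are integrable, which
  bounds the transform by a multiple of 1 / (1 + a^2).\<close>

lemma cauchy_fourier_decay: "\<exists>C\<ge>0. \<forall>a. norm (ft 1 (\<lambda>x. of_real (cauchy x)) a) <= C * jbracket a powr (- 2)"
proof -
 let ?f = "mono_symbol 1 0 (-1) 0"
 have f: "?f = (\<lambda>x. of_real (cauchy x))"
  by (simp add: mono_symbol_def fun_eq_iff cauchy_def powr_minus powr_one inverse_eq_divide)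
 have sm: "smooth ?f" using mono_symbol_umod[of "{()}" "\<lambda>_. 1" 1 "\<lambda>_. 0" 0 0 "-1"] by (auto dest: umod_smooth)
 have dec: "\<exists>C. decay C ((dx ^^ b) ?f)" for b
 proof -
  obtain C where "\<And>x. norm ((dx ^^ b) ?f x) <= C * (1 + x\<^sup>2) powr (-1 + real 0 / 2)" using bessel_symbol_derivs by blast
  then have "decay C ((dx ^^ b) ?f)"
   using smooth_measurable[OF smooth_dx_funpow[OF sm]]
   by (simp add: decay_def cauchy_def powr_minus powr_one inverse_eq_divide)
  then show ?thesis by blast
 qed
 obtain C0 where C0: "decay C0 ?f" using dec[of 0] by auto
 obtain C1 where C1: "decay C1 (dx ?f)" using dec[of 1] by auto
 obtain C2 where C2: "decay C2 (dx (dx ?f))" using dec[of 2] by (auto simp: numeral_2_eq_2)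
 have ic: "isCont (dx g) x" if "smooth g" for g :: "real => complex" and x
  using smooth_has_dx[OF smooth_dx[OF that]] has_vector_derivative_continuous by blast
 have 1: "ft 1 (dx ?f) a = - (\<i> * of_real 1 * of_real a * ft 1 ?f a)" for a
  by (rule ft_of_derivative[OF smooth_has_dx[OF sm] ic[OF sm] C0 C1])
 have 2: "ft 1 (dx (dx ?f)) a = - (\<i> * of_real 1 * of_real a * ft 1 (dx ?f) a)" for a
  by (rule ft_of_derivative[OF smooth_has_dx[OF smooth_dx[OF sm]] ic[OF smooth_dx[OF sm]] C1 C2])
 have "norm (ft 1 ?f a) <= (C0 * pi + C2 * pi) * jbracket a powr (- 2)" for a
 proof -
  have "norm (ft 1 (dx (dx ?f)) a) = \<bar>a\<bar> * (\<bar>a\<bar> * norm (ft 1 ?f a))"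
   unfolding 2 1 by (simp add: norm_mult)
  then have "(1 + a\<^sup>2) * norm (ft 1 ?f a) = norm (ft 1 ?f a) + norm (ft 1 (dx (dx ?f)) a)"
   by (simp add: distrib_right power2_eq_square)
  also have "... <= C0 * pi + C2 * pi" by (intro add_mono ft_bound C0 C2)
  finally show ?thesis
   by (simp add: jbracket_powr powr_minus powr_one divide_inverse[symmetric] pos_le_divide_eq mult.commute)
 qed
 moreover have "0 <= C0 * pi + C2 * pi" using decay_nonneg[OF C0] decay_nonneg[OF C2] by simp
 ultimately show ?thesis unfolding f by blast
qed

text \<open>Exponentials with integer frequencies are almost orthogonal in L^2 with the Cauchy
  weight: their Gram matrix decays like the inverse square of the frequency difference and is
  bounded on square-summable sequences by Schur's test. The estimate is the dual statement.\<close>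

lemma Bessel_inequality:
 obtains C where "0 <= C" "\<And>(F :: int set) h. finite F ==> integrable lborel h ==> integrable lborel (\<lambda>z. (1 + z\<^sup>2) * (norm (h z))\<^sup>2) ==>
  (\<Sum>k\<in>F. (norm (LBINT z. cis (of_int k * z) * h z))\<^sup>2) <= C * (LBINT z. (1 + z\<^sup>2) * (norm (h z))\<^sup>2)"
proof -
 obtain C' where C': "0 <= C'" "\<And>a. norm (ft 1 (\<lambda>x. of_real (cauchy x)) a) <= C' * jbracket a powr (- 2)"
  using cauchy_fourier_decay by blast
 obtain W where W: "0 <= W" "\<And>F. finite F ==> (\<Sum>k\<in>F. jbracket (of_int k) powr (- 2)) <= W"
  using jbracket_summable[of 2] by auto
 define C where "C = C' * W + 1"
 have C: "0 < C" using C'(1) W(1) by (simp add: C_def add_nonneg_pos)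
 have main: "(\<Sum>k\<in>F. (norm (LBINT z. cis (of_int k * z) * h z))\<^sup>2) <= C * (LBINT z. (1 + z\<^sup>2) * (norm (h z))\<^sup>2)"
  if F: "finite (F :: int set)" and h: "integrable lborel h" and h2: "integrable lborel (\<lambda>z. (1 + z\<^sup>2) * (norm (h z))\<^sup>2)" for F h
 proof -
  have [measurable]: "h \<in> borel_measurable borel" using borel_measurable_integrable[OF h] by simp
  define c where "c k = (LBINT z. cis (of_int k * z) * h z)" for k :: int
  \<comment> \<open>The dual trigonometric polynomial: pairing it with \<open>h\<close> yields the
    sum of squared coefficients.\<close>
  define D where "D z = (\<Sum>k\<in>F. cnj (c k) * cis (of_int k * z))" for z
  have [measurable]: "D \<in> borel_measurable borel" unfolding D_def by measurable
  let ?S = "\<Sum>k\<in>F. (norm (c k))\<^sup>2"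
  let ?H = "LBINT z. (1 + z\<^sup>2) * (norm (h z))\<^sup>2"
  have ch: "integrable lborel (\<lambda>z. cis (of_int k * z) * h z)" for k :: int
   by (rule integrable_boundI[OF h]) (auto simp: norm_mult)
  have Db: "norm (D z) <= (\<Sum>k\<in>F. norm (c k))" for z
   unfolding D_def by (rule order_trans[OF norm_sum]) (simp add: norm_mult)
  have iD2: "integrable lborel (\<lambda>z. (norm (D z))\<^sup>2 * cauchy z)"
  proof (rule integrable_boundI)
   show "integrable lborel (\<lambda>z. (\<Sum>k\<in>F. norm (c k))\<^sup>2 * cauchy z)" by simp
   show "AE z in lborel. norm ((norm (D z))\<^sup>2 * cauchy z) <= norm ((\<Sum>k\<in>F. norm (c k))\<^sup>2 * cauchy z)"
    using Db by (auto intro!: AE_I2 mult_right_mono power_mono simp: abs_mult)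
  qed measurable
  have S: "complex_of_real ?S = (LBINT z. D z * h z)"
  proof -
   have "(LBINT z. D z * h z) = (LBINT z. (\<Sum>k\<in>F. cnj (c k) * (cis (of_int k * z) * h z)))"
    by (intro LBINT_cong refl) (simp add: D_def sum_distrib_right mult.assoc)
   also have "... = (\<Sum>k\<in>F. cnj (c k) * c k)"
    unfolding c_def by (subst Bochner_Integration.integral_sum) (use ch in auto)
   also have "... = complex_of_real ?S"
    by (simp add: complex_norm_square mult.commute del: of_real_power)
   finally show ?thesis ..
  qed
  \<comment> \<open>Schur's test in symmetric form: the product of two coefficients is at most half
    the sum of their squares, and each row of the Gram matrix sums to at most C' W.\<close>
  have D2: "(LBINT z. (norm (D z))\<^sup>2 * cauchy z) <= C * ?S"
  proof -
   let ?w = "\<lambda>a. ft 1 (\<lambda>x. of_real (cauchy x)) a"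
   have icc: "integrable lborel (\<lambda>z. cis (1 * (z * a)) * complex_of_real (cauchy z))" for a
    by (rule integrable_boundI[OF integrable_cauchy]) (auto simp: norm_mult)
   have "complex_of_real (LBINT z. (norm (D z))\<^sup>2 * cauchy z)
    = (LBINT z. (\<Sum>k\<in>F. \<Sum>l\<in>F. (cnj (c k) * c l) * (cis (1 * (z * of_int (k - l))) * complex_of_real (cauchy z))))"
   proof (subst integral_complex_of_real[symmetric], intro LBINT_cong refl)
    fix z
    have "complex_of_real ((norm (D z))\<^sup>2 * cauchy z) = D z * cnj (D z) * complex_of_real (cauchy z)"
     by (simp add: complex_norm_square del: of_real_power)
    also have "D z * cnj (D z) = (\<Sum>k\<in>F. \<Sum>l\<in>F. (cnj (c k) * cis (of_int k * z)) * (c l * cis (- (of_int l * z))))"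
     unfolding D_def by (simp add: sum_product cis_cnj)
    also have "... = (\<Sum>k\<in>F. \<Sum>l\<in>F. (cnj (c k) * c l) * cis (1 * (z * of_int (k - l))))"
    proof (intro sum.cong refl)
     fix k l
     have "cis (of_int k * z) * cis (- (of_int l * z)) = cis (1 * (z * of_int (k - l)))"
      unfolding cis_mult by (rule arg_cong[where f = cis]) (simp add: algebra_simps)
     then show "(cnj (c k) * cis (of_int k * z)) * (c l * cis (- (of_int l * z))) = (cnj (c k) * c l) * cis (1 * (z * of_int (k - l)))"
      by (metis (no_types, lifting) mult.assoc mult.commute)
    qed
    finally show "complex_of_real ((norm (D z))\<^sup>2 * cauchy z)
     = (\<Sum>k\<in>F. \<Sum>l\<in>F. (cnj (c k) * c l) * (cis (1 * (z * of_int (k - l))) * complex_of_real (cauchy z)))"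
     by (simp add: sum_distrib_right mult.assoc)
   qed
   also have "... = (\<Sum>k\<in>F. \<Sum>l\<in>F. (cnj (c k) * c l) * ?w (of_int (k - l)))"
    unfolding ft_def
    by (subst Bochner_Integration.integral_sum, intro Bochner_Integration.integrable_sum integrable_mult_right icc,
      intro sum.cong refl, subst Bochner_Integration.integral_sum, intro integrable_mult_right icc, simp)
   finally have "(LBINT z. (norm (D z))\<^sup>2 * cauchy z) = Re (\<Sum>k\<in>F. \<Sum>l\<in>F. (cnj (c k) * c l) * ?w (of_int (k - l)))"
    by (metis Re_complex_of_real)
   also have "... <= norm (\<Sum>k\<in>F. \<Sum>l\<in>F. (cnj (c k) * c l) * ?w (of_int (k - l)))" by (rule complex_Re_le_cmod)
   also have "... <= (\<Sum>k\<in>F. \<Sum>l\<in>F. norm (c k) * norm (c l) * (C' * jbracket (of_int (k - l)) powr (- 2)))"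
    by (intro order_trans[OF norm_sum] sum_mono) (auto simp: norm_mult simp del: of_int_diff intro!: mult_left_mono C'(2))
   also have "... <= (\<Sum>k\<in>F. \<Sum>l\<in>F. ((norm (c k))\<^sup>2 / 2 + (norm (c l))\<^sup>2 / 2) * (C' * jbracket (of_int (k - l)) powr (- 2)))"
   proof (intro sum_mono mult_right_mono)
    fix k l
    have "0 <= (norm (c k) - norm (c l))\<^sup>2" by simp
    then show "norm (c k) * norm (c l) <= (norm (c k))\<^sup>2 / 2 + (norm (c l))\<^sup>2 / 2"
     by (simp add: power2_eq_square algebra_simps)
   qed (use C'(1) in auto)
   also have "... = (\<Sum>k\<in>F. (norm (c k))\<^sup>2 * (C' * (\<Sum>l\<in>F. jbracket (of_int (k - l)) powr (- 2))))"
   proof -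
    have sy: "jbracket (of_int (k - l)) = jbracket (of_int (l - k))" for k l :: int
     by (simp add: jbracket_def power2_commute)
    have "(\<Sum>k\<in>F. \<Sum>l\<in>F. (norm (c l))\<^sup>2 / 2 * (C' * jbracket (of_int (k - l)) powr (- 2)))
     = (\<Sum>k\<in>F. \<Sum>l\<in>F. (norm (c k))\<^sup>2 / 2 * (C' * jbracket (of_int (k - l)) powr (- 2)))"
     by (subst sum.swap) (simp only: sy)
    then show ?thesis
     by (simp add: distrib_right sum.distrib sum_distrib_left[symmetric] sum_divide_distrib[symmetric] mult.assoc)
   qed
   also have "... <= (\<Sum>k\<in>F. (norm (c k))\<^sup>2 * C)"
   proof (intro sum_mono mult_left_mono)
    fix k
    have "(\<Sum>l\<in>F. jbracket (of_int (k - l)) powr (- 2)) = (\<Sum>j\<in>(\<lambda>l. k - l) ` F. jbracket (of_int j) powr (- 2))"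
     by (subst sum.reindex) (auto simp: inj_on_def)
    also have "... <= W" by (rule W(2)) (use F in simp)
    finally have "C' * (\<Sum>l\<in>F. jbracket (of_int (k - l)) powr (- 2)) <= C' * W" by (intro mult_left_mono C'(1))
    then show "C' * (\<Sum>l\<in>F. jbracket (of_int (k - l)) powr (- 2)) <= C" by (simp add: C_def)
   qed simp
   finally show ?thesis by (simp add: sum_distrib_left mult.commute)
  qed
  \<comment> \<open>A weighted inequality between the two means, balanced so that after integration
    the polynomial contributes exactly half of the sum of squares, which is then absorbed on the
    left.\<close>
  have pt: "norm (D z * h z) <= (norm (D z))\<^sup>2 * cauchy z / (2 * C) + C / 2 * ((1 + z\<^sup>2) * (norm (h z))\<^sup>2)" for z
  proof -
   define u where "u = norm (D z)"
   define v where "v = (1 + z\<^sup>2) * norm (h z)"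
   have cz: "cauchy z * (1 + z\<^sup>2) = 1" by (simp add: cauchy_def)
   have "0 <= cauchy z * (u - C * v)\<^sup>2 / (2 * C)" using C by (simp add: divide_nonneg_pos)
   also have "... = u\<^sup>2 * cauchy z / (2 * C) - cauchy z * u * v + C / 2 * (cauchy z * v\<^sup>2)"
    using C by (simp add: power2_eq_square field_simps)
   also have "cauchy z * u * v = (cauchy z * (1 + z\<^sup>2)) * (norm (D z) * norm (h z))" by (simp add: u_def v_def)
   also have "cauchy z * v\<^sup>2 = (cauchy z * (1 + z\<^sup>2)) * ((1 + z\<^sup>2) * (norm (h z))\<^sup>2)" by (simp add: v_def power2_eq_square)
   finally show ?thesis unfolding cz by (simp add: u_def norm_mult)
  qed
  have "?S <= norm (LBINT z. D z * h z)"
   using S[symmetric] by (simp del: of_real_sum of_real_power)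
  also have "... <= (LBINT z. (norm (D z))\<^sup>2 * cauchy z / (2 * C) + C / 2 * ((1 + z\<^sup>2) * (norm (h z))\<^sup>2))"
   by (rule norm_integral_le[OF _ AE_I2[OF pt]]) (use iD2 h2 in auto)
  also have "... = (LBINT z. (norm (D z))\<^sup>2 * cauchy z) / (2 * C) + C / 2 * ?H"
   using iD2 h2 by simp
  also have "... <= C * ?S / (2 * C) + C / 2 * ?H"
   using D2 C by (intro add_right_mono divide_right_mono) auto
  also have "... = ?S / 2 + C / 2 * ?H" using C by simp
  finally have "?S <= C * ?H" by simp
  then show ?thesis by (simp add: c_def)
 qed
 show thesis by (rule that[OF less_imp_le[OF C] main])
qed

section \<open>From the data norms to summable families\<close>

lemma tame_reflect: assumes "tame c" shows "tame (\<lambda>z. c (x - z))"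
proof -
 obtain B h where h: "integrable lborel h" "\<And>y. norm (c y) <= B + h y" using assms unfolding tame_def by blast
 note [measurable] = tame_measurable[OF assms]
 have "integrable lborel (\<lambda>z. h (x + (-1) * z))" using h(1) lborel_integrable_real_affine_iff[of "-1" h x] by simp
 then show ?thesis unfolding tame_def using h(2) by (intro conjI exI[of _ B] exI[of _ "\<lambda>z. h (x - z)"]) auto
qed

text \<open>Each term is at most the total, so all but one power of a term can be replaced by the
  total.\<close>

lemma sum_powr_le:
 fixes x :: "'k => real"
 assumes p: "1 <= p" and F: "finite F" and x: "\<And>k. 0 <= x k"
 shows "(\<Sum>k\<in>F. x k powr p) <= (\<Sum>k\<in>F. x k) powr p"
proof (cases "(\<Sum>k\<in>F. x k) = 0")
 case True
 then have "\<forall>k\<in>F. x k = 0" using F x by (simp add: sum_nonneg_eq_0_iff)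
 then show ?thesis using p by (simp add: sum.neutral)
next
 case False
 define S where "S = (\<Sum>k\<in>F. x k)"
 have S: "0 < S" using False x by (simp add: S_def less_le sum_nonneg)
 have "(\<Sum>k\<in>F. x k powr p) <= (\<Sum>k\<in>F. x k * S powr (p - 1))"
 proof (rule sum_mono)
  fix k assume k: "k \<in> F"
  have le: "x k <= S" unfolding S_def by (rule member_le_sum[OF k]) (use x F in auto)
  show "x k powr p <= x k * S powr (p - 1)"
  proof (cases "x k = 0")
   case False
   then have xk: "0 < x k" using x[of k] by simp
   have "x k powr p = x k * x k powr (p - 1)" using xk by (simp add: powr_diff)
   also have "... <= x k * S powr (p - 1)" using xk le p by (intro mult_left_mono powr_mono2) auto
   finally show ?thesis .
  qed (use p in simp)
 qed
 also have "... = S * S powr (p - 1)" by (simp add: S_def sum_distrib_right)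
 also have "... = S powr p" using S by (simp add: powr_diff)
 finally show ?thesis by (simp add: S_def)
qed

lemma representsD: "represents g T ==> schwartz phi ==> T phi = dist_of g phi"
 by (simp add: represents_def)

lemma inv_fourier_cmult: "inv_fourier (\<lambda>xi. c * G xi) x = c * inv_fourier G x"
proof -
 have "(LBINT xi. cis (x * xi) * (c * G xi)) = (LBINT xi. c * (cis (x * xi) * G xi))"
  by (intro LBINT_cong refl) simp
 also have "... = c * (LBINT xi. cis (x * xi) * G xi)" by (rule integral_mult_right_zero)
 finally show ?thesis by (simp add: inv_fourier_def)
qed

lemma inv_fourier_shift: "inv_fourier (\<lambda>xi. G (xi - k)) x = cis (k * x) * inv_fourier G x"
proof -
 have "(LBINT xi. cis (x * xi) * G (xi - k)) = \<bar>1\<bar> *\<^sub>R (LBINT eta. cis (x * (k + 1 * eta)) * G ((k + 1 * eta) - k))"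
  by (rule lborel_integral_real_affine) simp
 also have "... = (LBINT eta. cis (k * x) * (cis (x * eta) * G eta))"
 proof -
  have "cis (x * (k + eta)) = cis (k * x) * cis (x * eta)" for eta
   unfolding cis_mult by (rule arg_cong[where f = cis]) (simp add: algebra_simps)
  then show ?thesis by (simp add: mult.assoc)
 qed
 also have "... = cis (k * x) * (LBINT eta. cis (x * eta) * G eta)" by (rule integral_mult_right_zero)
 finally show ?thesis by (simp add: inv_fourier_def)
qed

lemma peetre: "1 + (k::real)\<^sup>2 <= 2 * (1 + (eta + k)\<^sup>2) * (1 + eta\<^sup>2)"
proof -
 have "k\<^sup>2 <= 2 * (eta + k)\<^sup>2 + 2 * eta\<^sup>2"
  using zero_le_power2[of "2 * eta + k"] by (simp add: power2_eq_square algebra_simps)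
 moreover have "0 <= (eta + k)\<^sup>2 * eta\<^sup>2" by simp
 ultimately have "1 + k\<^sup>2 <= 2 + 2 * (eta + k)\<^sup>2 + 2 * eta\<^sup>2 + 2 * ((eta + k)\<^sup>2 * eta\<^sup>2)" by linarith
 also have "... = 2 * (1 + (eta + k)\<^sup>2) * (1 + eta\<^sup>2)" by (simp add: algebra_simps)
 finally show ?thesis .
qed

text \<open>Peetre's inequality bounds the Bessel symbol at \<eta> + k, normalized by its size at k,
  by a polynomial in \<eta> independent of k. The derivatives obey the same bound.\<close>

lemma bessel_shift_umod:
 assumes beta: "0 <= beta"
 shows "umod UNIV (\<lambda>k::int. \<lambda>eta. of_real (jbracket (of_int k) powr beta) * mono_symbol 1 0 (- beta / 2) 0 (eta - (- of_int k)))"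
 unfolding umod_def
proof (intro conjI allI ballI)
 let ?h = "mono_symbol 1 0 (- beta / 2) 0"
 have sm: "smooth ?h" using mono_symbol_umod[of "{()}" "\<lambda>_. 1" 1 "\<lambda>_. 0" 0 0 "- beta / 2"] by (auto dest: umod_smooth)
 fix k :: int
 show "smooth (\<lambda>eta. of_real (jbracket (of_int k) powr beta) * ?h (eta - (- of_int k)))"
  by (intro smooth_mult smooth_const smooth_shift sm)
next
 let ?h = "mono_symbol 1 0 (- beta / 2) 0"
 have sm: "smooth ?h" using mono_symbol_umod[of "{()}" "\<lambda>_. 1" 1 "\<lambda>_. 0" 0 0 "- beta / 2"] by (auto dest: umod_smooth)
 fix b
 obtain C where C: "\<And>x. norm ((dx ^^ b) ?h x) <= C * (1 + x\<^sup>2) powr (- beta / 2 + real 0 / 2)" using bessel_symbol_derivs by blast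
 have C0: "0 <= C" using order_trans[OF norm_ge_zero C[of 0]] by simp
 obtain M N where M: "\<forall>i\<in>{()}. \<forall>x. norm ((dx ^^ 0) (mono_symbol 1 0 (beta / 2) 0) x) <= M * (1 + \<bar>x\<bar> ^ N)"
 proof -
  have "umod {()} (\<lambda>_. mono_symbol 1 0 (beta / 2) 0)"
   by (rule mono_symbol_umod[of "{()}" "\<lambda>_. 1" 1 "\<lambda>_. 0" 0 0 "beta / 2"]) auto
  then show ?thesis using that unfolding umod_def by blast
 qed
 have "norm ((dx ^^ b) (\<lambda>eta. of_real (jbracket (of_int k) powr beta) * ?h (eta - (- of_int k))) eta)
   <= C * 2 powr (beta / 2) * M * (1 + \<bar>eta\<bar> ^ N)" for k :: int and eta
 proof -
  let ?J = "jbracket (of_int k) powr beta"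
  have e: "(dx ^^ b) (\<lambda>eta. of_real ?J * ?h (eta - (- of_int k))) = (\<lambda>eta. of_real ?J * (dx ^^ b) ?h (eta - (- of_int k)))"
  proof (induction b)
   case (Suc b)
   have "dx (\<lambda>eta. of_real ?J * (dx ^^ b) ?h (eta - (- of_int k))) = (\<lambda>eta. of_real ?J * dx ((dx ^^ b) ?h) (eta - (- of_int k)))"
    by (rule dx_eqI) (rule has_vector_derivative_mult_right, rule has_vector_derivative_shift, rule smooth_has_dx[OF smooth_dx_funpow[OF sm]])
   then show ?case using Suc by simp
  qed simp
  define u where "u = 1 + (eta + of_int k)\<^sup>2"
  have u: "0 < u" by (simp add: u_def)
  have "norm ((dx ^^ b) (\<lambda>eta. of_real ?J * ?h (eta - (- of_int k))) eta) <= ?J * (C * u powr (- beta / 2))"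
   unfolding e using C[of "eta - (- of_int k)"] by (auto simp: norm_mult u_def intro!: mult_left_mono)
  also have "?J = (1 + (of_int k)\<^sup>2) powr (beta / 2)" by (rule jbracket_powr)
  also have "... * (C * u powr (- beta / 2)) <= (2 * u * (1 + eta\<^sup>2)) powr (beta / 2) * (C * u powr (- beta / 2))"
   using peetre[of "of_int k" eta] beta C0 by (intro mult_right_mono powr_mono2) (auto simp: u_def)
  also have "... = C * 2 powr (beta / 2) * (1 + eta\<^sup>2) powr (beta / 2) * (u powr (beta / 2) * u powr (- beta / 2))"
   using u by (simp add: powr_mult)
  also have "u powr (beta / 2) * u powr (- beta / 2) = 1" using u by (simp add: powr_add[symmetric])
  also have "C * 2 powr (beta / 2) * (1 + eta\<^sup>2) powr (beta / 2) * 1 <= C * 2 powr (beta / 2) * (M * (1 + \<bar>eta\<bar> ^ N))"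
   using M C0 by (auto simp: mono_symbol_def intro!: mult_left_mono)
  finally show ?thesis by (simp add: mult.assoc jbracket_powr)
 qed
 then show "\<exists>C N. \<forall>i\<in>UNIV. \<forall>x. norm ((dx ^^ b) (\<lambda>eta. of_real (jbracket (of_int i) powr beta) * ?h (eta - (- of_int i))) x) <= C * (1 + \<bar>x\<bar> ^ N)"
  by blast
qed

text \<open>A strict bound on the infimum produces an actual representing function. Without one the
  infimum would be infinite.\<close>

lemma dist_Lnorm_lessE:
 assumes lt: "dist_Lnorm r T < ennreal A" and r: "0 < r"
 obtains g where "represents g T" "Lq r A g"
proof -
 obtain g where g: "represents g T" and L: "Lnorm (ennreal r) lborel (\<lambda>x. ennreal (norm (g x))) < ennreal A"
  using lt unfolding dist_Lnorm_def by (auto simp: INF_less_iff)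
 have A: "0 < A" using lt by (cases "A <= 0") (auto simp: ennreal_neg)
 let ?I = "(NN x. ennreal (norm (g x) powr r))"
 have e: "Lnorm (ennreal r) lborel (\<lambda>x. ennreal (norm (g x))) = epowr ?I (1 / r)"
  using r by (simp add: Lnorm_def epowr_def)
 have fin: "?I \<noteq> \<infinity>" using L unfolding e by (auto simp: epowr_def)
 then have "ennreal (enn2real ?I powr (1 / r)) < ennreal A" using L unfolding e by (simp add: epowr_def)
 then have "enn2real ?I powr (1 / r) < A" by (simp add: ennreal_less_iff)
 then have "(enn2real ?I powr (1 / r)) powr r <= A powr r" using r by (intro powr_mono2) auto
 then have "enn2real ?I <= A powr r" using r by (simp add: powr_powr)
 then have "?I <= ennreal (A powr r)" using fin by (metis ennreal_enn2real_if ennreal_leI infinity_ennreal_def)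
 moreover have "g \<in> borel_measurable borel" using g by (simp add: represents_def)
 ultimately show thesis using that[OF g] A by (simp add: Lq_def)
qed

context freq_window
begin

text \<open>At a fixed point x the piece at k is the k-th Fourier coefficient of z \<mapsto> \<Psi>
  z * g (x - z). Bessel's inequality bounds the sum of squares over k by a weighted local average of
  |g|^2. Since r >= 2, sequences summable with exponent 2 are summable with exponent r, and Jensen's
  inequality with exponent r / 2 permits integration in x.\<close>

lemma pieces_Lr:
 assumes r: "2 <= r"
 shows "\<exists>C\<ge>0. \<forall>g A. Lq r A g --> (\<exists>b. (\<forall>k::int. 0 <= b k \<and> Lq r (b k) (conv (ker ta\<sigma> (of_int k) 0) g)) \<and>
   (\<forall>F. finite F --> (\<Sum>k\<in>F. b k powr r) <= C * A powr r))"
proof -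
 obtain CB where CB: "0 <= CB" "\<And>(F :: int set) h. finite F ==> integrable lborel h ==> integrable lborel (\<lambda>z. (1 + z\<^sup>2) * (norm (h z))\<^sup>2) ==>
  (\<Sum>k\<in>F. (norm (LBINT z. cis (of_int k * z) * h z))\<^sup>2) <= CB * (LBINT z. (1 + z\<^sup>2) * (norm (h z))\<^sup>2)"
  using Bessel_inequality by blast
 define \<Psi> where "\<Psi> = ker ta\<sigma> 0 0"
 obtain C where C: "decay C \<Psi>"
  using schwartz_decay[OF schwartz_inv_fourier[OF sym_schwartz[OF bump_ta\<sigma>]]] unfolding \<Psi>_def ker_def by blast
 note [measurable] = decay_measurable[OF C]
 define w where "w z = (1 + z\<^sup>2) * (norm (\<Psi> z))\<^sup>2" for z
 have [measurable]: "w \<in> borel_measurable borel" unfolding w_def by measurable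
 have w0: "0 <= w z" for z by (simp add: w_def)
 have wle: "w z <= C\<^sup>2 * cauchy z" for z
 proof -
  have "w z <= (1 + z\<^sup>2) * (C * cauchy z)\<^sup>2"
   unfolding w_def by (intro mult_left_mono power_mono decayD[OF C]) (auto intro: add_nonneg_nonneg)
  also have "... = C\<^sup>2 * cauchy z * ((1 + z\<^sup>2) * cauchy z)" by (simp add: power2_eq_square)
  also have "(1 + z\<^sup>2) * cauchy z = 1" by (simp add: cauchy_def)
  finally show ?thesis by simp
 qed
 have wi: "integrable lborel w"
  by (rule integrable_boundI[of lborel "\<lambda>z. C\<^sup>2 * cauchy z"]) (use wle w0 in auto)
 define W where "W = C\<^sup>2 * pi + 1"
 have W: "0 < W" by (simp add: W_def add_nonneg_pos)
 have wW: "(LBINT z. w z) <= W"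
 proof -
  have "(LBINT z. w z) <= (LBINT z. C\<^sup>2 * cauchy z)"
   by (rule integral_mono[OF wi]) (use wle in auto)
  then show ?thesis by (simp add: integral_cauchy W_def)
 qed
 define p where "p = r / 2"
 have p: "1 <= p" using r by (simp add: p_def)
 have r0: "0 < r" "1 <= r" using r by auto
 define Cc where "Cc = CB powr p * W powr p"
 have main: "(\<exists>b. (\<forall>k::int. 0 <= b k \<and> Lq r (b k) (conv (ker ta\<sigma> (of_int k) 0) g)) \<and>
   (\<forall>F. finite F --> (\<Sum>k\<in>F. b k powr r) <= Cc * A powr r))" if g: "Lq r A g" for g A
 proof -
  have [measurable]: "g \<in> borel_measurable borel" and A0: "0 <= A"
   and gI: "(NN x. ennreal (norm (g x) powr r)) <= ennreal (A powr r)" using g by (auto simp: Lq_def)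
  have tg: "tame g" by (rule Lq_tame[OF g r0(2)])
  define c where "c k = conv (ker ta\<sigma> (of_int k) 0) g" for k :: int
  have cm[measurable]: "c k \<in> borel_measurable borel" for k
   unfolding c_def by (rule conv_measurable[OF sdecay_measurable[OF K\<^sub>0(3)]]) auto
  \<comment> \<open>At time zero the Galilean identity is a pure modulation, which exhibits the
    pieces as Fourier coefficients.\<close>
  have ck: "c k x = (LBINT z. cis (of_int k * z) * (\<Psi> z * g (x - z)))" for k x
   unfolding c_def conv_commute \<Psi>_def
   by (intro LBINT_cong refl) (subst ker_galilei, simp)
  have gi: "integrable lborel (\<lambda>x. norm (g x) powr r)"
   by (rule integrableI_nonneg) (use gI in \<open>auto intro: le_less_trans\<close>)
  have gri: "integrable lborel (\<lambda>z. norm (g (x - z)) powr r)" for x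
   using gi lborel_integrable_real_affine_iff[of "-1" "\<lambda>x. norm (g x) powr r" x] by simp
  have sq: "(norm y)\<^sup>2 powr p = norm y powr r" for y :: complex
  proof -
   have "(norm y)\<^sup>2 = norm y powr 2" by simp
   then have "(norm y)\<^sup>2 powr p = norm y powr (2 * p)" by (simp only: powr_powr)
   then show ?thesis by (simp add: p_def)
  qed
  have le1: "(norm y)\<^sup>2 <= 1 + norm y powr r" for y :: complex
  proof (cases "norm y <= 1")
   case True
   then have "(norm y)\<^sup>2 <= 1" by (simp add: power_le_one)
   then show ?thesis by (simp add: add_increasing2)
  next
   case False
   then have "norm y powr 2 <= norm y powr r" using r by (intro powr_mono) auto
   then show ?thesis using False by (simp add: powr_numeral)
  qed
  define H where "H x = (LBINT z. w z * (norm (g (x - z)))\<^sup>2)" for x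
  have iH: "integrable lborel (\<lambda>z. w z * (norm (g (x - z)))\<^sup>2)" for x
  proof (rule integrable_boundI)
   show "integrable lborel (\<lambda>z. w z + C\<^sup>2 * norm (g (x - z)) powr r)" using wi gri by simp
   show "AE z in lborel. norm (w z * (norm (g (x - z)))\<^sup>2) <= norm (w z + C\<^sup>2 * norm (g (x - z)) powr r)"
   proof (rule AE_I2)
    fix z
    have wC: "w z <= C\<^sup>2" using wle[of z] mult_left_mono[OF cauchy_le_1, of "C\<^sup>2" z] by simp
    have "w z * (norm (g (x - z)))\<^sup>2 <= w z * (1 + norm (g (x - z)) powr r)"
     by (intro mult_left_mono le1 w0)
    also have "... <= w z + C\<^sup>2 * norm (g (x - z)) powr r"
     unfolding distrib_left by (intro add_mono mult_right_mono wC) auto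
    finally show "norm (w z * (norm (g (x - z)))\<^sup>2) <= norm (w z + C\<^sup>2 * norm (g (x - z)) powr r)" using w0[of z] by simp
   qed
  qed measurable
  have H0: "0 <= H x" for x unfolding H_def by (rule Bochner_Integration.integral_nonneg) (use w0 in auto)
  have Hp: "ennreal (H x powr p) <= ennreal (W powr (p - 1)) * (NN z. ennreal (w z * norm (g (x - z)) powr r))" for x
  proof -
   have "ennreal (norm (LBINT z. complex_of_real (w z * (norm (g (x - z)))\<^sup>2)) powr p)
    <= ennreal (W powr (p - 1)) * (NN z. ennreal (w z * ((norm (g (x - z)))\<^sup>2) powr p))"
    by (rule jensen_norm[OF p wi w0 wW]) (auto simp: norm_mult norm_power w0 simp del: of_real_mult of_real_power)
   then show ?thesis using H0[of x] unfolding integral_complex_of_real H_def[symmetric] sq by simp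
  qed
  have csum: "(\<Sum>k\<in>F. norm (c k x) powr r) <= CB powr p * H x powr p" if F: "finite F" for F x
  proof -
   have "(\<Sum>k\<in>F. norm (c k x) powr r) = (\<Sum>k\<in>F. ((norm (c k x))\<^sup>2) powr p)" by (simp only: sq)
   also have "... <= (\<Sum>k\<in>F. (norm (c k x))\<^sup>2) powr p" by (rule sum_powr_le[OF p F]) simp
   also have "... <= (CB * H x) powr p"
   proof (rule powr_mono2)
    have e: "(1 + z\<^sup>2) * (norm (\<Psi> z * g (x - z)))\<^sup>2 = w z * (norm (g (x - z)))\<^sup>2" for z
     by (simp add: w_def norm_mult power_mult_distrib)
    have "integrable lborel (\<lambda>z. \<Psi> z * g (x - z))"
     using tame_mult_integrable[OF tame_reflect[OF tg] C, of x] by (simp add: mult.commute)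
    from CB(2)[OF F this] iH[of x] show "(\<Sum>k\<in>F. (norm (c k x))\<^sup>2) <= CB * H x"
     unfolding ck e H_def by blast
   qed (use p in \<open>auto intro: sum_nonneg\<close>)
   finally show ?thesis using CB(1) H0[of x] by (simp add: powr_mult)
  qed
  define I where "I k = (NN x. ennreal (norm (c k x) powr r))" for k
  have Isum: "(\<Sum>k\<in>F. I k) <= ennreal (Cc * A powr r)" if F: "finite F" for F
  proof -
   have "(\<Sum>k\<in>F. I k) = (NN x. (\<Sum>k\<in>F. ennreal (norm (c k x) powr r)))"
    unfolding I_def by (rule nn_integral_sum[symmetric]) measurable
   also have "... <= (NN x. ennreal (CB powr p * W powr (p - 1)) * (NN z. ennreal (w z * norm (g (x - z)) powr r)))"
   proof (rule nn_integral_mono)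
    fix x
    have "(\<Sum>k\<in>F. ennreal (norm (c k x) powr r)) = ennreal (\<Sum>k\<in>F. norm (c k x) powr r)" by (rule sum_ennreal) simp
    also have "... <= ennreal (CB powr p * H x powr p)" by (intro ennreal_leI csum F)
    also have "... = ennreal (CB powr p) * ennreal (H x powr p)" by (simp add: ennreal_mult)
    also have "... <= ennreal (CB powr p) * (ennreal (W powr (p - 1)) * (NN z. ennreal (w z * norm (g (x - z)) powr r)))"
     by (intro mult_left_mono Hp) auto
    finally show "(\<Sum>k\<in>F. ennreal (norm (c k x) powr r)) <= ennreal (CB powr p * W powr (p - 1)) * (NN z. ennreal (w z * norm (g (x - z)) powr r))"
     by (simp add: ennreal_mult mult.assoc)
   qed
   also have "... = ennreal (CB powr p * W powr (p - 1)) * (NN x. (NN z. ennreal (w z * norm (g (x - z)) powr r)))"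
    by (rule nn_integral_cmult) measurable
   also have "(NN x. (NN z. ennreal (w z * norm (g (x - z)) powr r)))
    = (NN z. (NN x. ennreal (w z * norm (g (x - z)) powr r)))"
    by (rule lborel_pair.Fubini') measurable
   also have "... <= (NN z. ennreal (w z) * ennreal (A powr r))"
   proof (rule nn_integral_mono)
    fix z
    have "(NN x. ennreal (w z * norm (g (x - z)) powr r)) = ennreal (w z) * (NN x. ennreal (norm (g (x - z)) powr r))"
     using w0[of z] by (subst nn_integral_cmult[symmetric]) (auto simp: ennreal_mult)
    also have "(NN x. ennreal (norm (g (x - z)) powr r)) = ennreal \<bar>1\<bar> * (NN x. ennreal (norm (g ((z + 1 * x) - z)) powr r))"
     by (rule nn_integral_real_affine[where f = "\<lambda>x. ennreal (norm (g (x - z)) powr r)"]) auto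
    also have "ennreal (w z) * ... <= ennreal (w z) * ennreal (A powr r)"
     using gI by (intro mult_left_mono) auto
    finally show "(NN x. ennreal (w z * norm (g (x - z)) powr r)) <= ennreal (w z) * ennreal (A powr r)" .
   qed
   also have "... = (NN z. ennreal (w z)) * ennreal (A powr r)" by (rule nn_integral_multc) measurable
   also have "(NN z. ennreal (w z)) = ennreal (LBINT z. w z)"
    by (rule nn_integral_eq_integral[OF wi]) (use w0 in auto)
   finally have "(\<Sum>k\<in>F. I k) <= ennreal (CB powr p * W powr (p - 1)) * (ennreal (LBINT z. w z) * ennreal (A powr r))"
    by (simp add: mult_left_mono)
   also have "... <= ennreal (CB powr p * W powr (p - 1)) * (ennreal W * ennreal (A powr r))"
    by (intro mult_left_mono mult_right_mono ennreal_leI wW) auto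
   also have "... = ennreal (Cc * A powr r)"
   proof -
    have w: "W powr p = W powr (p - 1) * W" using W by (simp add: powr_diff)
    have eq: "CB powr p * W powr (p - 1) * (W * A powr r) = Cc * A powr r"
     unfolding Cc_def w by (simp only: mult_ac)
    have "ennreal (CB powr p * W powr (p - 1)) * (ennreal W * ennreal (A powr r)) = ennreal (CB powr p * W powr (p - 1) * (W * A powr r))"
     using W by (simp add: ennreal_mult)
    then show ?thesis unfolding eq .
   qed
   finally show ?thesis .
  qed
  have Ifin: "I k \<noteq> \<infinity>" for k
  proof -
   have "I k <= ennreal (Cc * A powr r)" using Isum[of "{k}"] by simp
   then show ?thesis by (auto simp: top_unique)
  qed
  define b where "b k = enn2real (I k) powr (1 / r)" for k
  have br: "b k powr r = enn2real (I k)" for k using r0 by (simp add: b_def powr_powr)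
  have "Lq r (b k) (c k)" for k
   unfolding Lq_def br using Ifin[of k] by (auto simp: I_def b_def ennreal_enn2real_if)
  moreover have "(\<Sum>k\<in>F. b k powr r) <= Cc * A powr r" if F: "finite F" for F
  proof -
   have "ennreal (\<Sum>k\<in>F. b k powr r) = (\<Sum>k\<in>F. ennreal (enn2real (I k)))" unfolding br by (rule sum_ennreal[symmetric]) simp
   also have "... = (\<Sum>k\<in>F. I k)" using Ifin by (intro sum.cong refl) (simp add: ennreal_enn2real_if)
   also have "... <= ennreal (Cc * A powr r)" by (rule Isum[OF F])
   finally show ?thesis using W by (simp add: Cc_def)
  qed
  moreover have "0 <= b k" for k by (simp add: b_def)
  ultimately show ?thesis unfolding c_def by blast
 qed
 have "0 <= Cc" by (simp add: Cc_def)
 then show ?thesis using main by blast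
qed

text \<open>Moved to frequency zero and multiplied by the weight of order beta at k, the localized
  inverse Bessel symbols form a uniform Schwartz family. Undoing the normalization gives the gain in
  k.\<close>

lemma bessel_kernel:
 assumes beta: "0 <= beta"
 shows "\<exists>C\<ge>0. \<forall>k::int. sdecay (C * jbracket (of_int k) powr (- beta))
   (inv_fourier (\<lambda>xi. of_real (\<sigma> (xi - of_int k)) * of_real ((1 + xi\<^sup>2) powr (- beta / 2))))"
proof -
 let ?m = "\<lambda>k::int. \<lambda>eta. complex_of_real (jbracket (of_int k) powr beta) * mono_symbol 1 0 (- beta / 2) 0 (eta - (- of_int k))"
 let ?F = "\<lambda>k eta. ?m k eta * complex_of_real (\<sigma> eta)"
 have "usch UNIV ?F" by (rule usch_mult[OF bessel_shift_umod[OF beta] schwartz_imp_usch[OF bump_schwartz[OF bump_\<sigma>]]])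
 from usch_decay[OF usch_inv_fourier[OF this]]
 obtain C where C: "0 <= C" "\<And>k. decay C (inv_fourier (?F k))" by auto
 have "sdecay (C * jbracket (of_int k) powr (- beta)) (inv_fourier (\<lambda>xi. of_real (\<sigma> (xi - of_int k)) * of_real ((1 + xi\<^sup>2) powr (- beta / 2))))" for k :: int
 proof -
  let ?J = "jbracket (of_int k)"
  have J: "0 < ?J" using jbracket_ge_1[of "of_int k"] by linarith
  let ?G = "\<lambda>eta. complex_of_real (?J powr (- beta)) * ?F k eta"
  have G: "?G (xi - of_int k) = of_real (\<sigma> (xi - of_int k)) * of_real ((1 + xi\<^sup>2) powr (- beta / 2))" for xi
  proof -
   have "complex_of_real (?J powr (- beta)) * complex_of_real (?J powr beta) = 1"
    unfolding of_real_mult[symmetric] using J by (simp add: powr_add[symmetric])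
   then have "?G (xi - of_int k) = 1 * (mono_symbol 1 0 (- beta / 2) 0 (xi - of_int k - (- of_int k)) * complex_of_real (\<sigma> (xi - of_int k)))"
    by (simp only: mult.assoc[symmetric])
   then show ?thesis by (simp add: mono_symbol_def)
  qed
  have e: "inv_fourier (\<lambda>xi. of_real (\<sigma> (xi - of_int k)) * of_real ((1 + xi\<^sup>2) powr (- beta / 2))) x
   = cis (of_int k * x) * (complex_of_real (?J powr (- beta)) * inv_fourier (?F k) x)" for x
  proof -
   have "inv_fourier (\<lambda>xi. ?G (xi - of_int k)) x = cis (of_int k * x) * inv_fourier ?G x" by (rule inv_fourier_shift)
   moreover have "inv_fourier ?G x = complex_of_real (?J powr (- beta)) * inv_fourier (?F k) x"
    by (rule inv_fourier_cmult)
   ultimately show ?thesis unfolding G by simp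
  qed
  note [measurable] = decay_measurable[OF C(2)[of k]]
  have "decay (C * ?J powr (- beta)) (inv_fourier (\<lambda>xi. of_real (\<sigma> (xi - of_int k)) * of_real ((1 + xi\<^sup>2) powr (- beta / 2))))"
   unfolding decay_def
  proof (intro conjI allI)
   show "inv_fourier (\<lambda>xi. of_real (\<sigma> (xi - of_int k)) * of_real ((1 + xi\<^sup>2) powr (- beta / 2))) \<in> borel_measurable borel"
    by (subst measurable_cong[OF e]) measurable
   fix x
   show "norm (inv_fourier (\<lambda>xi. of_real (\<sigma> (xi - of_int k)) * of_real ((1 + xi\<^sup>2) powr (- beta / 2))) x) <= C * ?J powr (- beta) * cauchy x"
    unfolding e using mult_left_mono[OF decayD[OF C(2)[of k], of x], of "?J powr (- beta)"] by (simp add: norm_mult mult_ac)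
  qed
  then show ?thesis by (rule decay_sdecay)
 qed
 then show ?thesis using C(1) by blast
qed

text \<open>The modulation norm with exponents r, 1 and no weight is at most S, expressed through
  representing functions. Both data norms are reduced to this single condition.\<close>

definition has_data :: "real => real => distribution => bool" where
 "has_data r S f \<longleftrightarrow> 0 <= S \<and> (\<exists>g a. (\<forall>k. represents (g k) (box \<sigma> k f) \<and> Lq r (a k) (g k)) \<and>
   (NC k. ennreal (a k)) <= ennreal S)"

text \<open>With s > 1/2 the weights of order -2s are summable, which is the room needed to pass
  from square summability with weight s to absolute summability.\<close>

lemma modulation_has_data:
 assumes r: "0 < r" and s: "1 / 2 < s"
 shows "\<exists>C\<ge>0. \<forall>f A. 0 < A --> modulation_norm \<sigma> s r 2 f < ennreal A --> has_data r (C * A) f"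
proof -
 obtain W where W: "0 <= W" "(NC k. ennreal (jbracket (of_int k) powr (- (2 * s)))) <= ennreal W"
  using jbracket_summable[of "2 * s"] s by auto
 have "has_data r ((2 * W + 1) * A) f" if A: "0 < A" and m: "modulation_norm \<sigma> s r 2 f < ennreal A" for f A
 proof -
  define d where "d k = dist_Lnorm r (box \<sigma> k f)" for k
  let ?J = "\<lambda>k::int. jbracket (of_int k)"
  have J: "0 < ?J k" for k using jbracket_ge_1[of "of_int k"] by linarith
  define N where "N = (NC k. ennreal (?J k powr (2 * s)) * epowr (d k) 2)"
  have "epowr N (1 / 2) < ennreal A" using m by (simp add: modulation_norm_def N_def d_def)
  then have Nfin: "N \<noteq> \<infinity>" and "ennreal (enn2real N powr (1 / 2)) < ennreal A" by (auto simp: epowr_def split: if_splits)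
  then have "enn2real N powr (1 / 2) < A" by (simp add: ennreal_less_iff)
  then have "(enn2real N powr (1 / 2)) powr 2 <= A powr 2" by (intro powr_mono2) auto
  then have "enn2real N <= A\<^sup>2" using A by (simp add: powr_powr powr_numeral)
  then have NA: "N <= ennreal (A\<^sup>2)" using Nfin by (metis ennreal_enn2real_if ennreal_leI infinity_ennreal_def)
  have dfin: "d k \<noteq> \<infinity>" for k
  proof
   assume "d k = \<infinity>"
   then have "ennreal (?J k powr (2 * s)) * epowr (d k) 2 = \<infinity>" using J[of k] by (simp add: epowr_def ennreal_mult_top)
   moreover have "ennreal (?J k powr (2 * s)) * epowr (d k) 2 <= N"
    unfolding N_def by (rule nn_integral_ge_point) simp
   ultimately show False using Nfin by (simp add: top_unique)
  qed
  \<comment> \<open>The margin makes the bound strictly larger than the infimum, so that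
    representing functions exist, and is itself summable in k with sum proportional to A.\<close>
  define a where "a k = enn2real (d k) + A * ?J k powr (- (2 * s))" for k
  have "d k < ennreal (a k)" for k
  proof -
   have "0 < A * ?J k powr (- (2 * s))" using A J[of k] by simp
   then have "ennreal (enn2real (d k)) < ennreal (a k)" by (auto simp: a_def intro!: ennreal_lessI add_nonneg_pos)
   then show ?thesis using dfin[of k] by (simp add: ennreal_enn2real_if)
  qed
  then have "\<exists>g. represents g (box \<sigma> k f) \<and> Lq r (a k) g" for k
   using dist_Lnorm_lessE[OF _ r, of "box \<sigma> k f" "a k"] unfolding d_def by blast
  then obtain g where g: "\<And>k. represents (g k) (box \<sigma> k f) \<and> Lq r (a k) (g k)" by metis
  \<comment> \<open>A termwise substitute for Cauchy-Schwarz in k, balanced by A so that the final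
    bound is linear in A. The factor 2 accounts for the margin in \<open>a\<close>.\<close>
  have le: "a k <= (2 * A) * ?J k powr (- (2 * s)) + (1 / A) * (?J k powr (2 * s) * (enn2real (d k)) powr 2)" for k
  proof -
   define u where "u = ?J k powr s"
   define x where "x = enn2real (d k)"
   have u: "0 < u" using J[of k] by (simp add: u_def)
   have u2: "?J k powr (2 * s) = u\<^sup>2" "?J k powr (- (2 * s)) = 1 / u\<^sup>2"
   proof -
    have "?J k powr (2 * s) = ?J k powr s * ?J k powr s" by (simp add: powr_add[symmetric])
    then show "?J k powr (2 * s) = u\<^sup>2" by (simp add: u_def power2_eq_square)
    then show "?J k powr (- (2 * s)) = 1 / u\<^sup>2" by (simp add: powr_minus_divide)
   qed
   have x0: "0 <= x" by (simp add: x_def)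
   have "0 <= (A / u - u * x)\<^sup>2 / A" using A by simp
   also have "(A / u - u * x)\<^sup>2 / A = A / u\<^sup>2 + u\<^sup>2 * x\<^sup>2 / A - 2 * x"
    using A u by (simp add: power2_eq_square field_simps)
   finally have "x <= A / u\<^sup>2 + u\<^sup>2 * x\<^sup>2 / A" using x0 by linarith
   then show ?thesis using x0 by (simp add: a_def u2 x_def[symmetric] powr_numeral)
  qed
  have "(NC k. ennreal (a k))
   <= (NC k. ennreal (2 * A) * ennreal (?J k powr (- (2 * s))) + ennreal (1 / A) * (ennreal (?J k powr (2 * s)) * epowr (d k) 2))"
  proof (rule nn_integral_mono)
   fix k
   have "ennreal (a k) <= ennreal ((2 * A) * ?J k powr (- (2 * s)) + (1 / A) * (?J k powr (2 * s) * (enn2real (d k)) powr 2))"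
    by (rule ennreal_leI[OF le])
   also have "... = ennreal (2 * A) * ennreal (?J k powr (- (2 * s))) + ennreal (1 / A) * (ennreal (?J k powr (2 * s)) * epowr (d k) 2)"
    using A dfin[of k] by (simp add: epowr_def ennreal_mult[symmetric])
   finally show "ennreal (a k) <= ennreal (2 * A) * ennreal (?J k powr (- (2 * s))) + ennreal (1 / A) * (ennreal (?J k powr (2 * s)) * epowr (d k) 2)" .
  qed
  also have "... = ennreal (2 * A) * (NC k. ennreal (?J k powr (- (2 * s)))) + ennreal (1 / A) * N"
   unfolding N_def by (simp add: nn_integral_add nn_integral_cmult)
  also have "... <= ennreal (2 * A) * ennreal W + ennreal (1 / A) * ennreal (A\<^sup>2)"
   by (intro add_mono mult_left_mono W(2) NA) auto
  also have "... = ennreal ((2 * W + 1) * A)"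
   using A W(1) by (simp add: ennreal_mult[symmetric] ennreal_plus[symmetric] power2_eq_square algebra_simps del: ennreal_plus)
  finally show ?thesis unfolding has_data_def using g A W(1) by (intro conjI exI[of _ g] exI[of _ a]) auto
 qed
 then show ?thesis using W(1) by (intro exI[of _ "2 * W + 1"]) auto
qed

text \<open>Each frequency piece of \<open>f\<close> is a localized inverse Bessel kernel, gaining
  order beta in k, convolved with a piece of the L^r function g0. Summation by Hoelder's inequality
  in k needs weights whose power r' is summable, which is the condition beta > 1 - 1 / r.\<close>

lemma sobolev_has_data:
 assumes r: "2 <= r" and beta: "1 - 1 / r < beta"
 shows "\<exists>C\<ge>0. \<forall>f A. tempered f --> 0 < A --> sobolev_norm r beta f < ennreal A --> has_data r (C * A) f"
proof -
 define r' where "r' = r / (r - 1)"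
 have r': "1 < r'" "1 / r' + 1 / r = 1" using r by (auto simp: r'_def field_simps)
 have beta0: "0 <= beta" using beta r by (smt (verit) divide_le_eq_1)
 have betar: "1 < beta * r'"
 proof -
  have "1 - 1 / r = 1 / r'" using r'(2) by linarith
  then have "1 / r' < beta" using beta by simp
  then show ?thesis using r'(1) by (simp add: divide_less_eq)
 qed
 obtain W where W: "0 <= W" "(NC k. ennreal (jbracket (of_int k) powr (- (beta * r')))) <= ennreal W"
  using jbracket_summable[OF betar] by auto
 obtain C1 where C1: "0 <= C1" "\<And>g A. Lq r A g ==> (\<exists>b. (\<forall>k::int. 0 <= b k \<and> Lq r (b k) (conv (ker ta\<sigma> (of_int k) 0) g)) \<and>
   (\<forall>F. finite F --> (\<Sum>k\<in>F. b k powr r) <= C1 * A powr r))" using pieces_Lr[OF r] by blast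
 let ?s = "\<lambda>k::int. \<lambda>xi. complex_of_real (\<sigma> (xi - of_int k)) * of_real ((1 + xi\<^sup>2) powr (- beta / 2))"
 obtain C2 where C2: "0 <= C2" "\<And>k::int. sdecay (C2 * jbracket (of_int k) powr (- beta)) (inv_fourier (?s k))"
  using bessel_kernel[OF beta0] by blast
 define C where "C = C2 * pi * (W + C1)"
 have "has_data r (C * A) f" if f: "tempered f" and A: "0 < A" and sn: "sobolev_norm r beta f < ennreal A" for f A
 proof -
  obtain g0 where g0: "represents g0 (bessel beta f)" "Lq r A g0"
   using sn r unfolding sobolev_norm_def by (auto elim: dist_Lnorm_lessE)
  obtain b where b: "\<And>k. 0 <= b k" "\<And>k. Lq r (b k) (conv (ker ta\<sigma> (of_int k) 0) g0)" "\<And>F. finite F ==> (\<Sum>k\<in>F. b k powr r) <= C1 * A powr r"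
   using C1(2)[OF g0(2)] by blast
  \<comment> \<open>Two convolutions: the inner one keeps the summability of the pieces of g0 with
    exponent r, the outer one supplies the weight in k. Their symbols multiply to the window divided
    by the Bessel symbol.\<close>
  define g where "g k = conv (inv_fourier (?s k)) (conv (ker ta\<sigma> (of_int k) 0) g0)" for k :: int
  define a where "a k = C2 * jbracket (of_int k) powr (- beta) * pi * b k" for k :: int
  have Ba: "Bd r (a k) (g k)" for k
   unfolding g_def a_def by (rule Bd_conv_Lq[OF C2(2) b(2)]) (use r in simp)
  have ss: "schwartz (?s k)" for k
   using schwartz_\<sigma>_mult usch_mult[OF mono_symbol_umod[of "{()}" "\<lambda>_. 1" 1 "\<lambda>_. 0" 0 0 "- beta / 2"], of "\<lambda>_. (\<lambda>xi. complex_of_real (\<sigma> (xi - of_int k)))"]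
    bump_schwartz[OF bump_shift[OF bump_\<sigma>], of "of_int k"]
   by (simp add: schwartz_iff_usch mono_symbol_def[abs_def] mult.commute)
  have rep: "represents (g k) (box \<sigma> k f)" for k
   unfolding represents_def
  proof (intro conjI allI impI)
   show "g k \<in> borel_measurable lborel" using Bd_measurable[OF Ba] by simp
   fix phi assume phi: "schwartz phi"
   have t1: "tame (conv (ker ta\<sigma> (of_int k) 0) g0)" by (rule Lq_tame[OF b(2)]) (use r in simp)
   have t0: "tame g0" by (rule Lq_tame[OF g0(2)]) (use r in simp)
   show "integrable lborel (\<lambda>x. g k x * phi x)" unfolding g_def by (rule conv_pairing(2)[OF ss t1 phi])
   have s1: "schwartz (\<lambda>xi. ?s k xi * inv_fourier phi xi)" by (rule schwartz_mult[OF ss schwartz_inv_fourier[OF phi]])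
   have st: "sym ta\<sigma> (of_int k) 0 xi * (?s k xi * inv_fourier phi xi) = ?s k xi * inv_fourier phi xi" for xi
   proof -
    have "complex_of_real (ta\<sigma> (xi - of_int k)) * complex_of_real (\<sigma> (xi - of_int k)) = complex_of_real (\<sigma> (xi - of_int k))"
     using \<sigma>_mult_ta\<sigma>[of "xi - of_int k"] by (metis mult.commute of_real_mult)
    then show ?thesis unfolding sym_0 by (simp only: mult.assoc[symmetric])
   qed
   have "dist_of (g k) phi = (LBINT y. conv (ker ta\<sigma> (of_int k) 0) g0 y * fourier (\<lambda>xi. ?s k xi * inv_fourier phi xi) y)"
    unfolding g_def dist_of_def by (rule conv_pairing(1)[OF ss t1 phi])
   also have "... = (LBINT y. g0 y * fourier (\<lambda>xi. sym ta\<sigma> (of_int k) 0 xi * inv_fourier (fourier (\<lambda>xi. ?s k xi * inv_fourier phi xi)) xi) y)"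
    unfolding ker_def by (rule conv_pairing(1)[OF sym_schwartz[OF bump_ta\<sigma>] t0 schwartz_fourier[OF s1]])
   also have "... = dist_of g0 (fourier (\<lambda>xi. ?s k xi * inv_fourier phi xi))"
    unfolding inv_fourier_fourier[OF s1] st dist_of_def ..
   also have "... = bessel beta f (fourier (\<lambda>xi. ?s k xi * inv_fourier phi xi))"
    by (rule representsD[OF g0(1) schwartz_fourier[OF s1], symmetric])
   also have "... = f (fourier (\<lambda>xi. of_real ((1 + xi\<^sup>2) powr (beta / 2)) * (?s k xi * inv_fourier phi xi)))"
    unfolding bessel_def multiplier_def dist_inv_fourier_def dist_mult_def dist_fourier_def inv_fourier_fourier[OF s1] ..
   also have "(\<lambda>xi. complex_of_real ((1 + xi\<^sup>2) powr (beta / 2)) * (?s k xi * inv_fourier phi xi)) = (\<lambda>xi. of_real (\<sigma> (xi - of_int k)) * inv_fourier phi xi)"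
   proof
    fix xi :: real
    have "(1 + xi\<^sup>2) powr (beta / 2) * (1 + xi\<^sup>2) powr (- beta / 2) = 1" by (simp add: powr_add[symmetric])
    then have e: "complex_of_real ((1 + xi\<^sup>2) powr (beta / 2)) * complex_of_real ((1 + xi\<^sup>2) powr (- beta / 2)) = 1"
     unfolding of_real_mult[symmetric] by simp
    have ac: "x * ((y * z) * v) = (x * z) * (y * v)" for x y z v :: complex by (simp add: mult_ac)
    show "complex_of_real ((1 + xi\<^sup>2) powr (beta / 2)) * (?s k xi * inv_fourier phi xi) = of_real (\<sigma> (xi - of_int k)) * inv_fourier phi xi"
     unfolding ac e by simp
   qed
   also have "f (fourier (\<lambda>xi. of_real (\<sigma> (xi - of_int k)) * inv_fourier phi xi)) = box \<sigma> k f phi"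
    unfolding box_def multiplier_def dist_inv_fourier_def dist_mult_def dist_fourier_def ..
   finally show "box \<sigma> k f phi = dist_of (g k) phi" ..
  qed
  have fin: "(\<Sum>k\<in>F. ennreal (b k powr r)) <= ennreal (C1 * A powr r)" if "finite F" for F
   using b(3)[OF that] by (subst sum_ennreal) (auto intro: ennreal_leI)
  have bs: "(NC k. ennreal (b k powr r)) <= ennreal (C1 * A powr r)"
   by (rule int_nn_integral_le) (rule fin, simp)
  have "(NC k. ennreal (a k))
   <= (NC k. ennreal (C2 * pi * A) * ennreal (jbracket (of_int k) powr (- (beta * r'))) + ennreal (C2 * pi * A / A powr r) * ennreal (b k powr r))"
  proof (rule nn_integral_mono)
   fix k :: int
   let ?j = "jbracket (of_int k)"
   have j: "0 < ?j" using jbracket_ge_1[of "of_int k"] by linarith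
   \<comment> \<open>Dividing by A before applying Young's inequality makes the resulting bound
     homogeneous of degree one in A.\<close>
   have "?j powr (- beta) * (b k / A) <= (?j powr (- beta)) powr r' / r' + (b k / A) powr r / r"
    by (rule Youngs_inequality) (use r r' b(1) A in auto)
   also have "... <= (?j powr (- beta)) powr r' + (b k / A) powr r"
    using r r'(1) by (intro add_mono) (auto simp: divide_le_eq mult_le_cancel_left1)
   also have "... = ?j powr (- (beta * r')) + b k powr r / A powr r" using b(1)[of k] A by (simp add: powr_powr powr_divide)
   finally have "(C2 * pi * A) * (?j powr (- beta) * (b k / A)) <= (C2 * pi * A) * (?j powr (- (beta * r')) + b k powr r / A powr r)"
    using C2(1) A by (intro mult_left_mono) auto
   moreover have "(C2 * pi * A) * (?j powr (- beta) * (b k / A)) = a k" using A by (simp add: a_def)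
   ultimately have "a k <= (C2 * pi * A) * ?j powr (- (beta * r')) + (C2 * pi * A / A powr r) * b k powr r"
    by (simp add: distrib_left)
   then have "ennreal (a k) <= ennreal ((C2 * pi * A) * ?j powr (- (beta * r')) + (C2 * pi * A / A powr r) * b k powr r)" by (rule ennreal_leI)
   also have "... = ennreal (C2 * pi * A) * ennreal (?j powr (- (beta * r'))) + ennreal (C2 * pi * A / A powr r) * ennreal (b k powr r)"
    using C2(1) A by (simp add: ennreal_mult[symmetric])
   finally show "ennreal (a k) <= ennreal (C2 * pi * A) * ennreal (?j powr (- (beta * r'))) + ennreal (C2 * pi * A / A powr r) * ennreal (b k powr r)" .
  qed
  also have "... = ennreal (C2 * pi * A) * (NC k. ennreal (jbracket (of_int k) powr (- (beta * r'))))
    + ennreal (C2 * pi * A / A powr r) * (NC k. ennreal (b k powr r))"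
   by (simp add: nn_integral_add nn_integral_cmult)
  also have "... <= ennreal (C2 * pi * A) * ennreal W + ennreal (C2 * pi * A / A powr r) * ennreal (C1 * A powr r)"
   by (intro add_mono mult_left_mono W(2) bs) auto
  also have "... = ennreal (C2 * pi * A * W + C2 * pi * A / A powr r * (C1 * A powr r))"
   using A W(1) C1(1) C2(1) by (simp add: ennreal_mult[symmetric])
  also have "C2 * pi * A * W + C2 * pi * A / A powr r * (C1 * A powr r) = C * A"
   using A by (simp add: C_def algebra_simps)
  finally show ?thesis unfolding has_data_def
   using rep Bd_Lq[OF Ba] A C1(1) C2(1) W(1) by (intro conjI exI[of _ g] exI[of _ a]) (auto simp: C_def)
 qed
 moreover have "0 <= C" using C1(1) C2(1) W(1) by (simp add: C_def)
 ultimately show ?thesis by blast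
qed

text \<open>The k-th member is the frequency piece of the data propagated by the kernel with the
  enlarged window. The identity is checked for each k after testing, and the pieces are summed by
  the decomposition of tempered distributions.\<close>

lemma free_family:
 assumes f: "tempered f" and h: "has_data r S f" and r: "1 <= r"
 shows "\<exists>c. fam r (Kp * S) c \<and> (\<forall>t\<in>{-1..1}. \<forall>phi. schwartz phi --> (LBINT x. Syn c t x * phi x) = schroedinger t f phi)"
proof -
 obtain g a where S0: "0 <= S" and rep: "\<And>k. represents (g k) (box \<sigma> k f)" and L: "\<And>k. Lq r (a k) (g k)"
  and as: "(NC k. ennreal (a k)) <= ennreal S" using h unfolding has_data_def by blast
 define c where "c k t = conv (ker ta\<sigma> (of_int k) t) (g k)" for k :: int and t
 have gm[measurable]: "g k \<in> borel_measurable borel" for k using L[of k] by (simp add: Lq_def)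
 have tg: "tame (g k)" for k by (rule Lq_tame[OF L r])
 have cB: "Bd r (Kp * a k) (c k t)" if "t \<in> {-1..1}" for k t
  unfolding c_def Kp_def by (rule Bd_conv_Lq[OF K\<^sub>0(3)[OF that] L r])
 have mc: "measf c"
 proof (rule measfI)
  fix k
  note [measurable (raw)] = ker_measurable[OF bump_ta\<sigma>]
  show "(\<lambda>p. c k (fst p) (snd p)) \<in> borel_measurable (borel \<Otimes>\<^sub>M borel)" unfolding c_def conv_def by measurable
 qed
 have a0: "0 <= a k" for k using L[of k] by (simp add: Lq_def)
 have "(NC k. ennreal (Kp * a k)) = ennreal Kp * (NC k. ennreal (a k))"
  using Kp_nonneg a0 by (subst nn_integral_cmult[symmetric]) (auto simp: ennreal_mult)
 also have "... <= ennreal Kp * ennreal S" by (intro mult_left_mono as) auto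
 also have "... = ennreal (Kp * S)" using Kp_nonneg S0 by (simp add: ennreal_mult)
 finally have fc: "fam r (Kp * S) c" unfolding fam_def
  using mc cB Kp_nonneg S0 by (intro conjI exI[of _ "\<lambda>k. Kp * a k"]) auto
 obtain A where A: "\<And>k t. t \<in> {-1..1} ==> Bd r (A k) (c k t)" "\<And>k. 0 <= A k" "integrable (count_space UNIV) A"
  using famE[OF fc] by metis
 have "(LBINT x. Syn c t x * phi x) = schroedinger t f phi" if t: "t \<in> {-1..1}" and phi: "schwartz phi" for t phi
 proof -
  let ?M = "\<lambda>xi. cis (- (t * xi\<^sup>2)) * inv_fourier phi xi"
  have sM: "schwartz ?M" by (rule schwartz_propagator[OF schwartz_inv_fourier[OF phi]])
  note [measurable] = schwartz_measurable[OF phi]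
  define I where "I k = (LBINT x. piece c k t x * phi x)" for k
  have Ik: "I k = f (fourier (\<lambda>xi. of_real (\<sigma> (xi - of_int k)) * ?M xi))" for k :: int
  proof -
   let ?s0 = "\<lambda>xi. sym ta\<sigma> (of_int k) 0 xi * inv_fourier phi xi"
   let ?s1 = "\<lambda>xi. sym ta\<sigma> (of_int k) t xi * ?s0 xi"
   have s0: "schwartz ?s0" by (rule schwartz_mult[OF sym_schwartz[OF bump_ta\<sigma>] schwartz_inv_fourier[OF phi]])
   have s1: "schwartz ?s1" by (rule schwartz_mult[OF sym_schwartz[OF bump_ta\<sigma>] s0])
   have "I k = (LBINT y. c k t y * fourier ?s0 y)"
    unfolding I_def piece_def ker_def by (rule conv_pairing(1)[OF sym_schwartz[OF bump_ta\<sigma>] Bd_tame[OF A(1)[OF t]] phi])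
   also have "... = (LBINT y. g k y * fourier (\<lambda>xi. sym ta\<sigma> (of_int k) t xi * inv_fourier (fourier ?s0) xi) y)"
    unfolding c_def ker_def by (rule conv_pairing(1)[OF sym_schwartz[OF bump_ta\<sigma>] tg schwartz_fourier[OF s0]])
   also have "... = dist_of (g k) (fourier ?s1)" unfolding inv_fourier_fourier[OF s0] dist_of_def ..
   also have "... = box \<sigma> k f (fourier ?s1)"
    by (rule representsD[OF rep schwartz_fourier[OF s1], symmetric])
   also have "... = f (fourier (\<lambda>xi. of_real (\<sigma> (xi - of_int k)) * ?s1 xi))"
    unfolding box_def multiplier_def dist_inv_fourier_def dist_mult_def dist_fourier_def inv_fourier_fourier[OF s1] ..
   \<comment> \<open>Both factors \<open>ta\<sigma>\<close>, one from the propagated kernel and one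
     from the synthesis, are absorbed by \<sigma>.\<close>
   also have "(\<lambda>xi. of_real (\<sigma> (xi - of_int k)) * ?s1 xi) = (\<lambda>xi. of_real (\<sigma> (xi - of_int k)) * ?M xi)"
   proof
    fix xi
    have e: "complex_of_real (\<sigma> (xi - of_int k)) * of_real (ta\<sigma> (xi - of_int k)) = of_real (\<sigma> (xi - of_int k))"
     using \<sigma>_mult_ta\<sigma>[of "xi - of_int k"] by (metis of_real_mult)
    have ac: "s * ((u * v) * (u * x)) = ((s * u) * u) * (v * x)" for s u v x :: complex by (simp add: mult_ac)
    show "of_real (\<sigma> (xi - of_int k)) * ?s1 xi = of_real (\<sigma> (xi - of_int k)) * ?M xi"
     unfolding sym_0 unfolding sym_def ac e ..
   qed
   finally show ?thesis .
  qed
  have pb: "norm (piece c k t x) <= Kp * A k" for k x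
   by (rule Bd_le[OF piece_Bd[of r "A k" c k t, OF A(1)[OF t] r]])
  have fub: "(LBINT x. Syn c t x * phi x) = (LC k. I k)" "integrable (count_space UNIV) I"
  proof -
   have m: "(\<lambda>(k, x). piece c k t x * phi x) \<in> borel_measurable (count_space UNIV \<Otimes>\<^sub>M lborel)"
    by (rule count_pair_measurable) (intro borel_measurable_times measfD[OF piece_measf[OF mc]]; measurable)
   have i1: "integrable (count_space UNIV) (\<lambda>k. Kp * A k)" using A(3) by simp
   have i2: "integrable lborel (\<lambda>x. norm (phi x))" by (rule integrable_norm[OF schwartz_integrable[OF phi]])
   have le: "norm (piece c k t x * phi x) <= (Kp * A k) * norm (phi x)" for k x
    unfolding norm_mult by (intro mult_right_mono pb) auto
   note F = Fubini_product_bound[OF sigma_finite_measure_count_space sigma_finite_lborel' m i1 i2 le]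
   have "(LBINT x. Syn c t x * phi x) = (LBINT x. LC k. piece c k t x * phi x)"
    unfolding Syn_def integral_mult_left_zero ..
   then show "(LBINT x. Syn c t x * phi x) = (LC k. I k)" unfolding I_def using F(2) by simp
   show "integrable (count_space UNIV) I" using F(3) by (simp add: I_def[abs_def])
  qed
  \<comment> \<open>The decomposition converges only along symmetric partial sums, whereas the
    synthesis is an absolutely convergent sum; dominated convergence matches the two.\<close>
  have "(\<lambda>N. LC k. indicator {-int N..int N} k *\<^sub>R I k) \<longlonglongrightarrow> (LC k. I k)"
  proof (rule integral_dominated_convergence[where w = "\<lambda>k. norm (I k)"])
   show "integrable (count_space UNIV) (\<lambda>k. norm (I k))" by (rule integrable_norm[OF fub(2)])
   show "AE k in count_space UNIV. (\<lambda>N. indicator {-int N..int N} k *\<^sub>R I k) \<longlonglongrightarrow> I k"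
   proof (rule AE_I2)
    fix k :: int
    have "\<forall>\<^sub>F N in sequentially. indicator {-int N..int N} k *\<^sub>R I k = I k"
     using eventually_ge_at_top[of "nat \<bar>k\<bar>"] by eventually_elim (auto simp: indicator_def)
    then show "(\<lambda>N. indicator {-int N..int N} k *\<^sub>R I k) \<longlonglongrightarrow> I k" by (rule tendsto_eventually)
   qed
   show "AE k in count_space UNIV. norm (indicator {-int N..int N} k *\<^sub>R I k) <= norm (I k)" for N
    by (rule AE_I2) (auto simp: indicator_def)
  qed simp_all
  moreover have "(LC k. indicator {-int N..int N} k *\<^sub>R I k) = (\<Sum>k\<in>{-int N..int N}. I k)" for N
  proof -
   have "(LC k. indicator {-int N..int N} k *\<^sub>R I k) = (\<Sum>k | indicator {-int N..int N} k *\<^sub>R I k \<noteq> 0. indicator {-int N..int N} k *\<^sub>R I k)"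
   proof -
    have "finite {k. indicator {-int N..int N} k *\<^sub>R I k \<noteq> 0}"
     by (rule finite_subset[of _ "{-int N..int N}"]) (auto simp: indicator_def)
    then show ?thesis by (subst lebesgue_integral_count_space_finite_support) auto
   qed
   also have "... = (\<Sum>k\<in>{-int N..int N}. indicator {-int N..int N} k *\<^sub>R I k)"
    by (rule sum.mono_neutral_left) (auto simp: indicator_def)
   finally show ?thesis by simp
  qed
  ultimately have "(\<lambda>N. \<Sum>k\<in>{-int N..int N}. I k) \<longlonglongrightarrow> (LBINT x. Syn c t x * phi x)" unfolding fub(1) by simp
  moreover have "(\<lambda>N. \<Sum>k\<in>{-int N..int N}. I k) \<longlonglongrightarrow> f (fourier ?M)"
   unfolding Ik by (rule \<sigma>_decomposition[OF f sM])
  ultimately have "(LBINT x. Syn c t x * phi x) = f (fourier ?M)" by (rule LIMSEQ_unique)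
  then show ?thesis by (simp add: schroedinger_def multiplier_def dist_inv_fourier_def dist_mult_def dist_fourier_def)
 qed
 then show ?thesis using fc by blast
qed

end

section \<open>The Picard iteration\<close>

lemma exponent3: "0 < q ==> 1 / q <= 1 / q + 1 / q + 1 / (q::real)"
 by (simp add: divide_le_cancel)

lemma exponent2: "0 < q ==> 1 / q <= 1 / q + 2 / (q::real)"
 by (simp add: divide_le_cancel)

text \<open>The excess power of |a| is taken out by the supremum bound.\<close>

lemma Bd_exponent_mono:
 assumes a: "Bd q A a" and q: "0 < q" "q <= q'" shows "Bd q' A a"
proof -
 note [measurable] = Bd_measurable[OF a]
 have A0: "0 <= A" by (rule Bd_nonneg[OF a])
 have le: "norm (a x) powr q' <= A powr (q' - q) * norm (a x) powr q" for x
 proof (cases "norm (a x) = 0")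
  case False
  then have "norm (a x) powr q' = norm (a x) powr (q' - q) * norm (a x) powr q"
   by (simp add: powr_add[symmetric])
  also have "... <= A powr (q' - q) * norm (a x) powr q"
   using q by (intro mult_right_mono powr_mono2 Bd_le[OF a]) auto
  finally show ?thesis .
 qed (use q in simp)
 have "(NN x. ennreal (norm (a x) powr q')) <= (NN x. ennreal (A powr (q' - q)) * ennreal (norm (a x) powr q))"
  using le by (intro nn_integral_mono) (auto simp: ennreal_mult[symmetric] intro!: ennreal_leI)
 also have "... = ennreal (A powr (q' - q)) * (NN x. ennreal (norm (a x) powr q))" by (rule nn_integral_cmult) measurable
 also have "... <= ennreal (A powr (q' - q)) * ennreal (A powr q)" by (intro mult_left_mono Bd_nn[OF a]) auto
 also have "... = ennreal (A powr q')"
  using A0 q by (cases "A = 0") (auto simp: ennreal_mult[symmetric] powr_add[symmetric])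
 finally show ?thesis using a by (simp add: Bd_def Lq_def)
qed

lemma fam_exponent_mono: "fam q S c ==> 0 < q ==> q <= q' ==> fam q' S c"
 unfolding fam_def using Bd_exponent_mono by meson

lemma fam_cong:
 assumes "fam q S c" "measf d" "\<And>k t x. t \<in> {-1..1} ==> d k t x = c k t x" shows "fam q S d"
proof -
 have "d k t = c k t" if "t \<in> {-1..1}" for k t using assms(3)[OF that] by (rule ext)
 then show ?thesis using assms(1,2) unfolding fam_def by simp
qed

lemma fam_le:
 assumes c: "fam q S c" and t: "t \<in> {-1..1}" shows "norm (c k t x) <= S"
proof -
 obtain A where A: "\<And>k t. t \<in> {-1..1} ==> Bd q (A k) (c k t)" "\<And>k. 0 <= A k" "(NC k. ennreal (A k)) <= ennreal S"
  using famE[OF c] by metis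
 have "ennreal (A k) <= (NC k. ennreal (A k))" by (rule nn_integral_ge_point) simp
 then have "A k <= S" using A(3) fam_nonneg[OF c] by (metis ennreal_le_iff order_trans)
 then show ?thesis using Bd_le[OF A(1)[OF t]] order_trans by blast
qed

text \<open>Completeness of the family space in the form needed here: a series whose norms are
  summable may be added member by member, the two sums over bounds being exchanged by
  Tonelli.\<close>

lemma fam_count_sum:
 fixes d :: "nat => int => real => real => complex"
 assumes d: "\<And>j. fam q (a j) (d j)" and q: "1 <= q" and s: "(NC j. ennreal (a j)) <= ennreal S" and S: "0 <= S"
 shows "fam q S (\<lambda>k t x. LC j. d j k t x)"
proof -
 have "\<exists>A. (\<forall>k. \<forall>t\<in>{-1..1}. Bd q (A k) (d j k t)) \<and> (\<forall>k. 0 <= A k) \<and> (NC k. ennreal (A k)) <= ennreal (a j)" for j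
  using famE[OF d[of j]] by metis
 then obtain A where A: "\<And>j k t. t \<in> {-1..1} ==> Bd q (A j k) (d j k t)" "\<And>j k. 0 <= A j k"
  "\<And>j. (NC k. ennreal (A j k)) <= ennreal (a j)" by metis
 have tot: "(NC k. (NC j. ennreal (A j k))) <= ennreal S"
 proof -
  have "(NC k. (NC j. ennreal (A j k)))
   = (NC j. (NC k. ennreal (A j k)))"
   by (subst nn_integral_fst_count_space[where f = "\<lambda>(k, j). ennreal (A j k)", simplified],
    subst nn_integral_snd_count_space[where f = "\<lambda>(k, j). ennreal (A j k)", simplified]) (rule refl)
  also have "... <= (NC j. ennreal (a j))" by (intro nn_integral_mono A(3))
  finally show ?thesis using s by (rule order_trans)
 qed
 have fin: "(NC j. ennreal (A j k)) <= ennreal S" for k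
 proof -
  have "(NC j. ennreal (A j k)) <= (NC k. (NC j. ennreal (A j k)))"
   by (rule nn_integral_ge_point[of _ _ "\<lambda>k. (NC j. ennreal (A j k))"]) simp
  then show ?thesis using tot by (rule order_trans)
 qed
 have Ai: "integrable (count_space UNIV) (\<lambda>j. A j k)" for k
  by (rule nonneg_count_integrable[OF A(2) fin S])
 define E where "E k = (LC j. A j k)" for k
 have Ek: "ennreal (E k) = (NC j. ennreal (A j k))" for k
  unfolding E_def by (rule nn_integral_eq_integral[OF Ai, symmetric]) (use A(2) in auto)
 have m: "measf (\<lambda>k t x. LC j. d j k t x)"
  by (rule measfI) (rule count_integral_measurable, rule measfD[OF fam_measf[OF d]]; measurable)
 have "Bd q (E k) (\<lambda>x. LC j. d j k t x)" if t: "t \<in> {-1..1}" for k t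
 proof (rule Bd_integral[OF sigma_finite_measure_count_space q _ Ai])
  show "(\<lambda>(j, x). d j k t x) \<in> borel_measurable (count_space UNIV \<Otimes>\<^sub>M lborel)"
   by (rule count_pair_measurable) (rule measfD[OF fam_measf[OF d]]; measurable)
  show "Bd q (A j k) (d j k t)" for j by (rule A(1)[OF t])
  show "(LC j. A j k) <= E k" by (simp add: E_def)
 qed
 then show ?thesis unfolding fam_def using m S tot Ek by (intro conjI exI[of _ E]) auto
qed

lemma geometric_count_sum:
 assumes a: "0 <= a" shows "(NC j. ennreal (a * (1 / 2) ^ (i + j))) <= ennreal (2 * a * (1 / 2) ^ i)"
proof -
 have s: "(\<lambda>j. a * (1 / 2) ^ (i + j)) sums (2 * a * (1 / 2) ^ i)"
 proof -
  have "(\<lambda>j. (1 / 2 :: real) ^ j) sums (1 / (1 - 1 / 2))" by (rule geometric_sums) simp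
  from sums_mult[OF this, of "a * (1 / 2) ^ i"] show ?thesis by (simp add: power_add mult_ac)
 qed
 have "(NC j. ennreal (a * (1 / 2) ^ (i + j))) = (\<Sum>j. ennreal (a * (1 / 2) ^ (i + j)))"
  by (rule nn_integral_count_space_nat)
 also have "... = ennreal (\<Sum>j. a * (1 / 2) ^ (i + j))"
  by (rule suminf_ennreal2) (use a s in \<open>auto simp: sums_iff\<close>)
 also have "(\<Sum>j. a * (1 / 2) ^ (i + j)) = 2 * a * (1 / 2) ^ i" using s by (simp add: sums_iff)
 finally show ?thesis by simp
qed

lemma sdecay_conv_integrable:
 assumes K: "sdecay C K" and a: "Bd q A a" shows "integrable lborel (\<lambda>y. K (x - y) * a y)"
proof -
 note [measurable] = sdecay_measurable[OF K] Bd_measurable[OF a]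
 have "integrable lborel (\<lambda>y. norm (K (x + (-1) * y)))"
  using sdecay_integrable_norm(1)[OF K] lborel_integrable_real_affine_iff[of "-1" "\<lambda>z. norm (K z)" x] by simp
 then have i: "integrable lborel (\<lambda>y. norm (K (x - y)) * A)" by simp
 show ?thesis
  by (rule integrable_boundI[OF i])
    (use Bd_le[OF a] Bd_nonneg[OF a] in \<open>auto simp: norm_mult intro!: AE_I2 mult_left_mono\<close>)
qed

lemma conv_diff:
 assumes K: "sdecay C K" and a: "Bd q A a" and b: "Bd q' B b"
 shows "conv K (\<lambda>y. a y - b y) x = conv K a x - conv K b x"
 unfolding conv_def right_diff_distrib
 by (rule Bochner_Integration.integral_diff[OF sdecay_conv_integrable[OF K a] sdecay_conv_integrable[OF K b]])

context freq_window
begin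

lemma piece_diff:
 assumes c: "fam q S c" and d: "fam q' S' d" and t: "t \<in> {-1..1}"
 shows "piece (\<lambda>k t x. c k t x - d k t x) k t x = piece c k t x - piece d k t x"
proof -
 obtain A where A: "\<And>k t. t \<in> {-1..1} ==> Bd q (A k) (c k t)" using famE[OF c] by metis
 obtain B where B: "\<And>k t. t \<in> {-1..1} ==> Bd q' (B k) (d k t)" using famE[OF d] by metis
 have "sdecay K\<^sub>0 (ker ta\<sigma> (of_int k) 0)" by (rule K\<^sub>0(3)) simp
 from conv_diff[OF this A[OF t] B[OF t]] show ?thesis unfolding piece_def .
qed

lemma Syn_diff:
 assumes c: "fam q S c" and d: "fam q' S' d" and q: "1 <= q" "1 <= q'" and t: "t \<in> {-1..1}"
 shows "Syn (\<lambda>k t x. c k t x - d k t x) t x = Syn c t x - Syn d t x"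
 unfolding Syn_def piece_diff[OF c d t]
 by (rule Bochner_Integration.integral_diff[OF Syn_integrable[OF c q(1) t] Syn_integrable[OF d q(2) t]])

lemma Syn_cong: "(\<And>k x. c k t x = d k t x) ==> Syn c t x = Syn d t x"
proof -
 assume "\<And>k x. c k t x = d k t x"
 then have "c k t = d k t" for k by (intro ext)
 then show ?thesis by (simp add: Syn_def piece_def)
qed

lemma Fm_integrable:
 assumes c: "fam q c1 c" and d: "fam q d1 d" and e: "fam q e1 e" and q: "1 <= q" and s: "s \<in> {-1..1}"
 shows "integrable (count_space UNIV) (\<lambda>z. near m z * prod3 c d e z s y)"
proof -
 have q': "1 / q <= 1 / q + 1 / q + 1 / q" using q by (intro exponent3) simp
 obtain B where B: "\<And>z. 0 <= B z" "integrable (count_space UNIV) B" "\<And>z s. s \<in> {-1..1} ==> Bd q (B z) (prod3 c d e z s)"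
  using fam3E[OF c d e q q q q q'] by metis
 show ?thesis
 proof (rule integrable_boundI[OF B(2)])
  show "AE z in count_space UNIV. norm (near m z * prod3 c d e z s y) <= norm (B z)"
  proof (rule AE_I2)
   fix z
   have "norm (near m z * prod3 c d e z s y) <= 1 * B z"
    unfolding norm_mult by (intro mult_mono Bd_le[OF B(3)[OF s]]) (auto simp: near_def)
   then show "norm (near m z * prod3 c d e z s y) <= norm (B z)" using B(1)[of z] by simp
  qed
 qed simp
qed

lemma T_integrable:
 assumes c: "fam q c1 c" and d: "fam q d1 d" and e: "fam q e1 e" and q: "1 <= q" and t: "t \<in> {-1..1}"
 shows "integrable lborel (\<lambda>s. (- \<i> * sg t s) * conv (ker \<sigma> (of_int m) (t - s)) (Fm c d e m s) x)"
proof -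
 have q': "1 / q <= 1 / q + 1 / q + 1 / q" using q by (intro exponent3) simp
 obtain B E where E: "\<And>m. 0 <= E m" "\<And>m s. s \<in> {-1..1} ==> Bd q (E m) (Fm c d e m s)"
  using fam3E[OF c d e q q q q q'] by metis
 show ?thesis
 proof (rule integrable_boundI)
  show "integrable lborel (\<lambda>s. indicator {-1..1::real} s *\<^sub>R (Kp * E m))"
   by (intro integrable_scaleR_left integrable_real_indicator) auto
  show "(\<lambda>s. (- \<i> * sg t s) * conv (ker \<sigma> (of_int m) (t - s)) (Fm c d e m s) x) \<in> borel_measurable lborel"
   by (rule T_integrand_measurable[OF fam_measf[OF c] fam_measf[OF d] fam_measf[OF e]]) measurable
  show "AE s in lborel. norm ((- \<i> * sg t s) * conv (ker \<sigma> (of_int m) (t - s)) (Fm c d e m s) x) <= norm (indicator {-1..1} s *\<^sub>R (Kp * E m))"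
  proof (rule AE_I2)
   fix s
   show "norm ((- \<i> * sg t s) * conv (ker \<sigma> (of_int m) (t - s)) (Fm c d e m s) x) <= norm (indicator {-1..1} s *\<^sub>R (Kp * E m))"
   proof (cases "sg t s = 0")
    case False
    then have r: "s \<in> {-1..1}" "t - s \<in> {-1..1}" using sg_range[OF _ t] by auto
    have "norm (conv (ker \<sigma> (of_int m) (t - s)) (Fm c d e m s) x) <= Kp * E m"
     unfolding Kp_def by (rule Bd_le[OF Bd_conv[OF K\<^sub>0(2)[OF r(2)] E(2)[OF r(1)] q]])
    then have "norm (sg t s) * norm (conv (ker \<sigma> (of_int m) (t - s)) (Fm c d e m s) x) <= 1 * (Kp * E m)"
     by (intro mult_mono norm_sg_le) auto
    then show ?thesis using r Kp_nonneg E(1)[of m] by (simp add: norm_mult)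
   qed simp
  qed
 qed
qed

text \<open>Linearity in whichever slot carries the difference, stated through the triple products
  so that one proof serves all three slots, including the conjugate-linear one.\<close>

lemma T_lin:
 assumes 1: "fam q a1 c1" "fam q b1 d1" "fam q f1 e1" and 2: "fam q a2 c2" "fam q b2 d2" "fam q f2 e2"
  and q: "1 <= q" and t: "t \<in> {-1..1}"
  and P: "\<And>z s y. s \<in> {-1..1} ==> prod3 c0 d0 e0 z s y = prod3 c1 d1 e1 z s y - prod3 c2 d2 e2 z s y"
 shows "T c0 d0 e0 m t x = T c1 d1 e1 m t x - T c2 d2 e2 m t x"
proof -
 have F: "Fm c0 d0 e0 m s = (\<lambda>y. Fm c1 d1 e1 m s y - Fm c2 d2 e2 m s y)" if "s \<in> {-1..1}" for s
  unfolding Fm_def P[OF that] right_diff_distrib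
  by (rule ext) (rule Bochner_Integration.integral_diff[OF Fm_integrable[OF 1 q that] Fm_integrable[OF 2 q that]])
 have q': "1 / q <= 1 / q + 1 / q + 1 / q" using q by (intro exponent3) simp
 obtain B1 E1 where E1: "\<And>m s. s \<in> {-1..1} ==> Bd q (E1 m) (Fm c1 d1 e1 m s)"
  using fam3E[OF 1 q q q q q'] by metis
 obtain B2 E2 where E2: "\<And>m s. s \<in> {-1..1} ==> Bd q (E2 m) (Fm c2 d2 e2 m s)"
  using fam3E[OF 2 q q q q q'] by metis
 have "(- \<i> * sg t s) * conv (ker \<sigma> (of_int m) (t - s)) (Fm c0 d0 e0 m s) x
  = (- \<i> * sg t s) * conv (ker \<sigma> (of_int m) (t - s)) (Fm c1 d1 e1 m s) x
   - (- \<i> * sg t s) * conv (ker \<sigma> (of_int m) (t - s)) (Fm c2 d2 e2 m s) x" for s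
 proof (cases "sg t s = 0")
  case False
  then have r: "s \<in> {-1..1}" "t - s \<in> {-1..1}" using sg_range[OF _ t] by auto
  show ?thesis unfolding F[OF r(1)] conv_diff[OF K\<^sub>0(2)[OF r(2)] E1[OF r(1)] E2[OF r(1)]] by (rule right_diff_distrib)
 qed simp
 then show ?thesis unfolding T_def
  using Bochner_Integration.integral_diff[OF T_integrable[OF 1 q t] T_integrable[OF 2 q t]] by presburger
qed

lemma T_diff:
 assumes c: "fam q S c" and d: "fam q S' d" and q: "1 <= q" and t: "t \<in> {-1..1}"
 shows "T c c c m t x - T d d d m t x
  = T (\<lambda>k t x. c k t x - d k t x) c c m t x + T d (\<lambda>k t x. c k t x - d k t x) c m t x + T d d (\<lambda>k t x. c k t x - d k t x) m t x"
proof -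
 have pd: "piece (\<lambda>k t x. c k t x - d k t x) k s y = piece c k s y - piece d k s y" if "s \<in> {-1..1}" for k s y
  by (rule piece_diff[OF c d that])
 have "T (\<lambda>k t x. c k t x - d k t x) c c m t x = T c c c m t x - T d c c m t x"
  by (rule T_lin[OF c c c d c c q t]) (auto simp: prod3_def pd algebra_simps split: prod.split)
 moreover have "T d (\<lambda>k t x. c k t x - d k t x) c m t x = T d c c m t x - T d d c m t x"
  by (rule T_lin[OF d c c d d c q t]) (auto simp: prod3_def pd algebra_simps split: prod.split)
 moreover have "T d d (\<lambda>k t x. c k t x - d k t x) m t x = T d d c m t x - T d d d m t x"
  by (rule T_lin[OF d d c d d d q t]) (auto simp: prod3_def pd algebra_simps split: prod.split)
 ultimately show ?thesis by simp
qed

text \<open>Telescoping in the three slots leaves terms with one difference in the exponent q1 and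
  two factors in the exponent r. This produces the Lipschitz constant 3 CT b^2 and the possible gain
  2 / r in integrability.\<close>

lemma T_diff_fam:
 assumes c: "fam r b c" and d: "fam r b d" and cd: "fam q1 dl (\<lambda>k t x. c k t x - d k t x)"
  and q: "1 <= r" "1 <= q1" "1 <= q" "1 / q <= 1 / q1 + 2 / r"
 shows "fam q (3 * CT * b\<^sup>2 * dl) (\<lambda>k t x. T c c c k t x - T d d d k t x)"
proof -
 let ?e = "\<lambda>k t x. c k t x - d k t x"
 have e: "1 / q <= 1 / q1 + 1 / r + 1 / r" "1 / q <= 1 / r + 1 / q1 + 1 / r" "1 / q <= 1 / r + 1 / r + 1 / q1" using q(4) by auto
 have 1: "fam q (CT * (dl * b * b)) (T ?e c c)" by (rule T_fam[OF cd c c q(2) q(1) q(1) q(3) e(1)])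
 have 2: "fam q (CT * (b * dl * b)) (T d ?e c)" by (rule T_fam[OF d cd c q(1) q(2) q(1) q(3) e(2)])
 have 3: "fam q (CT * (b * b * dl)) (T d d ?e)" by (rule T_fam[OF d d cd q(1) q(1) q(2) q(3) e(3)])
 have s: "fam q (CT * (dl * b * b) + CT * (b * dl * b) + CT * (b * b * dl)) (\<lambda>k t x. T ?e c c k t x + T d ?e c k t x + T d d ?e k t x)"
  by (rule fam_add[OF fam_add[OF 1 2 q(3)] 3 q(3)])
 have eq: "CT * (dl * b * b) + CT * (b * dl * b) + CT * (b * b * dl) = 3 * CT * b\<^sup>2 * dl"
  by (simp add: power2_eq_square algebra_simps)
 have m: "measf (\<lambda>k t x. T c c c k t x - T d d d k t x)"
  by (rule measfI)
    (intro borel_measurable_diff measfD[OF T_measf[OF fam_measf[OF c] fam_measf[OF c] fam_measf[OF c]]]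
     measfD[OF T_measf[OF fam_measf[OF d] fam_measf[OF d] fam_measf[OF d]]]; measurable)
 show ?thesis by (rule fam_cong[OF s[unfolded eq] m]) (rule T_diff[OF c d q(1)])
qed

section \<open>Picard iterates, their limit and its dependence on the data\<close>

primrec pic :: "(int => real => real => complex) => nat => int => real => real => complex" where
 "pic c0 0 = (\<lambda>k t x. 0)"
| "pic c0 (Suc j) = (\<lambda>k t x. c0 k t x + T (pic c0 j) (pic c0 j) (pic c0 j) k t x)"

text \<open>Because the iteration starts at zero, the increment with index 0 is the free family, and
  the increment with index j corresponds to the iterate u^j of the statement.\<close>

definition dpic where
 "dpic c0 j = (\<lambda>k t x. pic c0 (Suc j) k t x - pic c0 j k t x)"

lemma T_zero: "T (\<lambda>k t x. 0) (\<lambda>k t x. 0) (\<lambda>k t x. 0) m t x = 0"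
proof -
 have "piece (\<lambda>k t x. 0) k s y = 0" for k s y by (simp add: piece_def conv_def)
 then have "prod3 (\<lambda>k t x. 0) (\<lambda>k t x. 0) (\<lambda>k t x. 0) z s y = 0" for z s y by (auto simp: prod3_def split: prod.split)
 then show ?thesis by (simp add: T_def Fm_def conv_def)
qed

text \<open>The single smallness condition gives both requirements of the fixed point argument: the
  ball of radius 2a is preserved and the Lipschitz constant there is at most 1/2.\<close>

lemma small_a: assumes "0 <= a" "6 * CT * (2 * a)\<^sup>2 <= 1"
 shows "CT * ((2 * a) * (2 * a) * (2 * a)) <= a" "3 * CT * (2 * a)\<^sup>2 <= 1 / 2"
proof -
 show h: "3 * CT * (2 * a)\<^sup>2 <= 1 / 2" using assms(2) by simp
 have "CT * ((2 * a) * (2 * a) * (2 * a)) = (CT * (2 * a)\<^sup>2) * (2 * a)" by (simp add: power2_eq_square)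
 also have "... <= (1 / 2) * (2 * a)" using h assms(1) CT_nonneg
  by (intro mult_right_mono) (auto intro: order_trans[rotated])
 finally show "CT * ((2 * a) * (2 * a) * (2 * a)) <= a" by simp
qed

lemma pic_fam:
 assumes c0: "fam r a c0" and r: "1 <= r" and a: "6 * CT * (2 * a)\<^sup>2 <= 1"
 shows "fam r (2 * a) (pic c0 j)"
proof (induction j)
 case 0
 have "fam r 0 (\<lambda>k t x. 0)" by (rule fam_zero) (use r in simp)
 then show ?case using fam_nonneg[OF c0] by (auto intro: fam_mono)
next
 case (Suc j)
 have r': "1 / r <= 1 / r + 1 / r + 1 / r" using r by (intro exponent3) simp
 have "fam r (a + CT * ((2 * a) * (2 * a) * (2 * a))) (pic c0 (Suc j))"
  unfolding pic.simps by (rule fam_add[OF c0 T_fam[OF Suc Suc Suc r r r r r'] r])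
 then show ?case using small_a(1)[OF fam_nonneg[OF c0] a] by (auto intro: fam_mono)
qed

text \<open>Every step multiplies a difference in L^q with two factors in L^r, which raises the
  numerator of 1 / q, over the denominator r, by 2. The minimum stops the improvement at the
  exponent r / (2n + 1) = 2, where it stays for all later increments.\<close>

lemma dpic_fam:
 fixes n :: nat
 assumes r: "r = 4 * real n + 2" and c0: "fam r a c0" and a: "6 * CT * (2 * a)\<^sup>2 <= 1"
 shows "fam (r / real (min (2 * j + 1) (2 * n + 1))) (a * (1 / 2) ^ j) (dpic c0 j)"
proof (induction j)
 case 0
 have "dpic c0 0 = c0" by (simp add: dpic_def T_zero)
 then show ?case using c0 by simp
next
 case (Suc j)
 have r1: "1 <= r" using r by simp
 define l where "l j = min (2 * j + 1) (2 * n + 1)" for j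
 have l: "1 <= l j" "l j <= 2 * n + 1" "l (Suc j) <= l j + 2" for j by (auto simp: l_def)
 have q: "1 <= r / real (l j)" for j
 proof -
  have "real (l j) <= r" using l(2)[of j] r by simp
  then show ?thesis using l(1)[of j] by (simp add: le_divide_eq)
 qed
 have "real (l (Suc j)) <= real (l j) + 2" using l(3)[of j] by linarith
 then have e: "1 / (r / real (l (Suc j))) <= 1 / (r / real (l j)) + 2 / r"
  using r1 by (simp add: divide_right_mono add_divide_distrib[symmetric])
 have "fam (r / real (l (Suc j))) (3 * CT * (2 * a)\<^sup>2 * (a * (1 / 2) ^ j))
   (\<lambda>k t x. T (pic c0 (Suc j)) (pic c0 (Suc j)) (pic c0 (Suc j)) k t x - T (pic c0 j) (pic c0 j) (pic c0 j) k t x)"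
  by (rule T_diff_fam[OF pic_fam[OF c0 r1 a] pic_fam[OF c0 r1 a] Suc[unfolded dpic_def l_def[symmetric]] r1 q q e])
 moreover have "(\<lambda>k t x. T (pic c0 (Suc j)) (pic c0 (Suc j)) (pic c0 (Suc j)) k t x - T (pic c0 j) (pic c0 j) (pic c0 j) k t x) = dpic c0 (Suc j)"
  by (simp add: dpic_def)
 moreover have "3 * CT * (2 * a)\<^sup>2 * (a * (1 / 2) ^ j) <= a * (1 / 2) ^ Suc j"
 proof -
  have "3 * CT * (2 * a)\<^sup>2 * (a * (1 / 2) ^ j) <= (1 / 2) * (a * (1 / 2) ^ j)"
   using small_a(2)[OF fam_nonneg[OF c0] a] fam_nonneg[OF c0] by (intro mult_right_mono) auto
  then show ?thesis by simp
 qed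
 ultimately show ?case unfolding l_def by (auto intro: fam_mono)
qed

lemma pic_sum: "pic c0 i k t x = (\<Sum>j<i. dpic c0 j k t x)"
 by (induction i) (auto simp: dpic_def)

text \<open>The limit of the iteration, written as the series of its increments so that the
  estimates for series of families apply to the limit and to its tails.\<close>

definition sol :: "(int => real => real => complex) => int => real => real => complex" where
 "sol c0 k t x = (LC j. dpic c0 j k t x)"

lemma sol_properties:
 fixes n :: nat
 assumes r: "r = 4 * real n + 2" and c0: "fam r a c0" and a: "6 * CT * (2 * a)\<^sup>2 <= 1"
 shows "fam r (2 * a) (sol c0)"
  and "\<And>i. fam r (2 * a * (1 / 2) ^ i) (\<lambda>k t x. sol c0 k t x - pic c0 i k t x)"
  and "fam 2 (2 * a) (\<lambda>k t x. sol c0 k t x - pic c0 n k t x)"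
  and "\<And>k t x. t \<in> {-1..1} ==> sol c0 k t x = c0 k t x + T (sol c0) (sol c0) (sol c0) k t x"
proof -
 have r1: "1 <= r" "0 < r" using r by auto
 have a0: "0 <= a" by (rule fam_nonneg[OF c0])
 note D = dpic_fam[OF r c0 a]
 have Dr: "fam r (a * (1 / 2) ^ j) (dpic c0 j)" for j
 proof (rule fam_exponent_mono[OF D])
  show "0 < r / real (min (2 * j + 1) (2 * n + 1))" using r1 by simp
  show "r / real (min (2 * j + 1) (2 * n + 1)) <= r" using r1 by (simp add: divide_le_eq mult_le_cancel_left1)
 qed
 \<comment> \<open>From index n on the increments have exponent exactly 2, since r = 2 (2n +
   1).\<close>
 have D2: "fam 2 (a * (1 / 2) ^ (n + j)) (dpic c0 (n + j))" for j
 proof -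
  have "r / real (min (2 * (n + j) + 1) (2 * n + 1)) = 2" using r by (simp add: min_def field_simps)
  then show ?thesis using D[of "n + j"] by simp
 qed
 have tail: "sol c0 k t x - pic c0 i k t x = (LC j. dpic c0 (i + j) k t x)" if t: "t \<in> {-1..1}" for i k t x
 proof -
  have ab: "norm (dpic c0 j k t x) <= a * (1 / 2) ^ j" for j by (rule fam_le[OF Dr t])
  have sm: "summable (\<lambda>j. norm (dpic c0 j k t x))"
  proof (rule summable_comparison_test')
   show "summable (\<lambda>j. a * (1 / 2) ^ j)" by (intro summable_mult summable_geometric) simp
   show "norm (norm (dpic c0 j k t x)) <= a * (1 / 2) ^ j" if "0 <= j" for j using ab by simp
  qed
  have i1: "integrable (count_space UNIV) (\<lambda>j. dpic c0 j k t x)" using sm by (simp add: integrable_count_space_nat_iff)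
  have sm2: "summable (\<lambda>j. norm (dpic c0 (i + j) k t x))" using summable_ignore_initial_segment[OF sm, of i] by (simp add: add.commute)
  have i2: "integrable (count_space UNIV) (\<lambda>j. dpic c0 (i + j) k t x)" using sm2 by (simp add: integrable_count_space_nat_iff)
  have "sol c0 k t x = (\<Sum>j. dpic c0 j k t x)" unfolding sol_def by (rule integral_count_space_nat[OF i1])
  also have "... = (\<Sum>j. dpic c0 (j + i) k t x) + (\<Sum>j<i. dpic c0 j k t x)"
   by (rule suminf_split_initial_segment[OF summable_norm_cancel[OF sm]])
  also have "(\<Sum>j. dpic c0 (j + i) k t x) = (LC j. dpic c0 (i + j) k t x)"
   unfolding integral_count_space_nat[OF i2] by (simp add: add.commute)
  finally show ?thesis unfolding pic_sum by simp
 qed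
 have pm: "measf (pic c0 i)" for i by (rule fam_measf[OF pic_fam[OF c0 r1(1) a]])
 have "fam r (2 * a * (1 / 2) ^ 0) (\<lambda>k t x. LC j. dpic c0 (0 + j) k t x)"
  by (rule fam_count_sum[OF Dr r1(1) geometric_count_sum[OF a0]]) (use a0 in simp)
 then show S: "fam r (2 * a) (sol c0)" by (simp add: sol_def[abs_def])
 have md: "measf (\<lambda>k t x. sol c0 k t x - pic c0 i k t x)" for i
  by (rule measfI) (intro borel_measurable_diff measfD[OF fam_measf[OF S]] measfD[OF pm]; measurable)
 show Si: "fam r (2 * a * (1 / 2) ^ i) (\<lambda>k t x. sol c0 k t x - pic c0 i k t x)" for i
  by (rule fam_cong[OF fam_count_sum[OF Dr r1(1) geometric_count_sum[OF a0]] md tail]) (use a0 in auto)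
 have S2: "fam 2 (2 * a * (1 / 2) ^ n) (\<lambda>k t x. sol c0 k t x - pic c0 n k t x)"
  by (rule fam_cong[OF fam_count_sum[OF D2 _ geometric_count_sum[OF a0]] md tail]) (use a0 in auto)
 have "2 * a * (1 / 2) ^ n <= 2 * a" using a0 by (simp add: mult_left_le power_le_one)
 then show "fam 2 (2 * a) (\<lambda>k t x. sol c0 k t x - pic c0 n k t x)" by (rule fam_mono[OF S2])
 fix k t x assume t: "t \<in> {-1..1::real}"
 let ?R = "sol c0 k t x - (c0 k t x + T (sol c0) (sol c0) (sol c0) k t x)"
 \<comment> \<open>The defect of the fixed point equation is compared with that of the i-th iterate:
   the tail of the series and the Lipschitz difference of the cubic terms each contribute at most a
   / 2^i.\<close>
 have "norm ?R <= (4 * a) * (1 / 2) ^ i" for i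
 proof -
  have h: "2 * a * (1 / 2) ^ i <= 2 * a" using a0 by (simp add: mult_left_le power_le_one)
  have e: "1 / r <= 1 / r + 2 / r" using r1 by (intro exponent2) simp
  have 1: "norm (sol c0 k t x - pic c0 (Suc i) k t x) <= 2 * a * (1 / 2) ^ Suc i" by (rule fam_le[OF Si t])
  have 2: "norm (T (sol c0) (sol c0) (sol c0) k t x - T (pic c0 i) (pic c0 i) (pic c0 i) k t x) <= 3 * CT * (2 * a)\<^sup>2 * (2 * a * (1 / 2) ^ i)"
   by (rule fam_le[OF T_diff_fam[OF S pic_fam[OF c0 r1(1) a] Si r1(1) r1(1) r1(1) e] t])
  have "3 * CT * (2 * a)\<^sup>2 * (2 * a * (1 / 2) ^ i) <= 1 / 2 * (2 * a * (1 / 2) ^ i)"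
   using small_a(2)[OF a0 a] a0 by (intro mult_right_mono) auto
  moreover have "?R = (sol c0 k t x - pic c0 (Suc i) k t x) - (T (sol c0) (sol c0) (sol c0) k t x - T (pic c0 i) (pic c0 i) (pic c0 i) k t x)"
   by simp
  then have "norm ?R <= norm (sol c0 k t x - pic c0 (Suc i) k t x) + norm (T (sol c0) (sol c0) (sol c0) k t x - T (pic c0 i) (pic c0 i) (pic c0 i) k t x)"
   by (metis norm_triangle_ineq4)
  moreover have "2 * a * (1 / 2) ^ Suc i = a * (1 / 2) ^ i" "1 / 2 * (2 * a * (1 / 2) ^ i) = a * (1 / 2) ^ i"
   "(4 * a) * (1 / 2) ^ i = 4 * (a * (1 / 2) ^ i)" "0 <= a * (1 / 2) ^ i" using a0 by simp_all
  ultimately show ?thesis using 1 2 by linarith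
 qed
 moreover have "(\<lambda>i. (4 * a) * (1 / 2) ^ i) \<longlonglongrightarrow> 0"
  by (rule tendsto_mult_right_zero) (rule LIMSEQ_power_zero, simp)
 ultimately have "norm ?R <= 0" by (intro LIMSEQ_le_const) auto
 then show "sol c0 k t x = c0 k t x + T (sol c0) (sol c0) (sol c0) k t x" by simp
qed

text \<open>A crude bound 4a for the difference is improved repeatedly by the contraction: E becomes
  dl + E / 2, whose fixed point is 2 dl. Finitely many steps bring the remainder below dl, which
  gives the factor 3.\<close>

lemma sol_dependence:
 fixes n :: nat
 assumes r: "r = 4 * real n + 2" and c: "fam r a c" and d: "fam r a d" and a: "6 * CT * (2 * a)\<^sup>2 <= 1"
  and cd: "fam r dl (\<lambda>k t x. c k t x - d k t x)" and dl: "0 < dl"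
 shows "fam r (3 * dl) (\<lambda>k t x. sol c k t x - sol d k t x)"
proof -
 have r1: "1 <= r" using r by simp
 have a0: "0 <= a" by (rule fam_nonneg[OF c])
 note S = sol_properties[OF r c a] and S' = sol_properties[OF r d a]
 have e: "1 / r <= 1 / r + 2 / r" using r1 by (intro exponent2) simp
 have md: "measf (\<lambda>k t x. sol c k t x - sol d k t x)"
  by (rule measfI) (intro borel_measurable_diff measfD[OF fam_measf[OF S(1)]] measfD[OF fam_measf[OF S'(1)]]; measurable)
 have it: "fam r (2 * dl + 4 * a * (1 / 2) ^ i) (\<lambda>k t x. sol c k t x - sol d k t x)" for i
 proof (induction i)
  case 0
  have "fam r (2 * a + 2 * a) (\<lambda>k t x. sol c k t x - sol d k t x)" by (rule fam_diff[OF S(1) S'(1) r1])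
  then show ?case using dl by (auto intro: fam_mono)
 next
  case (Suc i)
  let ?E = "2 * dl + 4 * a * (1 / 2) ^ i"
  have "fam r (dl + 3 * CT * (2 * a)\<^sup>2 * ?E) (\<lambda>k t x. (c k t x - d k t x) + (T (sol c) (sol c) (sol c) k t x - T (sol d) (sol d) (sol d) k t x))"
   by (rule fam_add[OF cd T_diff_fam[OF S(1) S'(1) Suc r1 r1 r1 e] r1])
  then have f: "fam r (dl + 3 * CT * (2 * a)\<^sup>2 * ?E) (\<lambda>k t x. sol c k t x - sol d k t x)"
  proof (rule fam_cong[OF _ md])
   fix k t x assume t: "t \<in> {-1..1::real}"
   show "sol c k t x - sol d k t x = (c k t x - d k t x) + (T (sol c) (sol c) (sol c) k t x - T (sol d) (sol d) (sol d) k t x)"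
    using S(4)[OF t, of k x] S'(4)[OF t, of k x] by (metis add_diff_add)
  qed
  have "3 * CT * (2 * a)\<^sup>2 * ?E <= 1 / 2 * ?E"
   using small_a(2)[OF a0 a] a0 dl by (intro mult_right_mono) auto
  then have "dl + 3 * CT * (2 * a)\<^sup>2 * ?E <= 2 * dl + 4 * a * (1 / 2) ^ Suc i" by simp
  then show ?case by (rule fam_mono[OF f])
 qed
 have "(\<lambda>i. 4 * a * (1 / 2) ^ i) \<longlonglongrightarrow> 0"
  by (rule tendsto_mult_right_zero) (rule LIMSEQ_power_zero, simp)
 then have "\<forall>\<^sub>F i in sequentially. 4 * a * (1 / 2) ^ i < dl" using dl by (rule order_tendstoD(2))
 then obtain i where "4 * a * (1 / 2) ^ i < dl" by (auto simp: eventually_sequentially)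
 then show ?thesis by (intro fam_mono[OF it[of i]]) simp
qed

end

section \<open>Uniqueness in \<open>L\<^sup>2\<close>\<close>

text \<open>Prepares the use of the Stone-Weierstrass theorem: a polynomial times a fixed Schwartz
  cutoff is an admissible test function.\<close>

lemma schwartz_real_polynomial_mult:
 fixes b :: "real => complex"
 assumes "real_polynomial_function p" "schwartz b" shows "schwartz (\<lambda>x. of_real (p x) * b x)"
 using assms
proof (induction arbitrary: b)
 case (linear f)
 then obtain c where "f = (\<lambda>x. x * c)" unfolding real_bounded_linear by blast
 then show ?case using schwartz_cmult[OF schwartz_mult_id[OF linear(2)], of "of_real c"] by (simp add: mult_ac)
next
 case (const c)
 show ?case by (rule schwartz_cmult[OF const])
next
 case (add f g)
 then show ?case using schwartz_add[OF add(3)[OF add(5)] add(4)[OF add(5)]] by (simp add: distrib_right)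
next
 case (mult f g)
 then show ?case using mult(3)[OF mult(4)[OF mult(5)]] by (simp add: mult_ac)
qed

lemma integrable_mult_L2:
 fixes d :: "real => complex" and b :: "real => real"
 assumes d: "integrable lborel (\<lambda>x. (norm (d x))\<^sup>2)" and b: "integrable lborel (\<lambda>x. (b x)\<^sup>2)"
  and [measurable]: "d \<in> borel_measurable borel" "b \<in> borel_measurable borel"
 shows "integrable lborel (\<lambda>x. norm (d x) * b x)"
proof (rule integrable_boundI[OF Bochner_Integration.integrable_add[OF d b]])
 show "AE x in lborel. norm (norm (d x) * b x) <= norm ((norm (d x))\<^sup>2 + (b x)\<^sup>2)"
 proof (rule AE_I2)
  fix x
  have "2 * (norm (d x) * \<bar>b x\<bar>) <= (norm (d x))\<^sup>2 + \<bar>b x\<bar>\<^sup>2" using sum_squares_bound[of "norm (d x)" "\<bar>b x\<bar>"] by simp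
  moreover have "0 <= norm (d x) * \<bar>b x\<bar>" by simp
  ultimately have "norm (d x) * \<bar>b x\<bar> <= (norm (d x))\<^sup>2 + \<bar>b x\<bar>\<^sup>2" by linarith
  then show "norm (norm (d x) * b x) <= norm ((norm (d x))\<^sup>2 + (b x)\<^sup>2)" by (simp add: abs_mult)
 qed
qed measurable

text \<open>The quadratic test inequality passes to pointwise limits with a square-integrable
  majorant. It is used first to leave polynomials and then to leave continuous functions.\<close>

lemma L2_test_limit:
 fixes d f :: "real => complex" and phi :: "nat => real => complex" and b :: "real => real"
 assumes d: "integrable lborel (\<lambda>x. (norm (d x))\<^sup>2)" and b: "integrable lborel (\<lambda>x. (b x)\<^sup>2)"
  and [measurable]: "d \<in> borel_measurable borel" "b \<in> borel_measurable borel" "\<And>n. phi n \<in> borel_measurable borel"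
   "f \<in> borel_measurable borel"
  and le: "\<And>n x. norm (phi n x) <= b x" and lim: "AE x in lborel. (\<lambda>n. phi n x) \<longlonglongrightarrow> f x"
  and B: "\<And>n. (norm (LBINT x. d x * phi n x))\<^sup>2 <= Q * (LBINT x. (norm (phi n x))\<^sup>2)"
 shows "(norm (LBINT x. d x * f x))\<^sup>2 <= Q * (LBINT x. (norm (f x))\<^sup>2)"
proof -
 have 1: "(\<lambda>n. LBINT x. d x * phi n x) \<longlonglongrightarrow> (LBINT x. d x * f x)"
 proof (rule integral_dominated_convergence[where w = "\<lambda>x. norm (d x) * b x"])
  show "AE x in lborel. (\<lambda>n. d x * phi n x) \<longlonglongrightarrow> d x * f x" using lim by eventually_elim (intro tendsto_intros)
  show "AE x in lborel. norm (d x * phi n x) <= norm (d x) * b x" for n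
   by (rule AE_I2) (simp add: norm_mult mult_left_mono le)
  show "integrable lborel (\<lambda>x. norm (d x) * b x)" by (rule integrable_mult_L2[OF d b]) measurable
 qed measurable
 have 2: "(\<lambda>n. LBINT x. (norm (phi n x))\<^sup>2) \<longlonglongrightarrow> (LBINT x. (norm (f x))\<^sup>2)"
 proof (rule integral_dominated_convergence[where w = "\<lambda>x. (b x)\<^sup>2"])
  show "AE x in lborel. (\<lambda>n. (norm (phi n x))\<^sup>2) \<longlonglongrightarrow> (norm (f x))\<^sup>2" using lim by eventually_elim (intro tendsto_intros)
  show "AE x in lborel. norm ((norm (phi n x))\<^sup>2) <= (b x)\<^sup>2" for n
   by (rule AE_I2) (simp add: power_mono le)
 qed (use b in measurable)
 show ?thesis
  by (rule LIMSEQ_le[OF tendsto_power[OF tendsto_norm[OF 1]] tendsto_mult[OF tendsto_const 2]]) (use B in blast)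
qed

text \<open>On the support of the cutoff a continuous function is a uniform limit of polynomials, so
  the test inequality known for Schwartz functions extends to continuous functions times the
  cutoff.\<close>

lemma continuous_test:
 fixes d b h :: "real => complex"
 assumes d: "integrable lborel (\<lambda>x. (norm (d x))\<^sup>2)" and [measurable]: "d \<in> borel_measurable borel"
  and B: "\<And>phi. schwartz phi ==> (norm (LBINT x. d x * phi x))\<^sup>2 <= Q * (LBINT x. (norm (phi x))\<^sup>2)"
  and b: "schwartz b" "\<And>x. R < \<bar>x\<bar> ==> b x = 0" and h: "continuous_on UNIV h"
 shows "(norm (LBINT x. d x * (h x * b x)))\<^sup>2 <= Q * (LBINT x. (norm (h x * b x))\<^sup>2)"
proof -
 have hc: "continuous_on {-R..R} h" by (rule continuous_on_subset[OF h]) simp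
 have "\<exists>p. polynomial_function p \<and> (\<forall>x\<in>{-R..R}. norm (h x - p x) < 1 / real (Suc n))" for n
  by (rule Stone_Weierstrass_polynomial_function[OF compact_Icc hc]) auto
 then obtain p where p: "\<And>n. polynomial_function (p n)" "\<And>n x. x \<in> {-R..R} ==> norm (h x - p n x) < 1 / real (Suc n)"
  by metis
 have s: "schwartz (\<lambda>x. p n x * b x)" for n
 proof -
  have r: "real_polynomial_function (\<lambda>x. Re (p n x))" "real_polynomial_function (\<lambda>x. Im (p n x))"
   using p(1)[of n] bounded_linear_Re bounded_linear_Im unfolding polynomial_function_def o_def by blast+
  have "schwartz (\<lambda>x. of_real (Re (p n x)) * b x + \<i> * (of_real (Im (p n x)) * b x))"
   by (intro schwartz_add schwartz_cmult schwartz_real_polynomial_mult r b(1))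
  moreover have "p n x * b x = of_real (Re (p n x)) * b x + \<i> * (of_real (Im (p n x)) * b x)" for x
   by (subst complex_eq[of "p n x"]) (simp add: algebra_simps)
  ultimately show ?thesis by simp
 qed
 have "bounded (h ` {-R..R})" by (rule compact_imp_bounded[OF compact_continuous_image[OF hc compact_Icc]])
 then obtain M where M: "\<And>x. x \<in> {-R..R} ==> norm (h x) <= M" unfolding bounded_iff by (metis imageI)
 have in_R: "x \<in> {-R..R}" if "b x \<noteq> 0" for x using b(2)[of x] that by (cases "R < \<bar>x\<bar>") auto
 note [measurable] = schwartz_measurable[OF s] schwartz_measurable[OF b(1)] borel_measurable_continuous_onI[OF h]
 show ?thesis
 proof (rule L2_test_limit[OF d, where b = "\<lambda>x. (M + 1) * norm (b x)" and phi = "\<lambda>n x. p n x * b x"])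
  show "integrable lborel (\<lambda>x. ((M + 1) * norm (b x))\<^sup>2)"
   unfolding power_mult_distrib by (intro integrable_mult_right schwartz_norm2_integrable b(1))
  show "norm (p n x * b x) <= (M + 1) * norm (b x)" for n x
  proof (cases "b x = 0")
   case False
   have "norm (p n x) <= norm (h x) + norm (h x - p n x)" by (metis norm_minus_commute norm_triangle_sub)
   also have "... <= M + 1 / real (Suc n)" by (intro add_mono M less_imp_le p(2) in_R False)
   also have "... <= M + 1" by (simp add: divide_le_eq)
   finally show ?thesis by (simp add: norm_mult mult_right_mono)
  qed simp
  show "AE x in lborel. (\<lambda>n. p n x * b x) \<longlonglongrightarrow> h x * b x"
  proof (rule AE_I2)
   fix x
   show "(\<lambda>n. p n x * b x) \<longlonglongrightarrow> h x * b x"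
   proof (cases "b x = 0")
    case False
    have "(\<lambda>n. p n x - h x) \<longlonglongrightarrow> 0"
     by (rule Lim_null_comparison[OF always_eventually[OF allI] LIMSEQ_inverse_real_of_nat])
       (use p(2)[OF in_R[OF False]] in \<open>simp add: norm_minus_commute less_imp_le inverse_eq_divide\<close>)
    then show ?thesis by (intro tendsto_mult tendsto_const) (simp add: LIM_zero_iff)
   qed simp
  qed
 qed (use B[OF s] in measurable)
qed

text \<open>The radial retraction onto the ball of radius m + 1. It is continuous and bounded, so
  approximants of a bounded function stay dominated without losing convergence.\<close>

definition clip :: "real => complex => complex" where
 "clip m z = z / of_real (max 1 (norm z / (m + 1)))"

lemma continuous_clip: "continuous_on UNIV (clip m)"
 unfolding clip_def[abs_def] divide_inverse[of _ "m + 1"] by (intro continuous_intros) auto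

lemma norm_clip_le: assumes "0 <= m" shows "norm (clip m z) <= m + 1"
proof -
 have "norm z = (norm z / (m + 1)) * (m + 1)" using assms by simp
 also have "... <= max 1 (norm z / (m + 1)) * (m + 1)" using assms by (intro mult_right_mono) auto
 finally have le: "norm z <= (m + 1) * max 1 (norm z / (m + 1))" by (simp only: mult.commute)
 have "norm (clip m z) = norm z / max 1 (norm z / (m + 1))" by (simp add: clip_def norm_divide)
 also have "... <= m + 1" using le by (subst pos_divide_le_eq) auto
 finally show ?thesis .
qed

lemma clip_id: "0 <= m ==> norm z <= m ==> clip m z = z"
 by (simp add: clip_def max_def divide_le_eq)

text \<open>The natural test function is the conjugate of \<open>d\<close>, which is only
  measurable. It is truncated in size and in space, approximated by continuous functions almost
  everywhere, clipped, and reached from Schwartz functions through polynomials.\<close>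

lemma (in freq_window) L2_duality:
 fixes d :: "real => complex"
 assumes d: "integrable lborel (\<lambda>x. (norm (d x))\<^sup>2)" and [measurable]: "d \<in> borel_measurable borel" and Q: "0 <= Q"
  and B: "\<And>phi. schwartz phi ==> (norm (LBINT x. d x * phi x))\<^sup>2 <= Q * (LBINT x. (norm (phi x))\<^sup>2)"
 shows "(LBINT x. (norm (d x))\<^sup>2) <= Q"
proof -
 note [measurable] = bump_measurable[OF bump_\<sigma>]
 \<comment> \<open>Partial sums of the partition of unity serve a second time, as smooth cutoffs
   between 0 and 1 that exhaust the line.\<close>
 define c where "c m x = (\<Sum>k\<in>{-int m..int m}. \<sigma> (x - of_int k))" for m x
 have [measurable]: "c m \<in> borel_measurable borel" for m unfolding c_def[abs_def] by measurable
 have \<sigma>0: "0 <= \<sigma> x" for x using window by (simp add: window_def)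
 have c0: "0 <= c m x" for m x unfolding c_def by (intro sum_nonneg \<sigma>0)
 have c1: "c m x <= 1" for m x
 proof -
  have "c m x <= (\<Sum>k\<in>{-int m..int m} \<union> {k. \<bar>x - of_int k\<bar> <= real \<rho>}. \<sigma> (x - of_int k))"
   unfolding c_def using card_supp by (intro sum_mono2 \<sigma>0) auto
  also have "... = 1" using card_supp by (intro sum_\<sigma>) auto
  finally show ?thesis .
 qed
 have ceq: "c m x = 1" if "\<bar>x\<bar> + real \<rho> <= real m" for m x
  unfolding c_def
 proof (rule sum_\<sigma>)
  fix k :: int assume k: "\<bar>x - of_int k\<bar> <= real \<rho>"
  have "- real m <= of_int k" "of_int k <= real m" using k that by linarith+
  then show "k \<in> {-int m..int m}" unfolding atLeastAtMost_iff by linarith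
 qed simp
 have cs: "schwartz (\<lambda>x. complex_of_real (c m x))" for m
  unfolding c_def of_real_sum by (intro schwartz_sum bump_schwartz bump_shift bump_\<sigma>) simp
 have csupp: "complex_of_real (c m x) = 0" if "real m + real \<rho> < \<bar>x\<bar>" for m x
 proof -
  have "\<sigma> (x - of_int k) = 0" if k: "k \<in> {-int m..int m}" for k
  proof (rule supp)
   have "of_int (- int m) <= (of_int k :: real)" "of_int k <= (of_int (int m) :: real)" using k unfolding of_int_le_iff by auto
   then show "real \<rho> < \<bar>x - of_int k\<bar>" using that \<open>real m + real \<rho> < \<bar>x\<bar>\<close> by simp
  qed
  then show ?thesis by (simp add: c_def)
 qed
 define J where "J m = (LBINT x. (if norm (d x) <= real m then (norm (d x))\<^sup>2 * c m x else 0))" for m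
 have "J m <= Q" for m
 proof -
  define f where "f x = (if norm (d x) <= real m then cnj (d x) else 0)" for x
  have [measurable]: "f \<in> borel_measurable borel" unfolding f_def[abs_def] by measurable
  have "f \<in> borel_measurable lebesgue" by (rule measurable_completion) simp
  \<comment> \<open>This form of measurability provides continuous functions that converge to
    \<open>f\<close> outside a negligible set.\<close>
  then have "f measurable_on UNIV" by (rule lebesgue_measurable_imp_measurable_on) (use sets.top[of "lebesgue :: real measure"] in simp)
  then obtain N g where N: "negligible N" and g: "\<And>n. continuous_on UNIV (g n)" "\<And>x. x \<notin> N ==> (\<lambda>n. g n x) \<longlonglongrightarrow> f x"
   unfolding measurable_on_def by auto
  have g': "continuous_on UNIV (\<lambda>x. clip (real m) (g n x))" for n
   by (rule continuous_on_compose2[OF continuous_clip g(1)]) simp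
  note [measurable] = borel_measurable_continuous_onI[OF g']
  have fl: "clip (real m) (f x) = f x" for x by (rule clip_id) (auto simp: f_def)
  have t: "(norm (LBINT x. d x * (f x * c m x)))\<^sup>2 <= Q * (LBINT x. (norm (f x * c m x))\<^sup>2)"
  proof (rule L2_test_limit[OF d, where b = "\<lambda>x. (real m + 1) * norm (complex_of_real (c m x))" and phi = "\<lambda>n x. clip (real m) (g n x) * c m x"])
   show "integrable lborel (\<lambda>x. ((real m + 1) * norm (complex_of_real (c m x)))\<^sup>2)"
    unfolding power_mult_distrib by (intro integrable_mult_right schwartz_norm2_integrable cs)
   show "norm (clip (real m) (g n x) * c m x) <= (real m + 1) * norm (complex_of_real (c m x))" for n x
    unfolding norm_mult by (intro mult_right_mono norm_clip_le) auto
   have "AE x in lebesgue. x \<notin> N" using N by (simp add: negligible_iff_null_sets AE_not_in)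
   then have "AE x in lborel. x \<notin> N" by (simp add: AE_completion_iff)
   then show "AE x in lborel. (\<lambda>n. clip (real m) (g n x) * c m x) \<longlonglongrightarrow> f x * c m x"
   proof eventually_elim
    case (elim x)
    have "(\<lambda>n. clip (real m) (g n x)) \<longlonglongrightarrow> clip (real m) (f x)"
     by (rule isCont_tendsto_compose[OF _ g(2)[OF elim]]) (use continuous_clip in \<open>simp add: continuous_on_eq_continuous_at\<close>)
    then show ?case unfolding fl by (intro tendsto_mult tendsto_const)
   qed
   show "(norm (LBINT x. d x * (clip (real m) (g n x) * c m x)))\<^sup>2 <= Q * (LBINT x. (norm (clip (real m) (g n x) * c m x))\<^sup>2)" for n
    by (rule continuous_test[OF d _ B cs csupp g']) auto
  qed measurable
  let ?I = "\<lambda>x. if norm (d x) <= real m then (norm (d x))\<^sup>2 * c m x else 0"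
  have "(LBINT x. d x * (f x * c m x)) = (LBINT x. complex_of_real (?I x))"
   by (intro LBINT_cong refl) (auto simp: f_def complex_norm_square mult.assoc simp del: of_real_power)
  then have 1: "(LBINT x. d x * (f x * c m x)) = complex_of_real (J m)" unfolding J_def by simp
  have 2: "(LBINT x. (norm (f x * c m x))\<^sup>2) <= J m"
   unfolding J_def
  proof (rule integral_mono)
   show "integrable lborel ?I"
    by (rule integrable_boundI[OF d]) (use c0 c1 in \<open>auto simp: mult_left_le intro!: AE_I2\<close>)
   have le: "(norm (f x * c m x))\<^sup>2 <= ?I x" for x
    using c0[of m x] c1[of m x] by (auto simp: f_def norm_mult power_mult_distrib power2_eq_square[of "c m x"] mult_left_le intro!: mult_left_mono)
   then show "(norm (f x * c m x))\<^sup>2 <= ?I x" for x .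
   show "integrable lborel (\<lambda>x. (norm (f x * c m x))\<^sup>2)"
    by (rule integrable_boundI[OF \<open>integrable lborel ?I\<close>])
      (use order_trans[OF le abs_ge_self] in \<open>simp_all only: real_norm_def abs_power2 AE_I2, measurable\<close>)
  qed
  \<comment> \<open>Testing with the truncated conjugate yields J on one side. The norm of the test
    function is at most J because the cutoff is at most 1, so one factor J can be divided
    out.\<close>
  have "(J m)\<^sup>2 <= Q * J m" using t 1 order_trans[OF _ mult_left_mono[OF 2 Q]] by simp
  then show "J m <= Q" using Q by (cases "0 < J m") (auto simp: power2_eq_square)
 qed
 moreover have "J \<longlonglongrightarrow> (LBINT x. (norm (d x))\<^sup>2)"
  unfolding J_def[abs_def]
 proof (rule integral_dominated_convergence[OF _ _ d])
  show "AE x in lborel. norm (if norm (d x) <= real m then (norm (d x))\<^sup>2 * c m x else 0) <= (norm (d x))\<^sup>2" for m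
   using c0 c1 by (auto simp: mult_left_le intro!: AE_I2)
  show "AE x in lborel. (\<lambda>m. if norm (d x) <= real m then (norm (d x))\<^sup>2 * c m x else 0) \<longlonglongrightarrow> (norm (d x))\<^sup>2"
  proof (rule AE_I2, rule tendsto_eventually)
   fix x
   obtain m0 :: nat where m0: "norm (d x) + \<bar>x\<bar> + real \<rho> <= real m0" using real_arch_simple by blast
   then have "(if norm (d x) <= real m then (norm (d x))\<^sup>2 * c m x else 0) = (norm (d x))\<^sup>2" if "m \<ge> m0" for m
   proof -
    have "real m0 <= real m" using that by simp
    then have "norm (d x) <= real m" "\<bar>x\<bar> + real \<rho> <= real m" using m0 norm_ge_zero[of "d x"] by linarith+
    then show ?thesis using ceq[of x m] by simp
   qed
   then show "\<forall>\<^sub>F m in sequentially. (if norm (d x) <= real m then (norm (d x))\<^sup>2 * c m x else 0) = (norm (d x))\<^sup>2"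
    by (rule eventually_sequentiallyI)
  qed
 qed measurable
 ultimately show ?thesis by (intro LIMSEQ_le_const2) auto
qed

section \<open>Gronwall's argument and the cubic term\<close>

lemma exp_tail:
 assumes l: "0 < l" and a: "0 <= a"
 shows "(NN t. indicator {t::real. a <= \<bar>t\<bar>} t * ennreal (exp (- l * \<bar>t\<bar>))) <= ennreal (2 / l) * ennreal (exp (- l * a))"
proof -
 have 1: "(NN t. ennreal (exp (- l * t)) * indicator {a..} t) = ennreal (0 - (- exp (- l * a) / l))"
 proof (rule nn_integral_FTC_atLeast)
  show "((\<lambda>t. - exp (- l * t) / l) has_real_derivative exp (- l * t)) (at t)" for t
   using l by (auto intro!: derivative_eq_intros)
  have "((\<lambda>t. exp (- (l * t))) \<longlongrightarrow> 0) at_top"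
   by (rule filterlim_compose[OF exp_at_bot filterlim_compose[OF filterlim_uminus_at_bot_at_top filterlim_tendsto_pos_mult_at_top[OF tendsto_const l filterlim_ident]]])
  from tendsto_divide[OF tendsto_minus[OF this] tendsto_const[of l]] show "((\<lambda>t. - exp (- l * t) / l) \<longlongrightarrow> 0) at_top" using l by simp
 qed (use l in auto)
 have 2: "(NN t. ennreal (exp (- l * - t)) * indicator {a..} (- t)) = (NN t. ennreal (exp (- l * t)) * indicator {a..} t)"
  by (subst (2) nn_integral_real_affine[of _ "-1" 0]) auto
 have "(NN t. indicator {t::real. a <= \<bar>t\<bar>} t * ennreal (exp (- l * \<bar>t\<bar>)))
   <= (NN t. ennreal (exp (- l * t)) * indicator {a..} t + ennreal (exp (- l * - t)) * indicator {a..} (- t))"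
  by (intro nn_integral_mono) (auto simp: indicator_def abs_if)
 also have "... = ennreal (exp (- l * a) / l) + ennreal (exp (- l * a) / l)"
  by (subst nn_integral_add) (use 1 2 in auto)
 also have "... = ennreal (2 / l) * ennreal (exp (- l * a))"
  using l by (simp add: ennreal_plus[symmetric] ennreal_mult[symmetric] del: ennreal_plus)
 finally show ?thesis .
qed

text \<open>Weighting by \<open>exp (- l \<bar>t\<bar>)\<close> with large \<open>l\<close> turns the Volterra inequality into a contraction.\<close>

lemma gronwall_zero:
 fixes beta :: "real => ennreal"
 assumes [measurable]: "beta \<in> borel_measurable borel" and K: "0 <= K" and out: "\<And>t. t \<notin> {-1..1} ==> beta t = 0"
  and M: "AE t in lborel. beta t <= ennreal M"
  and le: "AE t in lborel. beta t <= ennreal K * (NN s. indicator {s. \<bar>s\<bar> <= \<bar>t\<bar>} s * beta s)"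
 shows "AE t in lborel. beta t = 0"
proof -
 \<comment> \<open>With this choice the contraction factor 2 K / l is at most 1/2, and l is positive
   even for K = 0.\<close>
 define l where "l = 4 * K + 1"
 have l: "0 < l" using K by (simp add: l_def)
 define E where "E t = ennreal (exp (- l * \<bar>t\<bar>))" for t :: real
 have [measurable]: "E \<in> borel_measurable borel" unfolding E_def[abs_def] by measurable
 have E0: "E t \<noteq> 0" "E t <= 1" for t using l by (auto simp: E_def)
 define G where "G = (NN t. E t * beta t)"
 \<comment> \<open>Finiteness of G has to come first, since the final inequality G <= G / 2 rules
   out only finite positive values.\<close>
 have "G <= (NN t. ennreal M * indicator {-1..1::real} t)"
  unfolding G_def
 proof (rule nn_integral_mono_AE)
  show "AE t in lborel. E t * beta t <= ennreal M * indicator {-1..1} t"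
   using M
  proof eventually_elim
   case (elim t)
   then show ?case using out[of t] mult_mono[OF E0(2)[of t] elim] by (cases "t \<in> {-1..1}") auto
  qed
 qed
 also have "... < \<infinity>" by (simp add: nn_integral_cmult_indicator ennreal_mult_less_top)
 finally have fin: "G < \<infinity>" .
 have "G <= (NN t. (NN s. ennreal K * beta s * (indicator {t. \<bar>s\<bar> <= \<bar>t\<bar>} t * E t)))"
  unfolding G_def
 proof (rule nn_integral_mono_AE)
  show "AE t in lborel. E t * beta t <= (NN s. ennreal K * beta s * (indicator {t. \<bar>s\<bar> <= \<bar>t\<bar>} t * E t))"
   using le
  proof eventually_elim
   case (elim t)
   have "E t * beta t <= E t * (ennreal K * (NN s. indicator {s. \<bar>s\<bar> <= \<bar>t\<bar>} s * beta s))"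
    by (rule mult_left_mono[OF elim]) simp
   also have "... = (NN s. (E t * ennreal K) * (indicator {s. \<bar>s\<bar> <= \<bar>t\<bar>} s * beta s))"
    by (subst nn_integral_cmult) (auto simp: mult.assoc)
   also have "... = (NN s. ennreal K * beta s * (indicator {t. \<bar>s\<bar> <= \<bar>t\<bar>} t * E t))"
    by (intro nn_integral_cong) (auto simp: indicator_def mult_ac)
   finally show ?case .
  qed
 qed
 also have "... = (NN s. (NN t. ennreal K * beta s * (indicator {t. \<bar>s\<bar> <= \<bar>t\<bar>} t * E t)))"
  by (rule lborel_pair.Fubini') (simp add: indicator_def)
 also have "... = (NN s. ennreal K * beta s * (NN t. indicator {t. \<bar>s\<bar> <= \<bar>t\<bar>} t * E t))"
  by (intro nn_integral_cong nn_integral_cmult) measurable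
 also have "... <= (NN s. ennreal K * beta s * (ennreal (2 / l) * E s))"
  unfolding E_def by (intro nn_integral_mono mult_left_mono exp_tail[OF l]) auto
 also have "... = (NN s. ennreal (2 * K / l) * (E s * beta s))"
 proof (rule nn_integral_cong)
  fix s :: real
  have "ennreal K * beta s * (ennreal (2 / l) * E s) = (ennreal (2 / l) * ennreal K) * (E s * beta s)" by (simp only: mult_ac)
  also have "ennreal (2 / l) * ennreal K = ennreal (2 * K / l)" using K l by (simp add: ennreal_mult[symmetric])
  finally show "ennreal K * beta s * (ennreal (2 / l) * E s) = ennreal (2 * K / l) * (E s * beta s)" .
 qed
 also have "... = ennreal (2 * K / l) * G" unfolding G_def by (rule nn_integral_cmult) measurable
 finally have "G <= ennreal (2 * K / l) * G" .
 moreover obtain g where g: "0 <= g" "G = ennreal g" using fin by (cases G) auto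
 ultimately have "g <= (2 * K / l) * g" using K l by (simp add: ennreal_mult[symmetric])
 moreover have "2 * K / l <= 1 / 2" using K by (simp add: l_def divide_le_eq)
 ultimately have "g = 0" using g(1) mult_right_mono[of "2 * K / l" "1 / 2" g] by linarith
 then have "(NN t. E t * beta t) = 0" using g(2) by (simp add: G_def)
 then have "AE t in lborel. E t * beta t = 0" by (subst (asm) nn_integral_0_iff_AE) auto
 then show ?thesis by eventually_elim (use E0(1) in simp)
qed

lemma lborel_pair_section:
 assumes "(\<lambda>p. U (fst p) (snd p)) \<in> borel_measurable (borel \<Otimes>\<^sub>M borel)" and [measurable]: "f \<in> borel_measurable M" "g \<in> borel_measurable M"
 shows "(\<lambda>z. U (f z) (g z) :: complex) \<in> borel_measurable M"
 using measurable_compose[OF _ assms(1), of "\<lambda>z. (f z, g z)" M] by simp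

lemma cubic_diff:
 fixes a b :: complex
 assumes "norm a <= k" "norm b <= k"
 shows "norm (a * cnj a * a - b * cnj b * b) <= 3 * k\<^sup>2 * norm (a - b)"
proof -
 have k: "0 <= k" using norm_ge_zero[of a] assms(1) by linarith
 have "a * cnj a * a - b * cnj b * b = (a - b) * (cnj a * a) + cnj (a - b) * (b * a) + (a - b) * (b * cnj b)"
  by (simp add: algebra_simps)
 also have "norm ... <= norm ((a - b) * (cnj a * a)) + norm (cnj (a - b) * (b * a)) + norm ((a - b) * (b * cnj b))"
  by (intro norm_triangle_le add_mono norm_triangle_ineq) auto
 also have "... = norm (a - b) * (norm a * norm a) + norm (a - b) * (norm b * norm a) + norm (a - b) * (norm b * norm b)"
  by (simp only: norm_mult complex_mod_cnj)
 also have "... <= norm (a - b) * (k * k) + norm (a - b) * (k * k) + norm (a - b) * (k * k)"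
  using assms k by (intro add_mono mult_left_mono mult_mono) auto
 finally show ?thesis by (simp add: power2_eq_square)
qed

definition prop_test :: "(real => complex) => real => real => complex" where
 "prop_test phi ta = fourier (\<lambda>xi. cis (- (ta * xi\<^sup>2)) * inv_fourier phi xi)"

lemma schroedinger_dist_of: "schroedinger ta (dist_of h) phi = (LBINT x. h x * prop_test phi ta x)"
 by (simp add: schroedinger_def multiplier_def dist_inv_fourier_def dist_mult_def dist_fourier_def dist_of_def prop_test_def)

lemma (in freq_window) prop_test_measurable:
 "schwartz phi ==> f \<in> borel_measurable M ==> g \<in> borel_measurable M ==> (\<lambda>z. prop_test phi (f z) (g z)) \<in> borel_measurable M"
 unfolding prop_test_def by (rule propagated_measurable)

text \<open>The propagator is unitary: its symbol is unimodular and Plancherel's identity is used in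
  both directions. The L^2 norm of the test function is thus the same at all times.\<close>

lemma prop_test_norm2:
 assumes phi: "schwartz phi"
 shows "(NN x. ennreal ((norm (prop_test phi ta x))\<^sup>2)) = ennreal (LBINT x. (norm (phi x))\<^sup>2)"
proof -
 have s: "schwartz (\<lambda>xi. cis (- (ta * xi\<^sup>2)) * inv_fourier phi xi)" by (rule schwartz_propagator[OF schwartz_inv_fourier[OF phi]])
 have "(LBINT x. (norm (prop_test phi ta x))\<^sup>2) = 2 * pi * (LBINT x. (norm (inv_fourier phi x))\<^sup>2)"
  unfolding prop_test_def Plancherel_fourier[OF s] by (simp add: norm_mult)
 then have e: "(LBINT x. (norm (prop_test phi ta x))\<^sup>2) = (LBINT x. (norm (phi x))\<^sup>2)"
  unfolding Plancherel_inv_fourier[OF phi] .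
 show ?thesis unfolding e[symmetric]
  by (rule nn_integral_eq_integral) (simp_all add: prop_test_def schwartz_norm2_integrable[OF schwartz_fourier[OF s]])
qed

text \<open>Turns the iterated Duhamel integral into one absolutely convergent space-time integral.
  A supremum bound in x that lies in L^4 in time is enough, because the propagated test functions
  are uniformly integrable in norm.\<close>

lemma (in freq_window) N3_cubic:
 fixes W :: "real => real => complex"
 assumes W: "(\<lambda>p. W (fst p) (snd p)) \<in> borel_measurable (borel \<Otimes>\<^sub>M borel)"
  and [measurable]: "k \<in> borel_measurable borel" and k: "(NN s. indicator {-1..1} s * ennreal (k s ^ 4)) < \<infinity>"
  and le: "AE s in lborel. s \<in> {-1..1} --> (AE x in lborel. norm (W s x) <= k s)"
  and phi: "schwartz phi" and t: "t \<in> {-1..1}"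
 defines "P \<equiv> \<lambda>z. sg t (fst z) * (W (fst z) (snd z) * cnj (W (fst z) (snd z)) * W (fst z) (snd z) * prop_test phi (t - fst z) (snd z))"
 shows "integrable (lborel \<Otimes>\<^sub>M lborel) P" and "N3 W W W t phi = - \<i> * (LINT z|(lborel \<Otimes>\<^sub>M lborel). P z)"
proof -
 note [measurable (raw)] = lborel_pair_section[OF W] prop_test_measurable[OF phi]
 have [measurable]: "P \<in> borel_measurable (lborel \<Otimes>\<^sub>M lborel)" unfolding P_def by measurable
 obtain D where D: "0 <= D" "\<And>ta. ta \<in> {-1..1} ==> decay D (prop_test phi ta)"
  using propagated_decay[OF phi] unfolding prop_test_def by blast
 have Dn: "(NN x. ennreal (norm (prop_test phi ta x))) <= ennreal (D * pi)" if "ta \<in> {-1..1}" for ta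
  using decay_integral_norm[OF D(2)[OF that]]
  by (subst nn_integral_eq_integral[OF integrable_norm[OF decay_integrable[OF D(2)[OF that]]]]) (auto intro: ennreal_leI)
 show i: "integrable (lborel \<Otimes>\<^sub>M lborel) P"
 proof (rule integrableI_bounded)
  have "(\<integral>\<^sup>+z. ennreal (norm (P z)) \<partial>(lborel \<Otimes>\<^sub>M lborel)) = (NN s. (NN x. ennreal (norm (P (s, x)))))"
   by (rule lborel.nn_integral_fst[symmetric]) measurable
  also have "... <= (NN s. (indicator {-1..1} s + indicator {-1..1} s * ennreal (k s ^ 4)) * ennreal (D * pi))"
  proof (rule nn_integral_mono_AE)
   show "AE s in lborel. (NN x. ennreal (norm (P (s, x)))) <= (indicator {-1..1} s + indicator {-1..1} s * ennreal (k s ^ 4)) * ennreal (D * pi)"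
    using le
   proof eventually_elim
    case (elim s)
    show ?case
    proof (cases "sg t s = 0")
     case False
     then have r: "s \<in> {-1..1}" "t - s \<in> {-1..1}" using sg_range[OF _ t] by auto
     have "(NN x. ennreal (norm (P (s, x)))) <= (NN x. (1 + ennreal (k s ^ 4)) * ennreal (norm (prop_test phi (t - s) x)))"
     proof (rule nn_integral_mono_AE)
      have "AE x in lborel. norm (W s x) <= k s" using elim r(1) by blast
      then show "AE x in lborel. ennreal (norm (P (s, x))) <= (1 + ennreal (k s ^ 4)) * ennreal (norm (prop_test phi (t - s) x))"
      proof eventually_elim
       case (elim x)
       \<comment> \<open>On the bounded time interval the cubic power may be replaced by the fourth
         power, which is the one that is integrable in time.\<close>
       have w: "norm (W s x) ^ 3 <= 1 + norm (W s x) ^ 4"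
       proof (cases "norm (W s x) <= 1")
        case True
        then have "norm (W s x) ^ 3 <= 1" by (intro power_le_one) auto
        then show ?thesis by (simp add: add_increasing2)
       next
        case False
        then have "norm (W s x) ^ 3 <= norm (W s x) ^ 4" by (intro power_increasing) auto
        then show ?thesis by simp
       qed
       have "norm (W s x) ^ 4 <= k s ^ 4" by (intro power_mono elim) simp
       then have w': "norm (W s x) ^ 3 <= 1 + k s ^ 4" using w by linarith
       have "norm (P (s, x)) = norm (sg t s) * (norm (W s x) ^ 3 * norm (prop_test phi (t - s) x))"
        by (simp add: P_def norm_mult power3_eq_cube)
       also have "... <= 1 * ((1 + k s ^ 4) * norm (prop_test phi (t - s) x))"
        using w' by (intro mult_mono norm_sg_le mult_right_mono) auto
       finally have "ennreal (norm (P (s, x))) <= ennreal ((1 + k s ^ 4) * norm (prop_test phi (t - s) x))" by (intro ennreal_leI) simp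
       then show ?case by (simp add: ennreal_mult)
      qed
     qed
     also have "... = (1 + ennreal (k s ^ 4)) * (NN x. ennreal (norm (prop_test phi (t - s) x)))"
      by (rule nn_integral_cmult) measurable
     also have "... <= (1 + ennreal (k s ^ 4)) * ennreal (D * pi)" by (intro mult_left_mono Dn r(2)) simp
     finally show ?thesis using r(1) by simp
    qed (simp add: P_def)
   qed
  qed
  also have "... = ((NN s. indicator {-1..1::real} s) + (NN s. indicator {-1..1} s * ennreal (k s ^ 4))) * ennreal (D * pi)"
   by (subst nn_integral_multc) (auto simp: nn_integral_add)
  also have "... < \<infinity>" using k by (simp add: ennreal_mult_less_top)
  finally show "(\<integral>\<^sup>+z. ennreal (norm (P z)) \<partial>(lborel \<Otimes>\<^sub>M lborel)) < \<infinity>" .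
 qed measurable
 have "N3 W W W t phi = - \<i> * (LBINT s. sg t s * (LBINT x. W s x * cnj (W s x) * W s x * prop_test phi (t - s) x))"
  unfolding N3_def interval_integral_sg schroedinger_dist_of ..
 also have "(LBINT s. sg t s * (LBINT x. W s x * cnj (W s x) * W s x * prop_test phi (t - s) x)) = (LBINT s. LBINT x. P (s, x))"
  unfolding P_def by simp
 also have "... = (LINT z|(lborel \<Otimes>\<^sub>M lborel). P z)" by (rule lborel_pair.integral_fst'[OF i])
 finally show "N3 W W W t phi = - \<i> * (LINT z|(lborel \<Otimes>\<^sub>M lborel). P z)" .
qed

text \<open>The tested equation is turned into an L^2 bound for the difference at time t by duality,
  with a right-hand side involving earlier differences only; Gronwall's argument then applies. An a
  priori L^2 bound M for the difference is what makes both steps legitimate.\<close>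

lemma (in freq_window) cubic_uniqueness:
 fixes U U' :: "real => real => complex"
 assumes U: "(\<lambda>p. U (fst p) (snd p)) \<in> borel_measurable (borel \<Otimes>\<^sub>M borel)"
  and U': "(\<lambda>p. U' (fst p) (snd p)) \<in> borel_measurable (borel \<Otimes>\<^sub>M borel)"
  and [measurable]: "k \<in> borel_measurable borel" and k: "(NN s. indicator {-1..1} s * ennreal (k s ^ 4)) < \<infinity>"
  and le: "AE s in lborel. s \<in> {-1..1} --> (AE x in lborel. norm (U s x) <= k s)"
   "AE s in lborel. s \<in> {-1..1} --> (AE x in lborel. norm (U' s x) <= k s)"
  and M: "AE t in lborel. t \<in> {-1..1} --> (NN x. ennreal ((norm (U' t x - U t x))\<^sup>2)) <= ennreal M"
  and eq: "AE t in lborel. t \<in> {-1..1} --> (\<forall>phi. schwartz phi -->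
   (LBINT x. (U' t x - U t x) * phi x) = N3 U' U' U' t phi - N3 U U U t phi)"
 shows "AE t in lborel. t \<in> {-1..1} --> (AE x in lborel. U' t x = U t x)"
proof -
 note [measurable (raw)] = lborel_pair_section[OF U] lborel_pair_section[OF U']
 define beta where "beta t = indicator {-1..1} t * (NN x. ennreal ((norm (U' t x - U t x))\<^sup>2))" for t :: real
 have [measurable]: "beta \<in> borel_measurable borel" unfolding beta_def[abs_def] by measurable
 define K4 where "K4 = enn2real (NN s. indicator {-1..1} s * ennreal (k s ^ 4))"
 have K4: "0 <= K4" "(NN s. indicator {-1..1} s * ennreal (k s ^ 4)) = ennreal K4" using k by (auto simp: K4_def)
 have Mbeta: "AE t in lborel. beta t <= ennreal M" using M by eventually_elim (auto simp: beta_def indicator_def)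
 let ?Q = "\<lambda>t. (NN s. indicator {s. \<bar>s\<bar> <= \<bar>t\<bar>} s * beta s)"
 have Qfin: "?Q t < \<infinity>" for t
 proof -
  have "?Q t <= (NN s. ennreal M * indicator {-1..1::real} s)"
  proof (rule nn_integral_mono_AE)
   show "AE s in lborel. indicator {s. \<bar>s\<bar> <= \<bar>t\<bar>} s * beta s <= ennreal M * indicator {-1..1} s"
    using Mbeta by eventually_elim (auto simp: beta_def indicator_def)
  qed
  also have "... < \<infinity>" by (simp add: nn_integral_cmult_indicator ennreal_mult_less_top)
  finally show ?thesis .
 qed
 have est: "ennreal ((norm (LBINT x. (U' t x - U t x) * phi x))\<^sup>2) <= ennreal (9 * K4) * ?Q t * ennreal (LBINT x. (norm (phi x))\<^sup>2)"
  if t: "t \<in> {-1..1}" and phi: "schwartz phi" and e: "(LBINT x. (U' t x - U t x) * phi x) = N3 U' U' U' t phi - N3 U U U t phi" for t phi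
 proof -
  note [measurable (raw)] = prop_test_measurable[OF phi]
  let ?P = "\<lambda>W z. sg t (fst z) * (W (fst z) (snd z) * cnj (W (fst z) (snd z)) * W (fst z) (snd z) * prop_test phi (t - fst z) (snd z))"
  \<comment> \<open>The split for Cauchy-Schwarz in space-time: the difference on one side, 3 k^2
    times the test function on the other. The square of the latter contains 9 k^4, integrable in
    time, and the conserved L^2 norm of the test function. The condition |s| <= |t| covers both
    signs of t.\<close>
  let ?f = "\<lambda>z. ennreal (indicator {s. \<bar>s\<bar> <= \<bar>t\<bar> \<and> s \<in> {-1..1}} (fst z) * norm (U' (fst z) (snd z) - U (fst z) (snd z)))"
  let ?g = "\<lambda>z. ennreal (indicator {-1..1} (fst z) * (3 * (k (fst z))\<^sup>2) * norm (prop_test phi (t - fst z) (snd z)))"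
  note A = N3_cubic[OF U _ k le(1) phi t] and A' = N3_cubic[OF U' _ k le(2) phi t]
  have i: "integrable (lborel \<Otimes>\<^sub>M lborel) (\<lambda>z. ?P U' z - ?P U z)"
   by (rule Bochner_Integration.integrable_diff[OF A'(1) A(1)]) measurable
  have "N3 U' U' U' t phi - N3 U U U t phi = - \<i> * (LINT z|(lborel \<Otimes>\<^sub>M lborel). ?P U' z - ?P U z)"
   by (subst Bochner_Integration.integral_diff[OF A'(1) A(1)]) (simp_all add: A'(2) A(2) right_diff_distrib)
  then have "ennreal (norm (LBINT x. (U' t x - U t x) * phi x)) = ennreal (norm (LINT z|(lborel \<Otimes>\<^sub>M lborel). ?P U' z - ?P U z))"
   unfolding e by (simp add: norm_mult)
  also have "... <= (\<integral>\<^sup>+z. ennreal (norm (?P U' z - ?P U z)) \<partial>(lborel \<Otimes>\<^sub>M lborel))"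
   by (rule integral_norm_bound_ennreal[OF i])
  also have "... = (NN s. (NN x. ennreal (norm (?P U' (s, x) - ?P U (s, x)))))"
   by (rule lborel.nn_integral_fst[symmetric]) measurable
  also have "... <= (NN s. (NN x. ?f (s, x) * ?g (s, x)))"
  proof (rule nn_integral_mono_AE)
   show "AE s in lborel. (NN x. ennreal (norm (?P U' (s, x) - ?P U (s, x)))) <= (NN x. ?f (s, x) * ?g (s, x))"
    using le(1) le(2)
   proof eventually_elim
    case (elim s)
    show ?case
    proof (cases "sg t s = 0")
     case False
     then have r: "s \<in> {-1..1}" "\<bar>s\<bar> <= \<bar>t\<bar>" using sg_range[OF _ t, of s] by (auto simp: sg_def split: if_splits)
     have ae: "AE x in lborel. norm (U s x) <= k s" "AE x in lborel. norm (U' s x) <= k s" using elim r(1) by blast+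
     show ?thesis
     proof (rule nn_integral_mono_AE)
      show "AE x in lborel. ennreal (norm (?P U' (s, x) - ?P U (s, x))) <= ?f (s, x) * ?g (s, x)"
       using ae
      proof eventually_elim
       case (elim x)
       have "?P U' (s, x) - ?P U (s, x) = sg t s * ((U' s x * cnj (U' s x) * U' s x - U s x * cnj (U s x) * U s x) * prop_test phi (t - s) x)"
        by (simp add: algebra_simps)
       then have "norm (?P U' (s, x) - ?P U (s, x)) = norm (sg t s) * (norm (U' s x * cnj (U' s x) * U' s x - U s x * cnj (U s x) * U s x) * norm (prop_test phi (t - s) x))"
        by (simp only: norm_mult)
       also have "... <= 1 * ((3 * (k s)\<^sup>2 * norm (U' s x - U s x)) * norm (prop_test phi (t - s) x))"
        by (intro mult_mono norm_sg_le mult_right_mono cubic_diff elim) auto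
       finally show ?case using r by (simp add: ennreal_mult[symmetric] mult_ac)
      qed
     qed
    qed simp
   qed
  qed
  also have "... = (\<integral>\<^sup>+z. ?f z * ?g z \<partial>(lborel \<Otimes>\<^sub>M lborel))" by (rule lborel.nn_integral_fst) measurable
  finally have "(ennreal (norm (LBINT x. (U' t x - U t x) * phi x)))\<^sup>2 <= (\<integral>\<^sup>+z. ?f z * ?g z \<partial>(lborel \<Otimes>\<^sub>M lborel))\<^sup>2"
   by (rule power_mono) simp
  also have "... <= (\<integral>\<^sup>+z. (?f z)\<^sup>2 \<partial>(lborel \<Otimes>\<^sub>M lborel)) * (\<integral>\<^sup>+z. (?g z)\<^sup>2 \<partial>(lborel \<Otimes>\<^sub>M lborel))"
   by (rule Cauchy_Schwarz_nn_integral) measurable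
  also have "(\<integral>\<^sup>+z. (?f z)\<^sup>2 \<partial>(lborel \<Otimes>\<^sub>M lborel)) = (NN s. (NN x. (?f (s, x))\<^sup>2))"
   by (rule lborel.nn_integral_fst[symmetric]) measurable
  also have "... = ?Q t"
   by (intro nn_integral_cong) (auto simp: beta_def indicator_def ennreal_power)
  also have "(\<integral>\<^sup>+z. (?g z)\<^sup>2 \<partial>(lborel \<Otimes>\<^sub>M lborel)) = (NN s. (NN x. (?g (s, x))\<^sup>2))"
   by (rule lborel.nn_integral_fst[symmetric]) measurable
  also have "... = (NN s. ennreal 9 * (indicator {-1..1} s * ennreal (k s ^ 4)) * ennreal (LBINT x. (norm (phi x))\<^sup>2))"
  proof (rule nn_integral_cong)
   fix s :: real
   have "(NN x. (?g (s, x))\<^sup>2) = (NN x. (ennreal 9 * (indicator {-1..1} s * ennreal (k s ^ 4))) * ennreal ((norm (prop_test phi (t - s) x))\<^sup>2))"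
    by (intro nn_integral_cong) (auto simp: indicator_def ennreal_power ennreal_mult power_mult_distrib simp flip: power_mult)
   also have "... = (ennreal 9 * (indicator {-1..1} s * ennreal (k s ^ 4))) * (NN x. ennreal ((norm (prop_test phi (t - s) x))\<^sup>2))"
    by (rule nn_integral_cmult) measurable
   finally show "(NN x. (?g (s, x))\<^sup>2) = ennreal 9 * (indicator {-1..1} s * ennreal (k s ^ 4)) * ennreal (LBINT x. (norm (phi x))\<^sup>2)"
    unfolding prop_test_norm2[OF phi] .
  qed
  also have "... = ennreal (9 * K4) * ennreal (LBINT x. (norm (phi x))\<^sup>2)"
   using K4 by (subst nn_integral_multc, measurable, subst nn_integral_cmult, measurable) (simp add: ennreal_mult)
  finally show ?thesis by (simp add: ennreal_power mult_ac)
 qed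
 have key: "AE t in lborel. beta t <= ennreal (9 * K4) * ?Q t"
  using eq M
 proof eventually_elim
  case (elim t)
  show ?case
  proof (cases "t \<in> {-1..1}")
   case True
   define Q where "Q = enn2real (ennreal (9 * K4) * ?Q t)"
   have Q: "0 <= Q" "ennreal (9 * K4) * ?Q t = ennreal Q" using Qfin[of t] by (auto simp: Q_def ennreal_mult_less_top)
   have i: "integrable lborel (\<lambda>x. (norm (U' t x - U t x))\<^sup>2)"
    using elim(2) True by (intro integrableI_bounded) (auto intro: le_less_trans)
   have "(LBINT x. (norm (U' t x - U t x))\<^sup>2) <= Q"
   proof (rule L2_duality[OF i _ Q(1)])
    fix phi assume phi: "schwartz phi"
    have "ennreal ((norm (LBINT x. (U' t x - U t x) * phi x))\<^sup>2) <= ennreal (Q * (LBINT x. (norm (phi x))\<^sup>2))"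
     using est[OF True phi] elim(1) True phi Q by (simp add: ennreal_mult)
    then show "(norm (LBINT x. (U' t x - U t x) * phi x))\<^sup>2 <= Q * (LBINT x. (norm (phi x))\<^sup>2)"
     using Q(1) by (subst (asm) ennreal_le_iff) auto
   qed measurable
   then have "(NN x. ennreal ((norm (U' t x - U t x))\<^sup>2)) <= ennreal Q"
    by (subst nn_integral_eq_integral[OF i]) (auto intro: ennreal_leI)
   then show ?thesis using True Q(2) by (simp add: beta_def)
  qed (simp add: beta_def)
 qed
 have "AE t in lborel. beta t = 0"
  by (rule gronwall_zero[OF _ _ _ Mbeta key]) (use K4 in \<open>auto simp: beta_def\<close>)
 then show ?thesis
 proof eventually_elim
  case (elim t)
  show ?case
  proof
   assume "t \<in> {-1..1}"
   then have "(NN x. ennreal ((norm (U' t x - U t x))\<^sup>2)) = 0" using elim by (simp add: beta_def)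
   then have "AE x in lborel. ennreal ((norm (U' t x - U t x))\<^sup>2) = 0" by (subst (asm) nn_integral_0_iff_AE) auto
   then show "AE x in lborel. U' t x = U t x" by eventually_elim (simp add: ennreal_eq_0_iff)
  qed
 qed
qed

section \<open>Corresponding solutions\<close>

lemma epowr_mono: "x <= y ==> 0 <= b ==> epowr x b <= epowr y b"
 unfolding epowr_def by (cases x; cases y) (auto intro!: ennreal_leI powr_mono2 simp: top_unique)

lemma epowr_ennreal: "0 <= x ==> epowr (ennreal x) b = ennreal (x powr b)"
 by (simp add: epowr_def)

lemma epowr_measurable [measurable (raw)]:
 assumes [measurable]: "f \<in> borel_measurable M" shows "(\<lambda>z. epowr (f z) b) \<in> borel_measurable M"
 unfolding epowr_def by measurable

lemma Lnorm_le:
 assumes q: "0 < q" and A: "0 <= A" and le: "(\<integral>\<^sup>+x. epowr (f x) q \<partial>M) <= ennreal (A powr q)"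
 shows "Lnorm (ennreal q) M f <= ennreal A"
proof -
 have "epowr (\<integral>\<^sup>+x. epowr (f x) q \<partial>M) (1 / q) <= epowr (ennreal (A powr q)) (1 / q)"
  using q by (intro epowr_mono le) simp
 also have "... = ennreal A" using q A by (simp add: epowr_ennreal powr_powr)
 finally show ?thesis using q by (simp add: Lnorm_def)
qed

lemma Lnorm_Bd:
 assumes q: "0 < q" and g: "Bd q A g" and u: "AE x in lborel. u x = g x"
 shows "Lnorm (ennreal q) lborel (\<lambda>x. ennreal (norm (u x))) <= ennreal A"
proof (rule Lnorm_le[OF q Bd_nonneg[OF g]])
 have "(NN x. epowr (ennreal (norm (u x))) q) <= (NN x. ennreal (norm (g x) powr q))"
 proof (rule nn_integral_mono_AE)
  show "AE x in lborel. epowr (ennreal (norm (u x))) q <= ennreal (norm (g x) powr q)"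
   using u by eventually_elim (simp add: epowr_ennreal)
 qed
 also have "... <= ennreal (A powr q)" by (rule Bd_nn[OF g])
 finally show "(NN x. epowr (ennreal (norm (u x))) q) <= ennreal (A powr q)" .
qed

lemma mixed_norm_le:
 assumes p: "0 < p" and A: "0 <= A" and ab: "a < b"
  and le: "AE t in lborel. t \<in> {a..b} --> Lnorm Q lborel (\<lambda>x. ennreal (norm (u t x))) <= ennreal A"
 shows "mixed_norm (ennreal p) {a..b} Q u <= ennreal (A * (b - a) powr (1 / p))"
 unfolding mixed_norm_def
proof (rule Lnorm_le[OF p])
 show "0 <= A * (b - a) powr (1 / p)" using A by simp
 let ?L = "\<lambda>t. Lnorm Q lborel (\<lambda>x. ennreal (norm (u t x)))"
 have "(\<integral>\<^sup>+t. epowr (?L t) p \<partial>restrict_space lborel {a..b}) = (NN t. epowr (?L t) p * indicator {a..b} t)"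
  by (rule nn_integral_restrict_space) simp
 also have "... <= (NN t. ennreal (A powr p) * indicator {a..b} t)"
 proof (rule nn_integral_mono_AE)
  show "AE t in lborel. epowr (?L t) p * indicator {a..b} t <= ennreal (A powr p) * indicator {a..b} t"
   using le
  proof eventually_elim
   case (elim t)
   have "t \<in> {a..b} ==> epowr (?L t) p <= epowr (ennreal A) p" using elim p by (intro epowr_mono) auto
   then show ?case using A by (auto simp: indicator_def epowr_ennreal)
  qed
 qed
 also have "... = ennreal (A powr p * (b - a))" using ab by (simp add: nn_integral_cmult_indicator ennreal_mult)
 also have "A powr p * (b - a) = (A * (b - a) powr (1 / p)) powr p" using p A ab by (simp add: powr_mult powr_powr)
 finally show "(\<integral>\<^sup>+t. epowr (?L t) p \<partial>restrict_space lborel {a..b}) <= ennreal ((A * (b - a) powr (1 / p)) powr p)" .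
qed

text \<open>Extension by zero outside [-1,1], so that functions measurable only on the strip become
  Borel functions on the plane.\<close>

definition slab :: "(real => real => complex) => real => real => complex" where
 "slab u t x = (if t \<in> {-1..1} then u t x else 0)"

lemma slab_eq: "t \<in> {-1..1} ==> slab u t = u t"
 by (simp add: slab_def fun_eq_iff)

lemma slab_out: "t \<notin> {-1..1} ==> slab u t = (\<lambda>x. 0)"
 unfolding slab_def by (rule ext) (rule if_not_P)

text \<open>Clamping the time to [-1,1] maps the plane measurably into the strip and agrees with the
  identity there.\<close>

lemma slab_measurable:
 assumes "spacetime_measurable {-1..1} u"
 shows "(\<lambda>p. slab u (fst p) (snd p)) \<in> borel_measurable (borel \<Otimes>\<^sub>M borel)"
proof -
 have "(\<lambda>p. max (-1) (min 1 (fst p))) \<in> borel \<Otimes>\<^sub>M borel \<rightarrow>\<^sub>M restrict_space lborel {-1..1::real}"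
  by (rule measurable_restrict_space2) auto
 then have "(\<lambda>p. (max (-1) (min 1 (fst p)), snd p)) \<in> borel \<Otimes>\<^sub>M borel \<rightarrow>\<^sub>M restrict_space lborel {-1..1::real} \<Otimes>\<^sub>M lborel"
  by (rule measurable_Pair) simp
 from measurable_compose[OF this assms[unfolded spacetime_measurable_def]]
 have [measurable]: "(\<lambda>p. u (max (-1) (min 1 (fst p))) (snd p)) \<in> borel_measurable (borel \<Otimes>\<^sub>M borel)" by simp
 have "(\<lambda>p. if fst p \<in> {-1..1} then u (max (-1) (min 1 (fst p))) (snd p) else 0) \<in> borel_measurable (borel \<Otimes>\<^sub>M borel)" by measurable
 moreover have "slab u (fst p) (snd p) = (if fst p \<in> {-1..1} then u (max (-1) (min 1 (fst p))) (snd p) else 0)" for p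
  by (auto simp: slab_def max_def min_def)
 ultimately show ?thesis by simp
qed

lemma spacetime_measurable_borel:
 assumes "(\<lambda>p. U (fst p) (snd p)) \<in> borel_measurable (borel \<Otimes>\<^sub>M borel)" shows "spacetime_measurable I U"
 unfolding spacetime_measurable_def case_prod_beta'
proof (rule lborel_pair_section[OF assms])
 show "fst \<in> borel_measurable (restrict_space lborel I \<Otimes>\<^sub>M lborel)"
  by (rule measurable_compose[OF measurable_fst]) (simp add: measurable_restrict_space1)
qed simp

lemma spacetime_measurable_section:
 assumes "spacetime_measurable {-1..1} u" "t \<in> {-1..1}" shows "u t \<in> borel_measurable borel"
proof -
 have "(\<lambda>x. slab u t x) \<in> borel_measurable borel"
  by (rule lborel_pair_section[OF slab_measurable[OF assms(1)], where f = "\<lambda>x. t" and g = "\<lambda>x. x"]) simp_all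
 then show ?thesis unfolding slab_eq[OF assms(2)] .
qed

lemma N3_sg: "N3 W W W t phi = - \<i> * (LBINT s. sg t s * (LBINT x. W s x * cnj (W s x) * W s x * prop_test phi (t - s) x))"
 unfolding N3_def interval_integral_sg schroedinger_dist_of ..

lemma N3_cong:
 assumes "\<And>s x. s \<in> {-1..1} ==> W s x = W' s x" "t \<in> {-1..1}" shows "N3 W W W t phi = N3 W' W' W' t phi"
proof -
 have eq: "sg t s * (LBINT x. W s x * cnj (W s x) * W s x * prop_test phi (t - s) x)
  = sg t s * (LBINT x. W' s x * cnj (W' s x) * W' s x * prop_test phi (t - s) x)" for s
  using assms(1)[of s] sg_range[OF _ assms(2), of s] by (cases "sg t s = 0") auto
 show ?thesis unfolding N3_sg eq ..
qed

lemma N3_slab: "t \<in> {-1..1} ==> N3 (slab u) (slab u) (slab u) t phi = N3 u u u t phi"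
 by (rule N3_cong) (simp_all add: slab_def)

text \<open>Iterates are determined only up to null sets, in x for almost every time. Both kinds of
  null sets disappear under the integrals in the Duhamel term.\<close>

lemma (in freq_window) N3_AE_cong:
 assumes m: "spacetime_measurable {-1..1} u" "spacetime_measurable {-1..1} u'"
  and ae: "AE t in lborel. t \<in> {-1..1} --> (AE x in lborel. u t x = u' t x)"
  and t: "t \<in> {-1..1}" and phi: "schwartz phi"
 shows "N3 u u u t phi = N3 u' u' u' t phi"
proof -
 note [measurable (raw)] = lborel_pair_section[OF slab_measurable[OF m(1)]] lborel_pair_section[OF slab_measurable[OF m(2)]] prop_test_measurable[OF phi]
 have "(LBINT s. sg t s * (LBINT x. slab u s x * cnj (slab u s x) * slab u s x * prop_test phi (t - s) x))
  = (LBINT s. sg t s * (LBINT x. slab u' s x * cnj (slab u' s x) * slab u' s x * prop_test phi (t - s) x))"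
 proof (rule integral_cong_AE)
  show "AE s in lborel. sg t s * (LBINT x. slab u s x * cnj (slab u s x) * slab u s x * prop_test phi (t - s) x)
   = sg t s * (LBINT x. slab u' s x * cnj (slab u' s x) * slab u' s x * prop_test phi (t - s) x)"
   using ae
  proof eventually_elim
   case (elim s)
   show ?case
   proof (cases "s \<in> {-1..1}")
    case True
    then have ae': "AE x in lborel. slab u s x = slab u' s x" using elim by (simp add: slab_def)
    have "(LBINT x. slab u s x * cnj (slab u s x) * slab u s x * prop_test phi (t - s) x)
     = (LBINT x. slab u' s x * cnj (slab u' s x) * slab u' s x * prop_test phi (t - s) x)"
    proof (rule integral_cong_AE)
     show "AE x in lborel. slab u s x * cnj (slab u s x) * slab u s x * prop_test phi (t - s) x = slab u' s x * cnj (slab u' s x) * slab u' s x * prop_test phi (t - s) x"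
      using ae' by eventually_elim simp
    qed measurable
    then show ?thesis by simp
   qed (simp add: slab_out)
  qed
 qed measurable
 then have "N3 (slab u) (slab u) (slab u) t phi = N3 (slab u') (slab u') (slab u') t phi" unfolding N3_sg by simp
 then show ?thesis unfolding N3_slab[OF t] .
qed

text \<open>A sublevel set of the essential supremum is the zero set of the measure of an
  exceptional set, and that measure is a measurable function of t by Tonelli.\<close>

lemma esssup_measurable:
 fixes V :: "real => real => complex"
 assumes V: "(\<lambda>p. V (fst p) (snd p)) \<in> borel_measurable (borel \<Otimes>\<^sub>M borel)"
 shows "(\<lambda>t. esssup lborel (\<lambda>x. ennreal (norm (V t x)))) \<in> borel_measurable borel"
proof (rule borel_measurableI_le)
 fix y
 note [measurable (raw)] = lborel_pair_section[OF V]
 have "esssup lborel (\<lambda>x. ennreal (norm (V t x))) <= y \<longleftrightarrow> (NN x. (if ennreal (norm (V t x)) <= y then 0 else 1)) = 0" for t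
 proof -
  have "esssup lborel (\<lambda>x. ennreal (norm (V t x))) <= y \<longleftrightarrow> (AE x in lborel. ennreal (norm (V t x)) <= y)"
  proof
   assume "esssup lborel (\<lambda>x. ennreal (norm (V t x))) <= y"
   then show "AE x in lborel. ennreal (norm (V t x)) <= y"
    using esssup_AE[of "\<lambda>x. ennreal (norm (V t x))" lborel] by (auto elim: eventually_mono)
  next
   assume ae: "AE x in lborel. ennreal (norm (V t x)) <= y"
   show "esssup lborel (\<lambda>x. ennreal (norm (V t x))) <= y" by (rule esssup_I[OF _ ae]) measurable
  qed
  also have "... \<longleftrightarrow> (AE x in lborel. (if ennreal (norm (V t x)) <= y then 0 else 1 :: ennreal) = 0)" by (simp add: if_bool_eq_conj)
  also have "... \<longleftrightarrow> (NN x. (if ennreal (norm (V t x)) <= y then 0 else 1)) = 0"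
   by (rule nn_integral_0_iff_AE[symmetric]) measurable
  finally show ?thesis .
 qed
 then show "{t \<in> space borel. esssup lborel (\<lambda>x. ennreal (norm (V t x))) <= y} \<in> sets borel" by simp measurable
qed

text \<open>Unpacks membership in \<open>S0\<close> into the form required by the uniqueness lemma:
  a real majorant in L^4 of time for the supremum in x, and a uniform L^2 bound for almost every
  time. The majorant is the essential supremum, finite almost everywhere.\<close>

lemma S0_bounds:
 assumes v: "v \<in> S0"
 obtains k m where "0 <= m" "k \<in> borel_measurable borel" "\<And>s. 0 <= k s" "(NN s. indicator {-1..1} s * ennreal (k s ^ 4)) < \<infinity>"
  "AE s in lborel. s \<in> {-1..1} --> (AE x in lborel. norm (v s x) <= k s)"
  "AE t in lborel. t \<in> {-1..1} --> (NN x. ennreal ((norm (v t x))\<^sup>2)) <= ennreal m"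
proof -
 have m: "spacetime_measurable {-1..1} v" and n4: "mixed_norm 4 {-1..1} \<infinity> v < \<infinity>" and n2: "mixed_norm \<infinity> {-1..1} 2 v < \<infinity>"
  using v by (auto simp: S0_def LtLx_def)
 define \<kappa> where "\<kappa> t = esssup lborel (\<lambda>x. ennreal (norm (slab v t x)))" for t
 have [measurable]: "\<kappa> \<in> borel_measurable borel" unfolding \<kappa>_def[abs_def] by (rule esssup_measurable[OF slab_measurable[OF m]])
 have "(\<integral>\<^sup>+t. epowr (esssup lborel (\<lambda>x. ennreal (norm (v t x)))) 4 \<partial>restrict_space lborel {-1..1}) \<noteq> \<infinity>"
  using n4 by (auto simp: mixed_norm_def Lnorm_def epowr_def)
 also have "(\<integral>\<^sup>+t. epowr (esssup lborel (\<lambda>x. ennreal (norm (v t x)))) 4 \<partial>restrict_space lborel {-1..1})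
   = (NN t. epowr (esssup lborel (\<lambda>x. ennreal (norm (v t x)))) 4 * indicator {-1..1} t)"
  by (rule nn_integral_restrict_space) simp
 also have "... = (NN t. epowr (\<kappa> t) 4 * indicator {-1..1} t)"
  by (intro nn_integral_cong) (auto simp: \<kappa>_def slab_def indicator_def)
 finally have fin: "(NN t. epowr (\<kappa> t) 4 * indicator {-1..1} t) \<noteq> \<infinity>" .
 have ae: "AE t in lborel. epowr (\<kappa> t) 4 * indicator {-1..1} t \<noteq> \<infinity>" by (rule nn_integral_noteq_infinite[OF _ fin]) measurable
 have L: "esssup (restrict_space lborel {-1..1}) (\<lambda>t. Lnorm 2 lborel (\<lambda>x. ennreal (norm (v t x)))) < \<infinity>"
  using n2 by (simp add: mixed_norm_def Lnorm_def)
 define b where "b = enn2real (esssup (restrict_space lborel {-1..1}) (\<lambda>t. Lnorm 2 lborel (\<lambda>x. ennreal (norm (v t x)))))"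
 have b: "esssup (restrict_space lborel {-1..1}) (\<lambda>t. Lnorm 2 lborel (\<lambda>x. ennreal (norm (v t x)))) = ennreal b" "0 <= b"
  using L by (auto simp: b_def)
 show thesis
 proof (rule that[of "b\<^sup>2" "\<lambda>t. enn2real (\<kappa> t)"])
  have "(NN s. indicator {-1..1} s * ennreal (enn2real (\<kappa> s) ^ 4)) <= (NN t. epowr (\<kappa> t) 4 * indicator {-1..1} t)"
   by (intro nn_integral_mono) (auto simp: epowr_def indicator_def powr_numeral)
  then show "(NN s. indicator {-1..1} s * ennreal (enn2real (\<kappa> s) ^ 4)) < \<infinity>"
   using fin by (simp add: less_top[symmetric] top_unique) (metis neq_top_trans)
  show "AE s in lborel. s \<in> {-1..1} --> (AE x in lborel. norm (v s x) <= enn2real (\<kappa> s))"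
   using ae
  proof eventually_elim
   case (elim s)
   show ?case
   proof
    assume s: "s \<in> {-1..1}"
    then have "\<kappa> s \<noteq> \<infinity>" using elim by (auto simp: epowr_def)
    then have k: "\<kappa> s = ennreal (enn2real (\<kappa> s))" by (simp add: less_top)
    have "AE x in lborel. ennreal (norm (slab v s x)) <= \<kappa> s" unfolding \<kappa>_def by (rule esssup_AE)
    then show "AE x in lborel. norm (v s x) <= enn2real (\<kappa> s)"
    proof eventually_elim
     case (elim x)
     then have "ennreal (norm (v s x)) <= ennreal (enn2real (\<kappa> s))" using k s by (simp add: slab_def)
     then show ?case by (simp add: ennreal_le_iff)
    qed
   qed
  qed
  have "AE t in restrict_space lborel {-1..1}. Lnorm 2 lborel (\<lambda>x. ennreal (norm (v t x))) <= ennreal b"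
   unfolding b(1)[symmetric] by (rule esssup_AE)
  then have "AE t in lborel. t \<in> {-1..1} --> Lnorm 2 lborel (\<lambda>x. ennreal (norm (v t x))) <= ennreal b"
   by (subst (asm) AE_restrict_space_iff) auto
  then show "AE t in lborel. t \<in> {-1..1} --> (NN x. ennreal ((norm (v t x))\<^sup>2)) <= ennreal (b\<^sup>2)"
  proof eventually_elim
   case (elim t)
   show ?case
   proof
    assume "t \<in> {-1..1}"
    then have le: "epowr (NN x. ennreal ((norm (v t x))\<^sup>2)) (1 / 2) <= ennreal b"
     using elim by (simp add: Lnorm_def epowr_ennreal powr_numeral)
    show "(NN x. ennreal ((norm (v t x))\<^sup>2)) <= ennreal (b\<^sup>2)"
    proof (cases "(NN x. ennreal ((norm (v t x))\<^sup>2))")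
     case (real y)
     then have "sqrt y <= b" using le b(2) by (simp add: epowr_ennreal powr_half_sqrt)
     then show ?thesis using real b(2) by (simp add: real_sqrt_le_iff' ennreal_leI sqrt_le_D)
    next
     case top
     then show ?thesis using le by (simp add: epowr_def top_unique)
    qed
   qed
  qed
 qed auto
qed

lemma represents_cong: "represents g T ==> (\<And>phi. schwartz phi ==> T phi = T' phi) ==> represents g T'"
 by (simp add: represents_def)

lemma spacetime_measurable_partial_sum:
 "(\<And>j. j < m ==> spacetime_measurable I (w j)) ==> spacetime_measurable I (partial_sum w m)"
 unfolding spacetime_measurable_def partial_sum_def case_prod_beta' by (intro borel_measurable_sum) auto

lemma pow4_add_le: "0 <= x ==> 0 <= y ==> (x + y) ^ 4 <= 8 * x ^ 4 + 8 * (y::real) ^ 4"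
proof -
 have s: "(u + w)\<^sup>2 <= 2 * u\<^sup>2 + 2 * w\<^sup>2" for u w :: real
  using sum_squares_bound[of u w] by (simp add: power2_sum)
 assume "0 <= x" "0 <= y"
 have "(x + y) ^ 4 = ((x + y)\<^sup>2)\<^sup>2" by (simp flip: power_mult)
 also have "... <= (2 * x\<^sup>2 + 2 * y\<^sup>2)\<^sup>2" by (intro power_mono s) simp
 also have "... <= 2 * (2 * x\<^sup>2)\<^sup>2 + 2 * (2 * y\<^sup>2)\<^sup>2" by (rule s)
 finally show ?thesis by (simp add: power_mult_distrib flip: power_mult)
qed

section \<open>Solutions generated by a small free family\<close>

locale small_data = freq_window +
 fixes n :: nat and r a :: real and c0 :: "int => real => real => complex" and f :: distribution
 assumes r: "r = 4 * real n + 2" and n: "1 <= n" and c0: "fam r a c0" and a: "6 * CT * (2 * a)\<^sup>2 <= 1"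
  and free: "\<And>t phi. t \<in> {-1..1} ==> schwartz phi ==> (LBINT x. Syn c0 t x * phi x) = schroedinger t f phi"
begin

lemma r1: "1 <= r" using r by simp

lemmas sol = sol_properties[OF r c0 a]
lemmas famp = pic_fam[OF c0 r1 a]

lemma famd: "fam r (2 * a + 2 * a) (dpic c0 j)"
 unfolding dpic_def by (rule fam_diff[OF famp famp r1])

abbreviation "w \<equiv> \<lambda>j. Syn (dpic c0 j)"
abbreviation "V \<equiv> Syn (\<lambda>k t x. sol c0 k t x - pic c0 n k t x)"

lemma Syn_meas: "fam q S c ==> spacetime_measurable I (Syn c)"
 by (rule spacetime_measurable_borel) (use Syn_measurable[OF fam_measf] in \<open>simp add: case_prod_beta'\<close>)

lemma Syn_dpic: "t \<in> {-1..1} ==> w j t x = Syn (pic c0 (Suc j)) t x - Syn (pic c0 j) t x"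
 unfolding dpic_def by (rule Syn_diff[OF famp famp r1 r1])

text \<open>The increments telescope, so the partial sums in the definition of the iterates are the
  synthesized Picard iterates. This identifies the two recursions.\<close>

lemma partial_Syn: "t \<in> {-1..1} ==> partial_sum w j t x = Syn (pic c0 j) t x"
proof (induction j)
 case 0
 show ?case by (simp add: partial_sum_def Syn_def piece_def conv_def)
next
 case (Suc j)
 then show ?case using Syn_dpic[of t j x] by (simp add: partial_sum_def)
qed

lemma Syn_dpic_0: "t \<in> {-1..1} ==> w 0 t x = Syn c0 t x"
 by (rule Syn_cong) (simp add: dpic_def T_zero)

lemma famT: "fam r b c ==> fam r (CT * (b * b * b)) (T c c c)"
 by (rule T_fam[OF _ _ _ r1 r1 r1 r1 exponent3]) (use r1 in simp_all)

lemma Syn_pic_Suc: assumes t: "t \<in> {-1..1}"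
 shows "Syn (pic c0 (Suc j)) t x = Syn c0 t x + Syn (T (pic c0 j) (pic c0 j) (pic c0 j)) t x"
proof -
 have "Syn (T (pic c0 j) (pic c0 j) (pic c0 j)) t x = Syn (\<lambda>k t x. pic c0 (Suc j) k t x - c0 k t x) t x"
  by (rule Syn_cong) simp
 then show ?thesis using Syn_diff[OF famp c0 r1 r1 t, of "Suc j" x] by simp
qed

lemma Syn_sol: assumes t: "t \<in> {-1..1}"
 shows "Syn (sol c0) t x = Syn c0 t x + Syn (T (sol c0) (sol c0) (sol c0)) t x"
proof -
 have "Syn (T (sol c0) (sol c0) (sol c0)) t x = Syn (\<lambda>k t x. sol c0 k t x - c0 k t x) t x"
  by (rule Syn_cong) (use sol(4)[OF t] in simp)
 then show ?thesis using Syn_diff[OF sol(1) c0 r1 r1 t, of x] by simp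
qed

lemma split_first: "1 <= (m::nat) ==> (\<Sum>k<m. g k) = g 0 + (\<Sum>k=1..<m. (g k :: complex))"
 using sum.atLeast_Suc_lessThan[of 0 m g] by (simp add: lessThan_atLeast0)

lemma Syn_pic: assumes t: "t \<in> {-1..1}" and j: "1 <= j"
 shows "Syn (pic c0 j) t x = Syn c0 t x + (\<Sum>k=1..<j. w k t x)"
 using partial_Syn[OF t, of j x] Syn_dpic_0[OF t, of x] unfolding partial_sum_def split_first[OF j] by simp

lemma Syn_dpic_eq: assumes t: "t \<in> {-1..1}" and j: "1 <= j"
 shows "w j t x = Syn (T (pic c0 j) (pic c0 j) (pic c0 j)) t x - (\<Sum>k=1..<j. w k t x)"
proof -
 have "w j t x = Syn (pic c0 (Suc j)) t x - Syn (pic c0 j) t x" by (rule Syn_dpic[OF t])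
 also have "... = (Syn c0 t x + Syn (T (pic c0 j) (pic c0 j) (pic c0 j)) t x) - (Syn c0 t x + (\<Sum>k=1..<j. w k t x))"
  by (simp only: Syn_pic_Suc[OF t] Syn_pic[OF t j])
 finally show ?thesis by simp
qed

lemma V_eq: assumes t: "t \<in> {-1..1}"
 shows "V t x = Syn (T (sol c0) (sol c0) (sol c0)) t x - (\<Sum>k=1..<n. w k t x)"
proof -
 have "V t x = Syn (sol c0) t x - Syn (pic c0 n) t x" by (rule Syn_diff[OF sol(1) famp r1 r1 t])
 also have "... = (Syn c0 t x + Syn (T (sol c0) (sol c0) (sol c0)) t x) - (Syn c0 t x + (\<Sum>k=1..<n. w k t x))"
  by (simp only: Syn_sol[OF t] Syn_pic[OF t n])
 finally show ?thesis by simp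
qed

lemma V_sum: "t \<in> {-1..1} ==> V t x + partial_sum w n t x = Syn (sol c0) t x"
 using partial_Syn[of t n x] Syn_diff[OF sol(1) famp r1 r1, of t n x] by simp

lemma sol_split: "t \<in> {-1..1} ==> Syn (sol c0) t x = V t x + Syn (pic c0 n) t x"
 using Syn_diff[OF sol(1) famp r1 r1, of t n x] by simp

lemma Syn_test_integrable:
 assumes c: "fam q S c" "1 <= q" and t: "t \<in> {-1..1}" and phi: "schwartz phi"
 shows "integrable lborel (\<lambda>x. Syn c t x * phi x)"
proof -
 note B = Syn_Bd[OF c t]
 note [measurable] = Bd_measurable[OF B] schwartz_measurable[OF phi]
 show ?thesis
 proof (rule integrable_boundI)
 show "integrable lborel (\<lambda>x. (Kp * S) * norm (phi x))" by (intro integrable_mult_right integrable_norm schwartz_integrable phi)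
 have "norm (Syn c t x * phi x) <= (Kp * S) * norm (phi x)" for x
  unfolding norm_mult by (rule mult_right_mono[OF Bd_le[OF B]]) simp
 then show "AE x in lborel. norm (Syn c t x * phi x) <= norm ((Kp * S) * norm (phi x))"
  unfolding real_norm_def by (intro AE_I2 order_trans[OF _ abs_ge_self])
 qed measurable
qed

lemma represents_Syn:
 assumes c: "fam q S c" "1 <= q" and t: "t \<in> {-1..1}" and G: "\<And>phi. schwartz phi ==> (LBINT x. Syn c t x * phi x) = G phi"
 shows "represents (Syn c t) G"
 using Syn_test_integrable[OF c t] Bd_measurable[OF Syn_Bd[OF c t]] G unfolding represents_def dist_of_def by simp

text \<open>One identity for both uses: iterates, with \<open>c\<close> a Picard iterate, and the
  remainder, with \<open>c\<close> the limit and j = n.\<close>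

lemma pairing:
 assumes c: "fam r b c" and t: "t \<in> {-1..1}" and phi: "schwartz phi"
  and u: "\<And>x. u x = Syn (T c c c) t x - (\<Sum>k=1..<j. w k t x)"
 shows "(LBINT x. u x * phi x) = N3 (Syn c) (Syn c) (Syn c) t phi - (\<Sum>k=1..<j. dist_of (w k t) phi)"
proof -
 have i: "integrable lborel (\<lambda>x. w k t x * phi x)" for k by (rule Syn_test_integrable[OF famd r1 t phi])
 have "(LBINT x. u x * phi x) = (LBINT x. Syn (T c c c) t x * phi x - (\<Sum>k=1..<j. w k t x * phi x))"
  by (simp add: u left_diff_distrib sum_distrib_right)
 also have "... = (LBINT x. Syn (T c c c) t x * phi x) - (LBINT x. (\<Sum>k=1..<j. w k t x * phi x))"
  by (intro Bochner_Integration.integral_diff Bochner_Integration.integrable_sum i Syn_test_integrable[OF famT[OF c] r1 t phi])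
 also have "(LBINT x. (\<Sum>k=1..<j. w k t x * phi x)) = (\<Sum>k=1..<j. dist_of (w k t) phi)"
  unfolding dist_of_def by (rule Bochner_Integration.integral_sum[OF i])
 also have "(LBINT x. Syn (T c c c) t x * phi x) = N3 (Syn c) (Syn c) (Syn c) t phi"
  by (rule T_represents[OF c c c r1 r1 r1 phi t])
 finally show ?thesis .
qed

lemma iterates_w: "iterates n f w"
 unfolding iterates_def
proof (intro conjI ballI allI impI)
 show "spacetime_measurable {-1..1} (w j)" for j by (rule Syn_meas[OF famd])
 show "AE t in lborel. t \<in> {-1..1} --> represents (w 0 t) (schroedinger t f)"
  using Syn_dpic_0 free by (intro AE_I2 impI represents_Syn[OF famd r1]) simp_all
 fix j assume j: "j \<in> {1..<n}"
 show "AE t in lborel. t \<in> {-1..1} --> represents (w j t)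
   (\<lambda>phi. N3 (partial_sum w j) (partial_sum w j) (partial_sum w j) t phi - (\<Sum>k=1..<j. dist_of (w k t) phi))"
 proof (intro AE_I2 impI represents_Syn[OF famd r1])
  fix t :: real and phi assume t: "t \<in> {-1..1}" and phi: "schwartz phi"
  have "N3 (partial_sum w j) (partial_sum w j) (partial_sum w j) t phi = N3 (Syn (pic c0 j)) (Syn (pic c0 j)) (Syn (pic c0 j)) t phi"
   by (rule N3_cong[OF partial_Syn t])
  moreover have "(LBINT x. w j t x * phi x) = N3 (Syn (pic c0 j)) (Syn (pic c0 j)) (Syn (pic c0 j)) t phi - (\<Sum>k=1..<j. dist_of (w k t) phi)"
   using j by (intro pairing[OF famp t phi] Syn_dpic_eq[OF t]) simp
  ultimately show "(LBINT x. w j t x * phi x) = N3 (partial_sum w j) (partial_sum w j) (partial_sum w j) t phi - (\<Sum>k=1..<j. dist_of (w k t) phi)"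
   by simp
 qed
qed

lemma partial_sum_AE:
 fixes z :: "nat => real => real => complex"
 assumes ae: "\<And>k. k < j ==> AE t in lborel. t \<in> {-1..1} --> (AE x in lborel. z k t x = w k t x)"
 shows "AE t in lborel. t \<in> {-1..1} --> (AE x in lborel. partial_sum z j t x = Syn (pic c0 j) t x)"
proof -
 have "AE t in lborel. \<forall>k\<in>{..<j}. t \<in> {-1..1} --> (AE x in lborel. z k t x = w k t x)"
  by (rule AE_ball_countable') (use ae in auto)
 then show ?thesis
 proof eventually_elim
  case (elim t)
  show ?case
  proof
   assume t: "t \<in> {-1..1}"
   then have "AE x in lborel. \<forall>k\<in>{..<j}. z k t x = w k t x" by (intro AE_ball_countable') (use elim in auto)
   then show "AE x in lborel. partial_sum z j t x = Syn (pic c0 j) t x"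
   proof eventually_elim
    case (elim x)
    then have "partial_sum z j t x = partial_sum w j t x" by (simp add: partial_sum_def)
    then show ?case using partial_Syn[OF t] by simp
   qed
  qed
 qed
qed

lemma dist_of_AE:
 assumes m: "\<And>k. k < j ==> spacetime_measurable {-1..1} (z k)"
  and ae: "\<And>k. k < j ==> AE t in lborel. t \<in> {-1..1} --> (AE x in lborel. z k t x = w k t x)"
 shows "AE t in lborel. t \<in> {-1..1} --> (\<forall>phi. schwartz phi --> (\<Sum>k=1..<j. dist_of (z k t) phi) = (\<Sum>k=1..<j. dist_of (w k t) phi))"
proof -
 have "AE t in lborel. \<forall>k\<in>{1..<j}. t \<in> {-1..1} --> (AE x in lborel. z k t x = w k t x)"
  by (rule AE_ball_countable') (use ae in auto)
 then show ?thesis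
 proof eventually_elim
  case (elim t)
  have "dist_of (z k t) phi = dist_of (w k t) phi" if t: "t \<in> {-1..1}" and phi: "schwartz phi" and k: "k \<in> {1..<j}" for phi k
   unfolding dist_of_def
  proof (rule integral_cong_AE)
   have zm[measurable]: "z k t \<in> borel_measurable borel" by (rule spacetime_measurable_section[OF m t]) (use k in simp)
   note [measurable] = Bd_measurable[OF Syn_Bd[OF famd[of k] r1 t]] schwartz_measurable[OF phi]
   show "(\<lambda>x. z k t x * phi x) \<in> borel_measurable lborel" "(\<lambda>x. w k t x * phi x) \<in> borel_measurable lborel" by measurable
   have "AE x in lborel. z k t x = w k t x" using elim t k by blast
   then show "AE x in lborel. z k t x * phi x = w k t x * phi x" by eventually_elim simp
  qed
  then show ?case by (intro impI allI sum.cong refl) auto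
 qed
qed

text \<open>Strong induction, because the Duhamel term and the subtracted sum of the j-th iterate
  involve all earlier ones. If those agree almost everywhere, the j-th iterates represent the same
  distribution.\<close>

lemma iterates_unique:
 assumes z: "iterates n f z" shows "j < n ==> AE t in lborel. t \<in> {-1..1} --> (AE x in lborel. z j t x = w j t x)"
proof (induction j rule: less_induct)
 case (less j)
 have m: "\<And>k. k < j ==> spacetime_measurable {-1..1} (z k)" using z less.prems unfolding iterates_def by auto
 have IH: "\<And>k. k < j ==> AE t in lborel. t \<in> {-1..1} --> (AE x in lborel. z k t x = w k t x)" using less by auto
 show ?case
 proof (cases "j = 0")
  case True
  have "AE t in lborel. t \<in> {-1..1} --> represents (z 0 t) (schroedinger t f)" using z unfolding iterates_def by blast
  moreover have "AE t in lborel. t \<in> {-1..1} --> represents (w 0 t) (schroedinger t f)" using iterates_w unfolding iterates_def by blast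
  ultimately show ?thesis unfolding True by eventually_elim (use represents_unique in blast)
 next
  case False
  then have j: "j \<in> {1..<n}" using less.prems by simp
  note R = iterates_def[of n f, THEN iffD1, THEN conjunct2, THEN conjunct2, THEN bspec, OF _ j]
  have N: "N3 (partial_sum z j) (partial_sum z j) (partial_sum z j) t phi = N3 (partial_sum w j) (partial_sum w j) (partial_sum w j) t phi"
   if t: "t \<in> {-1..1}" and phi: "schwartz phi" for t phi
  proof -
   have "N3 (partial_sum z j) (partial_sum z j) (partial_sum z j) t phi = N3 (Syn (pic c0 j)) (Syn (pic c0 j)) (Syn (pic c0 j)) t phi"
    by (rule N3_AE_cong[OF spacetime_measurable_partial_sum[OF m] Syn_meas[OF famp] partial_sum_AE[OF IH] t phi])
   also have "... = N3 (partial_sum w j) (partial_sum w j) (partial_sum w j) t phi"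
    by (rule N3_cong[OF partial_Syn[symmetric] t])
   finally show ?thesis .
  qed
  have D: "AE t in lborel. t \<in> {-1..1} --> (\<forall>phi. schwartz phi --> (\<Sum>k=1..<j. dist_of (z k t) phi) = (\<Sum>k=1..<j. dist_of (w k t) phi))"
   by (rule dist_of_AE[OF m IH])
  show ?thesis using R[OF z] R[OF iterates_w] D
  proof eventually_elim
   case (elim t)
   show ?case
   proof
    assume t: "t \<in> {-1..1}"
    show "AE x in lborel. z j t x = w j t x"
     by (rule represents_unique[OF represents_cong[OF elim(1)[rule_format, OF t]] elim(2)[rule_format, OF t]])
       (use elim(3) t N[OF t] in simp)
   qed
  qed
 qed
qed

text \<open>The tail of the Picard series from index n on is bounded in L^2 and in L^\<infinity>
  uniformly in time, which controls both norms of \<open>S0\<close> on a bounded interval.\<close>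

lemma V_S0: "V \<in> S0"
proof -
 have B: "Bd 2 (Kp * (2 * a)) (V t)" if "t \<in> {-1..1}" for t by (rule Syn_Bd[OF sol(3) _ that]) simp
 have A: "0 <= Kp * (2 * a)" by (rule Bd_nonneg[OF B[of 0]]) simp
 have m: "spacetime_measurable {-1..1} V" by (rule Syn_meas[OF sol(3)])
 have "mixed_norm (ennreal 4) {-1..1} \<infinity> V <= ennreal (Kp * (2 * a) * (1 - (-1)) powr (1 / 4))"
 proof (intro mixed_norm_le A AE_I2 impI)
  fix t :: real assume t: "t \<in> {-1..1}"
  note [measurable] = Bd_measurable[OF B[OF t]]
  show "Lnorm \<infinity> lborel (\<lambda>x. ennreal (norm (V t x))) <= ennreal (Kp * (2 * a))"
   unfolding Lnorm_def if_P[OF refl] by (rule esssup_I) (auto intro!: AE_I2 ennreal_leI Bd_le[OF B[OF t]])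
 qed auto
 then have 4: "mixed_norm 4 {-1..1} \<infinity> V < \<infinity>" by (simp add: le_less_trans[OF _ ennreal_less_top])
 have "mixed_norm \<infinity> {-1..1} 2 V <= ennreal (Kp * (2 * a))"
  unfolding mixed_norm_def Lnorm_def[of \<infinity>] if_P[OF refl]
 proof (rule esssup_I)
  note [measurable (raw)] = Syn_measurable_raw[OF fam_measf[OF sol(3)]]
  have "(\<lambda>t. epowr (NN x. epowr (ennreal (norm (V t x))) 2) (1 / 2)) \<in> borel_measurable borel" by measurable
  then show "(\<lambda>t. Lnorm 2 lborel (\<lambda>x. ennreal (norm (V t x)))) \<in> borel_measurable (restrict_space lborel {-1..1})"
   by (intro measurable_restrict_space1) (simp add: Lnorm_def)
  show "AE t in restrict_space lborel {-1..1}. Lnorm 2 lborel (\<lambda>x. ennreal (norm (V t x))) <= ennreal (Kp * (2 * a))"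
  proof (rule AE_I2)
   fix t :: real assume "t \<in> space (restrict_space lborel {-1..1})"
   then have "t \<in> {-1..1}" by (simp add: space_restrict_space)
   from Lnorm_Bd[OF _ B[OF this], of "V t"] show "Lnorm 2 lborel (\<lambda>x. ennreal (norm (V t x))) <= ennreal (Kp * (2 * a))" by simp
  qed
 qed
 then have "mixed_norm \<infinity> {-1..1} 2 V < \<infinity>" by (rule le_less_trans) simp
 then show ?thesis using 4 m by (simp add: S0_def LtLx_def)
qed

lemma remainder_V: "remainder n w V"
 unfolding remainder_def Let_def
proof (intro conjI V_S0 AE_I2 impI represents_Syn[OF sol(3)])
 fix t :: real and phi assume t: "t \<in> {-1..1}" and phi: "schwartz phi"
 let ?z = "\<lambda>t x. V t x + partial_sum w n t x"
 have "N3 ?z ?z ?z t phi = N3 (Syn (sol c0)) (Syn (sol c0)) (Syn (sol c0)) t phi" by (rule N3_cong[OF V_sum t])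
 then show "(LBINT x. V t x * phi x) = N3 ?z ?z ?z t phi - (\<Sum>k=1..<n. dist_of (w k t) phi)"
  using pairing[OF sol(1) t phi V_eq[OF t]] by simp
qed simp

text \<open>The total functions, rather than the remainders, solve the same cubic equation and are
  compared. They need not lie in L^2, but their common iterates cancel, so the difference is
  \<open>v - V\<close>, a difference of two functions that do.\<close>

lemma remainder_unique:
 assumes z: "iterates n f z" and v: "remainder n z v"
 shows "AE t in lborel. t \<in> {-1..1} --> (AE x in lborel. v t x + partial_sum z n t x = Syn (sol c0) t x)"
proof -
 have mz: "\<And>k. k < n ==> spacetime_measurable {-1..1} (z k)" using z unfolding iterates_def by auto
 have v0: "v \<in> S0" using v by (simp add: remainder_def)
 obtain m k where m0: "0 <= m" and k: "k \<in> borel_measurable borel" "\<And>s. 0 <= k s" "(NN s. indicator {-1..1} s * ennreal (k s ^ 4)) < \<infinity>"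
  and vk: "AE s in lborel. s \<in> {-1..1} --> (AE x in lborel. norm (v s x) <= k s)"
  and v2: "AE t in lborel. t \<in> {-1..1} --> (NN x. ennreal ((norm (v t x))\<^sup>2)) <= ennreal m"
  by (rule S0_bounds[OF v0], rule that)
 define y where "y = (\<lambda>t x. v t x + partial_sum z n t x)"
 have my: "spacetime_measurable {-1..1} y"
  using v0 spacetime_measurable_partial_sum[OF mz] unfolding y_def S0_def LtLx_def spacetime_measurable_def case_prod_beta'
  by (intro borel_measurable_add) auto
 have pz: "AE t in lborel. t \<in> {-1..1} --> (AE x in lborel. partial_sum z n t x = Syn (pic c0 n) t x)"
  by (rule partial_sum_AE[OF iterates_unique[OF z]])
 have D: "AE t in lborel. t \<in> {-1..1} --> (\<forall>phi. schwartz phi --> (\<Sum>k=1..<n. dist_of (z k t) phi) = (\<Sum>k=1..<n. dist_of (w k t) phi))"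
  by (rule dist_of_AE[OF mz iterates_unique[OF z]])
 note B = Syn_Bd[OF sol(1) r1] and Bp = Syn_Bd[OF famp r1, of _ n] and BV = Syn_Bd[OF sol(3)]
 define b where "b = Kp * (2 * a)"
 have b: "0 <= b" using fam_nonneg[OF c0] Kp_nonneg by (simp add: b_def)
 have meas_sol: "(\<lambda>p. Syn (sol c0) (fst p) (snd p)) \<in> borel_measurable (borel \<Otimes>\<^sub>M borel)"
  using Syn_measurable[OF fam_measf[OF sol(1)]] by (simp add: case_prod_beta')
 have "AE t in lborel. t \<in> {-1..1} --> (AE x in lborel. slab y t x = Syn (sol c0) t x)"
 \<comment> \<open>The supremum bound adds the bound b of the partial sum to the bound k of
   \<open>v\<close>. The constant M comes from the squared L^2 bounds m of \<open>v\<close> and b^2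
   of \<open>V\<close>, each doubled by squaring the triangle inequality.\<close>
 proof (rule cubic_uniqueness[OF meas_sol slab_measurable[OF my], where k = "\<lambda>s. k s + b" and M = "2 * m + 2 * b\<^sup>2"])
  show "(\<lambda>s. k s + b) \<in> borel_measurable borel" using k(1) by measurable
  note [measurable] = k(1)
  have "(NN s. indicator {-1..1} s * ennreal ((k s + b) ^ 4))
    <= (NN s. ennreal 8 * (indicator {-1..1} s * ennreal (k s ^ 4)) + ennreal (8 * b ^ 4) * indicator {-1..1} s)"
  proof (intro nn_integral_mono)
   fix s :: real
   have "ennreal ((k s + b) ^ 4) <= ennreal (8 * k s ^ 4 + 8 * b ^ 4)" by (intro ennreal_leI pow4_add_le k(2) b)
   also have "... = ennreal 8 * ennreal (k s ^ 4) + ennreal (8 * b ^ 4)" using b k(2)[of s] by (simp add: ennreal_mult)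
   finally show "indicator {-1..1} s * ennreal ((k s + b) ^ 4) <= ennreal 8 * (indicator {-1..1} s * ennreal (k s ^ 4)) + ennreal (8 * b ^ 4) * indicator {-1..1} s"
    by (auto simp: indicator_def)
  qed
  also have "... = ennreal 8 * (NN s. indicator {-1..1} s * ennreal (k s ^ 4)) + ennreal (8 * b ^ 4) * 2"
   by (subst nn_integral_add) (auto simp: nn_integral_cmult nn_integral_cmult_indicator)
  also have "... < \<infinity>" using k(3) by (simp add: ennreal_mult_less_top)
  finally show "(NN s. indicator {-1..1} s * ennreal ((k s + b) ^ 4)) < \<infinity>" .
  show "AE s in lborel. s \<in> {-1..1} --> (AE x in lborel. norm (Syn (sol c0) s x) <= k s + b)"
   using B k(2) unfolding b_def by (intro AE_I2 impI add_increasing) (auto intro: Bd_le)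
  show "AE s in lborel. s \<in> {-1..1} --> (AE x in lborel. norm (slab y s x) <= k s + b)"
   using vk pz
  proof eventually_elim
   case (elim s)
   show ?case
   proof
    assume s: "s \<in> {-1..1}"
    show "AE x in lborel. norm (slab y s x) <= k s + b"
     using elim(1)[rule_format, OF s] elim(2)[rule_format, OF s]
    proof eventually_elim
     case (elim x)
     have "norm (Syn (pic c0 n) s x) <= b" unfolding b_def by (rule Bd_le[OF Bp[OF s]])
     then show ?case using elim s norm_triangle_ineq[of "v s x" "partial_sum z n s x"] by (simp add: slab_def y_def)
    qed
   qed
  qed
  show "AE t in lborel. t \<in> {-1..1} --> (NN x. ennreal ((norm (slab y t x - Syn (sol c0) t x))\<^sup>2)) <= ennreal (2 * m + 2 * b\<^sup>2)"
   using v2 pz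
  proof eventually_elim
   case (elim t)
   show ?case
   proof
    assume t: "t \<in> {-1..1}"
    have [measurable]: "v t \<in> borel_measurable borel" by (rule spacetime_measurable_section[OF _ t]) (use v0 in \<open>simp add: S0_def LtLx_def\<close>)
    note [measurable] = Bd_measurable[OF BV[OF _ t]]
    have "(NN x. ennreal ((norm (slab y t x - Syn (sol c0) t x))\<^sup>2))
     <= (NN x. 2 * ennreal ((norm (v t x))\<^sup>2) + 2 * ennreal ((norm (V t x))\<^sup>2))"
    proof (rule nn_integral_mono_AE)
     show "AE x in lborel. ennreal ((norm (slab y t x - Syn (sol c0) t x))\<^sup>2) <= 2 * ennreal ((norm (v t x))\<^sup>2) + 2 * ennreal ((norm (V t x))\<^sup>2)"
      using elim(2)[rule_format, OF t]
     proof eventually_elim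
      case (elim x)
      have "slab y t x - Syn (sol c0) t x = v t x - V t x"
       using elim t by (simp add: slab_def y_def sol_split[OF t])
      then have "(norm (slab y t x - Syn (sol c0) t x))\<^sup>2 <= (norm (v t x) + norm (V t x))\<^sup>2"
       by (simp add: norm_triangle_ineq4 power_mono)
      also have "... <= 2 * (norm (v t x))\<^sup>2 + 2 * (norm (V t x))\<^sup>2"
       using sum_squares_bound[of "norm (v t x)" "norm (V t x)"] by (simp add: power2_sum)
      finally have "ennreal ((norm (slab y t x - Syn (sol c0) t x))\<^sup>2) <= ennreal (2 * (norm (v t x))\<^sup>2 + 2 * (norm (V t x))\<^sup>2)" by (rule ennreal_leI)
      then show ?case by (simp add: ennreal_mult)
     qed
    qed
    also have "... = 2 * (NN x. ennreal ((norm (v t x))\<^sup>2)) + 2 * (NN x. ennreal ((norm (V t x))\<^sup>2))"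
     by (subst nn_integral_add) (auto simp: nn_integral_cmult)
    also have "... <= 2 * ennreal m + 2 * ennreal (b\<^sup>2)"
     using elim(1) t Bd_nn[OF BV[OF _ t]] b unfolding b_def[symmetric] by (intro add_mono mult_left_mono) (auto simp: powr_numeral)
    also have "... = ennreal (2 * m + 2 * b\<^sup>2)" using m0 by (simp add: ennreal_mult)
    finally show "(NN x. ennreal ((norm (slab y t x - Syn (sol c0) t x))\<^sup>2)) <= ennreal (2 * m + 2 * b\<^sup>2)" .
   qed
  qed
  show "AE t in lborel. t \<in> {-1..1} --> (\<forall>phi. schwartz phi --> (LBINT x. (slab y t x - Syn (sol c0) t x) * phi x)
    = N3 (slab y) (slab y) (slab y) t phi - N3 (Syn (sol c0)) (Syn (sol c0)) (Syn (sol c0)) t phi)"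
   using v[unfolded remainder_def Let_def, THEN conjunct2] pz D
  proof eventually_elim
   case (elim t)
   show ?case
   proof (intro impI allI)
    fix phi assume t: "t \<in> {-1..1}" and phi: "schwartz phi"
    have R: "represents (v t) (\<lambda>phi. N3 y y y t phi - (\<Sum>j=1..<n. dist_of (z j t) phi))" using elim(1) t by (simp add: y_def)
    have my': "y t \<in> borel_measurable borel" "v t \<in> borel_measurable borel"
     by (rule spacetime_measurable_section[OF my t], rule spacetime_measurable_section[OF _ t]) (use v0 in \<open>simp add: S0_def LtLx_def\<close>)
    have [measurable]: "slab y t \<in> borel_measurable borel" unfolding slab_eq[OF t] by (rule my'(1))
    note [measurable] = my' Bd_measurable[OF B[OF t]] Bd_measurable[OF BV[OF _ t]] schwartz_measurable[OF phi]
    have "(LBINT x. (slab y t x - Syn (sol c0) t x) * phi x) = (LBINT x. v t x * phi x - V t x * phi x)"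
    proof (rule integral_cong_AE)
     show "AE x in lborel. (slab y t x - Syn (sol c0) t x) * phi x = v t x * phi x - V t x * phi x"
      using elim(2)[rule_format, OF t]
     proof eventually_elim
      case (elim x)
      have "slab y t x - Syn (sol c0) t x = v t x - V t x"
       using elim t by (simp add: slab_def y_def sol_split[OF t])
      then show ?case by (simp add: left_diff_distrib)
     qed
    qed measurable
    also have "... = (LBINT x. v t x * phi x) - (LBINT x. V t x * phi x)"
     by (rule Bochner_Integration.integral_diff) (use R phi Syn_test_integrable[OF sol(3) _ t phi] in \<open>auto simp: represents_def\<close>)
    also have "(LBINT x. v t x * phi x) = N3 y y y t phi - (\<Sum>j=1..<n. dist_of (z j t) phi)"
     using representsD[OF R phi] by (simp add: dist_of_def)
    also have "(\<Sum>j=1..<n. dist_of (z j t) phi) = (\<Sum>j=1..<n. dist_of (w j t) phi)" using elim(3) t phi by blast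
    also have "(LBINT x. V t x * phi x) = N3 (Syn (sol c0)) (Syn (sol c0)) (Syn (sol c0)) t phi - (\<Sum>j=1..<n. dist_of (w j t) phi)"
     by (rule pairing[OF sol(1) t phi V_eq[OF t]])
    finally show "(LBINT x. (slab y t x - Syn (sol c0) t x) * phi x) = N3 (slab y) (slab y) (slab y) t phi - N3 (Syn (sol c0)) (Syn (sol c0)) (Syn (sol c0)) t phi"
     unfolding N3_slab[OF t] by simp
   qed
  qed
 qed
 then show ?thesis by eventually_elim (simp add: slab_def y_def)
qed

text \<open>Reduces statements about arbitrary corresponding solutions to the constructed one, as
  continuous dependence quantifies over all of them.\<close>

lemma corresponding_unique:
 assumes "corresponding_solution n f u"
 shows "AE t in lborel. t \<in> {-1..1} --> (AE x in lborel. u t x = Syn (sol c0) t x)"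
proof -
 obtain z v where z: "iterates n f z" "remainder n z v" and u: "u = (\<lambda>t x. partial_sum z n t x + v t x)"
  using assms unfolding corresponding_solution_def by blast
 show ?thesis using remainder_unique[OF z] unfolding u by (simp add: add.commute)
qed

lemma corresponding_exists: "corresponding_solution n f (\<lambda>t x. partial_sum w n t x + V t x)"
 unfolding corresponding_solution_def
proof (intro exI[of _ w] exI[of _ V] conjI iterates_w remainder_V allI impI refl)
 fix v assume "remainder n w v"
 from remainder_unique[OF iterates_w this]
 show "AE t in lborel. t \<in> {-1..1} --> (AE x in lborel. v t x = V t x)"
 proof eventually_elim
  case (elim t)
  show ?case
  proof
   assume t: "t \<in> {-1..1}"
   from elim[rule_format, OF t] show "AE x in lborel. v t x = V t x"
   proof eventually_elim
    case (elim x)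
    then have "v t x + partial_sum w n t x = V t x + partial_sum w n t x" using V_sum[OF t, of x] by simp
    then show ?case by simp
   qed
  qed
 qed
qed

lemma solution_exists:
 assumes p: "0 < p"
 shows "\<exists>u. corresponding_solution n f u \<and> u \<in> LtLx (ennreal p) {0..1} (ennreal r) \<and> duhamel_solution {0..1} f u"
proof (intro exI conjI)
 let ?u = "\<lambda>t x. partial_sum w n t x + V t x"
 show "corresponding_solution n f ?u" by (rule corresponding_exists)
 have eq: "?u t x = Syn (sol c0) t x" if "t \<in> {-1..1}" for t x using V_sum[OF that] by (simp add: add.commute)
 have "mixed_norm (ennreal p) {0..1} (ennreal r) ?u <= ennreal (Kp * (2 * a) * (1 - 0) powr (1 / p))"
 proof (intro mixed_norm_le p AE_I2 impI)
  show "0 <= Kp * (2 * a)" using Kp_nonneg fam_nonneg[OF c0] by simp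
  fix t :: real assume t: "t \<in> {0..1}"
  show "Lnorm (ennreal r) lborel (\<lambda>x. ennreal (norm (?u t x))) <= ennreal (Kp * (2 * a))"
   using t r1 eq[of t] by (intro Lnorm_Bd[OF _ Syn_Bd[OF sol(1) r1, of t]]) auto
 qed simp
 then have "mixed_norm (ennreal p) {0..1} (ennreal r) ?u < \<infinity>" by (rule le_less_trans) simp
 moreover have "spacetime_measurable {0..1} ?u"
  using spacetime_measurable_partial_sum[OF Syn_meas[OF famd]] Syn_meas[OF sol(3)] unfolding spacetime_measurable_def case_prod_beta'
  by (intro borel_measurable_add) auto
 ultimately show "?u \<in> LtLx (ennreal p) {0..1} (ennreal r)" by (simp add: LtLx_def)
 show "duhamel_solution {0..1} f ?u"
  unfolding duhamel_solution_def
 proof (intro AE_I2 impI)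
  fix t :: real assume "t \<in> {0..1}"
  then have t: "t \<in> {-1..1}" by simp
  have "?u t = Syn (sol c0) t" using eq[OF t] by (simp add: fun_eq_iff)
  moreover have "represents (Syn (sol c0) t) (\<lambda>phi. schroedinger t f phi + N3 ?u ?u ?u t phi)"
  proof (rule represents_Syn[OF sol(1) r1 t])
   fix phi assume phi: "schwartz phi"
   have "(LBINT x. Syn (sol c0) t x * phi x) = (LBINT x. Syn c0 t x * phi x + Syn (T (sol c0) (sol c0) (sol c0)) t x * phi x)"
    by (simp add: Syn_sol[OF t] distrib_right)
   also have "... = (LBINT x. Syn c0 t x * phi x) + (LBINT x. Syn (T (sol c0) (sol c0) (sol c0)) t x * phi x)"
    by (intro Bochner_Integration.integral_add Syn_test_integrable[OF c0 r1 t phi] Syn_test_integrable[OF famT[OF sol(1)] r1 t phi])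
   also have "... = schroedinger t f phi + N3 (Syn (sol c0)) (Syn (sol c0)) (Syn (sol c0)) t phi"
    unfolding free[OF t phi] T_represents[OF sol(1) sol(1) sol(1) r1 r1 r1 phi t] ..
   also have "N3 (Syn (sol c0)) (Syn (sol c0)) (Syn (sol c0)) t phi = N3 ?u ?u ?u t phi" by (rule N3_cong[OF _ t]) (simp add: eq)
   finally show "(LBINT x. Syn (sol c0) t x * phi x) = schroedinger t f phi + N3 ?u ?u ?u t phi" .
  qed
  ultimately show "represents (?u t) (\<lambda>phi. schroedinger t f phi + N3 ?u ?u ?u t phi)" by simp
 qed
qed

end

section \<open>The theorem\<close>

lemma schwartz_seminorm_nonneg: assumes "schwartz phi" shows "0 <= schwartz_seminorm j k phi"
proof -
 have "bdd_above (range (\<lambda>x. norm (x ^ j *\<^sub>R (dx ^^ k) phi x)))"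
  using assms unfolding schwartz_def bounded_iff bdd_above_def by fast
 then show ?thesis unfolding schwartz_seminorm_def by (rule cSUP_upper2[where x = 0]) auto
qed

text \<open>Makes the linear theory applicable to the difference of two data. The seminorm sums are
  enlarged to a common range of orders.\<close>

lemma tempered_diff:
 assumes f: "tempered f" and g: "tempered g" shows "tempered (\<lambda>phi. f phi - g phi)"
proof -
 obtain C N where C: "\<And>phi. schwartz phi ==> norm (f phi) <= C * (\<Sum>j\<le>N. \<Sum>k\<le>N. schwartz_seminorm j k phi)"
  using f unfolding tempered_def by blast
 obtain D M where D: "\<And>phi. schwartz phi ==> norm (g phi) <= D * (\<Sum>j\<le>M. \<Sum>k\<le>M. schwartz_seminorm j k phi)"
  using g unfolding tempered_def by blast
 have "norm (f phi - g phi) <= (\<bar>C\<bar> + \<bar>D\<bar>) * (\<Sum>j\<le>max N M. \<Sum>k\<le>max N M. schwartz_seminorm j k phi)" if phi: "schwartz phi" for phi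
 proof -
  let ?S = "\<lambda>N. \<Sum>j\<le>N. \<Sum>k\<le>N. schwartz_seminorm j k phi"
  note s0 = schwartz_seminorm_nonneg[OF phi]
  have S: "0 <= ?S K" for K by (intro sum_nonneg s0)
  have mono: "?S K <= ?S L" if "K <= L" for K L
  proof -
   have "?S K <= (\<Sum>j\<le>K. \<Sum>k\<le>L. schwartz_seminorm j k phi)" by (intro sum_mono sum_mono2 s0) (use that in auto)
   also have "... <= ?S L" by (intro sum_mono2 sum_nonneg s0) (use that in auto)
   finally show ?thesis .
  qed
  have "norm (f phi - g phi) <= C * ?S N + D * ?S M" using norm_triangle_ineq4[of "f phi" "g phi"] C[OF phi] D[OF phi] by linarith
  also have "... <= \<bar>C\<bar> * ?S (max N M) + \<bar>D\<bar> * ?S (max N M)"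
   by (intro add_mono mult_mono mono S) auto
  finally show ?thesis by (simp only: distrib_right)
 qed
 then show ?thesis using f g unfolding tempered_def by (auto simp: right_diff_distrib)
qed

context freq_window
begin

text \<open>Abstract in the norm: all that is asked of \<open>N\<close> is that it controls the
  summable frequency pieces linearly. Both parts of the final statement are instances.\<close>

lemma small_data_theorem:
 fixes N :: "distribution => ennreal" and n :: nat
 assumes p: "0 < p" and n: "1 <= n" and r: "r = 4 * real n + 2"
  and N: "\<exists>C\<ge>0. \<forall>f A. tempered f --> 0 < A --> N f < ennreal A --> has_data r (C * A) f"
 shows "\<exists>e\<in>{0<..1}. (\<forall>f. tempered f --> N f <= ennreal e -->
   (\<exists>u. corresponding_solution n f u \<and> u \<in> LtLx (ennreal p) {0..1} (ennreal r) \<and> duhamel_solution {0..1} f u)) \<and>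
  continuous_dependence n p r N e"
proof -
 obtain C where C: "0 <= C" "\<And>f A. tempered f ==> 0 < A ==> N f < ennreal A ==> has_data r (C * A) f" using N by blast
 define D where "D = Kp * C + 1"
 have D: "0 < D" "Kp * C <= D" using Kp_nonneg C(1) by (auto simp: D_def add_nonneg_pos)
 \<comment> \<open>With a = 3 D e the smallness condition reads 216 CT D^2 e^2 <= 1, where 216 = 6 *
   2^2 * 3^2. The summand 1 in the denominator keeps e at most 1.\<close>
 define e where "e = 1 / (1 + 216 * CT * D\<^sup>2)"
 have CD: "0 <= 216 * CT * D\<^sup>2" using CT_nonneg by simp
 have e: "0 < e" "e <= 1" using CD by (auto simp: e_def divide_le_eq add_pos_nonneg)
 \<comment> \<open>The radius has room for the family of one datum, of size 2 D e, and for an added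
   difference family of size at most D e.\<close>
 define a where "a = 3 * D * e"
 have "6 * CT * (2 * a)\<^sup>2 = (216 * CT * D\<^sup>2) * e * e" by (simp add: a_def power2_eq_square)
 also have "... <= (216 * CT * D\<^sup>2) * e * 1" using e CD by (intro mult_left_mono) auto
 also have "... <= 1" using CD by (simp add: e_def divide_le_eq)
 finally have a: "6 * CT * (2 * a)\<^sup>2 <= 1" .
 have r1: "1 <= r" using r by simp
 have fw: "freq_window \<sigma> \<rho>" by (rule freq_window_axioms)
 have data: "\<exists>c. fam r (D * A) c \<and> (\<forall>t\<in>{-1..1}. \<forall>phi. schwartz phi --> (LBINT x. Syn c t x * phi x) = schroedinger t f phi)"
  if f: "tempered f" and A: "0 < A" "N f < ennreal A" for f A
 proof -
  obtain c where c: "fam r (Kp * (C * A)) c" and c': "\<forall>t\<in>{-1..1}. \<forall>phi. schwartz phi --> (LBINT x. Syn c t x * phi x) = schroedinger t f phi"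
   using free_family[OF f C(2)[OF f A] r1] by blast
  have "Kp * (C * A) <= D * A" using mult_right_mono[OF D(2), of A] A(1) by (simp add: mult.assoc)
  then show ?thesis using fam_mono[OF c] c' by blast
 qed
 \<comment> \<open>The hypothesis on the data is non-strict, but representing functions are
   extracted from strict bounds; doubling e bridges the gap.\<close>
 have le2: "N f < ennreal (2 * e)" if "N f <= ennreal e" for f
  by (rule le_less_trans[OF that]) (use e in \<open>simp add: ennreal_less_iff\<close>)
 have aD: "D * (2 * e) <= a" "D * (2 * e) + D * e <= a" using D e by (simp_all add: a_def)
 have small: "small_data \<sigma> \<rho> n r a c f"
  if "fam r a c" "\<And>t phi. t \<in> {-1..1} ==> schwartz phi ==> (LBINT x. Syn c t x * phi x) = schroedinger t f phi" for c f
  using that r n a by unfold_locales auto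
 show ?thesis
 proof (intro bexI[of _ e] conjI allI impI)
  show "e \<in> {0<..1}" using e by simp
 next
  fix f assume f: "tempered f" "N f <= ennreal e"
  obtain c where c: "fam r (D * (2 * e)) c" "\<forall>t\<in>{-1..1}. \<forall>phi. schwartz phi --> (LBINT x. Syn c t x * phi x) = schroedinger t f phi"
   using data[OF f(1) _ le2[OF f(2)]] e by auto
  have "small_data \<sigma> \<rho> n r a c f" by (rule small[OF fam_mono[OF c(1) aD(1)]]) (use c(2) in blast)
  then show "\<exists>u. corresponding_solution n f u \<and> u \<in> LtLx (ennreal p) {0..1} (ennreal r) \<and> duhamel_solution {0..1} f u"
   by (rule small_data.solution_exists[OF _ p])
 next
  show "continuous_dependence n p r N e"
   unfolding continuous_dependence_def
  proof (intro allI impI)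
   fix eta :: real assume eta: "0 < eta"
   define L where "L = Kp * (3 * D)"
   have L: "0 <= L" using Kp_nonneg D by (simp add: L_def)
   define dl where "dl = min e (eta / (2 * (L + 1)))"
   have dl: "0 < dl" "dl <= e" using e eta L by (auto simp: dl_def)
   have "L * dl <= L * (eta / (2 * (L + 1)))" using L by (intro mult_left_mono) (auto simp: dl_def)
   also have "... < eta" using L eta by (simp add: divide_less_eq)
   finally have Ldl: "L * dl < eta" .
   show "\<exists>dl>0. \<forall>f1 f2 u1 u2. tempered f1 --> tempered f2 --> N f1 + N f2 <= ennreal e -->
    corresponding_solution n f1 u1 --> corresponding_solution n f2 u2 --> N (\<lambda>phi. f1 phi - f2 phi) < ennreal dl -->
    mixed_norm (ennreal p) {0..1} (ennreal r) (\<lambda>t x. u1 t x - u2 t x) < ennreal eta"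
   proof (intro exI[of _ dl] conjI dl(1) allI impI)
    fix f1 f2 u1 u2
    assume f1: "tempered f1" and f2: "tempered f2" and Ne: "N f1 + N f2 <= ennreal e"
     and u1: "corresponding_solution n f1 u1" and u2: "corresponding_solution n f2 u2"
     and Nd: "N (\<lambda>phi. f1 phi - f2 phi) < ennreal dl"
    have "N f2 <= ennreal e" by (rule order_trans[OF _ Ne]) simp
    then obtain c2 where c2: "fam r (D * (2 * e)) c2" and c2': "\<And>t phi. t \<in> {-1..1} ==> schwartz phi ==> (LBINT x. Syn c2 t x * phi x) = schroedinger t f2 phi"
     using data[OF f2 _ le2] e by (metis mult_pos_pos zero_less_numeral)
    obtain d where d: "fam r (D * dl) d" and d': "\<And>t phi. t \<in> {-1..1} ==> schwartz phi ==> (LBINT x. Syn d t x * phi x) = schroedinger t (\<lambda>phi. f1 phi - f2 phi) phi"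
     using data[OF tempered_diff[OF f1 f2] dl(1) Nd] by metis
    \<comment> \<open>The family for f1 is built from that of f2 and that of the difference, so the
      difference of the families is exactly \<open>d\<close> and small. Independently chosen
      families for f1 and f2 need not be close to each other.\<close>
    define c1 where "c1 = (\<lambda>k t x. c2 k t x + d k t x)"
    have "D * (2 * e) + D * dl <= a" using aD(2) mult_left_mono[OF dl(2), of D] D(1) by linarith
    then have F1: "fam r a c1" unfolding c1_def by (rule fam_mono[OF fam_add[OF c2 d r1]])
    have F2: "fam r a c2" by (rule fam_mono[OF c2 aD(1)])
    have cd: "(\<lambda>k t x. c1 k t x - c2 k t x) = d" by (simp add: c1_def)
    have S2: "small_data \<sigma> \<rho> n r a c2 f2" by (rule small[OF F2 c2'])
    have S1: "small_data \<sigma> \<rho> n r a c1 f1"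
    proof (rule small[OF F1])
     fix t :: real and phi assume t: "t \<in> {-1..1}" and phi: "schwartz phi"
     have "Syn c1 t x = Syn c2 t x + Syn d t x" for x
      using Syn_diff[OF F1 F2 r1 r1 t, of x] unfolding cd by simp
     then have "(LBINT x. Syn c1 t x * phi x) = (LBINT x. Syn c2 t x * phi x + Syn d t x * phi x)" by (simp add: distrib_right)
     also have "... = (LBINT x. Syn c2 t x * phi x) + (LBINT x. Syn d t x * phi x)"
      by (intro Bochner_Integration.integral_add small_data.Syn_test_integrable[OF S2 c2 r1 t phi] small_data.Syn_test_integrable[OF S2 d r1 t phi])
     also have "... = schroedinger t f1 phi"
      unfolding c2'[OF t phi] d'[OF t phi]
      by (simp add: schroedinger_def multiplier_def dist_inv_fourier_def dist_mult_def dist_fourier_def)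
     finally show "(LBINT x. Syn c1 t x * phi x) = schroedinger t f1 phi" .
    qed
    have Ddl: "0 < D * dl" using D dl by simp
    have dep: "fam r (3 * (D * dl)) (\<lambda>k t x. sol c1 k t x - sol c2 k t x)"
     by (rule sol_dependence[OF r F1 F2 a _ Ddl]) (simp only: cd d)
    have "mixed_norm (ennreal p) {0..1} (ennreal r) (\<lambda>t x. u1 t x - u2 t x) <= ennreal (L * dl * (1 - 0) powr (1 / p))"
    proof (rule mixed_norm_le[OF p])
     show "0 <= L * dl" using L dl by simp
     show "AE t in lborel. t \<in> {0..1} --> Lnorm (ennreal r) lborel (\<lambda>x. ennreal (norm (u1 t x - u2 t x))) <= ennreal (L * dl)"
      using small_data.corresponding_unique[OF S1 u1] small_data.corresponding_unique[OF S2 u2]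
     proof eventually_elim
      case (elim t)
      show ?case
      proof
       assume "t \<in> {0..1}"
       then have t: "t \<in> {-1..1}" by simp
       have B: "Bd r (L * dl) (Syn (\<lambda>k t x. sol c1 k t x - sol c2 k t x) t)"
        using Syn_Bd[OF dep r1 t] by (simp add: L_def mult.assoc)
       have "AE x in lborel. u1 t x - u2 t x = Syn (\<lambda>k t x. sol c1 k t x - sol c2 k t x) t x"
        using elim(1)[rule_format, OF t] elim(2)[rule_format, OF t]
        by eventually_elim
         (simp add: Syn_diff[OF sol_properties(1)[OF r F1 a] sol_properties(1)[OF r F2 a] r1 r1 t])
       then show "Lnorm (ennreal r) lborel (\<lambda>x. ennreal (norm (u1 t x - u2 t x))) <= ennreal (L * dl)"
        using r1 by (intro Lnorm_Bd[OF _ B]) simp_all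
      qed
     qed
    qed simp
    also have "... < ennreal eta" using Ldl L dl by (simp add: ennreal_less_iff)
    finally show "mixed_norm (ennreal p) {0..1} (ennreal r) (\<lambda>t x. u1 t x - u2 t x) < ennreal eta" .
   qed
  qed
 qed
qed

end

theorem theorem4p7:
  fixes \<epsilon> \<alpha> \<alpha>' p r :: real and n :: nat and \<sigma> :: "real \<Rightarrow> real"
  assumes "\<epsilon> > 0" and "n \<ge> 2" and "window \<sigma>"
    and "r = 4 * real n + 2"
    and "\<alpha> = 1 - 1 / (4 * real n + 2)" and "\<alpha>' = 1 / 2"
    and "2 / p + 1 / (4 * real n + 2) = 1 / 2"
  shows "\<exists>\<epsilon>\<^sub>n \<epsilon>\<^sub>n'. \<epsilon>\<^sub>n \<in> {0<..1} \<and> \<epsilon>\<^sub>n' \<in> {0<..1} \<and>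
    (\<forall>f. tempered f \<longrightarrow>
       sobolev_norm r (\<alpha> + \<epsilon>) f \<le> ennreal \<epsilon>\<^sub>n \<or> modulation_norm \<sigma> (\<alpha>' + \<epsilon>) r 2 f \<le> ennreal \<epsilon>\<^sub>n' \<longrightarrow>
       (\<exists>u. corresponding_solution n f u \<and> u \<in> LtLx (ennreal p) {0..1} (ennreal r) \<and>
            duhamel_solution {0..1} f u)) \<and>
    continuous_dependence n p r (sobolev_norm r (\<alpha> + \<epsilon>)) \<epsilon>\<^sub>n \<and>
    continuous_dependence n p r (modulation_norm \<sigma> (\<alpha>' + \<epsilon>) r 2) \<epsilon>\<^sub>n'"
proof -
  obtain \<rho> where "freq_window \<sigma> \<rho>" using window_freq_window[OF assms(3)] by blast
  then interpret freq_window \<sigma> \<rho> .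
  have r: "2 \<le> r" "0 < r" "1 \<le> n" using assms(2,4) by auto
  \<comment> \<open>Positivity of p is extracted from the exponent relation.\<close>
  have "1 / (4 * real n + 2) < 1 / 2" using assms(2) by (intro divide_strict_left_mono) auto
  then have "0 < 2 / p" using assms(7) by linarith
  then have p: "0 < p" by (simp add: zero_less_divide_iff)
  \<comment> \<open>The exponents \<alpha> and \<alpha>' are exactly the two summability thresholds,
    and \<epsilon> provides the strict inequalities.\<close>
  have s: "1 - 1 / r < \<alpha> + \<epsilon>" "1 / 2 < \<alpha>' + \<epsilon>" using assms(1,4,5,6) by simp_all
  have N2: "\<exists>C\<ge>0. \<forall>f A. tempered f \<longrightarrow> 0 < A \<longrightarrow> modulation_norm \<sigma> (\<alpha>' + \<epsilon>) r 2 f < ennreal A \<longrightarrow> has_data r (C * A) f"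
    using modulation_has_data[OF r(2) s(2)] by blast
  show ?thesis
    using small_data_theorem[OF p r(3) assms(4) sobolev_has_data[OF r(1) s(1)]] small_data_theorem[OF p r(3) assms(4) N2] by blast
qed

end
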